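(* Let $P$ be a finitely generated cancellative abelian monoid and let $\Gamma$ be a row-finite $P$-graph with no sources. Suppose that $\Gamma$ is aperiodic. If $\{t_\xi:\xi\in\Gamma\}$ is a Cuntz-Krieger $\Gamma$-family in a $C^*$-algebra $B$, then the induced homomorphism $\pi_t:C^*(\Gamma)\to B$ (satisfying $\pi_t(s_\xi)=t_\xi$ for all $\xi\in\Gamma$) is injective if and only if $t_v\neq0$ for every $v\in\Gamma^0$.
   Context: Conventions: "homomorphism" means $*$-homomorphism. $P$ is written additively and regarded as a submonoid of its Grothendieck group. A $P$-graph is a countable small category $\Gamma$ (identified with its set of morphisms) with a functor $d:\Gamma\to P$ ($P$ viewed as a category with one object) satisfying the factorisation property: whenever $d(\xi)=p+q$ there exist unique $\eta,\zeta\in\Gamma$ with $d(\eta)=p$, $d(\zeta)=q$ and $\xi=\eta\zeta$. $\Gamma^p=d^{-1}(p)$; $r,s$ denote codomain and domain; $\Gamma^0$ is the set of identity morphisms, identified with the objects; $v\Gamma^p=\{\xi\in\Gamma^p:r(\xi)=v\}$. $\Gamma$ is row-finite with no sources if $0<|v\Gamma^p|<\infty$ for all $v\in\Gamma^0,p\in P$. A Cuntz-Krieger $\Gamma$-family in a $C^*$-algebra $B$ is a collection $\{t_\xi:\xi\in\Gamma\}\subseteq B$ such that: the $t_v$, $v\in\Gamma^0$, are mutually orthogonal projections; $t_\xi t_\eta=t_{\xi\eta}$ if $s(\xi)=r(\eta)$; $t_\xi^*t_\xi=t_{s(\xi)}$; and $t_v=\sum_{\xi\in v\Gamma^p}t_\xi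 t_\xi^*$ for all $v\in\Gamma^0$, $p\in P$. $C^*(\Gamma)$ is the universal $C^*$-algebra generated by a Cuntz-Krieger $\Gamma$-family $\{s_\xi\}$. $\Omega_P=\{(p,q)\in P\times P: q=p+r\text{ for some }r\in P\}$ is a $P$-graph with $r(p,q)=p$, $s(p,q)=q$, $(p,q)(q,r)=(p,r)$, $d(p,q)=q-p$. $\Gamma^\Omega$ is the set of degree-preserving functors $x:\Omega_P\to\Gamma$; $x(0):=x(0,0)$, and $\sigma^p(x)(q,r)=x(p+q,p+r)$. $\Gamma$ is aperiodic if for every $v\in\Gamma^0$ there exists $x\in\Gamma^\Omega$ with $x(0)=v$ such that $\sigma^p(x)\ne\sigma^q(x)$ whenever $p\neq q$ in $P$. *)

theory Defs
  imports
    Complex_Main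
    "HOL-Library.Countable_Set"
    "HOL-Library.FuncSet"
    "HOL-Algebra.Module"
begin

section \<open>C*-algebras\<close>

definition complex_ring :: "complex ring" where
  "complex_ring = \<lparr>carrier = UNIV, mult = (*), one = 1, zero = 0, add = (+)\<rparr>"

lemma cring_complex_ring: "cring complex_ring"
  by (rule cringI; (rule abelian_groupI | rule comm_monoidI)?)
     (auto simp: complex_ring_def algebra_simps intro: exI[of _ "- _"])

text \<open>
  C*-algebras are not assumed to be unital.  The field \<open>one\<close> inherited from the record
  of modules is unconstrained, and nothing below refers to it.
\<close>

record 'a cstar = "(complex, 'a) module" +
  adj :: "'a \<Rightarrow> 'a"
  nrm :: "'a \<Rightarrow> real"

locale cstar_algebra = module complex_ring B for B :: "'a cstar" (structure) +
  assumes mult_closed: "x \<in> carrier B \<Longrightarrow> y \<in> carrier B \<Longrightarrow> x \<otimes>\<^bsub>B\<^esub> y \<in> carrier B"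
    and mult_assoc: "x \<in> carrier B \<Longrightarrow> y \<in> carrier B \<Longrightarrow> z \<in> carrier B \<Longrightarrow>
      (x \<otimes>\<^bsub>B\<^esub> y) \<otimes>\<^bsub>B\<^esub> z = x \<otimes>\<^bsub>B\<^esub> (y \<otimes>\<^bsub>B\<^esub> z)"
    and distrib_right: "x \<in> carrier B \<Longrightarrow> y \<in> carrier B \<Longrightarrow> z \<in> carrier B \<Longrightarrow>
      (x \<oplus>\<^bsub>B\<^esub> y) \<otimes>\<^bsub>B\<^esub> z = x \<otimes>\<^bsub>B\<^esub> z \<oplus>\<^bsub>B\<^esub> y \<otimes>\<^bsub>B\<^esub> z"
    and distrib_left: "x \<in> carrier B \<Longrightarrow> y \<in> carrier B \<Longrightarrow> z \<in> carrier B \<Longrightarrow>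
      x \<otimes>\<^bsub>B\<^esub> (y \<oplus>\<^bsub>B\<^esub> z) = x \<otimes>\<^bsub>B\<^esub> y \<oplus>\<^bsub>B\<^esub> x \<otimes>\<^bsub>B\<^esub> z"
    and smult_mult_left: "x \<in> carrier B \<Longrightarrow> y \<in> carrier B \<Longrightarrow>
      (c \<odot>\<^bsub>B\<^esub> x) \<otimes>\<^bsub>B\<^esub> y = c \<odot>\<^bsub>B\<^esub> (x \<otimes>\<^bsub>B\<^esub> y)"
    and smult_mult_right: "x \<in> carrier B \<Longrightarrow> y \<in> carrier B \<Longrightarrow>
      x \<otimes>\<^bsub>B\<^esub> (c \<odot>\<^bsub>B\<^esub> y) = c \<odot>\<^bsub>B\<^esub> (x \<otimes>\<^bsub>B\<^esub> y)"
    and adj_closed: "x \<in> carrier B \<Longrightarrow> adj B x \<in> carrier B"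
    and adj_adj: "x \<in> carrier B \<Longrightarrow> adj B (adj B x) = x"
    and adj_add: "x \<in> carrier B \<Longrightarrow> y \<in> carrier B \<Longrightarrow>
      adj B (x \<oplus>\<^bsub>B\<^esub> y) = adj B x \<oplus>\<^bsub>B\<^esub> adj B y"
    and adj_smult: "x \<in> carrier B \<Longrightarrow> adj B (c \<odot>\<^bsub>B\<^esub> x) = cnj c \<odot>\<^bsub>B\<^esub> adj B x"
    and adj_mult: "x \<in> carrier B \<Longrightarrow> y \<in> carrier B \<Longrightarrow>
      adj B (x \<otimes>\<^bsub>B\<^esub> y) = adj B y \<otimes>\<^bsub>B\<^esub> adj B x"
    and nrm_nonneg: "x \<in> carrier B \<Longrightarrow> 0 \<le> nrm B x"
    and nrm_eq_0_iff: "x \<in> carrier B \<Longrightarrow> nrm B x = 0 \<longleftrightarrow> x = \<zero>\<^bsub>B\<^esub>"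
    and nrm_triangle: "x \<in> carrier B \<Longrightarrow> y \<in> carrier B \<Longrightarrow>
      nrm B (x \<oplus>\<^bsub>B\<^esub> y) \<le> nrm B x + nrm B y"
    and nrm_smult: "x \<in> carrier B \<Longrightarrow> nrm B (c \<odot>\<^bsub>B\<^esub> x) = cmod c * nrm B x"
    and nrm_mult: "x \<in> carrier B \<Longrightarrow> y \<in> carrier B \<Longrightarrow>
      nrm B (x \<otimes>\<^bsub>B\<^esub> y) \<le> nrm B x * nrm B y"
    and cstar_identity: "x \<in> carrier B \<Longrightarrow> nrm B (adj B x \<otimes>\<^bsub>B\<^esub> x) = (nrm B x)\<^sup>2"
    and complete: "(\<And>n. f n \<in> carrier B) \<Longrightarrow>
      (\<And>e. e > 0 \<Longrightarrow> \<exists>N. \<forall>m\<ge>N. \<forall>n\<ge>N. nrm B (f m \<ominus>\<^bsub>B\<^esub> f n) < e) \<Longrightarrow>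
      \<exists>l\<in>carrier B. (\<lambda>n. nrm B (f n \<ominus>\<^bsub>B\<^esub> l)) \<longlonglongrightarrow> 0"

definition cstar_hom :: "'a cstar \<Rightarrow> 'b cstar \<Rightarrow> ('a \<Rightarrow> 'b) set" where
  "cstar_hom A B = {\<pi> \<in> carrier A \<rightarrow> carrier B.
     (\<forall>x\<in>carrier A. \<forall>y\<in>carrier A. \<pi> (x \<oplus>\<^bsub>A\<^esub> y) = \<pi> x \<oplus>\<^bsub>B\<^esub> \<pi> y) \<and>
     (\<forall>c. \<forall>x\<in>carrier A. \<pi> (c \<odot>\<^bsub>A\<^esub> x) = c \<odot>\<^bsub>B\<^esub> \<pi> x) \<and>
     (\<forall>x\<in>carrier A. \<forall>y\<in>carrier A. \<pi> (x \<otimes>\<^bsub>A\<^esub> y) = \<pi> x \<otimes>\<^bsub>B\<^esub> \<pi> y) \<and>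
     (\<forall>x\<in>carrier A. \<pi> (adj A x) = adj B (\<pi> x))}"

definition cstar_subalgebra :: "'a cstar \<Rightarrow> 'a set \<Rightarrow> bool" where
  "cstar_subalgebra A S \<longleftrightarrow> S \<subseteq> carrier A \<and> \<zero>\<^bsub>A\<^esub> \<in> S \<and>
     (\<forall>x\<in>S. \<forall>y\<in>S. x \<oplus>\<^bsub>A\<^esub> y \<in> S \<and> x \<otimes>\<^bsub>A\<^esub> y \<in> S) \<and>
     (\<forall>c. \<forall>x\<in>S. c \<odot>\<^bsub>A\<^esub> x \<in> S) \<and>
     (\<forall>x\<in>S. adj A x \<in> S) \<and>
     (\<forall>f. \<forall>l\<in>carrier A. (\<forall>n. f n \<in> S) \<longrightarrow> (\<lambda>n. nrm A (f n \<ominus>\<^bsub>A\<^esub> l)) \<longlonglongrightarrow> 0 \<longrightarrow> l \<in> S)"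

definition cstar_generated_by :: "'a cstar \<Rightarrow> 'a set \<Rightarrow> bool" where
  "cstar_generated_by A X \<longleftrightarrow> X \<subseteq> carrier A \<and>
     (\<forall>S. cstar_subalgebra A S \<and> X \<subseteq> S \<longrightarrow> S = carrier A)"

definition projection :: "'a cstar \<Rightarrow> 'a \<Rightarrow> bool" where
  "projection B e \<longleftrightarrow> e \<in> carrier B \<and> adj B e = e \<and> e \<otimes>\<^bsub>B\<^esub> e = e"


section \<open>P-graphs\<close>

text \<open>
  The monoid \<open>P\<close> is a type of class \<^class>\<open>comm_monoid_add\<close>; cancellation is a separate
  assumption, because the class \<^class>\<open>cancel_comm_monoid_add\<close> also contains a total
  subtraction subject to further laws.  A small category is given by its morphisms, with
  \<open>rng\<close> (codomain) and \<open>src\<close> (domain) taking values in the identity morphisms;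
  \<open>comp \<Gamma> \<eta> \<zeta>\<close> is \<open>\<eta>\<zeta>\<close>, which is meaningful if \<open>src \<Gamma> \<eta> = rng \<Gamma> \<zeta>\<close>.
\<close>

record ('g, 'p) pgraph =
  mor :: "'g set"
  rng :: "'g \<Rightarrow> 'g"
  src :: "'g \<Rightarrow> 'g"
  comp :: "'g \<Rightarrow> 'g \<Rightarrow> 'g"
  deg :: "'g \<Rightarrow> 'p"

locale p_graph =
  fixes \<Gamma> :: "('g, 'p::comm_monoid_add) pgraph"
  assumes countable_mor: "countable (mor \<Gamma>)"
    and rng_closed: "\<xi> \<in> mor \<Gamma> \<Longrightarrow> rng \<Gamma> \<xi> \<in> mor \<Gamma>"
    and src_closed: "\<xi> \<in> mor \<Gamma> \<Longrightarrow> src \<Gamma> \<xi> \<in> mor \<Gamma>"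
    and rng_rng: "\<xi> \<in> mor \<Gamma> \<Longrightarrow> rng \<Gamma> (rng \<Gamma> \<xi>) = rng \<Gamma> \<xi>"
    and src_rng: "\<xi> \<in> mor \<Gamma> \<Longrightarrow> src \<Gamma> (rng \<Gamma> \<xi>) = rng \<Gamma> \<xi>"
    and rng_src: "\<xi> \<in> mor \<Gamma> \<Longrightarrow> rng \<Gamma> (src \<Gamma> \<xi>) = src \<Gamma> \<xi>"
    and src_src: "\<xi> \<in> mor \<Gamma> \<Longrightarrow> src \<Gamma> (src \<Gamma> \<xi>) = src \<Gamma> \<xi>"
    and comp_closed: "\<eta> \<in> mor \<Gamma> \<Longrightarrow> \<zeta> \<in> mor \<Gamma> \<Longrightarrow> src \<Gamma> \<eta> = rng \<Gamma> \<zeta> \<Longrightarrow>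
      comp \<Gamma> \<eta> \<zeta> \<in> mor \<Gamma>"
    and rng_comp: "\<eta> \<in> mor \<Gamma> \<Longrightarrow> \<zeta> \<in> mor \<Gamma> \<Longrightarrow> src \<Gamma> \<eta> = rng \<Gamma> \<zeta> \<Longrightarrow>
      rng \<Gamma> (comp \<Gamma> \<eta> \<zeta>) = rng \<Gamma> \<eta>"
    and src_comp: "\<eta> \<in> mor \<Gamma> \<Longrightarrow> \<zeta> \<in> mor \<Gamma> \<Longrightarrow> src \<Gamma> \<eta> = rng \<Gamma> \<zeta> \<Longrightarrow>
      src \<Gamma> (comp \<Gamma> \<eta> \<zeta>) = src \<Gamma> \<zeta>"
    and comp_assoc: "\<xi> \<in> mor \<Gamma> \<Longrightarrow> \<eta> \<in> mor \<Gamma> \<Longrightarrow> \<zeta> \<in> mor \<Gamma> \<Longrightarrow>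
      src \<Gamma> \<xi> = rng \<Gamma> \<eta> \<Longrightarrow> src \<Gamma> \<eta> = rng \<Gamma> \<zeta> \<Longrightarrow>
      comp \<Gamma> (comp \<Gamma> \<xi> \<eta>) \<zeta> = comp \<Gamma> \<xi> (comp \<Gamma> \<eta> \<zeta>)"
    and comp_rng: "\<xi> \<in> mor \<Gamma> \<Longrightarrow> comp \<Gamma> (rng \<Gamma> \<xi>) \<xi> = \<xi>"
    and comp_src: "\<xi> \<in> mor \<Gamma> \<Longrightarrow> comp \<Gamma> \<xi> (src \<Gamma> \<xi>) = \<xi>"
    and deg_identity: "\<xi> \<in> mor \<Gamma> \<Longrightarrow> deg \<Gamma> (rng \<Gamma> \<xi>) = 0"
    and deg_comp: "\<eta> \<in> mor \<Gamma> \<Longrightarrow> \<zeta> \<in> mor \<Gamma> \<Longrightarrow> src \<Gamma> \<eta> = rng \<Gamma> \<zeta> \<Longrightarrow>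
      deg \<Gamma> (comp \<Gamma> \<eta> \<zeta>) = deg \<Gamma> \<eta> + deg \<Gamma> \<zeta>"
    and factorisation: "\<xi> \<in> mor \<Gamma> \<Longrightarrow> deg \<Gamma> \<xi> = p + q \<Longrightarrow>
      \<exists>!(\<eta>, \<zeta>). \<eta> \<in> mor \<Gamma> \<and> \<zeta> \<in> mor \<Gamma> \<and> deg \<Gamma> \<eta> = p \<and> deg \<Gamma> \<zeta> = q \<and>
        src \<Gamma> \<eta> = rng \<Gamma> \<zeta> \<and> \<xi> = comp \<Gamma> \<eta> \<zeta>"

definition vertices :: "('g, 'p) pgraph \<Rightarrow> 'g set" where
  "vertices \<Gamma> = {v \<in> mor \<Gamma>. rng \<Gamma> v = v \<and> src \<Gamma> v = v}"

definition paths_into :: "('g, 'p) pgraph \<Rightarrow> 'g \<Rightarrow> 'p \<Rightarrow> 'g set" where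
  "paths_into \<Gamma> v p = {\<xi> \<in> mor \<Gamma>. deg \<Gamma> \<xi> = p \<and> rng \<Gamma> \<xi> = v}"

definition row_finite_no_sources :: "('g, 'p) pgraph \<Rightarrow> bool" where
  "row_finite_no_sources \<Gamma> \<longleftrightarrow>
     (\<forall>v\<in>vertices \<Gamma>. \<forall>p. finite (paths_into \<Gamma> v p) \<and> paths_into \<Gamma> v p \<noteq> {})"

text \<open>The \<open>P\<close>-graph \<open>\<Omega>\<close>; its degree map \<open>q - p\<close> is well defined when \<open>P\<close> is cancellative.\<close>

definition Omega :: "('p \<times> 'p, 'p::comm_monoid_add) pgraph" where
  "Omega = \<lparr>mor = {(p, q). \<exists>r. q = p + r},
            rng = (\<lambda>(p, q). (p, p)),
            src = (\<lambda>(p, q). (q, q)),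
            comp = (\<lambda>(p, q) (q', r). (p, r)),
            deg = (\<lambda>(p, q). THE r. q = p + r)\<rparr>"

text \<open>
  Infinite paths are functions on \<open>mor Omega\<close>, represented as extensional functions so
  that equality of functions is equality of paths.
\<close>

definition infinite_paths :: "('g, 'p::comm_monoid_add) pgraph \<Rightarrow> ('p \<times> 'p \<Rightarrow> 'g) set" where
  "infinite_paths \<Gamma> = {x \<in> mor Omega \<rightarrow>\<^sub>E mor \<Gamma>.
     (\<forall>\<alpha>\<in>mor Omega. rng \<Gamma> (x \<alpha>) = x (rng Omega \<alpha>) \<and> src \<Gamma> (x \<alpha>) = x (src Omega \<alpha>)
        \<and> deg \<Gamma> (x \<alpha>) = deg Omega \<alpha>) \<and>
     (\<forall>\<alpha>\<in>mor Omega. \<forall>\<beta>\<in>mor Omega. src Omega \<alpha> = rng Omega \<beta> \<longrightarrow>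
        x (comp Omega \<alpha> \<beta>) = comp \<Gamma> (x \<alpha>) (x \<beta>))}"

definition shift :: "'p::comm_monoid_add \<Rightarrow> ('p \<times> 'p \<Rightarrow> 'g) \<Rightarrow> ('p \<times> 'p \<Rightarrow> 'g)" where
  "shift p x = restrict (\<lambda>(q, r). x (p + q, p + r)) (mor Omega)"

definition aperiodic :: "('g, 'p::comm_monoid_add) pgraph \<Rightarrow> bool" where
  "aperiodic \<Gamma> \<longleftrightarrow> (\<forall>v\<in>vertices \<Gamma>. \<exists>x\<in>infinite_paths \<Gamma>. x (0, 0) = v \<and>
     (\<forall>p q. p \<noteq> q \<longrightarrow> shift p x \<noteq> shift q x))"


section \<open>Cuntz-Krieger families and the universal C*-algebra\<close>

definition ck_family :: "('g, 'p) pgraph \<Rightarrow> 'b cstar \<Rightarrow> ('g \<Rightarrow> 'b) \<Rightarrow> bool" where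
  "ck_family \<Gamma> B t \<longleftrightarrow>
     (\<forall>\<xi>\<in>mor \<Gamma>. t \<xi> \<in> carrier B) \<and>
     (\<forall>v\<in>vertices \<Gamma>. projection B (t v)) \<and>
     (\<forall>v\<in>vertices \<Gamma>. \<forall>w\<in>vertices \<Gamma>. v \<noteq> w \<longrightarrow> t v \<otimes>\<^bsub>B\<^esub> t w = \<zero>\<^bsub>B\<^esub>) \<and>
     (\<forall>\<xi>\<in>mor \<Gamma>. \<forall>\<eta>\<in>mor \<Gamma>. src \<Gamma> \<xi> = rng \<Gamma> \<eta> \<longrightarrow> t \<xi> \<otimes>\<^bsub>B\<^esub> t \<eta> = t (comp \<Gamma> \<xi> \<eta>)) \<and>
     (\<forall>\<xi>\<in>mor \<Gamma>. adj B (t \<xi>) \<otimes>\<^bsub>B\<^esub> t \<xi> = t (src \<Gamma> \<xi>)) \<and>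
     (\<forall>v\<in>vertices \<Gamma>. \<forall>p.
        t v = (\<Oplus>\<^bsub>B\<^esub>\<xi>\<in>paths_into \<Gamma> v p. t \<xi> \<otimes>\<^bsub>B\<^esub> adj B (t \<xi>)))"

definition induced_hom ::
  "('g, 'p) pgraph \<Rightarrow> 'a cstar \<Rightarrow> ('g \<Rightarrow> 'a) \<Rightarrow> 'b cstar \<Rightarrow> ('g \<Rightarrow> 'b) \<Rightarrow> ('a \<Rightarrow> 'b) \<Rightarrow> bool" where
  "induced_hom \<Gamma> A s B t \<pi> \<longleftrightarrow> \<pi> \<in> cstar_hom A B \<and> (\<forall>\<xi>\<in>mor \<Gamma>. \<pi> (s \<xi>) = t \<xi>)"

text \<open>
  \<open>(A, s)\<close> is the universal C*-algebra \<open>C*(\<Gamma>)\<close>.  A definition in HOL cannot quantify over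
  C*-algebras of all types, so the test algebras \<open>D\<close> have their carrier in one fixed type
  with continuum many elements (the structure on it being arbitrary).  This is no
  restriction: a C*-algebra generated by countably many elements is separable, so it has at
  most continuum many elements and is isomorphic to such a \<open>D\<close>; and a Cuntz-Krieger family
  in any C*-algebra lies in the C*-subalgebra that it generates.
\<close>

type_synonym continuum = "nat \<Rightarrow> nat"

definition universal_ck_algebra :: "('g, 'p) pgraph \<Rightarrow> 'a cstar \<Rightarrow> ('g \<Rightarrow> 'a) \<Rightarrow> bool" where
  "universal_ck_algebra \<Gamma> A s \<longleftrightarrow>
     cstar_algebra A \<and> ck_family \<Gamma> A s \<and> cstar_generated_by A (s ` mor \<Gamma>) \<and>
     (\<forall>(D :: continuum cstar) u. cstar_algebra D \<and> ck_family \<Gamma> D u \<longrightarrow>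
        (\<exists>\<pi>. induced_hom \<Gamma> A s D u \<pi>))"

end

theory Submission
  imports Defs "HOL-Analysis.Analysis"
begin

text \<open>
  If \<open>\<pi>\<close> is injective then \<open>t v = \<pi> (s v)\<close> vanishes only
  if \<open>s v\<close> does, so one implication says that no \<open>s v\<close> is zero in
  the universal algebra. By the universal property it is enough to find one Cuntz-Krieger
  family with nonzero vertex projections: the graph acts on the square-summable functions on
  its space of infinite paths by prefixing and removing initial segments, and the projection
  at \<open>v\<close> is nonzero because an aperiodic path starts there
  (\<open>universal_vertex_nonzero\<close>).

  For the converse, the universal algebra is the closed span of the monomials
  \<open>s\<^sub>\<xi> s\<^sub>\<eta>\<^sup>*\<close>, and it is graded by the difference of
  the degrees of \<open>\<xi>\<close> and \<open>\<eta>\<close>, taken in the Grothendieck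
  group of \<open>P\<close>. The heart of the proof is
  \<open>fourier_coefficient_bound\<close>: if all \<open>t v\<close> are nonzero, then the
  norm in the universal algebra of one homogeneous component of a finite linear combination
  is at most the norm in \<open>B\<close> of the whole combination. By the Cuntz-Krieger
  relations every first path may be assumed to have the same degree, and then a component is
  characterised by the degree of its second paths. Prolong all paths by one initial segment
  \<open>\<tau>\<close> of an aperiodic path. When \<open>\<tau>\<close> is long enough,
  prolongations of two second paths of different degrees have no common extension, so that
  compression by range projections of the prolonged paths removes the other components and
  turns the chosen one into a combination of matrix units (\<open>block_le\<close>). The
  combinations obtained in this way, one for each vertex, contain all coefficients of the
  component and bound its norm in the universal algebra; this follows without any structure
  theory by comparing the coefficients of iterated squares (\<open>nrm_gram_power\<close>,
  \<open>coef_le_block\<close>).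

  It remains to recover an element from its components. The universal property supplies a
  gauge action of the characters of \<open>P\<close>, and averaging this action against the
  squared modulus of a trigonometric polynomial multiplies the component of degree
  difference \<open>g\<close> by a Fejer kernel, the proportion of elements of a finite set
  \<open>E\<close> that \<open>g\<close> translates into \<open>E\<close>. This operation is
  contractive (\<open>fejer_contractive\<close>), because homomorphisms are, and it involves
  at most \<open>|E|\<^sup>2\<close> components. A finitely generated abelian monoid grows
  polynomially, so \<open>E\<close> can be chosen to make the kernel close to 1 at finitely
  many given places (\<open>folner\<close>). An element of the kernel of
  \<open>\<pi>\<close> therefore is close to a Fejer mean of an approximating combination,
  and all components of that combination are small, since its image in \<open>B\<close> is
  (\<open>kernel_trivial\<close>).

  The C*-algebraic input is obtained from the axioms by two devices: a square root \<open>1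
  - sqrt (1 - k)\<close> constructed as a fixed point (\<open>sqrt_exists\<close>), and the
  estimate \<open>\<parallel>x\<parallel>\<^sup>2 \<le> \<parallel>x\<^sup>*x +
  y\<^sup>*y\<parallel>\<close> for elements with \<open>x\<^sup>*y\<close> self-adjoint
  (\<open>nrm_le_sum_squares\<close>). They give contractivity of homomorphisms and
  orthogonality of the range projections \<open>t\<^sub>\<xi> t\<^sub>\<xi>\<^sup>*\<close>
  of equal degree, in place of spectral theory and of the order structure.
\<close>

section \<open>Elementary theory of C*-algebras\<close>

lemma complex_ring_simps [simp]:
  "carrier complex_ring = UNIV" "a \<otimes>\<^bsub>complex_ring\<^esub> b = a * b" "\<one>\<^bsub>complex_ring\<^esub> = 1"
  "\<zero>\<^bsub>complex_ring\<^esub> = 0" "a \<oplus>\<^bsub>complex_ring\<^esub> b = a + b"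
  by (simp_all add: complex_ring_def)

context cstar_algebra begin

lemma smult_in [simp, intro]: "x \<in> carrier B \<Longrightarrow> c \<odot> x \<in> carrier B"
  using smult_closed[of c x] by simp

lemma scale_add_left: "x \<in> carrier B \<Longrightarrow> (a + b) \<odot> x = a \<odot> x \<oplus> b \<odot> x"
  using smult_l_distr[of a b x] by simp

lemma scale_add_right:
  "x \<in> carrier B \<Longrightarrow> y \<in> carrier B \<Longrightarrow> a \<odot> (x \<oplus> y) = a \<odot> x \<oplus> a \<odot> y"
  using smult_r_distr[of a x y] by simp

lemma scale_scale [simp]: "x \<in> carrier B \<Longrightarrow> a \<odot> (b \<odot> x) = (a * b) \<odot> x"
  using smult_assoc1[of a b x] by simp

lemma scale_one [simp]: "x \<in> carrier B \<Longrightarrow> 1 \<odot> x = x"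
  using smult_one[of x] by simp

lemma scale_zero_left [simp]: "x \<in> carrier B \<Longrightarrow> 0 \<odot> x = \<zero>"
  using smult_l_null[of x] by simp

lemma scale_zero_right [simp]: "c \<odot> \<zero> = \<zero>"
  using smult_r_null[of c] by simp

lemma neg_eq_scale: "x \<in> carrier B \<Longrightarrow> \<ominus> x = (- 1) \<odot> x"
  using scale_add_left[of x "1" "-1"] M.minus_equality[of "(-1) \<odot> x" x]
  by (simp add: M.a_comm)

lemma minus_eq_scale:
  "x \<in> carrier B \<Longrightarrow> y \<in> carrier B \<Longrightarrow> x \<ominus> y = x \<oplus> (- 1) \<odot> y"
  by (simp add: a_minus_def neg_eq_scale)

lemmas [simp, intro] = mult_closed adj_closed
lemmas [simp] = adj_adj nrm_nonneg

lemma mult_zero_left [simp]: "x \<in> carrier B \<Longrightarrow> \<zero> \<otimes> x = \<zero>"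
  using smult_mult_left[of \<zero> x 0] by simp

lemma mult_zero_right [simp]: "x \<in> carrier B \<Longrightarrow> x \<otimes> \<zero> = \<zero>"
  using smult_mult_right[of x \<zero> 0] by simp

lemma adj_zero [simp]: "adj B \<zero> = \<zero>"
  using adj_smult[of \<zero> 0] by simp

lemma nrm_zero [simp]: "nrm B \<zero> = 0"
  using nrm_eq_0_iff[of \<zero>] by simp

lemma neg_zero [simp]: "\<ominus> \<zero> = \<zero>"
  by (simp add: neg_eq_scale)

lemma add_minus_cancel_left:
  "k \<in> carrier B \<Longrightarrow> x \<in> carrier B \<Longrightarrow> y \<in> carrier B \<Longrightarrow> (k \<oplus> x) \<ominus> (k \<oplus> y) = x \<ominus> y"
  by (simp add: a_minus_def M.minus_add M.a_assoc M.a_lcomm[of x "\<ominus> k" "\<ominus> y"] M.r_neg1 M.r_neg2)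

lemma minus_add_minus:
  "x \<in> carrier B \<Longrightarrow> y \<in> carrier B \<Longrightarrow> z \<in> carrier B \<Longrightarrow> (x \<ominus> y) \<oplus> (y \<ominus> z) = x \<ominus> z"
  by (simp add: a_minus_def M.a_assoc M.r_neg1)

lemma scale_minus_right:
  "x \<in> carrier B \<Longrightarrow> y \<in> carrier B \<Longrightarrow> c \<odot> (x \<ominus> y) = c \<odot> x \<ominus> c \<odot> y"
  by (simp add: minus_eq_scale scale_add_right)

lemma mult_minus_left:
  "x \<in> carrier B \<Longrightarrow> y \<in> carrier B \<Longrightarrow> z \<in> carrier B \<Longrightarrow> (x \<ominus> y) \<otimes> z = x \<otimes> z \<ominus> y \<otimes> z"
  by (simp add: minus_eq_scale distrib_right smult_mult_left)

lemma mult_minus_right: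
  "x \<in> carrier B \<Longrightarrow> y \<in> carrier B \<Longrightarrow> z \<in> carrier B \<Longrightarrow> z \<otimes> (x \<ominus> y) = z \<otimes> x \<ominus> z \<otimes> y"
  by (simp add: minus_eq_scale distrib_left smult_mult_right)

lemma adj_minus:
  "x \<in> carrier B \<Longrightarrow> y \<in> carrier B \<Longrightarrow> adj B (x \<ominus> y) = adj B x \<ominus> adj B y"
  by (simp add: minus_eq_scale adj_add adj_smult)

lemma nrm_minus_commute:
  assumes "x \<in> carrier B" "y \<in> carrier B"
  shows "nrm B (x \<ominus> y) = nrm B (y \<ominus> x)"
proof -
  have "x \<ominus> y = (-1) \<odot> (y \<ominus> x)"
    using assms by (simp add: minus_eq_scale scale_add_right M.a_comm)
  then show ?thesis using assms nrm_smult[of "y \<ominus> x" "-1"] by simp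
qed

lemma nrm_triangle_minus:
  assumes "x \<in> carrier B" "y \<in> carrier B" "z \<in> carrier B"
  shows "nrm B (x \<ominus> z) \<le> nrm B (x \<ominus> y) + nrm B (y \<ominus> z)"
proof -
  have "x \<ominus> z = (x \<ominus> y) \<oplus> (y \<ominus> z)"
    using assms by (simp add: minus_add_minus)
  then show ?thesis using nrm_triangle[of "x \<ominus> y" "y \<ominus> z"] assms by simp
qed

lemma nrm_minus_le:
  assumes "x \<in> carrier B" "y \<in> carrier B"
  shows "nrm B (x \<ominus> y) \<le> nrm B x + nrm B y"
  using nrm_triangle_minus[of x \<zero> y] nrm_minus_commute[of \<zero> y] assms by (simp add: a_minus_def)

lemma nrm_le_minus:
  assumes "x \<in> carrier B" "y \<in> carrier B"
  shows "nrm B x \<le> nrm B (x \<ominus> y) + nrm B y"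
  using nrm_triangle[of "x \<ominus> y" y] assms by (simp add: a_minus_def M.a_assoc M.l_neg)

lemma eq_if_nrm_minus_0:
  assumes "x \<in> carrier B" "y \<in> carrier B" "nrm B (x \<ominus> y) = 0"
  shows "x = y"
  using assms nrm_eq_0_iff[of "x \<ominus> y"] M.minus_closed[of x y]
  by (metis M.add.inv_closed a_minus_def M.minus_equality M.minus_minus)

lemma nrm_adj [simp]:
  assumes "x \<in> carrier B" shows "nrm B (adj B x) = nrm B x"
proof -
  have le: "nrm B y \<le> nrm B (adj B y)" if y: "y \<in> carrier B" for y
  proof (cases "nrm B y = 0")
    case False
    have "nrm B y * nrm B y \<le> nrm B (adj B y) * nrm B y"
      using cstar_identity[OF y] nrm_mult[of "adj B y" y] y by (simp add: power2_eq_square)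
    with False y show ?thesis using nrm_nonneg[OF y] by simp
  qed (use y in simp)
  show ?thesis using le[of x] le[of "adj B x"] assms by simp
qed

definition conv :: "(nat \<Rightarrow> 'a) \<Rightarrow> 'a \<Rightarrow> bool" where
  "conv f l \<longleftrightarrow> (\<lambda>n. nrm B (f n \<ominus> l)) \<longlonglongrightarrow> 0"

lemma conv_bound:
  assumes "\<And>n. f n \<in> carrier B" "l \<in> carrier B" "\<And>n. nrm B (f n \<ominus> l) \<le> g n" "g \<longlonglongrightarrow> 0"
  shows "conv f l"
  unfolding conv_def
  by (rule tendsto_sandwich[OF _ _ tendsto_const assms(4)]) (use assms in auto)

lemma conv_const: "l \<in> carrier B \<Longrightarrow> conv (\<lambda>_. l) l"
  by (simp add: conv_def a_minus_def M.r_neg)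

lemma conv_unique:
  assumes "\<And>n. f n \<in> carrier B" "k \<in> carrier B" "l \<in> carrier B" "conv f k" "conv f l"
  shows "k = l"
proof (rule eq_if_nrm_minus_0)
  have "nrm B (k \<ominus> l) \<le> nrm B (f n \<ominus> k) + nrm B (f n \<ominus> l)" for n
    using nrm_triangle_minus[of k "f n" l] nrm_minus_commute[of k "f n"] assms by simp
  moreover have "(\<lambda>n. nrm B (f n \<ominus> k) + nrm B (f n \<ominus> l)) \<longlonglongrightarrow> 0"
    using tendsto_add[OF assms(4,5)[unfolded conv_def]] by simp
  ultimately have "nrm B (k \<ominus> l) \<le> 0"
    by (intro tendsto_lowerbound[where F = sequentially and f = "\<lambda>n. nrm B (f n \<ominus> k) + nrm B (f n \<ominus> l)"]) auto
  then show "nrm B (k \<ominus> l) = 0" using assms by (simp add: order_antisym)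
qed (use assms in auto)

lemma conv_add:
  assumes "\<And>n. f n \<in> carrier B" "k \<in> carrier B" "\<And>n. g n \<in> carrier B" "l \<in> carrier B" "conv f k" "conv g l"
  shows "conv (\<lambda>n. f n \<oplus> g n) (k \<oplus> l)"
proof (rule conv_bound)
  fix n
  have "f n \<oplus> g n \<ominus> (k \<oplus> l) = (f n \<ominus> k) \<oplus> (g n \<ominus> l)"
    using assms by (simp add: a_minus_def M.a_ac M.minus_add)
  then show "nrm B (f n \<oplus> g n \<ominus> (k \<oplus> l)) \<le> nrm B (f n \<ominus> k) + nrm B (g n \<ominus> l)"
    using nrm_triangle[of "f n \<ominus> k" "g n \<ominus> l"] assms by simp
next
  show "(\<lambda>n. nrm B (f n \<ominus> k) + nrm B (g n \<ominus> l)) \<longlonglongrightarrow> 0"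
    using tendsto_add[OF assms(5,6)[unfolded conv_def]] by simp
qed (use assms in auto)

lemma conv_scale:
  assumes "\<And>n. f n \<in> carrier B" "k \<in> carrier B" "conv f k"
  shows "conv (\<lambda>n. c \<odot> f n) (c \<odot> k)"
  using assms tendsto_mult_right_zero[OF assms(3)[unfolded conv_def], of "cmod c"]
  unfolding conv_def by (simp add: scale_minus_right[symmetric] nrm_smult)

lemma conv_adj:
  assumes "\<And>n. f n \<in> carrier B" "k \<in> carrier B" "conv f k"
  shows "conv (\<lambda>n. adj B (f n)) (adj B k)"
  using assms unfolding conv_def by (simp add: adj_minus[symmetric])

lemma conv_nrm:
  assumes "\<And>n. f n \<in> carrier B" "k \<in> carrier B" "conv f k"
  shows "(\<lambda>n. nrm B (f n)) \<longlonglongrightarrow> nrm B k"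
proof (rule LIM_zero_cancel, rule tendsto_rabs_zero_cancel, rule tendsto_sandwich[OF _ _ tendsto_const])
  show "\<forall>\<^sub>F n in sequentially. \<bar>nrm B (f n) - nrm B k\<bar> \<le> nrm B (f n \<ominus> k)"
    using nrm_le_minus[of _ k] nrm_le_minus[of k] nrm_minus_commute[of k] assms
    by (intro always_eventually allI) (smt (verit))
  show "(\<lambda>n. nrm B (f n \<ominus> k)) \<longlonglongrightarrow> 0" using assms by (simp add: conv_def)
qed auto

lemma conv_mult:
  assumes "\<And>n. f n \<in> carrier B" "k \<in> carrier B" "\<And>n. g n \<in> carrier B" "l \<in> carrier B" "conv f k" "conv g l"
  shows "conv (\<lambda>n. f n \<otimes> g n) (k \<otimes> l)"
proof (rule conv_bound)
  fix n
  have "nrm B (f n \<otimes> g n \<ominus> k \<otimes> l) \<le> nrm B (f n \<otimes> g n \<ominus> f n \<otimes> l) + nrm B (f n \<otimes> l \<ominus> k \<otimes> l)"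
    using assms by (intro nrm_triangle_minus) auto
  also have "\<dots> \<le> nrm B (f n) * nrm B (g n \<ominus> l) + nrm B (f n \<ominus> k) * nrm B l"
    using assms nrm_mult[of "f n" "g n \<ominus> l"] nrm_mult[of "f n \<ominus> k" l]
    by (simp add: mult_minus_left mult_minus_right)
  finally show "nrm B (f n \<otimes> g n \<ominus> k \<otimes> l) \<le> nrm B (f n) * nrm B (g n \<ominus> l) + nrm B (f n \<ominus> k) * nrm B l" .
next
  show "(\<lambda>n. nrm B (f n) * nrm B (g n \<ominus> l) + nrm B (f n \<ominus> k) * nrm B l) \<longlonglongrightarrow> 0"
    using tendsto_add[OF tendsto_mult[OF conv_nrm[OF assms(1,2,5)] assms(6)[unfolded conv_def]]
        tendsto_mult[OF assms(5)[unfolded conv_def] tendsto_const[of "nrm B l"]]] by simp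
qed (use assms in auto)

lemma geometric_conv:
  assumes f: "\<And>n. f n \<in> carrier B" and r: "0 \<le> r" "r < 1"
    and step: "\<And>n. nrm B (f (Suc n) \<ominus> f n) \<le> r ^ n"
  shows "\<exists>l\<in>carrier B. conv f l"
proof -
  have dist: "nrm B (f (n + k) \<ominus> f n) \<le> r ^ n / (1 - r)" for n k
  proof -
    have "nrm B (f (n + k) \<ominus> f n) \<le> (\<Sum>i<k. r ^ (n + i))"
    proof (induction k)
      case 0 then show ?case using f by (simp add: a_minus_def M.r_neg)
    next
      case (Suc k)
      have "nrm B (f (n + Suc k) \<ominus> f n) \<le> nrm B (f (Suc (n + k)) \<ominus> f (n + k)) + nrm B (f (n + k) \<ominus> f n)"
        using nrm_triangle_minus[of "f (n + Suc k)" "f (n + k)" "f n"] f by simp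
      then show ?case using Suc step[of "n + k"] by simp
    qed
    also have "\<dots> = r ^ n * (\<Sum>i<k. r ^ i)" by (simp add: power_add sum_distrib_left)
    also have "\<dots> \<le> r ^ n * (1 / (1 - r))"
      using r by (intro mult_left_mono) (auto simp: sum_gp_strict divide_simps)
    finally show ?thesis by simp
  qed
  have lim: "(\<lambda>n. r ^ n / (1 - r)) \<longlonglongrightarrow> 0"
    using tendsto_divide[OF LIMSEQ_realpow_zero[OF r] tendsto_const[of "1 - r"]] r by simp
  have "\<exists>N. \<forall>m\<ge>N. \<forall>n\<ge>N. nrm B (f m \<ominus> f n) < e" if e: "e > 0" for e
  proof -
    have "\<forall>\<^sub>F n in sequentially. r ^ n / (1 - r) < e / 2"
      using order_tendstoD(2)[OF lim, of "e / 2"] e by simp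
    then obtain N where N: "r ^ N / (1 - r) < e / 2"
      unfolding eventually_sequentially by blast
    have "nrm B (f m \<ominus> f n) < e" if "m \<ge> N" "n \<ge> N" for m n
    proof -
      have "nrm B (f m \<ominus> f N) \<le> r ^ N / (1 - r)" "nrm B (f n \<ominus> f N) \<le> r ^ N / (1 - r)"
        using dist[of N "m - N"] dist[of N "n - N"] that by simp_all
      moreover have "nrm B (f m \<ominus> f n) \<le> nrm B (f m \<ominus> f N) + nrm B (f n \<ominus> f N)"
        using nrm_triangle_minus[of "f m" "f N" "f n"] nrm_minus_commute[of "f n" "f N"] f by simp
      ultimately show ?thesis using N by argo
    qed
    then show ?thesis by blast
  qed
  then show ?thesis using complete[of f] f unfolding conv_def by blast
qed

text \<open>
  If \<open>x\<^sup>*y\<close> is self-adjoint, the cross terms in \<open>(x \<plusminus>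
  \<i>y)\<^sup>*(x \<plusminus> \<i>y)\<close> cancel, so both elements \<open>x
  \<plusminus> \<i>y\<close> have the square root of \<open>\<parallel>x\<^sup>*x +
  y\<^sup>*y\<parallel>\<close> as their norm, and \<open>2x\<close> is their sum. This
  replaces the monotonicity of the norm on positive elements.
\<close>

lemma nrm_le_sum_squares:
  assumes x: "x \<in> carrier B" and y: "y \<in> carrier B" and comm: "adj B x \<otimes> y = adj B y \<otimes> x"
  shows "(nrm B x)\<^sup>2 \<le> nrm B (adj B x \<otimes> x \<oplus> adj B y \<otimes> y)"
proof -
  define N where "N = nrm B (adj B x \<otimes> x \<oplus> adj B y \<otimes> y)"
  have eq: "(nrm B (x \<oplus> c \<odot> y))\<^sup>2 = N" if c: "c = \<i> \<or> c = - \<i>" for c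
  proof -
    have c1: "cnj c * c = 1" "c + cnj c = 0" using c by auto
    have can: "cnj c \<odot> z \<oplus> (c \<odot> z \<oplus> w) = w" if "z \<in> carrier B" "w \<in> carrier B" for z w
      using that c1(2) by (simp add: M.a_assoc[symmetric] scale_add_left[symmetric] add.commute)
    have "adj B (x \<oplus> c \<odot> y) \<otimes> (x \<oplus> c \<odot> y) = adj B x \<otimes> x \<oplus> adj B y \<otimes> y"
      using x y c1 by (simp add: adj_add adj_smult distrib_left distrib_right smult_mult_left
          smult_mult_right comm M.a_assoc can scale_add_right mult.commute)
    then show ?thesis using cstar_identity[of "x \<oplus> c \<odot> y"] x y by (simp add: N_def)
  qed
  define w1 where "w1 = x \<oplus> \<i> \<odot> y"
  define w2 where "w2 = x \<oplus> (- \<i>) \<odot> y"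
  have w: "w1 \<in> carrier B" "w2 \<in> carrier B" using x y by (auto simp: w1_def w2_def)
  have n: "nrm B w1 = sqrt N" "nrm B w2 = sqrt N"
    using eq[of \<i>] eq[of "-\<i>"] w by (auto simp: w1_def w2_def real_sqrt_unique)
  have "w1 \<oplus> w2 = (x \<oplus> x) \<oplus> (\<i> \<odot> y \<oplus> (- \<i>) \<odot> y)"
    using x y by (simp add: w1_def w2_def M.a_ac)
  also have "\<dots> = 2 \<odot> x"
    using x y scale_add_left[of x 1 1] by (simp add: scale_add_left[symmetric])
  finally have "2 * nrm B x = nrm B (w1 \<oplus> w2)" using x by (simp add: nrm_smult)
  also have "\<dots> \<le> 2 * sqrt N" using nrm_triangle[OF w] n by simp
  finally have "nrm B x \<le> sqrt N" by simp
  then have "(nrm B x)\<^sup>2 \<le> (sqrt N)\<^sup>2" using x by (intro power_mono) auto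
  then show ?thesis using w by (simp add: N_def x y)
qed

lemma subalgebraD:
  assumes "cstar_subalgebra B S"
  shows "S \<subseteq> carrier B" "\<zero> \<in> S" "x \<in> S \<Longrightarrow> y \<in> S \<Longrightarrow> x \<oplus> y \<in> S" "x \<in> S \<Longrightarrow> y \<in> S \<Longrightarrow> x \<otimes> y \<in> S"
    "x \<in> S \<Longrightarrow> c \<odot> x \<in> S" "x \<in> S \<Longrightarrow> adj B x \<in> S"
    "l \<in> carrier B \<Longrightarrow> (\<And>n. f n \<in> S) \<Longrightarrow> conv f l \<Longrightarrow> l \<in> S"
  using assms unfolding cstar_subalgebra_def conv_def by blast+

lemma subalgebra_carrier: "cstar_subalgebra B (carrier B)"
  by (auto simp: cstar_subalgebra_def)

lemma commutant_subalgebra: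
  assumes "h \<in> carrier B" "adj B h = h"
  shows "cstar_subalgebra B {x \<in> carrier B. x \<otimes> h = h \<otimes> x}" (is "cstar_subalgebra B ?S")
  unfolding cstar_subalgebra_def
proof (intro conjI ballI allI impI)
  fix x y assume xy: "x \<in> ?S" "y \<in> ?S"
  show "x \<oplus> y \<in> ?S" using xy assms by (auto simp: distrib_left distrib_right)
  have "x \<otimes> y \<otimes> h = x \<otimes> (h \<otimes> y)" using xy assms by (auto simp: mult_assoc)
  also have "\<dots> = h \<otimes> (x \<otimes> y)" using xy assms by (auto simp: mult_assoc[symmetric])
  finally show "x \<otimes> y \<in> ?S" using xy assms by auto
next
  fix x assume x: "x \<in> ?S"
  then have xc: "x \<in> carrier B" and "adj B (h \<otimes> x) = adj B (x \<otimes> h)" by simp_all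
  then have "adj B x \<otimes> h = h \<otimes> adj B x" using xc assms by (simp only: adj_mult)
  then show "adj B x \<in> ?S" using x assms by auto
next
  fix f l assume l: "l \<in> carrier B" "\<forall>n. f n \<in> ?S" "(\<lambda>n. nrm B (f n \<ominus> l)) \<longlonglongrightarrow> 0"
  then have c: "conv f l" and f: "\<And>n. f n \<in> carrier B" by (auto simp: conv_def)
  have "conv (\<lambda>n. f n \<otimes> h) (l \<otimes> h)" "conv (\<lambda>n. h \<otimes> f n) (h \<otimes> l)"
    using conv_mult[OF f l(1) _ _ c conv_const] conv_mult[OF _ _ f l(1) conv_const c] assms by auto
  then have "l \<otimes> h = h \<otimes> l"
    using conv_unique[of "\<lambda>n. f n \<otimes> h" "l \<otimes> h" "h \<otimes> l"] l f assms by auto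
  then show "l \<in> ?S" using l by simp
qed (use assms in \<open>auto simp: smult_mult_left smult_mult_right\<close>)

text \<open>
  The equation says \<open>(1 - u)\<^sup>2 = 1 - k\<close>, expressed without a unit. The
  map \<open>u \<mapsto> (k + u\<^sup>2)/2\<close> is a contraction of a ball of radius less
  than 1, and its iterates from 0 converge to \<open>u\<close>. They are polynomials in
  \<open>k\<close>, which is why \<open>u\<close> lies in every closed subalgebra that
  contains \<open>k\<close>.
\<close>

lemma sqrt_exists:
  assumes k: "k \<in> carrier B" "adj B k = k" "nrm B k < 1"
  obtains u where "u \<in> carrier B" "adj B u = u" "u \<oplus> u = k \<oplus> u \<otimes> u"
    "\<And>S. cstar_subalgebra B S \<Longrightarrow> k \<in> S \<Longrightarrow> u \<in> S"
proof -
  define step where "step u = (1/2) \<odot> (k \<oplus> u \<otimes> u)" for u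
  define f where "f n = (step ^^ n) \<zero>" for n
  have f0: "f 0 = \<zero>" and fS: "f (Suc n) = step (f n)" for n by (auto simp: f_def)
  have sub: "f n \<in> S" if "cstar_subalgebra B S" "k \<in> S" for S n
    by (induction n) (use that in \<open>auto simp: f0 fS step_def intro!: subalgebraD(2-5)\<close>)
  have f: "f n \<in> carrier B" for n using sub[OF subalgebra_carrier k(1)] .
  \<comment> \<open>The scalar solution of the same equation, with the norm of
    \<open>k\<close> in place of \<open>k\<close>.\<close>
  define r where "r = 1 - sqrt (1 - nrm B k)"
  have r: "0 \<le> r" "r < 1" "nrm B k + r * r = 2 * r"
  proof -
    show "r \<ge> 0" "r < 1" using k by (auto simp: r_def)
    have "(sqrt (1 - nrm B k))\<^sup>2 = 1 - nrm B k" using k by simp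
    then show "nrm B k + r * r = 2 * r" unfolding r_def by (simp add: algebra_simps power2_eq_square)
  qed
  have fr: "nrm B (f n) \<le> r" for n
  proof (induction n)
    case (Suc n)
    have "nrm B (f (Suc n)) \<le> (nrm B k + nrm B (f n) * nrm B (f n)) / 2"
      using nrm_triangle[of k "f n \<otimes> f n"] nrm_mult[of "f n" "f n"] f k
      by (simp add: fS step_def nrm_smult)
    also have "\<dots> \<le> (nrm B k + r * r) / 2" using mult_mono[OF Suc Suc] f r by simp
    finally show ?case using r by simp
  qed (use r f0 in auto)
  have lip: "nrm B (step u \<ominus> step w) \<le> r * nrm B (u \<ominus> w)"
    if "u \<in> carrier B" "w \<in> carrier B" "nrm B u \<le> r" "nrm B w \<le> r" for u w
  proof -
    have "step u \<ominus> step w = (1/2) \<odot> (u \<otimes> u \<ominus> w \<otimes> w)"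
      using that k by (simp add: step_def scale_minus_right[symmetric] add_minus_cancel_left)
    moreover have "u \<otimes> u \<ominus> w \<otimes> w = u \<otimes> (u \<ominus> w) \<oplus> (u \<ominus> w) \<otimes> w"
      using that by (simp add: mult_minus_left mult_minus_right minus_add_minus)
    moreover have "nrm B (u \<otimes> (u \<ominus> w) \<oplus> (u \<ominus> w) \<otimes> w) \<le> r * nrm B (u \<ominus> w) + nrm B (u \<ominus> w) * r"
      using that nrm_triangle[of "u \<otimes> (u \<ominus> w)" "(u \<ominus> w) \<otimes> w"] nrm_mult[of u "u \<ominus> w"] nrm_mult[of "u \<ominus> w" w]
        mult_right_mono[of "nrm B u" r "nrm B (u \<ominus> w)"] mult_left_mono[of "nrm B w" r "nrm B (u \<ominus> w)"]
      by (simp add: mult.commute[of r])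
    ultimately show ?thesis using that by (simp add: nrm_smult mult.commute)
  qed
  have "nrm B (f (Suc n) \<ominus> f n) \<le> r ^ n" for n
  proof (induction n)
    case 0 then show ?case using fr[of 1] r f[of 1] by (simp add: f0 a_minus_def)
  next
    case (Suc n)
    have "nrm B (f (Suc (Suc n)) \<ominus> f (Suc n)) \<le> r * nrm B (f (Suc n) \<ominus> f n)"
      using lip[OF f f fr fr, of "Suc n" n] by (simp only: fS)
    also have "\<dots> \<le> r * r ^ n" using Suc r by (intro mult_left_mono) auto
    finally show ?case by simp
  qed
  from geometric_conv[OF f r(1,2) this] obtain u where u: "u \<in> carrier B" "conv f u" by blast
  have "conv (\<lambda>n. f (Suc n)) u" using u(2) unfolding conv_def by (rule LIMSEQ_Suc)
  moreover have "conv (\<lambda>n. f (Suc n)) (step u)"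
    unfolding fS step_def using u f k
    by (intro conv_scale conv_add conv_mult conv_const) auto
  ultimately have fixp: "u = step u"
    using conv_unique[of "\<lambda>n. f (Suc n)" u "step u"] u f k by (auto simp: step_def)
  have "u \<oplus> u = 2 \<odot> u" using scale_add_left[OF u(1), of 1 1] u by simp
  also have "\<dots> = 2 \<odot> step u" using fixp by simp
  also have "\<dots> = k \<oplus> u \<otimes> u" using u k by (simp add: step_def)
  finally have eq: "u \<oplus> u = k \<oplus> u \<otimes> u" .
  have "adj B (f n) = f n" for n
    by (induction n) (use f k in \<open>auto simp: f0 fS step_def adj_smult adj_add adj_mult\<close>)
  then have "conv f (adj B u)" using conv_adj[OF f u] by simp
  then have "adj B u = u" by (intro conv_unique[OF f _ u(1) _ u(2)] adj_closed u(1))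
  then show ?thesis using u(1) eq sub subalgebraD(7)[OF _ u(1) _ u(2)] by (intro that) blast+
qed

end

lemma cstar_homD:
  assumes "\<pi> \<in> cstar_hom A B"
  shows "x \<in> carrier A \<Longrightarrow> \<pi> x \<in> carrier B"
    "x \<in> carrier A \<Longrightarrow> y \<in> carrier A \<Longrightarrow> \<pi> (x \<oplus>\<^bsub>A\<^esub> y) = \<pi> x \<oplus>\<^bsub>B\<^esub> \<pi> y"
    "x \<in> carrier A \<Longrightarrow> \<pi> (c \<odot>\<^bsub>A\<^esub> x) = c \<odot>\<^bsub>B\<^esub> \<pi> x"
    "x \<in> carrier A \<Longrightarrow> y \<in> carrier A \<Longrightarrow> \<pi> (x \<otimes>\<^bsub>A\<^esub> y) = \<pi> x \<otimes>\<^bsub>B\<^esub> \<pi> y"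
    "x \<in> carrier A \<Longrightarrow> \<pi> (adj A x) = adj B (\<pi> x)"
  using assms by (auto simp: cstar_hom_def)

context cstar_algebra begin

text \<open>
  The hypothesis says \<open>(1 - v)\<^sup>2 = 1 - b\<^sup>2\<close>. Hence \<open>x =
  b\<^sup>2\<close> and \<open>y = (1 - v)b\<close> satisfy \<open>x\<^sup>*x + y\<^sup>*y =
  b\<^sup>4 + b(1 - b\<^sup>2)b = b\<^sup>2\<close>, so that
  \<open>\<parallel>b\<parallel>\<^sup>4 \<le> \<parallel>b\<parallel>\<^sup>2\<close>.
\<close>

lemma contraction_if_sqrt:
  assumes b: "b \<in> carrier B" "adj B b = b" and v: "v \<in> carrier B" "adj B v = v"
    and eq: "v \<oplus> v = b \<otimes> b \<oplus> v \<otimes> v" and comm: "b \<otimes> v = v \<otimes> b"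
  shows "nrm B b \<le> 1"
proof -
  define x where "x = b \<otimes> b"
  define y where "y = b \<ominus> v \<otimes> b"
  have xy: "x \<in> carrier B" "y \<in> carrier B" "adj B x = x" using b v by (auto simp: x_def y_def adj_mult)
  have ay: "adj B y = b \<ominus> b \<otimes> v" using b v by (simp add: y_def adj_minus adj_mult)
  have vb: "v \<otimes> (b \<otimes> z) = b \<otimes> (v \<otimes> z)" if "z \<in> carrier B" for z
    using b v that comm by (simp add: mult_assoc[symmetric])
  have "adj B x \<otimes> y = adj B y \<otimes> x"
    unfolding ay xy(3) unfolding x_def y_def using b v
    by (simp add: mult_minus_left mult_minus_right mult_assoc comm vb)
  then have "(nrm B x)\<^sup>2 \<le> nrm B (adj B x \<otimes> x \<oplus> adj B y \<otimes> y)"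
    by (rule nrm_le_sum_squares[OF xy(1,2)])
  also have "adj B x \<otimes> x \<oplus> adj B y \<otimes> y = b \<otimes> b"
  proof -
    have "adj B y \<otimes> y = (b \<otimes> b \<ominus> b \<otimes> (v \<otimes> b)) \<ominus> (b \<otimes> (v \<otimes> b) \<ominus> b \<otimes> (v \<otimes> (v \<otimes> b)))"
      unfolding ay unfolding y_def using b v
      by (simp add: mult_minus_left mult_minus_right mult_assoc)
    also have "\<dots> = (b \<otimes> b \<oplus> b \<otimes> (v \<otimes> (v \<otimes> b))) \<ominus> b \<otimes> ((v \<oplus> v) \<otimes> b)"
      using b v by (simp add: distrib_left distrib_right a_minus_def M.minus_add M.minus_minus M.a_ac)
    also have "b \<otimes> ((v \<oplus> v) \<otimes> b) = adj B x \<otimes> x \<oplus> b \<otimes> (v \<otimes> (v \<otimes> b))"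
      unfolding eq using b v xy by (simp add: distrib_left distrib_right mult_assoc x_def adj_mult)
    finally show ?thesis using b v xy
      by (simp add: a_minus_def M.minus_add M.a_ac M.r_neg1 M.r_neg2 M.r_neg)
  qed
  also have "nrm B (b \<otimes> b) = (nrm B b)\<^sup>2" using cstar_identity[OF b(1)] b(2) by simp
  finally have "((nrm B b)\<^sup>2)\<^sup>2 \<le> (nrm B b)\<^sup>2"
    using cstar_identity[OF b(1)] b(2) by (simp add: x_def)
  then have "\<not> 1 < (nrm B b)\<^sup>2"
    using mult_strict_left_mono[of 1 "(nrm B b)\<^sup>2" "(nrm B b)\<^sup>2"] by (auto simp: power2_eq_square)
  then show ?thesis using power2_le_imp_le[of "nrm B b" 1] by simp
qed

end

text \<open>
  A square root \<open>1 - u\<close> of \<open>1 - h\<^sup>2\<close> exists for self-adjoint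
  \<open>h\<close> of norm less than 1, commutes with \<open>h\<close>, and is preserved by
  a homomorphism, so the image of \<open>h\<close> has norm at most 1. The C*-identity
  reduces arbitrary elements to self-adjoint ones.
\<close>

lemma cstar_hom_contractive:
  assumes A: "cstar_algebra A" and B: "cstar_algebra B" and pi: "\<pi> \<in> cstar_hom A B" and a: "a \<in> carrier A"
  shows "nrm B (\<pi> a) \<le> nrm A a"
proof -
  interpret A: cstar_algebra A by fact
  interpret B: cstar_algebra B by fact
  note \<pi> = cstar_homD[OF pi]
  have sa: "nrm B (\<pi> h) \<le> 1" if h: "h \<in> carrier A" "adj A h = h" "nrm A h < 1" for h
  proof -
    let ?k = "h \<otimes>\<^bsub>A\<^esub> h"
    have "nrm A ?k = (nrm A h)\<^sup>2" using A.cstar_identity[OF h(1)] h(2) by simp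
    also have "\<dots> < 1" using h by (simp add: power_less_one_iff)
    finally have k: "?k \<in> carrier A" "adj A ?k = ?k" "nrm A ?k < 1" using h by (auto simp: A.adj_mult)
    obtain u where u: "u \<in> carrier A" "adj A u = u" "u \<oplus>\<^bsub>A\<^esub> u = ?k \<oplus>\<^bsub>A\<^esub> u \<otimes>\<^bsub>A\<^esub> u"
      "\<And>S. cstar_subalgebra A S \<Longrightarrow> ?k \<in> S \<Longrightarrow> u \<in> S" using A.sqrt_exists[OF k] by metis
    have "u \<in> {x \<in> carrier A. x \<otimes>\<^bsub>A\<^esub> h = h \<otimes>\<^bsub>A\<^esub> x}"
      using h by (intro u(4) A.commutant_subalgebra) (auto simp: A.mult_assoc)
    then have "u \<otimes>\<^bsub>A\<^esub> h = h \<otimes>\<^bsub>A\<^esub> u" by simp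
    then show ?thesis
      using h u(1,2) arg_cong[OF u(3), of \<pi>]
      by (intro B.contraction_if_sqrt[of "\<pi> h" "\<pi> u"]) (simp_all add: \<pi> flip: \<pi>(4) \<pi>(5))
  qed
  have sa': "nrm B (\<pi> h) \<le> nrm A h" if h: "h \<in> carrier A" "adj A h = h" for h
  proof (rule ccontr)
    assume neg: "\<not> ?thesis"
    then obtain d where d: "nrm A h < d" "d < nrm B (\<pi> h)" by (meson dense not_le)
    have d0: "d > 0" using d A.nrm_nonneg[OF h(1)] by linarith
    have "nrm B (\<pi> (of_real (1/d) \<odot>\<^bsub>A\<^esub> h)) \<le> 1"
      using h d d0 by (intro sa) (auto simp: A.adj_smult A.nrm_smult norm_divide)
    then show False using d d0 h by (simp add: \<pi> B.nrm_smult norm_divide)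
  qed
  have "nrm B (\<pi> (adj A a \<otimes>\<^bsub>A\<^esub> a)) \<le> nrm A (adj A a \<otimes>\<^bsub>A\<^esub> a)"
    using a by (intro sa') (auto simp: A.adj_mult)
  then have "(nrm B (\<pi> a))\<^sup>2 \<le> (nrm A a)\<^sup>2"
    using a by (simp add: \<pi> A.cstar_identity B.cstar_identity)
  then show ?thesis using power2_le_imp_le A.nrm_nonneg[OF a] by blast
qed

section \<open>Projections\<close>

context cstar_algebra begin

lemma finsum_mult_left:
  assumes "finite I" "x \<in> carrier B" "\<And>i. i \<in> I \<Longrightarrow> f i \<in> carrier B"
  shows "x \<otimes> finsum B f I = finsum B (\<lambda>i. x \<otimes> f i) I"
  using assms(1,3) by (induction I) (use assms(2) in \<open>simp_all add: Pi_def distrib_left\<close>)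

lemma finsum_mult_right:
  assumes "finite I" "x \<in> carrier B" "\<And>i. i \<in> I \<Longrightarrow> f i \<in> carrier B"
  shows "finsum B f I \<otimes> x = finsum B (\<lambda>i. f i \<otimes> x) I"
  using assms(1,3) by (induction I) (use assms(2) in \<open>simp_all add: Pi_def distrib_right\<close>)

lemma finsum_in [simp, intro]: "(\<And>i. i \<in> I \<Longrightarrow> f i \<in> carrier B) \<Longrightarrow> finsum B f I \<in> carrier B"
  by (rule M.finsum_closed) auto

lemma nrm_finsum_le:
  assumes "finite I" "\<And>i. i \<in> I \<Longrightarrow> f i \<in> carrier B"
  shows "nrm B (finsum B f I) \<le> (\<Sum>i\<in>I. nrm B (f i))"
  using assms
proof (induction I)
  case (insert i I)
  then show ?case using nrm_triangle[of "f i" "finsum B f I"] by (simp add: Pi_def)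
qed simp

lemma projectionD:
  assumes "projection B p" shows "p \<in> carrier B" "adj B p = p" "p \<otimes> p = p"
  using assms by (auto simp: projection_def)

lemma nrm_projection_le: assumes "projection B p" shows "nrm B p \<le> 1"
proof -
  have "(nrm B p)\<^sup>2 = nrm B p" using cstar_identity[of p] projectionD[OF assms] by simp
  then show ?thesis by (auto simp: power2_eq_square)
qed

lemma nrm_projection: assumes "projection B p" "p \<noteq> \<zero>" shows "nrm B p = 1"
proof -
  have "(nrm B p)\<^sup>2 = nrm B p" using cstar_identity[of p] projectionD[OF assms(1)] by simp
  then show ?thesis using nrm_eq_0_iff[of p] projectionD[OF assms(1)] assms(2) by (auto simp: power2_eq_square)
qed

lemma nrm_complement_le:
  assumes p: "projection B p" and x: "x \<in> carrier B"
  shows "nrm B (x \<ominus> p \<otimes> x) \<le> nrm B x"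
proof -
  note p = projectionD[OF p]
  let ?y = "x \<ominus> p \<otimes> x"
  have y: "?y \<in> carrier B" using p x by simp
  have "adj B ?y \<otimes> ?y = adj B x \<otimes> ?y"
  proof -
    have "p \<otimes> ?y = \<zero>"
      using p x by (simp add: mult_minus_right mult_assoc[symmetric]) (simp add: a_minus_def M.r_neg)
    then have "adj B (p \<otimes> x) \<otimes> ?y = \<zero>" using p x y by (simp add: adj_mult mult_assoc)
    then show ?thesis using p x y by (simp add: adj_minus[of x] mult_minus_left[of "adj B x"]) (simp add: a_minus_def)
  qed
  then have "(nrm B ?y)\<^sup>2 \<le> nrm B x * nrm B ?y"
    using cstar_identity[OF y] nrm_mult[of "adj B x" ?y] x y by simp
  then show ?thesis using x y by (metis mult_right_le_imp_le nrm_nonneg power2_eq_square less_eq_real_def)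
qed

lemma corner_subalgebra:
  assumes e: "projection B e"
  shows "cstar_subalgebra B {x \<in> carrier B. e \<otimes> x = x \<and> x \<otimes> e = x}" (is "cstar_subalgebra B ?S")
  unfolding cstar_subalgebra_def
proof (intro conjI ballI allI impI)
  note e = projectionD[OF e]
  show "?S \<subseteq> carrier B" "\<zero> \<in> ?S" using e by auto
  fix x c assume x: "x \<in> ?S"
  show "c \<odot> x \<in> ?S" using x e by (simp add: smult_mult_left smult_mult_right)
  have "adj B (e \<otimes> x) = adj B x" "adj B (x \<otimes> e) = adj B x" and xc: "x \<in> carrier B" using x by simp_all
  then have "adj B x \<otimes> e = adj B x" "e \<otimes> adj B x = adj B x"
    unfolding adj_mult[OF e(1) xc] adj_mult[OF xc e(1)] e(2) by blast+
  then show "adj B x \<in> ?S" using xc by simp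
  fix y assume y: "y \<in> ?S"
  show "x \<oplus> y \<in> ?S" using x y e by (simp add: distrib_left distrib_right)
  have "x \<in> carrier B" "y \<in> carrier B" "e \<otimes> x = x" "y \<otimes> e = y" using x y by simp_all
  then show "x \<otimes> y \<in> ?S" using mult_assoc[of e x y] mult_assoc[of x y e] e by simp
next
  note e = projectionD[OF e]
  fix f l assume l: "l \<in> carrier B" "\<forall>n. f n \<in> ?S" "(\<lambda>n. nrm B (f n \<ominus> l)) \<longlonglongrightarrow> 0"
  then have c: "conv f l" and f: "\<And>n. f n \<in> carrier B" by (auto simp: conv_def)
  have "conv (\<lambda>n. f n \<otimes> e) (l \<otimes> e)" "conv (\<lambda>n. e \<otimes> f n) (e \<otimes> l)"
    using conv_mult[OF f l(1) _ _ c conv_const] conv_mult[OF _ _ f l(1) conv_const c] e by auto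
  then have "l \<otimes> e = l" "e \<otimes> l = l"
    using conv_unique[of f "l \<otimes> e" l] conv_unique[of f "e \<otimes> l" l] l f e c by auto
  then show "l \<in> ?S" using l by simp
qed

text \<open>
  In the corner at \<open>e\<close>, the bound on \<open>e - y\<close> forces \<open>y \<ge>
  0\<close> and the bound on \<open>Ke + y\<close> forces \<open>y \<le> 0\<close>. After
  shrinking by \<open>c = 1 - \<epsilon>\<close>, both \<open>x\<^sup>2 = \<epsilon>e +
  cy\<close> and \<open>w\<^sup>2 = K\<epsilon>e - cy\<close> have commuting self-adjoint
  square roots. The sum of these squares is \<open>(1 + K)\<epsilon>e\<close>, which bounds
  \<open>\<parallel>x\<^sup>2\<parallel>\<close> and hence
  \<open>\<parallel>y\<parallel>\<close> by a multiple of \<open>\<epsilon>\<close>.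
\<close>

lemma zero_if_plus_minus_contractions:
  assumes e: "projection B e" and y: "y \<in> carrier B" "adj B y = y" "e \<otimes> y = y"
    and minus: "nrm B (e \<ominus> y) \<le> 1"
    and K: "1 \<le> K" and plus: "nrm B (of_real K \<odot> e \<oplus> y) \<le> K"
  shows "y = \<zero>"
proof (rule ccontr)
  note e' = projectionD[OF e]
  define n where "n = nrm B y"
  assume "y \<noteq> \<zero>"
  then have n: "n > 0" using nrm_eq_0_iff[OF y(1)] nrm_nonneg[OF y(1)] by (simp add: n_def)
  have ye: "y \<otimes> e = y" using arg_cong[OF y(3), of "adj B"] adj_mult[OF e'(1) y(1)] unfolding y(2) e'(2) by simp
  \<comment> \<open>The final estimate is \<open>n \<le> (2 + K + n) \<epsilon>\<close>;
    this choice contradicts it.\<close>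
  define \<epsilon> where "\<epsilon> = n / (n + 3 + K)"
  have \<epsilon>: "0 < \<epsilon>" "\<epsilon> < 1" using n K by (auto simp: \<epsilon>_def field_simps)
  \<comment> \<open>All computations take place in the commuting family of combinations of
    \<open>e\<close> and \<open>y\<close>.\<close>
  define L :: "real \<Rightarrow> real \<Rightarrow> 'a" where "L a b = of_real a \<odot> e \<oplus> of_real b \<odot> y" for a b
  have Lc: "L a b \<in> carrier B" "adj B (L a b) = L a b" for a b
    using y e' by (auto simp: L_def adj_add adj_smult)
  have Ladd: "L a b \<oplus> L a' b' = L (a + a') (b + b')" for a b a' b'
    using y e' by (simp add: L_def scale_add_left M.a_ac)
  have Lsc: "of_real c \<odot> L a b = L (c * a) (c * b)" for c a b
    using y e' by (simp add: L_def scale_add_right)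
  have Lm: "L a b \<ominus> L a' b' = L (a - a') (b - b')" for a b a' b'
    using Lsc[of "-1" a' b'] Ladd[of a b "- a'" "- b'"] Lc by (simp add: minus_eq_scale)
  have Lmul: "L a b \<otimes> L a' b' = L a' b' \<otimes> L a b" for a b a' b'
    using y e' ye by (simp add: L_def distrib_left distrib_right smult_mult_left smult_mult_right scale_add_right mult.commute M.a_ac)
  have LC: "e \<otimes> L a b = L a b" "L a b \<otimes> e = L a b" for a b
    using y e' ye by (simp_all add: L_def distrib_left distrib_right smult_mult_left smult_mult_right)
  have Le: "L a 0 = of_real a \<odot> e" "L 1 0 = e" "L 0 1 = y" for a using y e' by (auto simp: L_def)
  have nrmL: "nrm B (of_real c \<odot> z) = \<bar>c\<bar> * nrm B z" if "z \<in> carrier B" for c z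
    using that by (simp add: nrm_smult)
  have root: "\<exists>u\<in>carrier B. adj B u = u \<and> e \<otimes> u = u \<and> u \<otimes> e = u \<and> (e \<ominus> u) \<otimes> (e \<ominus> u) = L (1 - a) (- b) \<and>
      (\<forall>h\<in>carrier B. adj B h = h \<longrightarrow> L a b \<otimes> h = h \<otimes> L a b \<longrightarrow> u \<otimes> h = h \<otimes> u)"
    if ab: "nrm B (L a b) < 1" for a b
  proof -
    obtain u where u: "u \<in> carrier B" "adj B u = u" "u \<oplus> u = L a b \<oplus> u \<otimes> u"
      "\<And>S. cstar_subalgebra B S \<Longrightarrow> L a b \<in> S \<Longrightarrow> u \<in> S"
      using sqrt_exists[OF Lc ab] by metis
    have eu: "e \<otimes> u = u" "u \<otimes> e = u"
      using u(4)[OF corner_subalgebra[OF e]] Lc LC by auto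
    have "(e \<ominus> u) \<otimes> (e \<ominus> u) = (e \<ominus> u) \<ominus> (u \<ominus> u \<otimes> u)"
      using u(1) e' eu by (simp add: mult_minus_left mult_minus_right)
    also have "\<dots> = (e \<oplus> u \<otimes> u) \<ominus> (u \<oplus> u)"
      using u(1) e' by (simp add: a_minus_def M.minus_add M.a_ac)
    also have "\<dots> = e \<ominus> L a b"
      unfolding u(3) using u(1) e' Lc add_minus_cancel_left[of "u \<otimes> u" e "L a b"] by (simp add: M.a_comm)
    also have "\<dots> = L (1 - a) (- b)" using Lm[of 1 0 a b] Le by simp
    finally have "(e \<ominus> u) \<otimes> (e \<ominus> u) = L (1 - a) (- b)" .
    moreover have "u \<otimes> h = h \<otimes> u" if "h \<in> carrier B" "adj B h = h" "L a b \<otimes> h = h \<otimes> L a b" for h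
      using u(4)[OF commutant_subalgebra[OF that(1,2)]] Lc(1) that(3) by simp
    ultimately show ?thesis using u(1,2) eu by blast
  qed
  define c where "c = 1 - \<epsilon>"
  have c: "0 < c" "c < 1" using \<epsilon> by (auto simp: c_def)
  have "L c (- c) = of_real c \<odot> (e \<ominus> y)" using Lsc[of c 1 "-1"] Lm[of 1 0 0 1] Le by simp
  then have "nrm B (L c (- c)) = c * nrm B (e \<ominus> y)" using nrmL[of "e \<ominus> y" c] c y e' by simp
  also have "\<dots> \<le> c * 1" using minus c by (intro mult_left_mono) auto
  finally have "nrm B (L c (- c)) < 1" using c by simp
  from root[OF this] obtain u where u: "u \<in> carrier B" "adj B u = u" "e \<otimes> u = u" "u \<otimes> e = u"
    "(e \<ominus> u) \<otimes> (e \<ominus> u) = L (1 - c) c"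
    "\<And>h. h \<in> carrier B \<Longrightarrow> adj B h = h \<Longrightarrow> L c (- c) \<otimes> h = h \<otimes> L c (- c) \<Longrightarrow> u \<otimes> h = h \<otimes> u" by auto
  have "L c (c / K) = of_real (c / K) \<odot> (of_real K \<odot> e \<oplus> y)"
    using K Lsc[of "c / K" K 1] Ladd[of K 0 0 1] Le by simp
  then have "nrm B (L c (c / K)) \<le> c / K * K"
    using nrmL[of "of_real K \<odot> e \<oplus> y" "c / K"] plus c K y e' mult_left_mono[OF plus, of "c / K"] by simp
  then have "nrm B (L c (c / K)) < 1" using c K by simp
  from root[OF this] obtain v where v: "v \<in> carrier B" "adj B v = v" "e \<otimes> v = v" "v \<otimes> e = v"
    "(e \<ominus> v) \<otimes> (e \<ominus> v) = L (1 - c) (- (c / K))"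
    "\<And>h. h \<in> carrier B \<Longrightarrow> adj B h = h \<Longrightarrow> L c (c / K) \<otimes> h = h \<otimes> L c (c / K) \<Longrightarrow> v \<otimes> h = h \<otimes> v" by auto
  have "v \<otimes> L c (- c) = L c (- c) \<otimes> v" using v(6)[OF Lc Lmul] .
  then have uv: "u \<otimes> v = v \<otimes> u" using u(6)[OF v(1,2)] by simp
  define x where "x = e \<ominus> u"
  define w where "w = of_real (sqrt K) \<odot> (e \<ominus> v)"
  have xw: "x \<in> carrier B" "adj B x = x" "w \<in> carrier B" "adj B w = w"
    using u v e' by (auto simp: x_def w_def adj_minus adj_smult)
  have "(e \<ominus> u) \<otimes> (e \<ominus> v) = (e \<ominus> v) \<otimes> (e \<ominus> u)" using u(1-4) v(1-4) uv e'
    by (simp add: mult_minus_left mult_minus_right) (simp add: a_minus_def M.minus_add M.a_ac)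
  then have "x \<otimes> w = w \<otimes> x" unfolding x_def w_def using u(1) v(1) e'
    by (simp add: smult_mult_left smult_mult_right)
  then have "(nrm B x)\<^sup>2 \<le> nrm B (adj B x \<otimes> x \<oplus> adj B w \<otimes> w)"
    using xw by (intro nrm_le_sum_squares) auto
  moreover have xx: "x \<otimes> x = L \<epsilon> c" using u(5) by (simp add: x_def c_def)
  moreover have "w \<otimes> w = L (K * \<epsilon>) (- c)"
  proof -
    have "w \<otimes> w = of_real K \<odot> ((e \<ominus> v) \<otimes> (e \<ominus> v))"
      using v(1) e' K by (simp add: w_def smult_mult_left smult_mult_right flip: of_real_mult)
    then show ?thesis using v(5) Lsc[of K] K by (simp add: c_def)
  qed
  moreover have "L \<epsilon> c \<oplus> L (K * \<epsilon>) (- c) = of_real ((1 + K) * \<epsilon>) \<odot> e"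
  proof -
    have "\<epsilon> + K * \<epsilon> = (1 + K) * \<epsilon>" by (simp add: algebra_simps)
    then show ?thesis unfolding Ladd using Le(1)[of "(1 + K) * \<epsilon>"] by simp
  qed
  ultimately have "(nrm B x)\<^sup>2 \<le> (1 + K) * \<epsilon> * nrm B e"
    using xw e' nrmL[of e "(1 + K) * \<epsilon>"] K \<epsilon> by simp
  also have "\<dots> \<le> (1 + K) * \<epsilon>" using nrm_projection_le[OF e] K \<epsilon> by (simp add: mult_left_le)
  finally have "nrm B (L \<epsilon> c) \<le> (1 + K) * \<epsilon>" using cstar_identity[OF xw(1)] xw xx by simp
  moreover have "L \<epsilon> c \<ominus> L \<epsilon> 0 = of_real c \<odot> y" using Lm[of \<epsilon> c \<epsilon> 0] y e' by (simp add: L_def)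
  moreover have "nrm B (L \<epsilon> c \<ominus> L \<epsilon> 0) \<le> nrm B (L \<epsilon> c) + nrm B (L \<epsilon> 0)" by (intro nrm_minus_le Lc)
  moreover have "nrm B (L \<epsilon> 0) \<le> \<epsilon>"
    using nrm_projection_le[OF e] \<epsilon> nrmL[of e \<epsilon>] e' unfolding Le by (simp add: mult_left_le)
  ultimately have "c * n \<le> (2 + K) * \<epsilon>"
    using nrmL[OF y(1), of c] c by (simp add: n_def algebra_simps)
  then have "n \<le> (2 + K + n) * \<epsilon>" by (simp add: c_def algebra_simps)
  also have "\<dots> < (n + 3 + K) * \<epsilon>" using \<epsilon> by (simp add: algebra_simps)
  also have "\<dots> = n" using n K by (simp add: \<epsilon>_def)
  finally show False by simp
qed

text \<open>
  The elements \<open>y\<^sub>k = e p\<^sub>k e\<close>, where \<open>e = p\<^sub>i\<close>,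
  add up to \<open>e\<close>, and \<open>y\<^sub>i = e\<close>, so \<open>y\<^sub>j\<close>
  is minus the sum of the remaining ones. Each \<open>e - y\<^sub>k\<close> is a
  contraction, which makes \<open>y\<^sub>j\<close> both positive and negative in the sense
  of the preceding lemma; then \<open>y\<^sub>j = (p\<^sub>j e)\<^sup>*(p\<^sub>j e)\<close>
  vanishes.
\<close>

lemma projections_orthogonal:
  assumes I: "finite I" and p: "\<And>i. i \<in> I \<Longrightarrow> projection B (p i)"
    and q: "\<And>i. i \<in> I \<Longrightarrow> finsum B p I \<otimes> p i = p i"
    and ij: "i \<in> I" "j \<in> I" "i \<noteq> j"
  shows "p j \<otimes> p i = \<zero>"
proof -
  define e where "e = p i"
  note e = projectionD[OF p[OF ij(1)], folded e_def]
  have pc: "p k \<in> carrier B" if "k \<in> I" for k using projectionD[OF p[OF that]] by simp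
  define y where "y k = e \<otimes> p k \<otimes> e" for k
  have yc: "y k \<in> carrier B" if "k \<in> I" for k using pc[OF that] e by (simp add: y_def)
  have bound: "nrm B (e \<ominus> y k) \<le> 1" if "k \<in> I" for k
  proof -
    have "e \<ominus> y k = e \<otimes> (e \<ominus> p k \<otimes> e)"
      using e pc[OF that] by (simp add: y_def mult_minus_right mult_assoc)
    then have "nrm B (e \<ominus> y k) \<le> nrm B e * nrm B (e \<ominus> p k \<otimes> e)"
      using nrm_mult[of e "e \<ominus> p k \<otimes> e"] e pc[OF that] by simp
    also have "\<dots> \<le> 1 * 1"
      using nrm_projection_le[OF p[OF ij(1)]] nrm_complement_le[OF p[OF that] e(1)] e pc[OF that]
      by (intro mult_mono) (auto simp flip: e_def intro: order_trans)
    finally show ?thesis by simp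
  qed
  define R where "R = I - {i, j}"
  have R: "finite R" "R \<subseteq> I" "I = insert i (insert j R)" "i \<notin> R" "j \<notin> R" using I ij by (auto simp: R_def)
  have sumR: "nrm B (of_nat (card F) \<odot> e \<ominus> finsum B y F) \<le> card F" if "finite F" "F \<subseteq> I" for F
    using that
  proof (induction F)
    case empty then show ?case using e by (simp add: a_minus_def)
  next
    case (insert k F)
    have yF: "finsum B y F \<in> carrier B" using insert yc by (intro finsum_in) auto
    have "of_nat (card (insert k F)) \<odot> e \<ominus> finsum B y (insert k F)
        = (e \<ominus> y k) \<oplus> (of_nat (card F) \<odot> e \<ominus> finsum B y F)"
      using insert yc e yF by (simp add: Pi_def subset_iff scale_add_left a_minus_def M.minus_add M.a_ac)
    then show ?case using nrm_triangle[of "e \<ominus> y k" "of_nat (card F) \<odot> e \<ominus> finsum B y F"]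
      bound[of k] insert yc e yF by simp
  qed
  have yR: "finsum B y R \<in> carrier B" using R yc by (intro finsum_in) auto
  have "e \<otimes> finsum B p I \<otimes> e = e"
    using q[OF ij(1)] e I pc by (simp add: e_def[symmetric] mult_assoc)
  moreover have "e \<otimes> finsum B p I \<otimes> e = finsum B y I"
    using finsum_mult_left[OF I e(1), of p] finsum_mult_right[OF I e(1), of "\<lambda>i. e \<otimes> p i"] e pc
    by (simp add: y_def[abs_def])
  moreover have "finsum B y I = e \<oplus> (y j \<oplus> finsum B y R)"
  proof -
    have "y i = e" using e by (simp add: y_def flip: e_def)
    then show ?thesis using R(1,4,5) ij yc[OF ij(2)] e yR yc R(2)
      by (subst R(3)) (simp add: Pi_def subset_iff)
  qed
  ultimately have "e \<oplus> (y j \<oplus> finsum B y R) = e" by simp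
  then have "y j \<oplus> finsum B y R = \<zero>"
    using M.add.l_cancel_one[of e "y j \<oplus> finsum B y R"] e yc[OF ij(2)] yR by simp
  then have yj: "y j = \<ominus> finsum B y R"
    using yc[OF ij(2)] yR M.minus_equality by simp
  have "y j = \<zero>"
  proof (rule zero_if_plus_minus_contractions[OF p[OF ij(1), folded e_def]])
    show "nrm B (e \<ominus> y j) \<le> 1" using bound ij by simp
    \<comment> \<open>One copy of \<open>e\<close>, and one for each of the contractions
      \<open>e - y\<^sub>k\<close> with \<open>k\<close> in \<open>R\<close>.\<close>
    have "of_real (1 + real (card R)) \<odot> e \<oplus> y j = e \<oplus> (of_nat (card R) \<odot> e \<ominus> finsum B y R)"
      using e yR by (simp add: yj scale_add_left a_minus_def M.a_assoc)
    then show "nrm B (of_real (1 + real (card R)) \<odot> e \<oplus> y j) \<le> 1 + real (card R)"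
      using nrm_triangle[of e "of_nat (card R) \<odot> e \<ominus> finsum B y R"] sumR[OF R(1,2)]
        nrm_projection_le[OF p[OF ij(1)], folded e_def] e yR by simp
    show "adj B (y j) = y j" "e \<otimes> y j = y j"
      using e projectionD[OF p[OF ij(2)]] by (simp_all add: y_def adj_mult mult_assoc mult_assoc[symmetric, of e e])
  qed (use yc[OF ij(2)] in simp_all)
  moreover have "adj B (p j \<otimes> e) \<otimes> (p j \<otimes> e) = y j"
  proof -
    have "adj B (p j \<otimes> e) \<otimes> (p j \<otimes> e) = e \<otimes> (p j \<otimes> p j) \<otimes> e"
      using e projectionD(1,2)[OF p[OF ij(2)]] by (simp add: adj_mult mult_assoc)
    then show ?thesis using projectionD(3)[OF p[OF ij(2)]] by (simp add: y_def)
  qed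
  ultimately have "(nrm B (p j \<otimes> e))\<^sup>2 = 0"
    using cstar_identity[of "p j \<otimes> e"] e pc[OF ij(2)] by simp
  then show ?thesis using nrm_eq_0_iff[of "p j \<otimes> e"] e pc[OF ij(2)] by (simp add: e_def)
qed

end

section \<open>The universal property for algebras of arbitrary type\<close>

context cstar_algebra begin

definition seq_closure :: "'a set \<Rightarrow> 'a set" where
  "seq_closure C = {l \<in> carrier B. \<exists>f. (\<forall>n. f n \<in> C) \<and> conv f l}"

lemma seq_closureI:
  assumes C: "C \<subseteq> carrier B" and l: "l \<in> carrier B" and appr: "\<And>e. e > 0 \<Longrightarrow> \<exists>x\<in>C. nrm B (x \<ominus> l) < e"
  shows "l \<in> seq_closure C"
proof -
  have "\<forall>n. \<exists>x. x \<in> C \<and> nrm B (x \<ominus> l) < inverse (real (Suc n))"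
    using appr by (metis inverse_positive_iff_positive of_nat_0_less_iff zero_less_Suc)
  then obtain f where f: "\<And>n. f n \<in> C" "\<And>n. nrm B (f n \<ominus> l) < inverse (real (Suc n))" by metis
  have "conv f l"
    using f C l by (intro conv_bound[OF _ _ _ LIMSEQ_inverse_real_of_nat]) (auto intro: less_imp_le)
  then show ?thesis using f l by (auto simp: seq_closure_def)
qed

lemma seq_closureD:
  assumes "l \<in> seq_closure C" "e > 0" shows "\<exists>x\<in>C. nrm B (x \<ominus> l) < e"
proof -
  obtain f where f: "\<And>n. f n \<in> C" "conv f l" using assms by (auto simp: seq_closure_def)
  have "\<forall>\<^sub>F n in sequentially. nrm B (f n \<ominus> l) < e"
    using f(2) assms(2) unfolding conv_def by (rule order_tendstoD(2))
  then obtain n where "nrm B (f n \<ominus> l) < e" by (auto simp: eventually_sequentially)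
  then show ?thesis using f by blast
qed

lemma seq_closure_limit: "(\<And>n. f n \<in> C) \<Longrightarrow> l \<in> carrier B \<Longrightarrow> conv f l \<Longrightarrow> l \<in> seq_closure C"
  by (auto simp: seq_closure_def)

lemma seq_closure_subset: "C \<subseteq> carrier B \<Longrightarrow> C \<subseteq> seq_closure C"
  by (auto simp: seq_closure_def intro!: exI[of _ "\<lambda>_. _"] conv_const)

text \<open>
  The scalars \<open>Q\<close> under which \<open>C\<close> is stable need only be dense in
  the complex numbers: a countable \<open>Q\<close> keeps \<open>C\<close> countable, and
  \<open>Q = UNIV\<close> treats the closure of a linear span.
\<close>

lemma seq_closure_subalgebra:
  assumes C: "C \<subseteq> carrier B" "\<zero> \<in> C"
    and add: "\<And>x y. x \<in> C \<Longrightarrow> y \<in> C \<Longrightarrow> x \<oplus> y \<in> C"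
    and mult: "\<And>x y. x \<in> C \<Longrightarrow> y \<in> C \<Longrightarrow> x \<otimes> y \<in> C"
    and adj: "\<And>x. x \<in> C \<Longrightarrow> adj B x \<in> C"
    and scale: "\<And>q x. q \<in> Q \<Longrightarrow> x \<in> C \<Longrightarrow> q \<odot> x \<in> C"
    and dense: "\<And>(c::complex) e. e > 0 \<Longrightarrow> \<exists>q\<in>Q. cmod (q - c) < e"
  shows "cstar_subalgebra B (seq_closure C)"
  unfolding cstar_subalgebra_def
proof (intro conjI ballI allI impI)
  show "seq_closure C \<subseteq> carrier B" by (auto simp: seq_closure_def)
  show "\<zero> \<in> seq_closure C" using seq_closure_subset C by blast
  fix x assume x: "x \<in> seq_closure C"
  then obtain f where f: "\<And>n. f n \<in> C" "conv f x" "x \<in> carrier B" by (auto simp: seq_closure_def)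
  have fc: "\<And>n. f n \<in> carrier B" using f C by auto
  have "conv (\<lambda>n. adj B (f n)) (adj B x)" using fc f by (intro conv_adj) auto
  then show "adj B x \<in> seq_closure C"
    using f adj unfolding seq_closure_def by (auto intro!: exI[of _ "\<lambda>n. adj B (f n)"])
  {
    fix y assume "y \<in> seq_closure C"
    then obtain g where g: "\<And>n. g n \<in> C" "conv g y" "y \<in> carrier B" by (auto simp: seq_closure_def)
    have gc: "\<And>n. g n \<in> carrier B" using g C by auto
    have "conv (\<lambda>n. f n \<oplus> g n) (x \<oplus> y)" "conv (\<lambda>n. f n \<otimes> g n) (x \<otimes> y)"
      using fc gc f g by (auto intro!: conv_add conv_mult)
    then show "x \<oplus> y \<in> seq_closure C" "x \<otimes> y \<in> seq_closure C"
      using f(3) g(3) by (auto intro: seq_closure_limit[OF add[OF f(1) g(1)]] seq_closure_limit[OF mult[OF f(1) g(1)]])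
  }
  fix c :: complex
  show "c \<odot> x \<in> seq_closure C"
  proof (rule seq_closureI[OF C(1)])
    fix e :: real assume e: "e > 0"
    define d where "d = e / (2 * (cmod c + 1))"
    have d: "d > 0" "cmod c * d < e / 2"
      using e by (auto simp: d_def field_simps add_pos_nonneg)
    obtain z where z: "z \<in> C" "nrm B (z \<ominus> x) < d" using seq_closureD[OF x d(1)] by blast
    have zc: "z \<in> carrier B" using z C by auto
    define d' where "d' = e / (2 * (nrm B z + 1))"
    have pos: "nrm B z + 1 > 0" using nrm_nonneg[OF zc] by linarith
    then have d': "d' > 0" "d' * nrm B z < e / 2"
      using e by (auto simp: d'_def field_simps)
    obtain q where q: "q \<in> Q" "cmod (q - c) < d'" using dense[OF d'(1)] by blast
    have "q \<odot> z \<ominus> c \<odot> z = (q - c) \<odot> z"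
      using zc by (simp add: minus_eq_scale scale_add_left[symmetric])
    then have "nrm B (q \<odot> z \<ominus> c \<odot> z) \<le> d' * nrm B z"
      using q zc by (simp add: nrm_smult mult_right_mono)
    moreover have "nrm B (c \<odot> z \<ominus> c \<odot> x) \<le> cmod c * d"
      using z zc f(3) by (simp add: scale_minus_right[symmetric] nrm_smult mult_left_mono)
    moreover have "nrm B (q \<odot> z \<ominus> c \<odot> x) \<le> nrm B (q \<odot> z \<ominus> c \<odot> z) + nrm B (c \<odot> z \<ominus> c \<odot> x)"
      using zc f(3) by (intro nrm_triangle_minus) auto
    ultimately have "nrm B (q \<odot> z \<ominus> c \<odot> x) < e" using d d' by linarith
    then show "\<exists>w\<in>C. nrm B (w \<ominus> c \<odot> x) < e" using scale[OF q(1) z(1)] by blast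
  qed (use f in simp)
next
  fix f l assume l: "l \<in> carrier B" "\<forall>n. f n \<in> seq_closure C" "(\<lambda>n. nrm B (f n \<ominus> l)) \<longlonglongrightarrow> 0"
  show "l \<in> seq_closure C"
  proof (rule seq_closureI[OF C(1) l(1)])
    fix e :: real assume e: "e > 0"
    have "\<forall>\<^sub>F n in sequentially. nrm B (f n \<ominus> l) < e / 2"
      using l(3) e by (intro order_tendstoD(2)) auto
    then obtain n where n: "nrm B (f n \<ominus> l) < e / 2" by (auto simp: eventually_sequentially)
    obtain x where x: "x \<in> C" "nrm B (x \<ominus> f n) < e / 2" using seq_closureD[of "f n" C "e / 2"] l(2) e by auto
    have "nrm B (x \<ominus> l) \<le> nrm B (x \<ominus> f n) + nrm B (f n \<ominus> l)"
      using x C l by (intro nrm_triangle_minus) (auto simp: seq_closure_def)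
    then show "\<exists>x\<in>C. nrm B (x \<ominus> l) < e" using n x by (intro bexI[of _ x]) auto
  qed
qed

text \<open>
  A limit is determined by one sequence in the countable set \<open>C\<close>, that is, by a
  sequence of natural numbers that enumerate its terms.
\<close>

lemma seq_closure_inj_continuum:
  assumes "countable C" "C \<subseteq> carrier B"
  shows "\<exists>\<iota> :: 'a \<Rightarrow> continuum. inj_on \<iota> (seq_closure C)"
proof -
  have "\<forall>l\<in>seq_closure C. \<exists>f. (\<forall>n. f n \<in> C) \<and> conv f l" by (auto simp: seq_closure_def)
  then obtain F where F: "\<And>l n. l \<in> seq_closure C \<Longrightarrow> F l n \<in> C" "\<And>l. l \<in> seq_closure C \<Longrightarrow> conv (F l) l"
    by metis
  have "inj_on (\<lambda>l n. to_nat_on C (F l n)) (seq_closure C)"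
  proof (rule inj_onI)
    fix k l assume kl: "k \<in> seq_closure C" "l \<in> seq_closure C" "(\<lambda>n. to_nat_on C (F k n)) = (\<lambda>n. to_nat_on C (F l n))"
    have "F k n = F l n" for n
      using fun_cong[OF kl(3), of n] inj_on_to_nat_on[OF assms(1)] F(1) kl(1,2) by (auto dest: inj_onD)
    then have "F k = F l" by auto
    then have "conv (F k) l" using F(2)[OF kl(2)] by simp
    moreover have "\<And>n. F k n \<in> carrier B" "k \<in> carrier B" "l \<in> carrier B"
      using F(1) kl assms(2) by (auto simp: seq_closure_def)
    ultimately show "k = l" using conv_unique F(2)[OF kl(1)] by blast
  qed
  then show ?thesis by blast
qed

lemma countable_subalgebra:
  assumes "countable X" "X \<subseteq> carrier B"
  shows "\<exists>S. cstar_subalgebra B S \<and> X \<subseteq> S \<and> (\<exists>\<iota> :: 'a \<Rightarrow> continuum. inj_on \<iota> S)"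
proof -
  obtain Q :: "complex set" where Q: "countable Q" "\<And>U. open U \<Longrightarrow> U \<noteq> {} \<Longrightarrow> \<exists>q\<in>Q. q \<in> U"
    using countable_dense_exists[where 'a = complex] by blast
  have dense: "\<exists>q\<in>Q. cmod (q - c) < e" if "e > 0" for c e
    using Q(2)[of "ball c e"] that by (auto simp: dist_norm norm_minus_commute)
  define F where "F C = C \<union> (\<lambda>(x, y). x \<oplus> y) ` (C \<times> C) \<union> (\<lambda>(x, y). x \<otimes> y) ` (C \<times> C) \<union> adj B ` C
      \<union> (\<lambda>(q, x). q \<odot> x) ` (Q \<times> C)" for C
  define G where "G n = (F ^^ n) (insert \<zero> X)" for n
  have GS: "G (Suc n) = F (G n)" and G0: "G 0 = insert \<zero> X" for n by (auto simp: G_def)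
  have cnt: "countable (G n)" for n
    by (induction n) (use assms Q(1) in \<open>auto simp: G0 GS F_def\<close>)
  have sub: "G n \<subseteq> carrier B" for n
    by (induction n) (use assms in \<open>auto simp: G0 GS F_def subset_iff\<close>)
  have mono: "G m \<subseteq> G n" if "m \<le> n" for m n
    using that by (rule lift_Suc_mono_le[of G, rotated]) (auto simp: GS F_def)
  define C where "C = (\<Union>n. G n)"
  have C: "countable C" "C \<subseteq> carrier B" "X \<subseteq> C" "\<zero> \<in> C"
    using cnt sub G0 by (auto simp: C_def intro!: exI[of _ 0])
  have pair: "\<exists>n. x \<in> G n \<and> y \<in> G n" if "x \<in> C" "y \<in> C" for x y
    using that mono by (auto simp: C_def) (meson max.cobounded1 max.cobounded2 subset_iff)
  have step: "F (G n) \<subseteq> C" for n using GS[of n] by (auto simp: C_def)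
  have "x \<oplus> y \<in> C" "x \<otimes> y \<in> C" if xy: "x \<in> C" "y \<in> C" for x y
  proof -
    obtain n where "x \<in> G n" "y \<in> G n" using pair[OF xy] by auto
    then have "x \<oplus> y \<in> F (G n)" "x \<otimes> y \<in> F (G n)" by (force simp: F_def)+
    then show "x \<oplus> y \<in> C" "x \<otimes> y \<in> C" using step by auto
  qed
  moreover have "adj B x \<in> C" "q \<in> Q \<Longrightarrow> q \<odot> x \<in> C" if x: "x \<in> C" for x q
  proof -
    obtain n where "x \<in> G n" using x by (auto simp: C_def)
    then have "adj B x \<in> F (G n)" "q \<in> Q \<Longrightarrow> q \<odot> x \<in> F (G n)" by (force simp: F_def)+
    then show "adj B x \<in> C" "q \<in> Q \<Longrightarrow> q \<odot> x \<in> C" using step by auto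
  qed
  ultimately have "cstar_subalgebra B (seq_closure C)" using C dense by (intro seq_closure_subalgebra[where Q = Q]) auto
  moreover have "X \<subseteq> seq_closure C" using C seq_closure_subset by blast
  ultimately show ?thesis using seq_closure_inj_continuum[OF C(1,2)] by (intro exI[of _ "seq_closure C"]) simp
qed

end

definition transport :: "'a cstar \<Rightarrow> 'a set \<Rightarrow> ('a \<Rightarrow> 'c) \<Rightarrow> 'c cstar" where
  "transport B S \<iota> = (let \<kappa> = inv_into S \<iota> in
    \<lparr>carrier = \<iota> ` S, monoid.mult = (\<lambda>x y. \<iota> (\<kappa> x \<otimes>\<^bsub>B\<^esub> \<kappa> y)), one = undefined, zero = \<iota> \<zero>\<^bsub>B\<^esub>,
     add = (\<lambda>x y. \<iota> (\<kappa> x \<oplus>\<^bsub>B\<^esub> \<kappa> y)), module.smult = (\<lambda>c x. \<iota> (c \<odot>\<^bsub>B\<^esub> \<kappa> x)),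
     adj = (\<lambda>x. \<iota> (adj B (\<kappa> x))), nrm = (\<lambda>x. nrm B (\<kappa> x))\<rparr>)"

lemma transport_cstar:
  fixes B :: "'b cstar" (structure)
  assumes B: "cstar_algebra B" and S: "cstar_subalgebra B S" and inj: "inj_on \<iota> S"
  shows "cstar_algebra (transport B S \<iota>)" (is ?cstar)
    and "inv_into S \<iota> \<in> cstar_hom (transport B S \<iota>) B" (is ?hom)
proof -
  interpret cstar_algebra B by fact
  note S = subalgebraD[OF S]
  define \<kappa> where "\<kappa> = inv_into S \<iota>"
  define D where "D = transport B S \<iota>"
  have Sc [simp]: "x \<in> S \<Longrightarrow> x \<in> carrier B" for x using S(1) by auto
  note [simp] = S(2-6)
  have \<kappa>\<iota>[simp]: "\<kappa> (\<iota> x) = x" if "x \<in> S" for x using inj that by (simp add: \<kappa>_def)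
  have D: "carrier D = \<iota> ` S" "x \<otimes>\<^bsub>D\<^esub> y = \<iota> (\<kappa> x \<otimes> \<kappa> y)" "\<zero>\<^bsub>D\<^esub> = \<iota> \<zero>" "x \<oplus>\<^bsub>D\<^esub> y = \<iota> (\<kappa> x \<oplus> \<kappa> y)"
    "c \<odot>\<^bsub>D\<^esub> x = \<iota> (c \<odot> \<kappa> x)" "adj D x = \<iota> (adj B (\<kappa> x))" "nrm D x = nrm B (\<kappa> x)" for c x y
    by (simp_all add: D_def transport_def Let_def \<kappa>_def)
  have ab: "abelian_group D"
  proof (rule abelian_groupI)
    fix x assume "x \<in> carrier D"
    then obtain a where a: "a \<in> S" "x = \<iota> a" by (auto simp: D)
    then have "\<ominus> a \<in> S" using S(5)[of a "-1"] Sc by (simp add: neg_eq_scale)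
    then show "\<exists>y\<in>carrier D. y \<oplus>\<^bsub>D\<^esub> x = \<zero>\<^bsub>D\<^esub>" using a Sc by (intro bexI[of _ "\<iota> (\<ominus> a)"]) (auto simp: D M.l_neg)
  qed (auto simp: D M.a_ac)
  interpret D: abelian_group D by fact
  have mod: "module complex_ring D"
    by (rule moduleI[OF cring_complex_ring ab])
      (auto simp: D scale_add_left scale_add_right)
  have \<kappa>D: "\<kappa> x \<in> S" if "x \<in> carrier D" for x using that by (auto simp: D)
  have \<kappa>neg: "\<kappa> (\<ominus>\<^bsub>D\<^esub> x) = \<ominus> \<kappa> x" if x: "x \<in> carrier D" for x
  proof -
    have "\<kappa> (\<ominus>\<^bsub>D\<^esub> x) \<oplus> \<kappa> x = \<kappa> (\<ominus>\<^bsub>D\<^esub> x \<oplus>\<^bsub>D\<^esub> x)" using \<kappa>D x by (simp add: D(4))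
    also have "\<dots> = \<zero>" using x by (simp add: D.l_neg D(3))
    finally show ?thesis using \<kappa>D[OF x] \<kappa>D[of "\<ominus>\<^bsub>D\<^esub> x"] x M.minus_equality by simp
  qed
  have \<kappa>minus: "\<kappa> (x \<ominus>\<^bsub>D\<^esub> y) = \<kappa> x \<ominus> \<kappa> y" if "x \<in> carrier D" "y \<in> carrier D" for x y
    using that \<kappa>D[OF that(1)] \<kappa>D[of "\<ominus>\<^bsub>D\<^esub> y"] \<kappa>neg[OF that(2)] by (simp add: a_minus_def D(4))
  have comp: "\<exists>l\<in>carrier D. (\<lambda>n. nrm D (f n \<ominus>\<^bsub>D\<^esub> l)) \<longlonglongrightarrow> 0"
    if f: "\<And>n. f n \<in> carrier D" and cau: "\<And>e. e > 0 \<Longrightarrow> \<exists>N. \<forall>m\<ge>N. \<forall>n\<ge>N. nrm D (f m \<ominus>\<^bsub>D\<^esub> f n) < e" for f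
  proof -
    have "\<exists>l\<in>carrier B. (\<lambda>n. nrm B (\<kappa> (f n) \<ominus> l)) \<longlonglongrightarrow> 0"
      using cau f \<kappa>D Sc by (intro complete) (simp_all add: D(7) \<kappa>minus)
    then obtain l where l: "l \<in> carrier B" "conv (\<lambda>n. \<kappa> (f n)) l" unfolding conv_def by auto
    have "l \<in> S" using S(7)[OF l(1) _ l(2)] \<kappa>D f by auto
    then show ?thesis
      using l(2) f \<kappa>minus by (intro bexI[of _ "\<iota> l"]) (simp_all add: D(1,7) conv_def)
  qed
  have "cstar_algebra D"
  proof (intro cstar_algebra.intro mod cstar_algebra_axioms.intro, goal_cases)
    case (18 f) show ?case using 18 by (rule comp)
  qed (auto simp: D mult_assoc distrib_left distrib_right smult_mult_left smult_mult_right adj_add adj_smult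
      adj_mult nrm_eq_0_iff inj_on_eq_iff[OF inj] nrm_triangle nrm_smult nrm_mult cstar_identity)
  then show ?cstar by (simp add: D_def)
  show ?hom unfolding cstar_hom_def D_def[symmetric] \<kappa>_def[symmetric]
    by (auto simp: D)
qed

lemma cstar_hom_comp:
  assumes "\<pi> \<in> cstar_hom A D" "\<kappa> \<in> cstar_hom D B" shows "(\<lambda>x. \<kappa> (\<pi> x)) \<in> cstar_hom A B"
  using assms by (auto simp: cstar_hom_def Pi_def)

lemma cstar_hom_zero:
  assumes "cstar_algebra A" "cstar_algebra B" "\<pi> \<in> cstar_hom A B" shows "\<pi> \<zero>\<^bsub>A\<^esub> = \<zero>\<^bsub>B\<^esub>"
proof -
  interpret A: cstar_algebra A by fact
  interpret B: cstar_algebra B by fact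
  have "\<pi> (0 \<odot>\<^bsub>A\<^esub> \<zero>\<^bsub>A\<^esub>) = 0 \<odot>\<^bsub>B\<^esub> \<pi> \<zero>\<^bsub>A\<^esub>" by (intro cstar_homD[OF assms(3)]) auto
  then show ?thesis using cstar_homD(1)[OF assms(3), of "\<zero>\<^bsub>A\<^esub>"] by simp
qed

lemma cstar_hom_finsum:
  assumes A: "cstar_algebra A" and B: "cstar_algebra B" and \<pi>: "\<pi> \<in> cstar_hom A B"
    and I: "finite I" "\<And>i. i \<in> I \<Longrightarrow> f i \<in> carrier A"
  shows "\<pi> (finsum A f I) = finsum B (\<lambda>i. \<pi> (f i)) I"
proof -
  interpret A: cstar_algebra A by fact
  interpret B: cstar_algebra B by fact
  show ?thesis using I
  proof (induction I)
    case empty then show ?case using cstar_hom_zero[OF A B \<pi>] by simp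
  next
    case (insert i I)
    then show ?case by (simp add: Pi_def cstar_homD[OF \<pi>])
  qed
qed

text \<open>
  The universal property quantifies over algebras on the type
  \<^typ>\<open>continuum\<close> only. A Cuntz-Krieger family in any \<open>B\<close>
  generates a subalgebra that injects into this type, so the family can be moved there and
  the resulting homomorphism moved back.
\<close>

lemma universal_hom_exists:
  fixes B :: "'b cstar" (structure)
  assumes \<Gamma>: "p_graph \<Gamma>" and rf: "row_finite_no_sources \<Gamma>" and A: "universal_ck_algebra \<Gamma> A s"
    and B: "cstar_algebra B" and t: "ck_family \<Gamma> B t"
  shows "\<exists>\<pi>. induced_hom \<Gamma> A s B t \<pi>"
proof -
  interpret cstar_algebra B by fact
  have tc: "t \<xi> \<in> carrier B" if "\<xi> \<in> mor \<Gamma>" for \<xi> using t that by (auto simp: ck_family_def)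
  have vm: "v \<in> mor \<Gamma>" if "v \<in> vertices \<Gamma>" for v using that by (auto simp: vertices_def)
  obtain S and \<iota> :: "'b \<Rightarrow> continuum" where S: "cstar_subalgebra B S" "t ` mor \<Gamma> \<subseteq> S" "inj_on \<iota> S"
    using countable_subalgebra[of "t ` mor \<Gamma>"] p_graph.countable_mor[OF \<Gamma>] tc by auto
  define D where "D = transport B S \<iota>"
  define \<kappa> where "\<kappa> = inv_into S \<iota>"
  have D: "cstar_algebra D" and \<kappa>: "\<kappa> \<in> cstar_hom D B"
    using transport_cstar[OF B S(1,3)] by (auto simp: D_def \<kappa>_def)
  interpret D: cstar_algebra D by fact
  have Dd: "carrier D = \<iota> ` S" "x \<otimes>\<^bsub>D\<^esub> y = \<iota> (\<kappa> x \<otimes> \<kappa> y)" "\<zero>\<^bsub>D\<^esub> = \<iota> \<zero>" "adj D x = \<iota> (adj B (\<kappa> x))" for x y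
    by (simp_all add: D_def transport_def Let_def \<kappa>_def)
  have \<kappa>\<iota>[simp]: "\<kappa> (\<iota> x) = x" if "x \<in> S" for x using S(3) that by (simp add: \<kappa>_def)
  have \<iota>\<kappa>: "\<iota> (\<kappa> x) = x" if "x \<in> carrier D" for x using that by (auto simp: Dd)
  have tS: "t \<xi> \<in> S" if "\<xi> \<in> mor \<Gamma>" for \<xi> using S that by auto
  define u where "u \<xi> = \<iota> (t \<xi>)" for \<xi>
  have \<kappa>u: "\<kappa> (u \<xi>) = t \<xi>" and uc: "u \<xi> \<in> carrier D" if "\<xi> \<in> mor \<Gamma>" for \<xi>
    using tS[OF that] by (auto simp: u_def Dd)
  have "ck_family \<Gamma> D u"
    unfolding ck_family_def
  proof (intro conjI ballI allI impI)
    fix v assume v: "v \<in> vertices \<Gamma>"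
    then have "projection B (t v)" using t by (auto simp: ck_family_def)
    then show "projection D (u v)" using v vm uc \<kappa>u by (auto simp: projection_def Dd(2,4)) (auto simp: u_def)
    fix p
    have fin: "finite (paths_into \<Gamma> v p)" using rf v by (auto simp: row_finite_no_sources_def)
    have pm: "\<xi> \<in> mor \<Gamma>" if "\<xi> \<in> paths_into \<Gamma> v p" for \<xi> using that by (auto simp: paths_into_def)
    let ?s = "\<Oplus>\<^bsub>D\<^esub>\<xi>\<in>paths_into \<Gamma> v p. u \<xi> \<otimes>\<^bsub>D\<^esub> adj D (u \<xi>)"
    have "\<kappa> ?s = (\<Oplus>\<xi>\<in>paths_into \<Gamma> v p. \<kappa> (u \<xi> \<otimes>\<^bsub>D\<^esub> adj D (u \<xi>)))"
      using fin pm uc by (intro cstar_hom_finsum[OF D B \<kappa>]) auto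
    also have "\<dots> = (\<Oplus>\<xi>\<in>paths_into \<Gamma> v p. t \<xi> \<otimes> adj B (t \<xi>))"
      using pm uc \<kappa>u tc by (intro M.finsum_cong') (auto simp: cstar_homD[OF \<kappa>])
    also have "\<dots> = t v" using t v by (auto simp: ck_family_def)
    finally have "\<iota> (\<kappa> ?s) = u v" by (simp add: u_def)
    moreover have "?s \<in> carrier D" using pm uc by (intro D.M.finsum_closed) auto
    ultimately show "u v = ?s" using \<iota>\<kappa> by simp
  next
    fix v w assume "v \<in> vertices \<Gamma>" "w \<in> vertices \<Gamma>" "v \<noteq> w"
    then show "u v \<otimes>\<^bsub>D\<^esub> u w = \<zero>\<^bsub>D\<^esub>" using t vm by (simp add: Dd \<kappa>u ck_family_def)
  next
    fix \<xi> \<eta> assume "\<xi> \<in> mor \<Gamma>" "\<eta> \<in> mor \<Gamma>" "src \<Gamma> \<xi> = rng \<Gamma> \<eta>"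
    then show "u \<xi> \<otimes>\<^bsub>D\<^esub> u \<eta> = u (comp \<Gamma> \<xi> \<eta>)" using t by (simp add: Dd \<kappa>u ck_family_def) (simp add: u_def)
  next
    fix \<xi> assume "\<xi> \<in> mor \<Gamma>"
    then show "adj D (u \<xi>) \<otimes>\<^bsub>D\<^esub> u \<xi> = u (src \<Gamma> \<xi>)"
      using t subalgebraD(6)[OF S(1) tS] by (simp add: Dd \<kappa>u ck_family_def) (simp add: u_def)
  qed (use uc in auto)
  then obtain \<pi> where "induced_hom \<Gamma> A s D u \<pi>"
    using A D unfolding universal_ck_algebra_def by blast
  then have "induced_hom \<Gamma> A s B t (\<lambda>x. \<kappa> (\<pi> x))"
    using cstar_hom_comp[OF _ \<kappa>] \<kappa>u by (auto simp: induced_hom_def)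
  then show ?thesis by blast
qed

section \<open>Factorisation and the Cuntz-Krieger relations\<close>

locale row_finite_p_graph = p_graph \<Gamma> for \<Gamma> :: "('g, 'p::comm_monoid_add) pgraph" +
  assumes cancel: "\<And>p q r :: 'p. p + q = p + r \<Longrightarrow> q = r"
    and row_finite: "row_finite_no_sources \<Gamma>"
begin

lemma cancel_iff: "(p::'p) + q = p + r \<longleftrightarrow> q = r" "q + p = r + p \<longleftrightarrow> q = r"
  using cancel[of p q r] by (auto simp: add.commute)

lemma rng_vertex [simp]: "\<xi> \<in> mor \<Gamma> \<Longrightarrow> rng \<Gamma> \<xi> \<in> vertices \<Gamma>"
  by (simp add: vertices_def rng_closed rng_rng src_rng)

lemma src_vertex [simp]: "\<xi> \<in> mor \<Gamma> \<Longrightarrow> src \<Gamma> \<xi> \<in> vertices \<Gamma>"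
  by (simp add: vertices_def src_closed rng_src src_src)

lemma vertexD: "v \<in> vertices \<Gamma> \<Longrightarrow> v \<in> mor \<Gamma>" "v \<in> vertices \<Gamma> \<Longrightarrow> rng \<Gamma> v = v"
  "v \<in> vertices \<Gamma> \<Longrightarrow> src \<Gamma> v = v" "v \<in> vertices \<Gamma> \<Longrightarrow> deg \<Gamma> v = 0"
  using deg_identity[of v] by (auto simp: vertices_def)

lemma comp_inj:
  assumes "\<eta> \<in> mor \<Gamma>" "\<zeta> \<in> mor \<Gamma>" "src \<Gamma> \<eta> = rng \<Gamma> \<zeta>"
    and "\<eta>' \<in> mor \<Gamma>" "\<zeta>' \<in> mor \<Gamma>" "src \<Gamma> \<eta>' = rng \<Gamma> \<zeta>'"
    and eq: "comp \<Gamma> \<eta> \<zeta> = comp \<Gamma> \<eta>' \<zeta>'" and deg: "deg \<Gamma> \<eta> = deg \<Gamma> \<eta>'"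
  shows "\<eta> = \<eta>'" "\<zeta> = \<zeta>'"
proof -
  have "deg \<Gamma> \<eta> + deg \<Gamma> \<zeta> = deg \<Gamma> \<eta>' + deg \<Gamma> \<zeta>'"
    using deg_comp[OF assms(1-3)] deg_comp[OF assms(4-6)] eq by simp
  then have d: "deg \<Gamma> \<zeta> = deg \<Gamma> \<zeta>'" using deg cancel_iff by simp
  have "\<exists>!(\<alpha>, \<beta>). \<alpha> \<in> mor \<Gamma> \<and> \<beta> \<in> mor \<Gamma> \<and> deg \<Gamma> \<alpha> = deg \<Gamma> \<eta> \<and> deg \<Gamma> \<beta> = deg \<Gamma> \<zeta> \<and>
        src \<Gamma> \<alpha> = rng \<Gamma> \<beta> \<and> comp \<Gamma> \<eta> \<zeta> = comp \<Gamma> \<alpha> \<beta>"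
    by (rule factorisation[OF comp_closed[OF assms(1-3)] deg_comp[OF assms(1-3)]])
  from this[unfolded Ex1_def] obtain z where z: "\<And>y. (case y of (\<alpha>, \<beta>) \<Rightarrow>
      \<alpha> \<in> mor \<Gamma> \<and> \<beta> \<in> mor \<Gamma> \<and> deg \<Gamma> \<alpha> = deg \<Gamma> \<eta> \<and> deg \<Gamma> \<beta> = deg \<Gamma> \<zeta> \<and>
        src \<Gamma> \<alpha> = rng \<Gamma> \<beta> \<and> comp \<Gamma> \<eta> \<zeta> = comp \<Gamma> \<alpha> \<beta>) \<Longrightarrow> y = z"
    by blast
  have "(\<eta>, \<zeta>) = z" "(\<eta>', \<zeta>') = z" using assms d by (auto intro!: z)
  then show "\<eta> = \<eta>'" "\<zeta> = \<zeta>'" by auto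
qed

text \<open>
  The factorisation \<open>\<xi> = \<eta>\<zeta>\<close> with \<open>\<eta>\<close> of
  degree \<open>p\<close>; arbitrary if the degree of \<open>\<xi>\<close> is not of the
  form \<open>p + q\<close>.
\<close>

definition split_at :: "'p \<Rightarrow> 'g \<Rightarrow> 'g \<times> 'g" where
  "split_at p \<xi> = (SOME z. fst z \<in> mor \<Gamma> \<and> snd z \<in> mor \<Gamma> \<and> deg \<Gamma> (fst z) = p \<and>
     src \<Gamma> (fst z) = rng \<Gamma> (snd z) \<and> \<xi> = comp \<Gamma> (fst z) (snd z))"

definition init :: "'p \<Rightarrow> 'g \<Rightarrow> 'g" where "init p \<xi> = fst (split_at p \<xi>)"
definition tail :: "'p \<Rightarrow> 'g \<Rightarrow> 'g" where "tail p \<xi> = snd (split_at p \<xi>)"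

lemma init_tail:
  assumes "\<xi> \<in> mor \<Gamma>" "deg \<Gamma> \<xi> = p + q"
  shows "init p \<xi> \<in> mor \<Gamma>" "tail p \<xi> \<in> mor \<Gamma>" "deg \<Gamma> (init p \<xi>) = p" "deg \<Gamma> (tail p \<xi>) = q"
    "src \<Gamma> (init p \<xi>) = rng \<Gamma> (tail p \<xi>)" "comp \<Gamma> (init p \<xi>) (tail p \<xi>) = \<xi>"
    "rng \<Gamma> (init p \<xi>) = rng \<Gamma> \<xi>" "src \<Gamma> (tail p \<xi>) = src \<Gamma> \<xi>"
proof -
  have "\<exists>z. fst z \<in> mor \<Gamma> \<and> snd z \<in> mor \<Gamma> \<and> deg \<Gamma> (fst z) = p \<and>
     src \<Gamma> (fst z) = rng \<Gamma> (snd z) \<and> \<xi> = comp \<Gamma> (fst z) (snd z)"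
    using ex1_implies_ex[OF factorisation[OF assms]] by auto
  from someI_ex[OF this]
  have *: "init p \<xi> \<in> mor \<Gamma> \<and> tail p \<xi> \<in> mor \<Gamma> \<and> deg \<Gamma> (init p \<xi>) = p \<and>
      src \<Gamma> (init p \<xi>) = rng \<Gamma> (tail p \<xi>) \<and> \<xi> = comp \<Gamma> (init p \<xi>) (tail p \<xi>)"
    unfolding init_def tail_def split_at_def .
  then show "init p \<xi> \<in> mor \<Gamma>" "tail p \<xi> \<in> mor \<Gamma>" "deg \<Gamma> (init p \<xi>) = p"
    "src \<Gamma> (init p \<xi>) = rng \<Gamma> (tail p \<xi>)" "comp \<Gamma> (init p \<xi>) (tail p \<xi>) = \<xi>" by auto
  then show "rng \<Gamma> (init p \<xi>) = rng \<Gamma> \<xi>" "src \<Gamma> (tail p \<xi>) = src \<Gamma> \<xi>" "deg \<Gamma> (tail p \<xi>) = q"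
    using rng_comp[of "init p \<xi>" "tail p \<xi>"] src_comp[of "init p \<xi>" "tail p \<xi>"]
      deg_comp[of "init p \<xi>" "tail p \<xi>"] assms(2) cancel_iff by auto
qed

lemma init_comp_eq:
  assumes "\<eta> \<in> mor \<Gamma>" "\<zeta> \<in> mor \<Gamma>" "src \<Gamma> \<eta> = rng \<Gamma> \<zeta>"
  shows "init (deg \<Gamma> \<eta>) (comp \<Gamma> \<eta> \<zeta>) = \<eta>" "tail (deg \<Gamma> \<eta>) (comp \<Gamma> \<eta> \<zeta>) = \<zeta>"
proof -
  note i = init_tail[of "comp \<Gamma> \<eta> \<zeta>" "deg \<Gamma> \<eta>" "deg \<Gamma> \<zeta>", OF comp_closed[OF assms] deg_comp[OF assms]]
  show "init (deg \<Gamma> \<eta>) (comp \<Gamma> \<eta> \<zeta>) = \<eta>" "tail (deg \<Gamma> \<eta>) (comp \<Gamma> \<eta> \<zeta>) = \<zeta>"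
    using comp_inj[OF i(1,2,5) assms i(6,3)] by auto
qed

lemma init_comp:
  assumes "\<eta> \<in> mor \<Gamma>" "\<zeta> \<in> mor \<Gamma>" "src \<Gamma> \<eta> = rng \<Gamma> \<zeta>" "deg \<Gamma> \<eta> = p + q"
  shows "init p (comp \<Gamma> \<eta> \<zeta>) = init p \<eta>"
proof -
  note i = init_tail[OF assms(1,4)]
  have "comp \<Gamma> \<eta> \<zeta> = comp \<Gamma> (init p \<eta>) (comp \<Gamma> (tail p \<eta>) \<zeta>)"
    using comp_assoc[of "init p \<eta>" "tail p \<eta>" \<zeta>] i assms by simp
  then show ?thesis
    using init_comp_eq(1)[of "init p \<eta>" "comp \<Gamma> (tail p \<eta>) \<zeta>"] i assms by (simp add: comp_closed rng_comp)
qed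

lemma init_init:
  assumes "\<xi> \<in> mor \<Gamma>" "deg \<Gamma> \<xi> = p + q + r"
  shows "init p (init (p + q) \<xi>) = init p \<xi>"
  using init_comp[of "init (p + q) \<xi>" "tail (p + q) \<xi>" p q] init_tail[OF assms] by simp

lemma deg_0_vertex: assumes "\<xi> \<in> mor \<Gamma>" "deg \<Gamma> \<xi> = 0" shows "src \<Gamma> \<xi> = \<xi>" "rng \<Gamma> \<xi> = \<xi>"
proof -
  have "comp \<Gamma> (rng \<Gamma> \<xi>) \<xi> = comp \<Gamma> \<xi> (src \<Gamma> \<xi>)" using assms by (simp add: comp_rng comp_src)
  note eqs = comp_inj[OF _ _ _ _ _ _ this]
  have "rng \<Gamma> \<xi> = \<xi>" "\<xi> = src \<Gamma> \<xi>"
    by (rule eqs; use assms in \<open>simp add: rng_closed src_closed src_rng rng_src deg_identity\<close>)+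
  then show "rng \<Gamma> \<xi> = \<xi>" "src \<Gamma> \<xi> = \<xi>" by auto
qed

lemma finite_paths_into [simp]: "v \<in> vertices \<Gamma> \<Longrightarrow> finite (paths_into \<Gamma> v p)"
  using row_finite by (simp add: row_finite_no_sources_def)

end

lemma finsum_single_term:
  assumes "cstar_algebra B" "finite I" "i \<in> I" "f i \<in> carrier B" "\<And>j. j \<in> I \<Longrightarrow> j \<noteq> i \<Longrightarrow> f j = \<zero>\<^bsub>B\<^esub>"
  shows "finsum B f I = f i"
proof -
  interpret cstar_algebra B by fact
  have fc: "f j \<in> carrier B" if "j \<in> I" for j using assms(4) assms(5)[OF that] by (cases "j = i") auto
  have "finsum B f I = finsum B (\<lambda>j. if i = j then f j else \<zero>\<^bsub>B\<^esub>) I"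
    using fc assms(5) by (intro M.finsum_cong') auto
  also have "\<dots> = f i" using assms(2,3) fc by (intro M.finsum_singleton) auto
  finally show ?thesis .
qed

locale ck = row_finite_p_graph \<Gamma> + cstar_algebra B
  for \<Gamma> :: "('g, 'p::comm_monoid_add) pgraph" and B :: "'b cstar" (structure) and t :: "'g \<Rightarrow> 'b" +
  assumes ck: "ck_family \<Gamma> B t"
begin

lemma t_in [simp, intro]: "\<xi> \<in> mor \<Gamma> \<Longrightarrow> t \<xi> \<in> carrier B"
  using ck by (simp add: ck_family_def)

lemma t_projection: "v \<in> vertices \<Gamma> \<Longrightarrow> projection B (t v)"
  using ck by (simp add: ck_family_def)

lemma t_orth: "v \<in> vertices \<Gamma> \<Longrightarrow> w \<in> vertices \<Gamma> \<Longrightarrow> v \<noteq> w \<Longrightarrow> t v \<otimes> t w = \<zero>"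
  using ck by (simp add: ck_family_def)

lemma t_comp: "\<xi> \<in> mor \<Gamma> \<Longrightarrow> \<eta> \<in> mor \<Gamma> \<Longrightarrow> src \<Gamma> \<xi> = rng \<Gamma> \<eta> \<Longrightarrow> t (comp \<Gamma> \<xi> \<eta>) = t \<xi> \<otimes> t \<eta>"
  using ck by (simp add: ck_family_def)

lemma t_adj_self: "\<xi> \<in> mor \<Gamma> \<Longrightarrow> adj B (t \<xi>) \<otimes> t \<xi> = t (src \<Gamma> \<xi>)"
  using ck by (simp add: ck_family_def)

lemma t_sum: "v \<in> vertices \<Gamma> \<Longrightarrow> t v = (\<Oplus>\<xi>\<in>paths_into \<Gamma> v p. t \<xi> \<otimes> adj B (t \<xi>))"
  using ck by (simp add: ck_family_def)

lemma t_adj_vertex: "v \<in> vertices \<Gamma> \<Longrightarrow> adj B (t v) = t v"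
  using t_projection by (simp add: projection_def)

lemma t_rng_mult: "\<xi> \<in> mor \<Gamma> \<Longrightarrow> t (rng \<Gamma> \<xi>) \<otimes> t \<xi> = t \<xi>"
  using t_comp[of "rng \<Gamma> \<xi>" \<xi>] by (simp add: rng_closed src_rng comp_rng)

lemma t_mult_src: "\<xi> \<in> mor \<Gamma> \<Longrightarrow> t \<xi> \<otimes> t (src \<Gamma> \<xi>) = t \<xi>"
  using t_comp[of \<xi> "src \<Gamma> \<xi>"] by (simp add: src_closed rng_src comp_src)

lemma adj_t_rng: assumes "\<xi> \<in> mor \<Gamma>" shows "adj B (t \<xi>) \<otimes> t (rng \<Gamma> \<xi>) = adj B (t \<xi>)"
  using adj_mult[of "t (rng \<Gamma> \<xi>)" "t \<xi>"] assms by (simp add: t_rng_mult rng_closed t_adj_vertex)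

lemma src_adj_t: assumes "\<xi> \<in> mor \<Gamma>" shows "t (src \<Gamma> \<xi>) \<otimes> adj B (t \<xi>) = adj B (t \<xi>)"
  using adj_mult[of "t \<xi>" "t (src \<Gamma> \<xi>)"] assms by (simp add: t_mult_src src_closed t_adj_vertex)

lemma range_projection: assumes "\<xi> \<in> mor \<Gamma>" shows "projection B (t \<xi> \<otimes> adj B (t \<xi>))"
proof -
  have "(t \<xi> \<otimes> adj B (t \<xi>)) \<otimes> (t \<xi> \<otimes> adj B (t \<xi>)) = t \<xi> \<otimes> ((adj B (t \<xi>) \<otimes> t \<xi>) \<otimes> adj B (t \<xi>))"
    using assms by (simp add: mult_assoc)
  also have "\<dots> = t \<xi> \<otimes> adj B (t \<xi>)" using assms by (simp add: t_adj_self src_adj_t)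
  finally show ?thesis using assms by (simp add: projection_def adj_mult)
qed

lemma t_adj_t: assumes "\<xi> \<in> mor \<Gamma>" shows "t \<xi> \<otimes> adj B (t \<xi>) \<otimes> t \<xi> = t \<xi>"
  using assms by (simp add: mult_assoc t_adj_self t_mult_src)

lemma nrm_t_le: assumes "\<xi> \<in> mor \<Gamma>" shows "nrm B (t \<xi>) \<le> 1"
proof -
  have "(nrm B (t \<xi>))\<^sup>2 \<le> 1\<^sup>2"
    using cstar_identity[of "t \<xi>"] assms nrm_projection_le[OF t_projection[of "src \<Gamma> \<xi>"]] by (simp add: t_adj_self)
  then show ?thesis by (rule power2_le_imp_le) simp
qed

lemma adj_t_mult_orth:
  assumes "\<xi> \<in> mor \<Gamma>" "\<eta> \<in> mor \<Gamma>" "rng \<Gamma> \<xi> \<noteq> rng \<Gamma> \<eta>"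
  shows "adj B (t \<xi>) \<otimes> t \<eta> = \<zero>"
proof -
  have "adj B (t \<xi>) \<otimes> t \<eta> = (adj B (t \<xi>) \<otimes> t (rng \<Gamma> \<xi>)) \<otimes> (t (rng \<Gamma> \<eta>) \<otimes> t \<eta>)"
    using assms by (simp add: adj_t_rng t_rng_mult)
  also have "\<dots> = adj B (t \<xi>) \<otimes> ((t (rng \<Gamma> \<xi>) \<otimes> t (rng \<Gamma> \<eta>)) \<otimes> t \<eta>)"
    using assms by (simp only: mult_assoc t_in rng_closed adj_closed mult_closed)
  also have "\<dots> = \<zero>" using assms by (simp add: t_orth)
  finally show ?thesis .
qed

text \<open>
  The range projections of the paths of one degree into a vertex sum to the vertex
  projection, which fixes each of them; such projections are orthogonal by
  \<open>projections_orthogonal\<close>.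
\<close>

lemma same_degree_orth:
  assumes "\<xi> \<in> mor \<Gamma>" "\<eta> \<in> mor \<Gamma>" "deg \<Gamma> \<xi> = deg \<Gamma> \<eta>" "\<xi> \<noteq> \<eta>"
  shows "adj B (t \<xi>) \<otimes> t \<eta> = \<zero>"
proof (cases "rng \<Gamma> \<xi> = rng \<Gamma> \<eta>")
  case True
  define v where "v = rng \<Gamma> \<xi>"
  define I where "I = paths_into \<Gamma> v (deg \<Gamma> \<xi>)"
  have I: "finite I" "\<xi> \<in> I" "\<eta> \<in> I" "\<And>\<zeta>. \<zeta> \<in> I \<Longrightarrow> \<zeta> \<in> mor \<Gamma> \<and> rng \<Gamma> \<zeta> = v"
    unfolding I_def v_def using assms(1) finite_paths_into[OF rng_vertex] apply blast
    using assms True by (auto simp: paths_into_def)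
  have "t v \<otimes> (t \<zeta> \<otimes> adj B (t \<zeta>)) = t \<zeta> \<otimes> adj B (t \<zeta>)" if "\<zeta> \<in> I" for \<zeta>
    using I(4)[OF that] assms(1) t_rng_mult[of \<zeta>]
    by (simp add: v_def vertexD rng_closed flip: mult_assoc)
  moreover have "(\<Oplus>\<zeta>\<in>I. t \<zeta> \<otimes> adj B (t \<zeta>)) = t v"
    unfolding I_def by (rule t_sum[symmetric]) (simp add: v_def assms)
  ultimately have o: "(t \<xi> \<otimes> adj B (t \<xi>)) \<otimes> (t \<eta> \<otimes> adj B (t \<eta>)) = \<zero>"
    using I(4) range_projection
    by (intro projections_orthogonal[OF I(1) _ _ I(3,2) assms(4)[symmetric], of "\<lambda>\<zeta>. t \<zeta> \<otimes> adj B (t \<zeta>)"]) simp_all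
  have "adj B (t \<xi>) \<otimes> t \<eta> = adj B (t \<xi> \<otimes> adj B (t \<xi>) \<otimes> t \<xi>) \<otimes> (t \<eta> \<otimes> adj B (t \<eta>) \<otimes> t \<eta>)"
    using assms by (simp add: t_adj_t)
  also have "\<dots> = adj B (t \<xi>) \<otimes> (((t \<xi> \<otimes> adj B (t \<xi>)) \<otimes> (t \<eta> \<otimes> adj B (t \<eta>))) \<otimes> t \<eta>)"
    using assms by (simp add: adj_mult mult_assoc)
  finally show ?thesis using o assms by simp
qed (use assms adj_t_mult_orth in auto)

lemma same_degree_mult:
  assumes "\<xi> \<in> mor \<Gamma>" "\<eta> \<in> mor \<Gamma>" "deg \<Gamma> \<xi> = deg \<Gamma> \<eta>"
  shows "adj B (t \<xi>) \<otimes> t \<eta> = (if \<xi> = \<eta> then t (src \<Gamma> \<xi>) else \<zero>)"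
  using same_degree_orth[OF assms] t_adj_self assms by auto

lemma adj_t_mult_longer:
  assumes "\<xi> \<in> mor \<Gamma>" "\<theta> \<in> mor \<Gamma>" "deg \<Gamma> \<theta> = deg \<Gamma> \<xi> + q"
  shows "adj B (t \<xi>) \<otimes> t \<theta> = (if init (deg \<Gamma> \<xi>) \<theta> = \<xi> then t (tail (deg \<Gamma> \<xi>) \<theta>) else \<zero>)"
proof -
  note i = init_tail[OF assms(2,3)]
  have "adj B (t \<xi>) \<otimes> t \<theta> = (adj B (t \<xi>) \<otimes> t (init (deg \<Gamma> \<xi>) \<theta>)) \<otimes> t (tail (deg \<Gamma> \<xi>) \<theta>)"
    using t_comp[OF i(1,2,5)] i assms by (simp add: mult_assoc)
  then show ?thesis using same_degree_mult[OF assms(1) i(1)] i t_rng_mult by auto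
qed

text \<open>
  Inserting the expansion of the vertex projection between the two factors reduces the
  product to paths \<open>\<theta>\<close> that may be chosen longer than both
  \<open>\<xi>\<close> and \<open>\<eta>\<close>.
\<close>

lemma adj_t_mult_expand:
  assumes "\<xi> \<in> mor \<Gamma>" "\<eta> \<in> mor \<Gamma>" "rng \<Gamma> \<xi> = rng \<Gamma> \<eta>"
  shows "adj B (t \<xi>) \<otimes> t \<eta> = (\<Oplus>\<theta>\<in>paths_into \<Gamma> (rng \<Gamma> \<xi>) p. (adj B (t \<xi>) \<otimes> t \<theta>) \<otimes> adj B (adj B (t \<eta>) \<otimes> t \<theta>))"
proof -
  let ?I = "paths_into \<Gamma> (rng \<Gamma> \<xi>) p"
  have I: "\<theta> \<in> mor \<Gamma>" if "\<theta> \<in> ?I" for \<theta> using that by (auto simp: paths_into_def)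
  have "adj B (t \<xi>) \<otimes> t \<eta> = (adj B (t \<xi>) \<otimes> t (rng \<Gamma> \<xi>)) \<otimes> t \<eta>" using assms(1) by (simp add: adj_t_rng)
  also have "\<dots> = (\<Oplus>\<theta>\<in>?I. adj B (t \<xi>) \<otimes> (t \<theta> \<otimes> adj B (t \<theta>))) \<otimes> t \<eta>"
    using assms I finsum_mult_left[of ?I "adj B (t \<xi>)" "\<lambda>\<theta>. t \<theta> \<otimes> adj B (t \<theta>)"]
    by (subst t_sum[of "rng \<Gamma> \<xi>" p]) auto
  also have "\<dots> = (\<Oplus>\<theta>\<in>?I. adj B (t \<xi>) \<otimes> (t \<theta> \<otimes> adj B (t \<theta>)) \<otimes> t \<eta>)"
    using assms I by (intro finsum_mult_right) auto
  also have "\<dots> = (\<Oplus>\<theta>\<in>?I. (adj B (t \<xi>) \<otimes> t \<theta>) \<otimes> adj B (adj B (t \<eta>) \<otimes> t \<theta>))"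
    using assms I by (intro M.finsum_cong') (auto simp: adj_mult mult_assoc)
  finally show ?thesis .
qed

text \<open>
  With \<open>\<theta>\<close> of degree \<open>d(\<xi>) + d(\<eta>)\<close> in
  \<open>adj_t_mult_expand\<close>, a nonzero term requires that \<open>\<theta>\<close>
  extend both \<open>\<xi>\<close> and \<open>\<eta>\<close>.
\<close>

lemma no_common_extension:
  assumes "\<xi> \<in> mor \<Gamma>" "\<eta> \<in> mor \<Gamma>"
    and none: "\<And>\<kappa> \<kappa>'. \<kappa> \<in> mor \<Gamma> \<Longrightarrow> \<kappa>' \<in> mor \<Gamma> \<Longrightarrow> src \<Gamma> \<xi> = rng \<Gamma> \<kappa> \<Longrightarrow> src \<Gamma> \<eta> = rng \<Gamma> \<kappa>' \<Longrightarrow>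
      comp \<Gamma> \<xi> \<kappa> \<noteq> comp \<Gamma> \<eta> \<kappa>'"
  shows "adj B (t \<xi>) \<otimes> t \<eta> = \<zero>"
proof (cases "rng \<Gamma> \<xi> = rng \<Gamma> \<eta>")
  case True
  let ?p = "deg \<Gamma> \<xi> + deg \<Gamma> \<eta>"
  have "(adj B (t \<xi>) \<otimes> t \<theta>) \<otimes> adj B (adj B (t \<eta>) \<otimes> t \<theta>) = \<zero>" if "\<theta> \<in> paths_into \<Gamma> (rng \<Gamma> \<xi>) ?p" for \<theta>
  proof -
    have \<theta>: "\<theta> \<in> mor \<Gamma>" "deg \<Gamma> \<theta> = deg \<Gamma> \<xi> + deg \<Gamma> \<eta>" "deg \<Gamma> \<theta> = deg \<Gamma> \<eta> + deg \<Gamma> \<xi>"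
      using that by (auto simp: paths_into_def add.commute)
    note i = init_tail[OF \<theta>(1,2)] and j = init_tail[OF \<theta>(1,3)]
    have "init (deg \<Gamma> \<xi>) \<theta> \<noteq> \<xi> \<or> init (deg \<Gamma> \<eta>) \<theta> \<noteq> \<eta>"
      using none[OF i(2) j(2)] i(5,6) j(5,6) by auto
    then show ?thesis
      using adj_t_mult_longer[OF assms(1) \<theta>(1,2)] adj_t_mult_longer[OF assms(2) \<theta>(1,3)] assms \<theta> i j by auto
  qed
  then show ?thesis using adj_t_mult_expand[OF assms(1,2) True, of ?p] by (simp cong: M.finsum_cong)
qed (use assms adj_t_mult_orth in auto)

end

section \<open>Linear combinations of spanning monomials\<close>

text \<open>
  A formal linear combination is a list of coefficients and indices, in which indices may be
  repeated. The same list is evaluated in the universal algebra and in \<open>B\<close>,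
  which is how norms in the two are compared.
\<close>

primrec lincomb :: "'b cstar \<Rightarrow> ('k \<Rightarrow> 'b) \<Rightarrow> (complex \<times> 'k) list \<Rightarrow> 'b" where
  "lincomb B e [] = \<zero>\<^bsub>B\<^esub>"
| "lincomb B e (x # l) = fst x \<odot>\<^bsub>B\<^esub> e (snd x) \<oplus>\<^bsub>B\<^esub> lincomb B e l"

abbreviation supp :: "(complex \<times> 'k) list \<Rightarrow> 'k set" where
  "supp l \<equiv> snd ` set l"

text \<open>
  The operations on lists indexed by pairs mirror the calculus of matrix units:
  \<open>e\<^sub>i\<^sub>j\<^sup>* = e\<^sub>j\<^sub>i\<close>, and \<open>e\<^sub>i\<^sub>j
  e\<^sub>k\<^sub>l\<close> is \<open>e\<^sub>i\<^sub>l\<close> or zero according to whether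
  \<open>j = k\<close>.
\<close>

definition formal_adj :: "(complex \<times> 'i \<times> 'j) list \<Rightarrow> (complex \<times> 'j \<times> 'i) list" where
  "formal_adj = map (\<lambda>x. (cnj (fst x), prod.swap (snd x)))"

definition formal_mult :: "(complex \<times> 'i \<times> 'j) list \<Rightarrow> (complex \<times> 'j \<times> 'k) list \<Rightarrow> (complex \<times> 'i \<times> 'k) list" where
  "formal_mult l l' = concat (map (\<lambda>x. map (\<lambda>y. (fst x * fst y, fst (snd x), snd (snd y)))
     (filter (\<lambda>y. fst (snd y) = snd (snd x)) l')) l)"

definition coef :: "'k \<Rightarrow> (complex \<times> 'k) list \<Rightarrow> complex" where
  "coef z l = sum_list (map fst (filter (\<lambda>x. snd x = z) l))"

lemma supp_formal_adj: "supp (formal_adj l) = prod.swap ` supp l"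
  by (auto simp: formal_adj_def image_image)

lemma supp_formal_mult: "z \<in> supp (formal_mult l l') \<longleftrightarrow>
    (\<exists>x\<in>supp l. \<exists>y\<in>supp l'. fst y = snd x \<and> z = (fst x, snd y))"
  by (force simp: formal_mult_def)

context cstar_algebra begin

lemma lincomb_in [simp, intro]: "(\<And>k. k \<in> supp l \<Longrightarrow> e k \<in> carrier B) \<Longrightarrow> lincomb B e l \<in> carrier B"
  by (induction l) auto

lemma lincomb_cong: "(\<And>k. k \<in> supp l \<Longrightarrow> e k = e' k) \<Longrightarrow> lincomb B e l = lincomb B e' l"
  by (induction l) auto

lemma lincomb_map: "lincomb B e (map (\<lambda>x. (fst x, f (snd x))) l) = lincomb B (\<lambda>k. e (f k)) l"
  by (induction l) auto

lemma lincomb_append: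
  assumes "\<And>k. k \<in> supp l \<Longrightarrow> e k \<in> carrier B" "\<And>k. k \<in> supp l' \<Longrightarrow> e k \<in> carrier B"
  shows "lincomb B e (l @ l') = lincomb B e l \<oplus> lincomb B e l'"
  using assms by (induction l) (simp_all add: M.a_assoc)

lemma lincomb_scale:
  assumes "\<And>k. k \<in> supp l \<Longrightarrow> e k \<in> carrier B"
  shows "lincomb B e (map (\<lambda>x. (c * fst x, snd x)) l) = c \<odot> lincomb B e l"
  using assms by (induction l) (simp_all add: scale_add_right)

lemma lincomb_sandwich:
  assumes "x \<in> carrier B" "y \<in> carrier B" "\<And>k. k \<in> supp l \<Longrightarrow> e k \<in> carrier B"
  shows "x \<otimes> lincomb B e l \<otimes> y = lincomb B (\<lambda>k. x \<otimes> e k \<otimes> y) l"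
  using assms(3) by (induction l)
    (use assms(1,2) in \<open>simp_all add: distrib_left distrib_right smult_mult_left smult_mult_right\<close>)

lemma lincomb_formal_adj:
  assumes "\<And>k. k \<in> supp l \<Longrightarrow> e k \<in> carrier B" "\<And>k. k \<in> supp l \<Longrightarrow> e' (prod.swap k) = adj B (e k)"
  shows "lincomb B e' (formal_adj l) = adj B (lincomb B e l)"
  using assms by (induction l) (simp_all add: formal_adj_def adj_add adj_smult)

lemma lincomb_mult_single:
  assumes x: "e' x \<in> carrier B"
    and e: "\<And>k. k \<in> supp l \<Longrightarrow> e k \<in> carrier B"
    and ee: "\<And>k. k \<in> supp l \<Longrightarrow> e' x \<otimes> e k = (if fst k = snd x then e'' (fst x, snd k) else \<zero>)"
  shows "(c \<odot> e' x) \<otimes> lincomb B e l =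
    lincomb B e'' (map (\<lambda>y. (c * fst y, fst x, snd (snd y))) (filter (\<lambda>y. fst (snd y) = snd x) l))"
  using e ee
proof (induction l)
  case (Cons y l)
  have "lincomb B e l \<in> carrier B" "e (snd y) \<in> carrier B" using Cons.prems by auto
  moreover have "(c \<odot> e' x) \<otimes> lincomb B e l =
    lincomb B e'' (map (\<lambda>y. (c * fst y, fst x, snd (snd y))) (filter (\<lambda>y. fst (snd y) = snd x) l))"
    using Cons by auto
  moreover have "e' x \<otimes> e (snd y) = (if fst (snd y) = snd x then e'' (fst x, snd (snd y)) else \<zero>)"
    using Cons.prems(2)[of "snd y"] by simp
  moreover have "(c \<odot> e' x) \<otimes> lincomb B e (y # l) = (c * fst y) \<odot> (e' x \<otimes> e (snd y)) \<oplus> (c \<odot> e' x) \<otimes> lincomb B e l"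
    using x calculation(1,2) by (simp add: distrib_left smult_mult_left smult_mult_right mult.commute)
  moreover have "(c \<odot> e' x) \<otimes> lincomb B e l \<in> carrier B" using x calculation(1) by simp
  ultimately show ?case using x by auto
qed (use x in simp)

lemma lincomb_formal_mult:
  assumes e: "\<And>k. k \<in> supp l \<Longrightarrow> e k \<in> carrier B"
    and e': "\<And>k. k \<in> supp l' \<Longrightarrow> e' k \<in> carrier B"
    and ee: "\<And>x y. x \<in> supp l \<Longrightarrow> y \<in> supp l' \<Longrightarrow>
      e x \<otimes> e' y = (if fst y = snd x then e'' (fst x, snd y) else \<zero>)"
  shows "lincomb B e l \<otimes> lincomb B e' l' = lincomb B e'' (formal_mult l l')"
  using e ee
proof (induction l)
  case Nil then show ?case using e' by (simp add: formal_mult_def)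
next
  case (Cons x l)
  have c'': "e'' (fst x, snd y) \<in> carrier B" if "x \<in> supp (x' # l)" "y \<in> supp l'" "fst y = snd x"
    "\<And>k. k \<in> supp (x' # l) \<Longrightarrow> e k \<in> carrier B"
    "\<And>x y. x \<in> supp (x' # l) \<Longrightarrow> y \<in> supp l' \<Longrightarrow>
      e x \<otimes> e' y = (if fst y = snd x then e'' (fst x, snd y) else \<zero>)" for x y x'
    using that(5)[OF that(1,2)] that(3) that(4)[OF that(1)] e'[OF that(2)] by (metis mult_closed)
  have m: "lincomb B e l \<in> carrier B" "e (snd x) \<in> carrier B" using Cons.prems(1) by auto
  have l': "lincomb B e' l' \<in> carrier B" using e' by auto
  let ?h = "map (\<lambda>y. (fst x * fst y, fst (snd x), snd (snd y))) (filter (\<lambda>y. fst (snd y) = snd (snd x)) l')"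
  have "lincomb B e l \<otimes> lincomb B e' l' = lincomb B e'' (formal_mult l l')"
    using Cons.prems by (intro Cons.IH) auto
  moreover have "(fst x \<odot> e (snd x)) \<otimes> lincomb B e' l' = lincomb B e'' ?h"
    using Cons.prems(2) m(2) e' by (intro lincomb_mult_single) auto
  moreover have "lincomb B e'' (?h @ formal_mult l l') = lincomb B e'' ?h \<oplus> lincomb B e'' (formal_mult l l')"
  proof (rule lincomb_append)
    fix k assume "k \<in> supp ?h"
    then obtain w where "w \<in> set l'" "fst (snd w) = snd (snd x)" "k = (fst (snd x), snd (snd w))" by auto
    then show "e'' k \<in> carrier B" using c''[of "snd x" x "snd w"] Cons.prems by simp
  next
    fix k assume "k \<in> supp (formal_mult l l')"
    then obtain z y where "z \<in> supp l" "y \<in> supp l'" "fst y = snd z" "k = (fst z, snd y)"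
      unfolding supp_formal_mult by blast
    then show "e'' k \<in> carrier B" using c''[of z x y] Cons.prems by simp
  qed
  moreover have "formal_mult (x # l) l' = ?h @ formal_mult l l'" by (simp add: formal_mult_def)
  ultimately show ?case using m l' by (simp add: distrib_right)
qed

lemma lincomb_coef:
  assumes J: "finite J" "supp l \<subseteq> J" and e: "\<And>k. k \<in> J \<Longrightarrow> e k \<in> carrier B"
  shows "lincomb B e l = (\<Oplus>z\<in>J. coef z l \<odot> e z)"
  using J(2)
proof (induction l)
  case Nil then show ?case using e by (simp add: coef_def cong: M.finsum_cong)
next
  case (Cons x l)
  have "(\<Oplus>z\<in>J. coef z (x # l) \<odot> e z) =
      (\<Oplus>z\<in>J. (if z = snd x then fst x else 0) \<odot> e z \<oplus> coef z l \<odot> e z)"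
    using e by (intro M.finsum_cong') (auto simp: coef_def scale_add_left)
  also have "\<dots> = (\<Oplus>z\<in>J. (if z = snd x then fst x else 0) \<odot> e z) \<oplus> (\<Oplus>z\<in>J. coef z l \<odot> e z)"
    using e by (intro M.finsum_addf) auto
  also have "(\<Oplus>z\<in>J. (if z = snd x then fst x else 0) \<odot> e z) = fst x \<odot> e (snd x)"
    using finsum_single_term[OF cstar_algebra_axioms J(1), of "snd x" "\<lambda>z. (if z = snd x then fst x else 0) \<odot> e z"]
      Cons.prems e by simp
  finally show ?case using Cons by simp
qed

lemma nrm_lincomb_coef_le:
  assumes J: "finite J" "supp l \<subseteq> J" and e: "\<And>k. k \<in> J \<Longrightarrow> e k \<in> carrier B" "\<And>k. k \<in> J \<Longrightarrow> nrm B (e k) \<le> 1"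
  shows "nrm B (lincomb B e l) \<le> (\<Sum>z\<in>J. cmod (coef z l))"
proof -
  have "nrm B (lincomb B e l) \<le> (\<Sum>z\<in>J. nrm B (coef z l \<odot> e z))"
    using nrm_finsum_le[OF J(1), of "\<lambda>z. coef z l \<odot> e z"] e lincomb_coef[OF J e(1)] by simp
  also have "\<dots> \<le> (\<Sum>z\<in>J. cmod (coef z l))"
    using e by (intro sum_mono) (simp add: nrm_smult mult_left_le)
  finally show ?thesis .
qed

lemma nrm_lincomb_le:
  assumes "\<And>k. k \<in> supp l \<Longrightarrow> e k \<in> carrier B" "\<And>k. k \<in> supp l \<Longrightarrow> nrm B (e k) \<le> 1"
  shows "nrm B (lincomb B e l) \<le> sum_list (map (\<lambda>x. cmod (fst x)) l)"
  using assms
proof (induction l)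
  case (Cons x l)
  have "cmod (fst x) * nrm B (e (snd x)) \<le> cmod (fst x)" using Cons.prems by (simp add: mult_left_le)
  then show ?case using Cons nrm_triangle[of "fst x \<odot> e (snd x)" "lincomb B e l"] by (simp add: nrm_smult)
qed simp

lemma finsum_in_subset:
  assumes "finite I" "E \<subseteq> carrier B" "\<zero> \<in> E" "\<And>x y. x \<in> E \<Longrightarrow> y \<in> E \<Longrightarrow> x \<oplus> y \<in> E" "\<And>i. i \<in> I \<Longrightarrow> f i \<in> E"
  shows "finsum B f I \<in> E"
  using assms(1,5)
proof (induction I)
  case (insert i I)
  then have "f ` insert i I \<subseteq> carrier B" using assms(2) by auto
  then show ?case using insert assms(4) by (simp add: Pi_def image_subset_iff)
qed (use assms(3) in simp)

lemma lincomb_distinct: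
  assumes "distinct zs" "\<And>\<zeta>. \<zeta> \<in> set zs \<Longrightarrow> e (f \<zeta>) \<in> carrier B"
  shows "lincomb B e (map (\<lambda>\<zeta>. (c, f \<zeta>)) zs) = (\<Oplus>\<zeta>\<in>set zs. c \<odot> e (f \<zeta>))"
  using assms by (induction zs) (simp_all add: Pi_def)

text \<open>
  For self-adjoint elements the C*-identity turns squaring into squaring of the norm.
\<close>

lemma nrm_iterated_square:
  assumes x: "\<And>k. x k \<in> carrier B" "adj B (x 0) = x 0" "\<And>k. x (Suc k) = x k \<otimes> x k"
  shows "nrm B (x k) = nrm B (x 0) ^ (2 ^ k)"
proof -
  have sa: "adj B (x k) = x k" for k
    by (induction k) (use x in \<open>auto simp: adj_mult\<close>)
  show ?thesis
  proof (induction k)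
    case (Suc k)
    have "nrm B (x (Suc k)) = (nrm B (x k))\<^sup>2" using cstar_identity[OF x(1), of k] sa x(3) by simp
    then show ?case using Suc by (simp add: power_mult[symmetric] mult.commute)
  qed simp
qed

end

lemma cstar_hom_lincomb:
  assumes "cstar_algebra A" "cstar_algebra B" "\<pi> \<in> cstar_hom A B"
    and "\<And>k. k \<in> supp l \<Longrightarrow> e k \<in> carrier A"
  shows "\<pi> (lincomb A e l) = lincomb B (\<lambda>k. \<pi> (e k)) l"
proof -
  interpret A: cstar_algebra A by fact
  show ?thesis using assms(4)
    by (induction l) (simp_all add: cstar_hom_zero[OF assms(1-3)] cstar_homD[OF assms(3)])
qed

context row_finite_p_graph begin

definition span_pairs :: "('g \<times> 'g) set" where
  "span_pairs = {(\<xi>, \<eta>). \<xi> \<in> mor \<Gamma> \<and> \<eta> \<in> mor \<Gamma> \<and> src \<Gamma> \<xi> = src \<Gamma> \<eta>}"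

lemma span_pairs_iff [simp]:
  "z \<in> span_pairs \<longleftrightarrow> fst z \<in> mor \<Gamma> \<and> snd z \<in> mor \<Gamma> \<and> src \<Gamma> (fst z) = src \<Gamma> (snd z)"
  by (auto simp: span_pairs_def)

lemma span_pairsD:
  "supp l \<subseteq> span_pairs \<Longrightarrow> z \<in> supp l \<Longrightarrow> fst z \<in> mor \<Gamma> \<and> snd z \<in> mor \<Gamma> \<and> src \<Gamma> (fst z) = src \<Gamma> (snd z)"
  using span_pairs_iff by blast

end

context ck begin

text \<open>
  The span of these monomials is a dense subalgebra; see \<open>span_dense\<close>.
\<close>

definition T :: "'g \<times> 'g \<Rightarrow> 'b" where "T z = t (fst z) \<otimes> adj B (t (snd z))"

lemma T_in [simp, intro]: "fst z \<in> mor \<Gamma> \<Longrightarrow> snd z \<in> mor \<Gamma> \<Longrightarrow> T z \<in> carrier B"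
  by (simp add: T_def)

lemma nrm_T_le: assumes "fst z \<in> mor \<Gamma>" "snd z \<in> mor \<Gamma>" shows "nrm B (T z) \<le> 1"
proof -
  have "nrm B (T z) \<le> nrm B (t (fst z)) * nrm B (t (snd z))"
    using nrm_mult[of "t (fst z)" "adj B (t (snd z))"] assms by (simp add: T_def)
  also have "\<dots> \<le> 1 * 1" using assms by (intro mult_mono nrm_t_le) auto
  finally show ?thesis by simp
qed

lemma adj_T: "fst z \<in> mor \<Gamma> \<Longrightarrow> snd z \<in> mor \<Gamma> \<Longrightarrow> adj B (T z) = T (prod.swap z)"
  by (simp add: T_def adj_mult)

lemma T_comp:
  assumes "\<xi> \<in> mor \<Gamma>" "\<eta> \<in> mor \<Gamma>" "\<kappa> \<in> mor \<Gamma>" "\<kappa>' \<in> mor \<Gamma>" "src \<Gamma> \<xi> = rng \<Gamma> \<kappa>" "src \<Gamma> \<eta> = rng \<Gamma> \<kappa>'"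
  shows "t \<xi> \<otimes> T (\<kappa>, \<kappa>') \<otimes> adj B (t \<eta>) = T (comp \<Gamma> \<xi> \<kappa>, comp \<Gamma> \<eta> \<kappa>')"
  using assms by (simp add: T_def t_comp adj_mult mult_assoc)

text \<open>
  Monomials whose inner paths have equal degree multiply like matrix units.
\<close>

lemma T_mult:
  assumes "\<alpha> \<in> mor \<Gamma>" "\<beta> \<in> mor \<Gamma>" "\<gamma> \<in> mor \<Gamma>" "\<delta> \<in> mor \<Gamma>" "deg \<Gamma> \<beta> = deg \<Gamma> \<gamma>" "src \<Gamma> \<alpha> = src \<Gamma> \<beta>"
  shows "T (\<alpha>, \<beta>) \<otimes> T (\<gamma>, \<delta>) = (if \<gamma> = \<beta> then T (\<alpha>, \<delta>) else \<zero>)"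
proof -
  have "T (\<alpha>, \<beta>) \<otimes> T (\<gamma>, \<delta>) = t \<alpha> \<otimes> (adj B (t \<beta>) \<otimes> t \<gamma>) \<otimes> adj B (t \<delta>)"
    using assms(1-4) by (simp add: T_def mult_assoc)
  also have "\<dots> = (if \<gamma> = \<beta> then T (\<alpha>, \<delta>) else \<zero>)"
    using assms same_degree_mult[OF assms(2,3,5)] t_mult_src[OF assms(1)]
    by (simp add: T_def)
  finally show ?thesis .
qed

lemma span_in [simp, intro]: "supp l \<subseteq> span_pairs \<Longrightarrow> lincomb B T l \<in> carrier B"
  using span_pairsD by (intro lincomb_in) blast

lemma T_expand:
  assumes "\<xi> \<in> mor \<Gamma>" "\<eta> \<in> mor \<Gamma>" "src \<Gamma> \<xi> = src \<Gamma> \<eta>"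
  shows "T (\<xi>, \<eta>) = (\<Oplus>\<zeta>\<in>paths_into \<Gamma> (src \<Gamma> \<xi>) q. T (comp \<Gamma> \<xi> \<zeta>, comp \<Gamma> \<eta> \<zeta>))"
proof -
  let ?I = "paths_into \<Gamma> (src \<Gamma> \<xi>) q"
  have I: "\<zeta> \<in> mor \<Gamma> \<and> rng \<Gamma> \<zeta> = src \<Gamma> \<xi>" if "\<zeta> \<in> ?I" for \<zeta> using that by (auto simp: paths_into_def)
  have "T (\<xi>, \<eta>) = t \<xi> \<otimes> t (src \<Gamma> \<xi>) \<otimes> adj B (t \<eta>)"
    using assms(1) by (simp add: T_def t_mult_src)
  also have "\<dots> = (\<Oplus>\<zeta>\<in>?I. t \<xi> \<otimes> T (\<zeta>, \<zeta>)) \<otimes> adj B (t \<eta>)"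
    using assms I finsum_mult_left[of ?I "t \<xi>" "\<lambda>\<zeta>. T (\<zeta>, \<zeta>)"]
    by (subst t_sum[of "src \<Gamma> \<xi>" q]) (auto simp: T_def)
  also have "\<dots> = (\<Oplus>\<zeta>\<in>?I. t \<xi> \<otimes> T (\<zeta>, \<zeta>) \<otimes> adj B (t \<eta>))"
    using assms I by (intro finsum_mult_right) auto
  also have "\<dots> = (\<Oplus>\<zeta>\<in>?I. T (comp \<Gamma> \<xi> \<zeta>, comp \<Gamma> \<eta> \<zeta>))"
    using assms I by (intro M.finsum_cong') (auto simp: T_comp comp_closed)
  finally show ?thesis .
qed

text \<open>
  Only paths \<open>\<theta>\<close> of degree \<open>d(\<xi>) + d(\<eta>)\<close> that
  extend both \<open>\<xi>\<close> and \<open>\<eta>\<close> contribute to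
  \<open>adj_t_mult_expand\<close>, and each contributes the monomial of its two tails. This
  makes the span of the monomials closed under multiplication.
\<close>

lemma adj_t_mult_in_span:
  assumes "\<xi> \<in> mor \<Gamma>" "\<eta> \<in> mor \<Gamma>"
  shows "\<exists>l. supp l \<subseteq> {z \<in> span_pairs. rng \<Gamma> (fst z) = src \<Gamma> \<xi> \<and> rng \<Gamma> (snd z) = src \<Gamma> \<eta>} \<and>
    adj B (t \<xi>) \<otimes> t \<eta> = lincomb B T l"
proof -
  define G where "G = {z \<in> span_pairs. rng \<Gamma> (fst z) = src \<Gamma> \<xi> \<and> rng \<Gamma> (snd z) = src \<Gamma> \<eta>}"
  have G: "T z \<in> carrier B" if "z \<in> G" for z using that by (auto simp: G_def)
  define E where "E = {lincomb B T l | l. supp l \<subseteq> G}"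
  have Ezero: "\<zero> \<in> E" by (auto simp: E_def intro!: exI[of _ "[]"])
  have Eadd: "x \<oplus> y \<in> E" if "x \<in> E" "y \<in> E" for x y
  proof -
    obtain l l' where l: "x = lincomb B T l" "y = lincomb B T l'" "supp l \<subseteq> G" "supp l' \<subseteq> G"
      using \<open>x \<in> E\<close> \<open>y \<in> E\<close> by (auto simp: E_def)
    then have "x \<oplus> y = lincomb B T (l @ l')" unfolding l
      using G by (intro lincomb_append[symmetric]) blast+
    moreover have "supp (l @ l') \<subseteq> G" using l by auto
    ultimately show ?thesis unfolding E_def by blast
  qed
  have "adj B (t \<xi>) \<otimes> t \<eta> \<in> E"
  proof (cases "rng \<Gamma> \<xi> = rng \<Gamma> \<eta>")
    case True
    let ?p = "deg \<Gamma> \<xi> + deg \<Gamma> \<eta>"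
    have "(adj B (t \<xi>) \<otimes> t \<theta>) \<otimes> adj B (adj B (t \<eta>) \<otimes> t \<theta>) \<in> E" if "\<theta> \<in> paths_into \<Gamma> (rng \<Gamma> \<xi>) ?p" for \<theta>
    proof -
      have \<theta>: "\<theta> \<in> mor \<Gamma>" "deg \<Gamma> \<theta> = deg \<Gamma> \<xi> + deg \<Gamma> \<eta>" "deg \<Gamma> \<theta> = deg \<Gamma> \<eta> + deg \<Gamma> \<xi>"
        using that by (auto simp: paths_into_def add.commute)
      note i = init_tail[OF \<theta>(1,2)] and j = init_tail[OF \<theta>(1,3)]
      note m = adj_t_mult_longer[OF assms(1) \<theta>(1,2)] adj_t_mult_longer[OF assms(2) \<theta>(1,3)]
      show ?thesis
      proof (cases "init (deg \<Gamma> \<xi>) \<theta> = \<xi> \<and> init (deg \<Gamma> \<eta>) \<theta> = \<eta>")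
        case True
        let ?z = "(tail (deg \<Gamma> \<xi>) \<theta>, tail (deg \<Gamma> \<eta>) \<theta>)"
        have z: "?z \<in> G" using i j True by (auto simp: G_def)
        have "(adj B (t \<xi>) \<otimes> t \<theta>) \<otimes> adj B (adj B (t \<eta>) \<otimes> t \<theta>) = lincomb B T [(1, ?z)]"
          using m True i(2) j(2) by (simp add: T_def)
        moreover have "supp [(1 :: complex, ?z)] \<subseteq> G" using z by simp
        ultimately show ?thesis unfolding E_def by blast
      next
        case False
        then have "(adj B (t \<xi>) \<otimes> t \<theta>) \<otimes> adj B (adj B (t \<eta>) \<otimes> t \<theta>) = \<zero>" using m i(2) j(2) by auto
        then show ?thesis using Ezero by simp
      qed
    qed
    moreover have "E \<subseteq> carrier B" using G unfolding E_def by (blast intro: lincomb_in)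
    ultimately show ?thesis unfolding adj_t_mult_expand[OF assms True, of ?p]
      using Ezero Eadd assms by (intro finsum_in_subset) auto
  qed (use adj_t_mult_orth assms Ezero in auto)
  then show ?thesis by (auto simp: E_def G_def)
qed

definition path_span :: "'b set" where "path_span = {lincomb B T l | l. supp l \<subseteq> span_pairs}"

lemma path_span_subset: "path_span \<subseteq> carrier B" by (auto simp: path_span_def)

lemma path_span_zero: "\<zero> \<in> path_span" by (auto simp: path_span_def intro!: exI[of _ "[]"])

lemma path_span_add: assumes "x \<in> path_span" "y \<in> path_span" shows "x \<oplus> y \<in> path_span"
proof -
  obtain l l' where l: "x = lincomb B T l" "y = lincomb B T l'" "supp l \<subseteq> span_pairs" "supp l' \<subseteq> span_pairs"
    using assms by (auto simp: path_span_def)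
  then have "x \<oplus> y = lincomb B T (l @ l')" unfolding l
    using span_pairsD by (intro lincomb_append[symmetric]) blast+
  moreover have "supp (l @ l') \<subseteq> span_pairs" using l by auto
  ultimately show ?thesis unfolding path_span_def by blast
qed

lemma path_span_scale: assumes "x \<in> path_span" shows "c \<odot> x \<in> path_span"
proof -
  obtain l where l: "x = lincomb B T l" "supp l \<subseteq> span_pairs" using assms by (auto simp: path_span_def)
  then have "c \<odot> x = lincomb B T (map (\<lambda>x. (c * fst x, snd x)) l)" unfolding l
    using span_pairsD by (intro lincomb_scale[symmetric]) blast
  moreover have "supp (map (\<lambda>x. (c * fst x, snd x)) l) = supp l" by (simp add: image_image)
  ultimately show ?thesis unfolding path_span_def using l(2) by (metis (mono_tags, lifting) mem_Collect_eq)
qed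

lemma T_in_path_span: assumes "z \<in> span_pairs" shows "T z \<in> path_span"
proof -
  have "T z = lincomb B T [(1, z)]" "supp [(1 :: complex, z)] \<subseteq> span_pairs" using assms by auto
  then show ?thesis unfolding path_span_def by blast
qed

lemma path_span_induct [consumes 1, case_names zero add]:
  assumes "x \<in> path_span" "P \<zero>" "\<And>c z y. z \<in> span_pairs \<Longrightarrow> y \<in> path_span \<Longrightarrow> P y \<Longrightarrow> P (c \<odot> T z \<oplus> y)"
  shows "P x"
proof -
  have "P (lincomb B T l)" if "supp l \<subseteq> span_pairs" for l
    using that
  proof (induction l)
    case (Cons x l)
    then have "lincomb B T l \<in> path_span" by (auto simp: path_span_def)
    with Cons show ?case using assms(3)[of "snd x" "lincomb B T l" "fst x"] by simp
  qed (use assms(2) in simp)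
  then show ?thesis using assms(1) by (auto simp: path_span_def)
qed

lemma path_span_adj: assumes "x \<in> path_span" shows "adj B x \<in> path_span"
  using assms
proof (induction rule: path_span_induct)
  case (add c z y)
  then have "adj B (c \<odot> T z \<oplus> y) = cnj c \<odot> T (prod.swap z) \<oplus> adj B y"
    using path_span_subset by (auto simp: adj_add adj_smult adj_T)
  then show ?case using add by (auto intro!: path_span_add path_span_scale T_in_path_span)
qed (simp add: path_span_zero)

lemma T_mult_in_path_span: assumes z: "z \<in> span_pairs" and w: "w \<in> span_pairs" shows "T z \<otimes> T w \<in> path_span"
proof -
  obtain \<alpha> \<xi> \<eta> \<beta> where zw: "z = (\<alpha>, \<xi>)" "w = (\<eta>, \<beta>)" by (cases z, cases w)
  have m: "\<alpha> \<in> mor \<Gamma>" "\<xi> \<in> mor \<Gamma>" "\<eta> \<in> mor \<Gamma>" "\<beta> \<in> mor \<Gamma>" "src \<Gamma> \<alpha> = src \<Gamma> \<xi>" "src \<Gamma> \<eta> = src \<Gamma> \<beta>"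
    using z w zw by auto
  obtain k where k: "supp k \<subseteq> {z \<in> span_pairs. rng \<Gamma> (fst z) = src \<Gamma> \<xi> \<and> rng \<Gamma> (snd z) = src \<Gamma> \<eta>}"
    "adj B (t \<xi>) \<otimes> t \<eta> = lincomb B T k"
    using adj_t_mult_in_span[OF m(2,3)] by auto
  have "T z \<otimes> T w = t \<alpha> \<otimes> (adj B (t \<xi>) \<otimes> t \<eta>) \<otimes> adj B (t \<beta>)"
    using m(1-4) by (simp add: zw T_def mult_assoc)
  also have "\<dots> = lincomb B (\<lambda>x. t \<alpha> \<otimes> T x \<otimes> adj B (t \<beta>)) k"
    unfolding k(2) using m(1,4) k(1) span_pairs_iff by (intro lincomb_sandwich adj_closed t_in T_in) blast+
  also have "\<dots> = lincomb B (\<lambda>x. T (comp \<Gamma> \<alpha> (fst x), comp \<Gamma> \<beta> (snd x))) k"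
  proof (rule lincomb_cong)
    fix x assume "x \<in> supp k"
    then have "x \<in> span_pairs" "rng \<Gamma> (fst x) = src \<Gamma> \<xi>" "rng \<Gamma> (snd x) = src \<Gamma> \<eta>" using k(1) by blast+
    then show "t \<alpha> \<otimes> T x \<otimes> adj B (t \<beta>) = T (comp \<Gamma> \<alpha> (fst x), comp \<Gamma> \<beta> (snd x))"
      using T_comp[of \<alpha> \<beta> "fst x" "snd x"] m by simp
  qed
  also have "\<dots> = lincomb B T (map (\<lambda>x. (fst x, comp \<Gamma> \<alpha> (fst (snd x)), comp \<Gamma> \<beta> (snd (snd x)))) k)"
    by (rule lincomb_map[symmetric])
  finally have "T z \<otimes> T w = lincomb B T (map (\<lambda>x. (fst x, comp \<Gamma> \<alpha> (fst (snd x)), comp \<Gamma> \<beta> (snd (snd x)))) k)" .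
  moreover have "supp (map (\<lambda>x. (fst x, comp \<Gamma> \<alpha> (fst (snd x)), comp \<Gamma> \<beta> (snd (snd x)))) k) \<subseteq> span_pairs"
  proof
    fix y assume "y \<in> supp (map (\<lambda>x. (fst x, comp \<Gamma> \<alpha> (fst (snd x)), comp \<Gamma> \<beta> (snd (snd x)))) k)"
    then obtain w where "w \<in> set k" "y = (comp \<Gamma> \<alpha> (fst (snd w)), comp \<Gamma> \<beta> (snd (snd w)))" by auto
    then obtain x where x: "x \<in> supp k" "y = (comp \<Gamma> \<alpha> (fst x), comp \<Gamma> \<beta> (snd x))" by blast
    then have "x \<in> span_pairs" "rng \<Gamma> (fst x) = src \<Gamma> \<xi>" "rng \<Gamma> (snd x) = src \<Gamma> \<eta>" using k(1) by blast+
    then show "y \<in> span_pairs" using m x(2) by (simp add: comp_closed src_comp)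
  qed
  ultimately show ?thesis unfolding path_span_def by blast
qed

lemma path_span_mult: assumes "x \<in> path_span" "y \<in> path_span" shows "x \<otimes> y \<in> path_span"
proof -
  have c: "T z \<in> carrier B" if "z \<in> span_pairs" for z using that by auto
  have single: "T z \<otimes> y \<in> path_span" if z: "z \<in> span_pairs" for z
    using assms(2)
  proof (induction rule: path_span_induct)
    case (add d w y)
    then have "T z \<otimes> (d \<odot> T w \<oplus> y) = d \<odot> (T z \<otimes> T w) \<oplus> T z \<otimes> y"
      using c[OF z] c[OF add(1)] path_span_subset by (auto simp: distrib_left smult_mult_right)
    then show ?case using path_span_add[OF path_span_scale[OF T_mult_in_path_span[OF z add(1)]] add(3)] by simp
  qed (use c[OF z] in \<open>simp add: path_span_zero\<close>)
  show ?thesis using assms(1)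
  proof (induction rule: path_span_induct)
    case (add d w x)
    have "x \<in> carrier B" "y \<in> carrier B" using add(2) assms(2) path_span_subset by blast+
    then have "(d \<odot> T w \<oplus> x) \<otimes> y = d \<odot> (T w \<otimes> y) \<oplus> x \<otimes> y"
      using c[OF add(1)] by (simp add: distrib_right smult_mult_left)
    then show ?case using add single[OF add(1)] by (auto intro!: path_span_add path_span_scale)
  qed (use assms(2) path_span_subset in \<open>auto simp: path_span_zero\<close>)
qed

text \<open>
  The closure of the span of the monomials is a C*-subalgebra containing every
  \<open>t\<^sub>\<xi> = t\<^sub>\<xi> t\<^sub>v\<^sup>*\<close>, where \<open>v =
  s(\<xi>)\<close>.
\<close>

lemma span_dense:
  assumes gen: "cstar_generated_by B (t ` mor \<Gamma>)" and a: "a \<in> carrier B" and \<epsilon>: "\<epsilon> > 0"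
  obtains l where "supp l \<subseteq> span_pairs" "nrm B (lincomb B T l \<ominus> a) < \<epsilon>"
proof -
  have "cstar_subalgebra B (seq_closure path_span)"
    using path_span_subset path_span_zero path_span_add path_span_mult path_span_adj path_span_scale
  proof (rule seq_closure_subalgebra[where Q = UNIV])
    fix c :: complex and e :: real assume "e > 0"
    then show "\<exists>q\<in>UNIV. cmod (q - c) < e" by (intro bexI[of _ c]) auto
  qed
  moreover have "t \<xi> \<in> path_span" if "\<xi> \<in> mor \<Gamma>" for \<xi>
  proof -
    have "t \<xi> = T (\<xi>, src \<Gamma> \<xi>)"
      using that by (simp add: T_def t_adj_vertex t_mult_src src_closed)
    then show ?thesis using T_in_path_span[of "(\<xi>, src \<Gamma> \<xi>)"] that by (simp add: src_closed src_src)
  qed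
  then have "t ` mor \<Gamma> \<subseteq> seq_closure path_span" using seq_closure_subset[OF path_span_subset] by auto
  ultimately have "a \<in> seq_closure path_span" using gen a by (auto simp: cstar_generated_by_def)
  from seq_closureD[OF this \<epsilon>] show ?thesis using that by (auto simp: path_span_def)
qed

end

section \<open>Matrix units and compression\<close>

text \<open>
  Taking roots of the hypothesis removes the constant \<open>K\<close>, as \<open>K\<close>
  to the power \<open>1/2\<^sup>n\<close> tends to 1.
\<close>

lemma le_if_powers_le:
  fixes a N K :: real
  assumes "0 \<le> a" "0 \<le> N" "\<And>k. a ^ (2 ^ Suc k) \<le> K * N ^ (2 ^ Suc k)"
  shows "a \<le> N"
proof (rule ccontr)
  assume "\<not> a \<le> N"
  then have aN: "a > N" by simp
  have "N \<noteq> 0"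
  proof
    assume "N = 0"
    then have "a ^ 2 \<le> 0" using assms(3)[of 0] by (simp add: power2_eq_square)
    then show False using aN \<open>N = 0\<close> by (simp add: power2_eq_square mult_le_0_iff)
  qed
  then have N: "N > 0" using assms(2) by simp
  have r: "a / N > 1" using aN N by simp
  have bound: "(a / N) ^ (2 ^ Suc k) \<le> K" for k
    using assms(3)[of k] N by (simp add: power_divide divide_simps del: power_Suc)
  obtain n where n: "K < (a / N) ^ n" using real_arch_pow[OF r] by blast
  have "n \<le> 2 ^ Suc n" using less_exp[of "Suc n"] by simp
  then have "(a / N) ^ n \<le> (a / N) ^ (2 ^ Suc n)" using r by (intro power_increasing) auto
  then show False using bound[of n] n by simp
qed

lemma (in cstar_algebra) lincomb_delta:
  assumes "x \<in> carrier B"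
  shows "lincomb B (\<lambda>k. if k = z then x else \<zero>) l = coef z l \<odot> x"
  by (induction l) (use assms in \<open>auto simp: coef_def scale_add_left\<close>)

context row_finite_p_graph begin

definition paths_list :: "'g \<Rightarrow> 'p \<Rightarrow> 'g list" where
  "paths_list v q = (SOME zs. distinct zs \<and> set zs = paths_into \<Gamma> v q)"

lemma paths_list: "v \<in> vertices \<Gamma> \<Longrightarrow> distinct (paths_list v q)"
  "v \<in> vertices \<Gamma> \<Longrightarrow> set (paths_list v q) = paths_into \<Gamma> v q"
  using someI_ex[of "\<lambda>zs. distinct zs \<and> set zs = paths_into \<Gamma> v q"] finite_distinct_list[of "paths_into \<Gamma> v q"]
  unfolding paths_list_def by auto

text \<open>
  Unique by cancellation, and arbitrary if there is no such \<open>r\<close>.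
\<close>

definition difference :: "'p \<Rightarrow> 'p \<Rightarrow> 'p" where "difference p q = (SOME r. p = q + r)"

lemma difference: "\<exists>r. p = q + r \<Longrightarrow> q + difference p q = p"
  unfolding difference_def by (metis (mono_tags, lifting) someI_ex)

definition extend :: "'g \<times> 'g \<Rightarrow> 'g \<Rightarrow> 'g \<times> 'g" where
  "extend z \<zeta> = (comp \<Gamma> (fst z) \<zeta>, comp \<Gamma> (snd z) \<zeta>)"

lemma extend_span:
  assumes "z \<in> span_pairs" "\<zeta> \<in> mor \<Gamma>" "rng \<Gamma> \<zeta> = src \<Gamma> (fst z)"
  shows "extend z \<zeta> \<in> span_pairs" "deg \<Gamma> (fst (extend z \<zeta>)) = deg \<Gamma> (fst z) + deg \<Gamma> \<zeta>"
    "deg \<Gamma> (snd (extend z \<zeta>)) = deg \<Gamma> (snd z) + deg \<Gamma> \<zeta>" "src \<Gamma> (fst (extend z \<zeta>)) = src \<Gamma> \<zeta>"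
  using assms by (simp_all add: extend_def comp_closed src_comp deg_comp)

text \<open>
  Each monomial is replaced by its prolongations, by all paths of the degree that brings the
  degree of the first path up to \<open>p\<close>. This amounts to the Cuntz-Krieger
  relation at the common source.
\<close>

definition raise_degree :: "'p \<Rightarrow> (complex \<times> 'g \<times> 'g) list \<Rightarrow> (complex \<times> 'g \<times> 'g) list" where
  "raise_degree p l = concat (map (\<lambda>x. map (\<lambda>\<zeta>. (fst x, extend (snd x) \<zeta>))
     (paths_list (src \<Gamma> (fst (snd x))) (difference p (deg \<Gamma> (fst (snd x)))))) l)"

lemma supp_raise_degree:
  assumes l: "supp l \<subseteq> span_pairs" and y: "y \<in> supp (raise_degree p l)"
  obtains z \<zeta> where "z \<in> supp l" "\<zeta> \<in> mor \<Gamma>" "rng \<Gamma> \<zeta> = src \<Gamma> (fst z)" "deg \<Gamma> \<zeta> = difference p (deg \<Gamma> (fst z))"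
    "y = extend z \<zeta>"
proof -
  obtain x \<zeta> where x: "x \<in> set l" "\<zeta> \<in> set (paths_list (src \<Gamma> (fst (snd x))) (difference p (deg \<Gamma> (fst (snd x)))))"
    "y = extend (snd x) \<zeta>" using y by (auto simp: raise_degree_def)
  then have "snd x \<in> supp l" by simp
  moreover from this have "fst (snd x) \<in> mor \<Gamma>" using l span_pairsD by blast
  ultimately show ?thesis using x that[of "snd x" \<zeta>] by (simp add: paths_list paths_into_def)
qed

lemma raise_degree_filter:
  assumes l: "supp l \<subseteq> span_pairs"
    and Q: "\<And>z \<zeta>. z \<in> supp l \<Longrightarrow> \<zeta> \<in> mor \<Gamma> \<Longrightarrow> rng \<Gamma> \<zeta> = src \<Gamma> (fst z) \<Longrightarrow> Q (extend z \<zeta>) \<longleftrightarrow> Q z"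
  shows "filter (\<lambda>x. Q (snd x)) (raise_degree p l) = raise_degree p (filter (\<lambda>x. Q (snd x)) l)"
  using assms
proof (induction l)
  case (Cons x l)
  let ?zs = "paths_list (src \<Gamma> (fst (snd x))) (difference p (deg \<Gamma> (fst (snd x))))"
  let ?m = "map (\<lambda>\<zeta>. (fst x, extend (snd x) \<zeta>)) ?zs"
  have "fst (snd x) \<in> mor \<Gamma>" using Cons.prems(1) by simp
  then have "Q (snd y) \<longleftrightarrow> Q (snd x)" if "y \<in> set ?m" for y
    using that Cons.prems(2)[of "snd x"] by (auto simp: paths_list paths_into_def)
  then have "filter (\<lambda>x. Q (snd x)) ?m = (if Q (snd x) then ?m else [])"
    by (simp add: filter_id_conv filter_empty_conv del: set_map)
  moreover have "raise_degree p (x # l) = ?m @ raise_degree p l" "raise_degree p (if Q (snd x) then [x] else []) = (if Q (snd x) then ?m else [])"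
    by (simp_all add: raise_degree_def)
  moreover have "filter (\<lambda>x. Q (snd x)) (raise_degree p l) = raise_degree p (filter (\<lambda>x. Q (snd x)) l)"
    using Cons.prems by (intro Cons.IH) auto
  ultimately show ?case by (simp add: raise_degree_def)
qed (simp add: raise_degree_def)

end

context ck begin

lemma lincomb_raise_degree:
  assumes "supp l \<subseteq> span_pairs"
  shows "lincomb B T (raise_degree p l) = lincomb B T l"
  using assms
proof (induction l)
  case (Cons x l)
  obtain c \<xi> \<eta> where x: "x = (c, \<xi>, \<eta>)" by (cases x)
  have m: "\<xi> \<in> mor \<Gamma>" "\<eta> \<in> mor \<Gamma>" "src \<Gamma> \<xi> = src \<Gamma> \<eta>" using Cons.prems x by auto
  define q where "q = difference p (deg \<Gamma> \<xi>)"
  let ?zs = "paths_list (src \<Gamma> \<xi>) q"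
  have zs: "distinct ?zs" "set ?zs = paths_into \<Gamma> (src \<Gamma> \<xi>) q" using m paths_list by simp_all
  have zm: "\<zeta> \<in> mor \<Gamma> \<and> rng \<Gamma> \<zeta> = src \<Gamma> \<xi>" if "\<zeta> \<in> set ?zs" for \<zeta> using that zs(2) by (auto simp: paths_into_def)
  have Tz: "T (extend (\<xi>, \<eta>) \<zeta>) \<in> carrier B" if "\<zeta> \<in> set ?zs" for \<zeta>
    using extend_span(1)[of "(\<xi>, \<eta>)" \<zeta>] zm[OF that] m by auto
  let ?m = "map (\<lambda>\<zeta>. (c, extend (\<xi>, \<eta>) \<zeta>)) ?zs"
  have "lincomb B T ?m = (\<Oplus>\<zeta>\<in>set ?zs. c \<odot> T (extend (\<xi>, \<eta>) \<zeta>))"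
    using zs(1) Tz by (rule lincomb_distinct)
  also have "\<dots> = c \<odot> (\<Oplus>\<zeta>\<in>set ?zs. T (extend (\<xi>, \<eta>) \<zeta>))"
    using Tz by (intro finsum_smult_ldistr[symmetric]) auto
  also have "(\<Oplus>\<zeta>\<in>set ?zs. T (extend (\<xi>, \<eta>) \<zeta>)) = T (\<xi>, \<eta>)"
    unfolding zs(2) extend_def fst_conv snd_conv using m by (rule T_expand[symmetric])
  finally have "lincomb B T ?m = c \<odot> T (\<xi>, \<eta>)" .
  moreover have "raise_degree p (x # l) = ?m @ raise_degree p l" by (simp add: raise_degree_def x q_def)
  moreover have "lincomb B T (?m @ raise_degree p l) = lincomb B T ?m \<oplus> lincomb B T (raise_degree p l)"
  proof (rule lincomb_append)
    fix k assume "k \<in> supp ?m" then show "T k \<in> carrier B" using Tz by auto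
  next
    have l: "supp l \<subseteq> span_pairs" using Cons.prems by simp
    fix k assume "k \<in> supp (raise_degree p l)"
    from supp_raise_degree[OF l this] obtain z \<zeta> where
      z: "z \<in> supp l" "\<zeta> \<in> mor \<Gamma>" "rng \<Gamma> \<zeta> = src \<Gamma> (fst z)" "k = extend z \<zeta>" by metis
    then have "k \<in> span_pairs" using extend_span(1) l by blast
    then show "T k \<in> carrier B" by auto
  qed
  ultimately show ?case using Cons x by simp
qed (simp add: raise_degree_def)

text \<open>
  The relations of matrix units, required only for products in which the inner paths have
  equal degree. They hold for the monomials, and for the monomials prolonged by a fixed path
  \<open>\<tau>\<close> (\<open>block\<close>).
\<close>

definition matrix_system :: "('g \<times> 'g \<Rightarrow> 'b) \<Rightarrow> bool" where
  "matrix_system e \<longleftrightarrow> (\<forall>z\<in>span_pairs. e z \<in> carrier B \<and> adj B (e z) = e (prod.swap z)) \<and>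
    (\<forall>z\<in>span_pairs. \<forall>w\<in>span_pairs. deg \<Gamma> (snd z) = deg \<Gamma> (fst w) \<longrightarrow>
      e z \<otimes> e w = (if fst w = snd z then e (fst z, snd w) else \<zero>))"

lemma matrix_system_T: "matrix_system T"
  unfolding matrix_system_def
proof (intro conjI ballI impI)
  fix z w assume "z \<in> span_pairs" "w \<in> span_pairs" "deg \<Gamma> (snd z) = deg \<Gamma> (fst w)"
  then show "T z \<otimes> T w = (if fst w = snd z then T (fst z, snd w) else \<zero>)"
    using T_mult[of "fst z" "snd z" "fst w" "snd w"] by simp
qed (auto simp: adj_T)

text \<open>
  The monomial of the two paths prolonged by \<open>\<tau>\<close>. Compression will produce
  these elements; monomials with a source other than \<open>r(\<tau>)\<close> disappear.
\<close>

definition block :: "'g \<Rightarrow> 'g \<times> 'g \<Rightarrow> 'b" where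
  "block \<tau> z = (if src \<Gamma> (fst z) = rng \<Gamma> \<tau> then T (extend z \<tau>) else \<zero>)"

lemma matrix_system_block:
  assumes \<tau>: "\<tau> \<in> mor \<Gamma>"
  shows "matrix_system (block \<tau>)"
  unfolding matrix_system_def
proof (intro conjI ballI impI)
  fix z assume z: "z \<in> span_pairs"
  then show "block \<tau> z \<in> carrier B" using extend_span(1)[OF z \<tau>] by (auto simp: block_def)
  show "adj B (block \<tau> z) = block \<tau> (prod.swap z)"
    using z extend_span(1)[OF z \<tau>] by (auto simp: block_def adj_T extend_def)
  fix w assume w: "w \<in> span_pairs" and deg: "deg \<Gamma> (snd z) = deg \<Gamma> (fst w)"
  show "block \<tau> z \<otimes> block \<tau> w = (if fst w = snd z then block \<tau> (fst z, snd w) else \<zero>)"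
  proof (cases "src \<Gamma> (fst z) = rng \<Gamma> \<tau> \<and> src \<Gamma> (fst w) = rng \<Gamma> \<tau>")
    case True
    note ez = extend_span[OF z \<tau>] and ew = extend_span[OF w \<tau>]
    have "comp \<Gamma> (fst w) \<tau> = comp \<Gamma> (snd z) \<tau> \<longleftrightarrow> fst w = snd z"
      using comp_inj(1)[of "fst w" \<tau> "snd z" \<tau>] z w True deg \<tau> by auto
    then show ?thesis
      using True T_mult[of "fst (extend z \<tau>)" "snd (extend z \<tau>)" "fst (extend w \<tau>)" "snd (extend w \<tau>)"] ez ew deg
      by (simp add: block_def) (simp add: extend_def)
  next
    case False
    have "block \<tau> z \<in> carrier B" "block \<tau> w \<in> carrier B"
      using extend_span(1)[OF z \<tau>] extend_span(1)[OF w \<tau>] by (auto simp: block_def)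
    then show ?thesis using False z w by (auto simp: block_def)
  qed
qed

text \<open>
  The list that represents \<open>(a\<^sup>*a)\<close> raised to the power
  \<open>2\<^sup>k\<close>, where \<open>a\<close> is represented by \<open>l\<close>. It
  depends on \<open>l\<close> alone, and so is the same for every matrix system.
\<close>

definition gram_power :: "(complex \<times> 'g \<times> 'g) list \<Rightarrow> nat \<Rightarrow> (complex \<times> 'g \<times> 'g) list" where
  "gram_power l k = ((\<lambda>l. formal_mult l l) ^^ k) (formal_mult (formal_adj l) l)"

lemma supp_gram_power:
  assumes l: "supp l \<subseteq> span_pairs"
  shows "supp (gram_power l k) \<subseteq> span_pairs \<inter> (snd ` supp l) \<times> (snd ` supp l)"
proof (induction k)
  case 0
  show ?case
  proof
    fix z assume "z \<in> supp (gram_power l 0)"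
    then obtain x' y where "x' \<in> supp (formal_adj l)" "y \<in> supp l" "fst y = snd x'" "z = (fst x', snd y)"
      unfolding gram_power_def funpow_0 supp_formal_mult by blast
    then obtain x where "x \<in> supp l" "y \<in> supp l" "fst x = fst y" "z = (snd x, snd y)"
      unfolding supp_formal_adj by (metis fst_swap imageE snd_swap)
    moreover from this have "snd x \<in> snd ` supp l" "snd y \<in> snd ` supp l" by blast+
    ultimately show "z \<in> span_pairs \<inter> (snd ` supp l) \<times> (snd ` supp l)"
      using span_pairsD[OF l, of x] span_pairsD[OF l, of y] by (simp del: image_eqI)
  qed
next
  case (Suc k)
  show ?case
  proof
    fix z assume "z \<in> supp (gram_power l (Suc k))"
    then obtain x y where "x \<in> supp (gram_power l k)" "y \<in> supp (gram_power l k)" "fst y = snd x" "z = (fst x, snd y)"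
      unfolding gram_power_def funpow.simps comp_apply supp_formal_mult by blast
    then show "z \<in> span_pairs \<inter> (snd ` supp l) \<times> (snd ` supp l)"
      using subsetD[OF Suc, of x] subsetD[OF Suc, of y] by (cases x, cases y) auto
  qed
qed

text \<open>
  If all first paths have one degree and all second paths one degree, then the formal
  products are the actual ones in every matrix system, and the C*-identity computes the
  norms of the powers.
\<close>

lemma nrm_gram_power:
  assumes e: "matrix_system e" and l: "supp l \<subseteq> span_pairs"
    and deg: "\<And>z. z \<in> supp l \<Longrightarrow> deg \<Gamma> (fst z) = p \<and> deg \<Gamma> (snd z) = q"
  shows "nrm B (lincomb B e (gram_power l k)) = nrm B (lincomb B e l) ^ (2 ^ Suc k)"
proof -
  have ec: "e z \<in> carrier B" "adj B (e z) = e (prod.swap z)" if "z \<in> span_pairs" for z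
    using e that unfolding matrix_system_def by blast+
  have em: "e z \<otimes> e w = (if fst w = snd z then e (fst z, snd w) else \<zero>)"
    if "z \<in> span_pairs" "w \<in> span_pairs" "deg \<Gamma> (snd z) = deg \<Gamma> (fst w)" for z w
    using e that unfolding matrix_system_def by blast
  have lc: "e z \<in> carrier B" if "z \<in> supp l" for z using that ec l by blast
  have S: "z \<in> span_pairs" "deg \<Gamma> (fst z) = q" "deg \<Gamma> (snd z) = q" if "z \<in> supp (gram_power l k)" for z k
  proof -
    have "z \<in> span_pairs" "fst z \<in> snd ` supp l" "snd z \<in> snd ` supp l"
      using subsetD[OF supp_gram_power[OF l, of k] that] unfolding Int_iff mem_Times_iff by blast+
    moreover have "deg \<Gamma> \<eta> = q" if "\<eta> \<in> snd ` supp l" for \<eta> using that deg by blast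
    ultimately show "z \<in> span_pairs" "deg \<Gamma> (fst z) = q" "deg \<Gamma> (snd z) = q" by blast+
  qed
  have y: "lincomb B e l \<in> carrier B" by (intro lincomb_in lc)
  have st: "lincomb B e (formal_adj l) = adj B (lincomb B e l)"
    using ec(2) l by (intro lincomb_formal_adj lc) (metis subsetD)+
  have stc: "z \<in> span_pairs \<and> deg \<Gamma> (snd z) = p" if "z \<in> supp (formal_adj l)" for z
  proof -
    obtain x where "x \<in> supp l" "z = prod.swap x" using \<open>z \<in> supp (formal_adj l)\<close> unfolding supp_formal_adj by blast
    then show ?thesis using deg[of x] span_pairsD[OF l, of x] by simp
  qed
  have x0: "lincomb B e (gram_power l 0) = adj B (lincomb B e l) \<otimes> lincomb B e l"
  proof -
    have "lincomb B e (formal_adj l) \<otimes> lincomb B e l = lincomb B e (formal_mult (formal_adj l) l)"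
    proof (rule lincomb_formal_mult)
      fix x assume x: "x \<in> supp (formal_adj l)"
      then show "e x \<in> carrier B" using stc ec(1) by blast
      fix y assume y: "y \<in> supp l"
      have "x \<in> span_pairs" "y \<in> span_pairs" using stc[OF x] y l by blast+
      moreover have "deg \<Gamma> (snd x) = deg \<Gamma> (fst y)" using stc[OF x] deg[OF y] by metis
      ultimately show "e x \<otimes> e y = (if fst y = snd x then e (fst x, snd y) else \<zero>)" by (rule em)
    qed (rule lc)
    then show ?thesis by (simp add: gram_power_def st)
  qed
  have "nrm B (lincomb B e (gram_power l k)) = nrm B (lincomb B e (gram_power l 0)) ^ (2 ^ k)"
  proof (rule nrm_iterated_square)
    show "lincomb B e (gram_power l k) \<in> carrier B" for k using S(1) ec(1) by (intro lincomb_in) blast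
    show "adj B (lincomb B e (gram_power l 0)) = lincomb B e (gram_power l 0)" using y by (simp add: x0 adj_mult)
    show "lincomb B e (gram_power l (Suc k)) = lincomb B e (gram_power l k) \<otimes> lincomb B e (gram_power l k)" for k
    proof -
      have "lincomb B e (gram_power l k) \<otimes> lincomb B e (gram_power l k) = lincomb B e (formal_mult (gram_power l k) (gram_power l k))"
      proof (rule lincomb_formal_mult)
        fix x assume x: "x \<in> supp (gram_power l k)"
        then show "e x \<in> carrier B" using S(1) ec(1) by blast
        fix y assume y: "y \<in> supp (gram_power l k)"
        have "deg \<Gamma> (snd x) = deg \<Gamma> (fst y)" using S(2)[OF y] S(3)[OF x] by simp
        then show "e x \<otimes> e y = (if fst y = snd x then e (fst x, snd y) else \<zero>)"
          using S(1)[OF x] S(1)[OF y] by (intro em)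
      next
        fix y assume "y \<in> supp (gram_power l k)" then show "e y \<in> carrier B" using S(1) ec(1) by blast
      qed
      then show ?thesis by (simp add: gram_power_def)
    qed
  qed
  also have "\<dots> = nrm B (lincomb B e l) ^ (2 ^ Suc k)"
    using cstar_identity[OF y] by (simp add: x0 power_mult)
  finally show ?thesis .
qed

text \<open>
  Multiplying by \<open>t\<^sub>a\<^sup>*\<close> and \<open>t\<^sub>b\<close>, where
  \<open>a\<close> and \<open>b\<close> are the prolonged paths of the pair
  \<open>z\<close>, leaves the coefficient at \<open>z\<close> times a vertex projection,
  and a nonzero projection has norm 1.
\<close>

lemma coef_le_block:
  assumes \<tau>: "\<tau> \<in> mor \<Gamma>" and nz: "t (src \<Gamma> \<tau>) \<noteq> \<zero>" and l: "supp l \<subseteq> span_pairs"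
    and deg: "\<And>x. x \<in> supp l \<Longrightarrow> deg \<Gamma> (fst x) = q \<and> deg \<Gamma> (snd x) = q"
    and z: "z \<in> span_pairs" "deg \<Gamma> (fst z) = q" "deg \<Gamma> (snd z) = q" "src \<Gamma> (fst z) = rng \<Gamma> \<tau>"
  shows "cmod (coef z l) \<le> nrm B (lincomb B (block \<tau>) l)"
proof -
  define a where "a = comp \<Gamma> (fst z) \<tau>"
  define b where "b = comp \<Gamma> (snd z) \<tau>"
  have ab: "a \<in> mor \<Gamma>" "b \<in> mor \<Gamma>" "deg \<Gamma> a = q + deg \<Gamma> \<tau>" "deg \<Gamma> b = q + deg \<Gamma> \<tau>" "src \<Gamma> a = src \<Gamma> \<tau>" "src \<Gamma> b = src \<Gamma> \<tau>"
    using z \<tau> by (simp_all add: a_def b_def comp_closed deg_comp src_comp)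
  have bl: "block \<tau> x \<in> carrier B" if "x \<in> supp l" for x
    using matrix_system_block[OF \<tau>] that l unfolding matrix_system_def by blast
  have "adj B (t a) \<otimes> lincomb B (block \<tau>) l \<otimes> t b = lincomb B (\<lambda>x. adj B (t a) \<otimes> block \<tau> x \<otimes> t b) l"
    using ab by (intro lincomb_sandwich bl adj_closed t_in)
  also have "\<dots> = lincomb B (\<lambda>x. if x = z then t (src \<Gamma> \<tau>) else \<zero>) l"
  proof (rule lincomb_cong)
    fix x assume xl: "x \<in> supp l"
    then have x: "x \<in> span_pairs" "deg \<Gamma> (fst x) = q" "deg \<Gamma> (snd x) = q" using l deg by blast+
    show "adj B (t a) \<otimes> block \<tau> x \<otimes> t b = (if x = z then t (src \<Gamma> \<tau>) else \<zero>)"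
    proof (cases "src \<Gamma> (fst x) = rng \<Gamma> \<tau>")
      case False then show ?thesis using ab z by (auto simp: block_def)
    next
      case True
      have sx: "fst x \<in> mor \<Gamma>" "snd x \<in> mor \<Gamma>" "src \<Gamma> (snd x) = rng \<Gamma> \<tau>" using x(1) True by simp_all
      define a' where "a' = comp \<Gamma> (fst x) \<tau>"
      define b' where "b' = comp \<Gamma> (snd x) \<tau>"
      have ab': "a' \<in> mor \<Gamma>" "b' \<in> mor \<Gamma>" "deg \<Gamma> a' = q + deg \<Gamma> \<tau>" "deg \<Gamma> b' = q + deg \<Gamma> \<tau>" "src \<Gamma> a' = src \<Gamma> \<tau>" "src \<Gamma> b' = src \<Gamma> \<tau>"
        using sx x(2,3) \<tau> True unfolding a'_def b'_def by (simp_all add: comp_closed deg_comp src_comp)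
      have "a = a' \<longleftrightarrow> fst x = fst z"
        using comp_inj(1)[OF sx(1) \<tau> True z(1)[THEN span_pairs_iff[THEN iffD1], THEN conjunct1] \<tau> z(4)] x(2) z(2)
        unfolding a_def a'_def by metis
      moreover have "b' = b \<longleftrightarrow> snd x = snd z"
        using comp_inj(1)[OF sx(2) \<tau> sx(3) _ \<tau>, of "snd z"] z x(3) unfolding b_def b'_def by auto
      ultimately have eq: "a = a' \<and> b' = b \<longleftrightarrow> x = z" unfolding prod_eq_iff by blast
      have "adj B (t a) \<otimes> block \<tau> x \<otimes> t b = (adj B (t a) \<otimes> t a') \<otimes> (adj B (t b') \<otimes> t b)"
        using True ab ab' by (simp add: block_def T_def extend_def mult_assoc flip: a'_def b'_def)
      also have "\<dots> = (if a = a' \<and> b' = b then t (src \<Gamma> \<tau>) \<otimes> t (src \<Gamma> \<tau>) else \<zero>)"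
        using ab ab' \<tau> same_degree_mult[of a a'] same_degree_mult[of b' b] by (simp add: src_closed)
      finally show ?thesis
        unfolding eq using projectionD(3)[OF t_projection[OF src_vertex[OF \<tau>]]] by simp
    qed
  qed
  also have "\<dots> = coef z l \<odot> t (src \<Gamma> \<tau>)" using \<tau> by (intro lincomb_delta) (simp add: src_closed)
  finally have "cmod (coef z l) = nrm B (adj B (t a) \<otimes> lincomb B (block \<tau>) l \<otimes> t b)"
    using \<tau> nrm_projection[OF t_projection[OF src_vertex[OF \<tau>]] nz] by (simp add: nrm_smult src_closed)
  also have "\<dots> \<le> nrm B (adj B (t a) \<otimes> lincomb B (block \<tau>) l) * nrm B (t b)"
    using ab by (intro nrm_mult mult_closed adj_closed t_in lincomb_in bl)
  also have "\<dots> \<le> nrm B (adj B (t a) \<otimes> lincomb B (block \<tau>) l) * 1"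
    using ab by (intro mult_left_mono nrm_t_le nrm_nonneg mult_closed adj_closed t_in lincomb_in bl)
  also have "\<dots> \<le> nrm B (adj B (t a)) * nrm B (lincomb B (block \<tau>) l) * 1"
    using ab nrm_mult[of "adj B (t a)" "lincomb B (block \<tau>) l"] bl by (simp add: lincomb_in)
  also have "\<dots> \<le> 1 * nrm B (lincomb B (block \<tau>) l) * 1"
    using ab nrm_t_le[of a] by (intro mult_right_mono nrm_nonneg lincomb_in bl) simp_all
  finally show ?thesis by simp
qed

lemma sum_of_ranges:
  assumes H: "finite H" "\<And>\<alpha>. \<alpha> \<in> H \<Longrightarrow> \<alpha> \<in> mor \<Gamma> \<and> deg \<Gamma> \<alpha> = d"
  defines "e \<equiv> (\<Oplus>\<alpha>\<in>H. t \<alpha> \<otimes> adj B (t \<alpha>))"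
  shows "projection B e" "\<And>\<xi>. \<xi> \<in> H \<Longrightarrow> e \<otimes> t \<xi> = t \<xi>" "e \<in> carrier B"
proof -
  show ec: "e \<in> carrier B" using H by (auto simp: e_def)
  show et: "e \<otimes> t \<xi> = t \<xi>" if \<xi>: "\<xi> \<in> H" for \<xi>
  proof -
    have "e \<otimes> t \<xi> = (\<Oplus>\<alpha>\<in>H. t \<alpha> \<otimes> adj B (t \<alpha>) \<otimes> t \<xi>)"
      using H \<xi> unfolding e_def by (intro finsum_mult_right) auto
    also have "\<dots> = t \<xi> \<otimes> adj B (t \<xi>) \<otimes> t \<xi>"
    proof (rule finsum_single_term[OF cstar_algebra_axioms H(1) \<xi>])
      fix \<alpha> assume "\<alpha> \<in> H" "\<alpha> \<noteq> \<xi>"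
      then show "t \<alpha> \<otimes> adj B (t \<alpha>) \<otimes> t \<xi> = \<zero>"
        using H(2)[of \<alpha>] H(2)[OF \<xi>] same_degree_orth[of \<alpha> \<xi>] by (simp add: mult_assoc)
    qed (use H(2)[OF \<xi>] in auto)
    finally show ?thesis using H(2)[OF \<xi>] t_adj_t by simp
  qed
  have ea: "adj B e = e"
    using H(1,2) unfolding e_def
  proof (induction H)
    case (insert \<alpha> H)
    then show ?case using insert by (simp add: Pi_def adj_add adj_mult)
  qed simp
  have "e \<otimes> e = (\<Oplus>\<alpha>\<in>H. e \<otimes> (t \<alpha> \<otimes> adj B (t \<alpha>)))"
    using H ec by (subst (2) e_def, intro finsum_mult_left) auto
  also have "\<dots> = e"
    unfolding e_def
  proof (intro M.finsum_cong' refl, unfold e_def[symmetric])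
    fix \<alpha> assume \<alpha>: "\<alpha> \<in> H"
    then show "e \<otimes> (t \<alpha> \<otimes> adj B (t \<alpha>)) = t \<alpha> \<otimes> adj B (t \<alpha>)"
      using et[OF \<alpha>] H(2)[OF \<alpha>] ec by (simp flip: mult_assoc)
  qed (use H in auto)
  finally show "projection B e" using ec ea by (simp add: projection_def)
qed

lemma nrm_compression_le:
  assumes "projection B e" "projection B f" "x \<in> carrier B"
  shows "nrm B (e \<otimes> x \<otimes> f) \<le> nrm B x"
proof -
  note e = projectionD[OF assms(1)] and f = projectionD[OF assms(2)]
  have "nrm B (e \<otimes> x \<otimes> f) \<le> nrm B (e \<otimes> x) * nrm B f" using e f assms by (intro nrm_mult) auto
  also have "\<dots> \<le> nrm B (e \<otimes> x) * 1" using e assms nrm_projection_le[OF assms(2)] by (intro mult_left_mono) auto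
  also have "\<dots> \<le> nrm B e * nrm B x * 1" using e assms by (intro mult_right_mono nrm_mult) auto
  also have "\<dots> \<le> 1 * nrm B x * 1" using e assms nrm_projection_le[OF assms(1)] by (intro mult_right_mono) auto
  finally show ?thesis by simp
qed

text \<open>
  The compression uses the sums \<open>e\<^sub>1\<close> and \<open>e\<^sub>2\<close> of the
  range projections of the prolonged first paths and of those prolonged second paths that
  have degree \<open>q\<close> before prolongation. On a monomial with second path of degree
  \<open>q\<close> it acts as prolongation by \<open>\<tau>\<close>. Any other monomial with
  source \<open>r(\<tau>)\<close> is annihilated by \<open>e\<^sub>2\<close>, since by
  hypothesis its prolonged second path has no extension in common with the paths that define
  \<open>e\<^sub>2\<close>; and monomials with another source are annihilated by
  \<open>e\<^sub>1\<close>.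
\<close>

lemma block_le:
  assumes \<tau>: "\<tau> \<in> mor \<Gamma>" and l: "supp l \<subseteq> span_pairs"
    and deg: "\<And>z. z \<in> supp l \<Longrightarrow> deg \<Gamma> (fst z) = p"
    and none: "\<And>z \<beta> \<kappa> \<kappa>'. z \<in> supp l \<Longrightarrow> deg \<Gamma> (snd z) \<noteq> q \<Longrightarrow> src \<Gamma> (snd z) = rng \<Gamma> \<tau> \<Longrightarrow>
      \<beta> \<in> mor \<Gamma> \<Longrightarrow> deg \<Gamma> \<beta> = q \<Longrightarrow> src \<Gamma> \<beta> = rng \<Gamma> \<tau> \<Longrightarrow> \<kappa> \<in> mor \<Gamma> \<Longrightarrow> \<kappa>' \<in> mor \<Gamma> \<Longrightarrow>
      src \<Gamma> \<tau> = rng \<Gamma> \<kappa> \<Longrightarrow> src \<Gamma> \<tau> = rng \<Gamma> \<kappa>' \<Longrightarrow>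
      comp \<Gamma> (comp \<Gamma> \<beta> \<tau>) \<kappa> \<noteq> comp \<Gamma> (comp \<Gamma> (snd z) \<tau>) \<kappa>'"
  shows "nrm B (lincomb B (block \<tau>) (filter (\<lambda>x. deg \<Gamma> (snd (snd x)) = q) l)) \<le> nrm B (lincomb B T l)"
proof -
  define v where "v = rng \<Gamma> \<tau>"
  define H1 where "H1 = (\<lambda>\<xi>. comp \<Gamma> \<xi> \<tau>) ` {\<xi> \<in> fst ` supp l. src \<Gamma> \<xi> = v}"
  define H2 where "H2 = (\<lambda>\<xi>. comp \<Gamma> \<xi> \<tau>) ` {\<eta> \<in> snd ` supp l. src \<Gamma> \<eta> = v \<and> deg \<Gamma> \<eta> = q}"
  have lm: "fst z \<in> mor \<Gamma>" "snd z \<in> mor \<Gamma>" "src \<Gamma> (fst z) = src \<Gamma> (snd z)" if "z \<in> supp l" for z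
    using span_pairsD[OF l that] by auto
  have lm1: "\<xi> \<in> mor \<Gamma> \<and> deg \<Gamma> \<xi> = p" if "\<xi> \<in> fst ` supp l" for \<xi> using that lm(1) deg by blast
  have lm2: "\<eta> \<in> mor \<Gamma>" if "\<eta> \<in> snd ` supp l" for \<eta> using that lm(2) by blast
  have H1: "\<alpha> \<in> mor \<Gamma> \<and> deg \<Gamma> \<alpha> = p + deg \<Gamma> \<tau>" if \<alpha>: "\<alpha> \<in> H1" for \<alpha>
  proof -
    obtain \<xi> where "\<xi> \<in> fst ` supp l" "src \<Gamma> \<xi> = v" "\<alpha> = comp \<Gamma> \<xi> \<tau>" using \<alpha> unfolding H1_def by blast
    then show ?thesis using lm1 \<tau> by (simp add: v_def comp_closed deg_comp del: image_iff)
  qed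
  have H2: "\<alpha> \<in> mor \<Gamma> \<and> deg \<Gamma> \<alpha> = q + deg \<Gamma> \<tau>" if \<alpha>: "\<alpha> \<in> H2" for \<alpha>
  proof -
    obtain \<eta> where "\<eta> \<in> snd ` supp l" "src \<Gamma> \<eta> = v" "deg \<Gamma> \<eta> = q" "\<alpha> = comp \<Gamma> \<eta> \<tau>" using \<alpha> unfolding H2_def by blast
    then show ?thesis using lm2 \<tau> by (simp add: v_def comp_closed deg_comp)
  qed
  have "finite H1" "finite H2" by (auto simp: H1_def H2_def)
  note H1 = this(1) H1 and H2 = this(2) H2
  define e1 where "e1 = (\<Oplus>\<alpha>\<in>H1. t \<alpha> \<otimes> adj B (t \<alpha>))"
  define e2 where "e2 = (\<Oplus>\<alpha>\<in>H2. t \<alpha> \<otimes> adj B (t \<alpha>))"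
  note e1 = sum_of_ranges[OF H1, folded e1_def] and e2 = sum_of_ranges[OF H2, folded e2_def]
  have e1t: "e1 \<otimes> t \<xi> = (if src \<Gamma> \<xi> = v then t (comp \<Gamma> \<xi> \<tau>) \<otimes> adj B (t \<tau>) else \<zero>)" if \<xi>: "\<xi> \<in> fst ` supp l" for \<xi>
  proof -
    have \<xi>m: "\<xi> \<in> mor \<Gamma>" "deg \<Gamma> \<xi> = p" using lm1[OF \<xi>] by simp_all
    have sum: "e1 \<otimes> t \<xi> = (\<Oplus>\<alpha>\<in>H1. t \<alpha> \<otimes> adj B (t \<alpha>) \<otimes> t \<xi>)"
      using H1 \<xi>m unfolding e1_def by (intro finsum_mult_right) auto
    have single: "t (comp \<Gamma> \<beta> \<tau>) \<otimes> adj B (t (comp \<Gamma> \<beta> \<tau>)) \<otimes> t \<xi> =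
        (if \<beta> = \<xi> then t (comp \<Gamma> \<xi> \<tau>) \<otimes> adj B (t \<tau>) else \<zero>)"
      if \<beta>: "\<beta> \<in> fst ` supp l" "src \<Gamma> \<beta> = v" for \<beta>
    proof -
      have \<beta>m: "\<beta> \<in> mor \<Gamma>" "deg \<Gamma> \<beta> = p" using lm1[OF \<beta>(1)] by simp_all
      have "t (comp \<Gamma> \<beta> \<tau>) \<otimes> adj B (t (comp \<Gamma> \<beta> \<tau>)) \<otimes> t \<xi> = t (comp \<Gamma> \<beta> \<tau>) \<otimes> (adj B (t \<tau>) \<otimes> (adj B (t \<beta>) \<otimes> t \<xi>))"
        using \<beta>m \<xi>m \<beta>(2) \<tau> comp_closed[of \<beta> \<tau>] by (simp add: mult_assoc t_comp[of \<beta> \<tau>] adj_mult v_def)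
      then show ?thesis
        using same_degree_mult[of \<beta> \<xi>] \<beta>m \<xi>m \<tau> \<beta>(2) adj_t_rng[OF \<tau>] comp_closed[of \<beta> \<tau>]
        by (auto simp: v_def)
    qed
    show ?thesis
    proof (cases "src \<Gamma> \<xi> = v")
      case True
      have \<xi>H: "comp \<Gamma> \<xi> \<tau> \<in> H1" using True \<xi> unfolding H1_def by blast
      have "e1 \<otimes> t \<xi> = t (comp \<Gamma> \<xi> \<tau>) \<otimes> adj B (t (comp \<Gamma> \<xi> \<tau>)) \<otimes> t \<xi>"
        unfolding sum
      proof (rule finsum_single_term[OF cstar_algebra_axioms H1(1) \<xi>H])
        fix \<alpha> assume \<alpha>: "\<alpha> \<in> H1" "\<alpha> \<noteq> comp \<Gamma> \<xi> \<tau>"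
        then obtain \<beta> where "\<beta> \<in> fst ` supp l" "src \<Gamma> \<beta> = v" "\<alpha> = comp \<Gamma> \<beta> \<tau>" unfolding H1_def by blast
        then show "t \<alpha> \<otimes> adj B (t \<alpha>) \<otimes> t \<xi> = \<zero>" using single \<alpha>(2) by auto
      qed (use H1(2)[OF \<xi>H] \<xi>m in auto)
      then show ?thesis using single[OF \<xi> True] True by simp
    next
      case False
      have "t \<alpha> \<otimes> adj B (t \<alpha>) \<otimes> t \<xi> = \<zero>" if \<alpha>: "\<alpha> \<in> H1" for \<alpha>
      proof -
        obtain \<beta> where "\<beta> \<in> fst ` supp l" "src \<Gamma> \<beta> = v" "\<alpha> = comp \<Gamma> \<beta> \<tau>" using \<alpha> unfolding H1_def by blast
        then show ?thesis using single False by auto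
      qed
      then show ?thesis unfolding sum using False by (simp cong: M.finsum_cong)
    qed
  qed
  \<comment> \<open>The effect of the compression on a single monomial.\<close>
  have main: "e1 \<otimes> T z \<otimes> e2 = (if deg \<Gamma> (snd z) = q then block \<tau> z else \<zero>)" if z: "z \<in> supp l" for z
  proof (cases "src \<Gamma> (fst z) = v")
    case False
    have "e1 \<otimes> T z \<otimes> e2 = (e1 \<otimes> t (fst z)) \<otimes> (adj B (t (snd z)) \<otimes> e2)"
      using lm[OF z] e1(3) e2(3) by (simp add: T_def mult_assoc)
    then show ?thesis using e1t[of "fst z"] z False lm[OF z] e2(3) by (auto simp: block_def v_def)
  next
    case True
    define \<eta> where "\<eta> = comp \<Gamma> (snd z) \<tau>"
    have \<eta>: "\<eta> \<in> mor \<Gamma>" "deg \<Gamma> \<eta> = deg \<Gamma> (snd z) + deg \<Gamma> \<tau>" "src \<Gamma> \<eta> = src \<Gamma> \<tau>" "t \<eta> = t (snd z) \<otimes> t \<tau>"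
      using lm[OF z] True \<tau> by (auto simp: \<eta>_def v_def comp_closed deg_comp src_comp t_comp)
    have "e1 \<otimes> T z \<otimes> e2 = (e1 \<otimes> t (fst z)) \<otimes> (adj B (t (snd z)) \<otimes> e2)"
      using lm[OF z] e1(3) e2(3) by (simp add: T_def mult_assoc)
    also have "\<dots> = t (comp \<Gamma> (fst z) \<tau>) \<otimes> adj B (t \<tau>) \<otimes> (adj B (t (snd z)) \<otimes> e2)"
      using e1t[of "fst z"] z True by auto
    also have "\<dots> = t (comp \<Gamma> (fst z) \<tau>) \<otimes> adj B (e2 \<otimes> t \<eta>)"
      using lm[OF z] e2(3) projectionD(2)[OF e2(1)] \<tau> True comp_closed[of "fst z" \<tau>]
      by (simp add: \<eta>(4) adj_mult mult_assoc v_def)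
    finally have eq: "e1 \<otimes> T z \<otimes> e2 = t (comp \<Gamma> (fst z) \<tau>) \<otimes> adj B (e2 \<otimes> t \<eta>)" .
    show ?thesis
    proof (cases "deg \<Gamma> (snd z) = q")
      case dq: True
      then have "\<eta> \<in> H2" using z True lm(3)[OF z] unfolding H2_def \<eta>_def by fastforce
      then have "e2 \<otimes> t \<eta> = t \<eta>" using e2(2)[of \<eta>] by simp
      then show ?thesis unfolding eq using dq True by (simp add: block_def v_def T_def extend_def \<eta>_def)
    next
      case dq: False
      have "e2 \<otimes> t \<eta> = (\<Oplus>\<alpha>\<in>H2. t \<alpha> \<otimes> adj B (t \<alpha>) \<otimes> t \<eta>)"
        using H2 \<eta>(1) unfolding e2_def by (intro finsum_mult_right) auto
      also have "\<dots> = \<zero>"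
      proof -
        have "t \<alpha> \<otimes> adj B (t \<alpha>) \<otimes> t \<eta> = \<zero>" if \<alpha>: "\<alpha> \<in> H2" for \<alpha>
        proof -
          obtain \<beta> where \<beta>: "\<beta> \<in> snd ` supp l" "src \<Gamma> \<beta> = v" "deg \<Gamma> \<beta> = q" "\<alpha> = comp \<Gamma> \<beta> \<tau>"
            using \<alpha> unfolding H2_def by blast
          have \<beta>m: "\<beta> \<in> mor \<Gamma>" using lm2[OF \<beta>(1)] .
          have "src \<Gamma> \<alpha> = src \<Gamma> \<tau>" using \<beta> \<beta>m \<tau> by (simp add: src_comp v_def)
          then have "adj B (t \<alpha>) \<otimes> t \<eta> = \<zero>"
            using H2(2)[OF \<alpha>] \<eta> none[OF z dq _ \<beta>m \<beta>(3)] \<beta> True lm[OF z]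
            by (intro no_common_extension) (auto simp: \<eta>_def v_def)
          then show ?thesis using H2(2)[OF \<alpha>] \<eta>(1) by (simp add: mult_assoc)
        qed
        then show ?thesis by (simp cong: M.finsum_cong)
      qed
      finally show ?thesis unfolding eq using dq lm[OF z] \<tau> True comp_closed[of "fst z" \<tau>] by (simp add: v_def)
    qed
  qed
  have Tc: "T z \<in> carrier B" if "z \<in> supp l" for z using lm[OF that] by auto
  have "e1 \<otimes> lincomb B T l \<otimes> e2 = lincomb B (\<lambda>z. e1 \<otimes> T z \<otimes> e2) l"
    using e1(3) e2(3) Tc by (rule lincomb_sandwich)
  also have "\<dots> = lincomb B (\<lambda>z. if deg \<Gamma> (snd z) = q then block \<tau> z else \<zero>) l"
    using main by (rule lincomb_cong)
  also have "\<dots> = lincomb B (block \<tau>) (filter (\<lambda>x. deg \<Gamma> (snd (snd x)) = q) l)"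
  proof -
    have "block \<tau> z \<in> carrier B" if "z \<in> supp l" for z
      using matrix_system_block[OF \<tau>] that l unfolding matrix_system_def by blast
    then show ?thesis
    proof (induction l)
      case (Cons x l)
      then have "lincomb B (block \<tau>) (filter (\<lambda>x. deg \<Gamma> (snd (snd x)) = q) l) \<in> carrier B" by (intro lincomb_in) auto
      then show ?case using Cons by simp
    qed simp
  qed
  finally show ?thesis using nrm_compression_le[OF e1(1) e2(1), of "lincomb B T l"] l by auto
qed

end

section \<open>Aperiodicity and the Fourier coefficients\<close>

context row_finite_p_graph begin

lemma infinite_path_segment:
  assumes x: "x \<in> infinite_paths \<Gamma>"
  shows "x (p, p + q) \<in> mor \<Gamma>" "deg \<Gamma> (x (p, p + q)) = q" "rng \<Gamma> (x (p, p + q)) = x (p, p)"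
    "src \<Gamma> (x (p, p + q)) = x (p + q, p + q)"
    "x (p, p + q + r) = comp \<Gamma> (x (p, p + q)) (x (p + q, p + q + r))"
proof -
  have O: "(p, p + q) \<in> mor Omega" for p q :: 'p by (auto simp: Omega_def)
  have O': "rng Omega (p, q) = (p, p)" "src Omega (p, q) = (q, q)" "comp Omega (p, q) (q', r) = (p, r)" for p q q' r :: 'p
    by (auto simp: Omega_def)
  have d: "deg Omega (p, p + q) = q" for p q :: 'p
    by (simp add: Omega_def cancel_iff)
  have x1: "x \<in> mor Omega \<rightarrow> mor \<Gamma>" using x by (auto simp: infinite_paths_def PiE_def)
  have x2: "rng \<Gamma> (x \<alpha>) = x (rng Omega \<alpha>) \<and> src \<Gamma> (x \<alpha>) = x (src Omega \<alpha>)
        \<and> deg \<Gamma> (x \<alpha>) = deg Omega \<alpha>" if "\<alpha> \<in> mor Omega" for \<alpha>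
    using x that unfolding infinite_paths_def by blast
  have x3: "x (comp Omega \<alpha> \<beta>) = comp \<Gamma> (x \<alpha>) (x \<beta>)" if "\<alpha> \<in> mor Omega" "\<beta> \<in> mor Omega" "src Omega \<alpha> = rng Omega \<beta>" for \<alpha> \<beta>
    using x that unfolding infinite_paths_def by blast
  show "x (p, p + q) \<in> mor \<Gamma>" using x1 O by blast
  show "deg \<Gamma> (x (p, p + q)) = q" "rng \<Gamma> (x (p, p + q)) = x (p, p)" "src \<Gamma> (x (p, p + q)) = x (p + q, p + q)"
    using x2[OF O[of p q]] O' d by simp_all
  show "x (p, p + q + r) = comp \<Gamma> (x (p, p + q)) (x (p + q, p + q + r))"
    using x3[OF O[of p q] O[of "p + q" r]] unfolding O' by blast
qed

text \<open>
  Shifts of an aperiodic path \<open>x\<close> by \<open>p \<noteq> q\<close> already differ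
  on some initial segment, of degree \<open>b(p, q)\<close> say. Let \<open>\<tau>\<close>
  be an initial segment of \<open>x\<close> so long that it contains \<open>x(q, q +
  b)\<close> and \<open>x(p, p + b)\<close> for all pairs in \<open>F\<close>. If
  \<open>\<eta>\<tau>\<close> and \<open>\<beta>\<tau>\<close> had a common extension, with
  \<open>\<eta>\<close> and \<open>\<beta>\<close> of degrees \<open>p\<close> and
  \<open>q\<close>, then its segment from \<open>p + q\<close> to \<open>p + q + b\<close>
  would be equal to both of these, by unique factorisation.
\<close>

lemma aperiodic_path:
  assumes ap: "aperiodic \<Gamma>" and v: "v \<in> vertices \<Gamma>" and F: "finite F" "\<forall>z\<in>F. fst z \<noteq> snd z"
  shows "\<exists>\<tau>\<in>mor \<Gamma>. rng \<Gamma> \<tau> = v \<and> (\<forall>(p, q)\<in>F. \<forall>\<eta> \<beta> \<kappa> \<kappa>'. \<eta> \<in> mor \<Gamma> \<longrightarrow> \<beta> \<in> mor \<Gamma> \<longrightarrow> \<kappa> \<in> mor \<Gamma> \<longrightarrow> \<kappa>' \<in> mor \<Gamma> \<longrightarrow>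
     deg \<Gamma> \<eta> = p \<longrightarrow> deg \<Gamma> \<beta> = q \<longrightarrow> src \<Gamma> \<eta> = v \<longrightarrow> src \<Gamma> \<beta> = v \<longrightarrow> src \<Gamma> \<tau> = rng \<Gamma> \<kappa> \<longrightarrow> src \<Gamma> \<tau> = rng \<Gamma> \<kappa>' \<longrightarrow>
     comp \<Gamma> (comp \<Gamma> \<eta> \<tau>) \<kappa> \<noteq> comp \<Gamma> (comp \<Gamma> \<beta> \<tau>) \<kappa>')"
proof -
  obtain x where x': "x \<in> infinite_paths \<Gamma>" "x (0, 0) = v \<and> (\<forall>p q. p \<noteq> q \<longrightarrow> shift p x \<noteq> shift q x)"
    using bspec[OF ap[unfolded aperiodic_def] v] by (rule bexE)
  then have x: "x \<in> infinite_paths \<Gamma>" "x (0, 0) = v" by simp_all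
  note seg = infinite_path_segment[OF x(1)]
  have diff: "\<exists>b. x (p, p + b) \<noteq> x (q, q + b)" if pq: "p \<noteq> q" for p q
  proof (rule ccontr)
    assume "\<not> ?thesis"
    then have eq: "x (p, p + b) = x (q, q + b)" for b by blast
    have "x (p + a, p + a + r) = x (q + a, q + a + r)" for a r
    proof (rule comp_inj(2)[OF seg(1) seg(1) _ seg(1) seg(1)])
      show "comp \<Gamma> (x (p, p + a)) (x (p + a, p + a + r)) = comp \<Gamma> (x (q, q + a)) (x (q + a, q + a + r))"
        using seg(5)[of p a r] seg(5)[of q a r] eq[of "a + r"] unfolding add.assoc by metis
      show "deg \<Gamma> (x (p, p + a)) = deg \<Gamma> (x (q, q + a))" unfolding seg(2) ..
    qed (simp_all only: seg(3,4))
    then have "x (p + a, p + (a + r)) = x (q + a, q + (a + r))" for a r unfolding add.assoc .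
    then have "shift p x = shift q x"
      unfolding shift_def by (intro restrict_ext) (auto simp: Omega_def add.assoc)
    then show False using x'(2) pq by simp
  qed
  define b where "b z = (SOME b. x (fst z, fst z + b) \<noteq> x (snd z, snd z + b))" for z
  have b: "x (p, p + b (p, q)) \<noteq> x (q, q + b (p, q))" if "(p, q) \<in> F" for p q
    using someI_ex[OF diff[of p q]] bspec[OF F(2) that] by (simp add: b_def)
  define N where "N = (\<Sum>z\<in>F. fst z + snd z + b z)"
  define \<tau> where "\<tau> = x (0, 0 + N)"
  have \<tau>: "\<tau> \<in> mor \<Gamma>" "rng \<Gamma> \<tau> = v" "src \<Gamma> \<tau> = x (N, N)" using seg(1-4)[of 0 N] x(2) by (simp_all add: \<tau>_def)
  have dec: "\<exists>R. \<tau> = comp \<Gamma> (x (0, q)) (comp \<Gamma> (x (q, q + c)) (x (q + c, q + c + R))) \<and> N = q + c + R"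
    if "N = q + c + R" for q c R
  proof -
    have "x (q, q + (c + R)) = comp \<Gamma> (x (q, q + c)) (x (q + c, q + c + R))"
      using seg(5)[of q c R] by (simp add: add.assoc)
    moreover have "x (0, 0 + q + (c + R)) = comp \<Gamma> (x (0, 0 + q)) (x (0 + q, 0 + q + (c + R)))" by (rule seg(5))
    ultimately show ?thesis using that by (auto simp: \<tau>_def add.assoc)
  qed
  \<comment> \<open>Both extensions are split at the degrees \<open>p + q\<close> and
    \<open>p + q + c\<close>.\<close>
  have shape: "comp \<Gamma> (comp \<Gamma> \<eta> \<tau>) \<kappa> = comp \<Gamma> (comp \<Gamma> \<eta> (x (0, q))) (comp \<Gamma> (x (q, q + c)) (comp \<Gamma> (x (q + c, q + c + R)) \<kappa>))"
    if \<eta>: "\<eta> \<in> mor \<Gamma>" "src \<Gamma> \<eta> = v" and \<kappa>: "\<kappa> \<in> mor \<Gamma>" "src \<Gamma> \<tau> = rng \<Gamma> \<kappa>" and N: "N = q + c + R" for \<eta> \<kappa> q c R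
  proof -
    have s: "x (0, q) \<in> mor \<Gamma>" "rng \<Gamma> (x (0, q)) = v" "src \<Gamma> (x (0, q)) = x (q, q)" using seg(1-4)[of 0 q] x(2) by simp_all
    have "\<tau> = comp \<Gamma> (x (0, q)) (comp \<Gamma> (x (q, q + c)) (x (q + c, q + c + R)))"
      using dec[OF N] N cancel by (metis add.assoc)
    then show ?thesis
      using s seg(1-4)[of q c] seg(1-4)[of "q + c" R] \<eta> \<kappa> \<tau> N
      by (simp add: comp_assoc comp_closed rng_comp src_comp)
  qed
  have "comp \<Gamma> (comp \<Gamma> \<eta> \<tau>) \<kappa> \<noteq> comp \<Gamma> (comp \<Gamma> \<beta> \<tau>) \<kappa>'"
    if pq: "(p, q) \<in> F" and m: "\<eta> \<in> mor \<Gamma>" "\<beta> \<in> mor \<Gamma>" "\<kappa> \<in> mor \<Gamma>" "\<kappa>' \<in> mor \<Gamma>"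
      "deg \<Gamma> \<eta> = p" "deg \<Gamma> \<beta> = q" "src \<Gamma> \<eta> = v" "src \<Gamma> \<beta> = v" "src \<Gamma> \<tau> = rng \<Gamma> \<kappa>" "src \<Gamma> \<tau> = rng \<Gamma> \<kappa>'" for p q \<eta> \<beta> \<kappa> \<kappa>'
  proof
    define c where "c = b (p, q)"
    have "N = p + q + c + (\<Sum>z\<in>F - {(p, q)}. fst z + snd z + b z)"
      unfolding N_def c_def by (subst sum.remove[OF F(1) pq]) simp
    then obtain R where R: "N = p + q + c + R" by blast
    have N1: "N = q + c + (p + R)" and N2: "N = p + c + (q + R)" using R by (simp_all add: ac_simps)
    assume "comp \<Gamma> (comp \<Gamma> \<eta> \<tau>) \<kappa> = comp \<Gamma> (comp \<Gamma> \<beta> \<tau>) \<kappa>'"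
    then have eq: "comp \<Gamma> (comp \<Gamma> \<eta> (x (0, q))) (comp \<Gamma> (x (q, q + c)) (comp \<Gamma> (x (q + c, q + c + (p + R))) \<kappa>)) =
      comp \<Gamma> (comp \<Gamma> \<beta> (x (0, p))) (comp \<Gamma> (x (p, p + c)) (comp \<Gamma> (x (p + c, p + c + (q + R))) \<kappa>'))"
      using shape[OF m(1,7,3,9) N1] shape[OF m(2,8,4,10) N2] by simp
    have s: "x (0, r) \<in> mor \<Gamma>" "rng \<Gamma> (x (0, r)) = v" "src \<Gamma> (x (0, r)) = x (r, r)" "deg \<Gamma> (x (0, r)) = r" for r
      using seg(1-4)[of 0 r] x(2) by simp_all
    have k: "rng \<Gamma> \<kappa> = x (q + c + (p + R), q + c + (p + R))" "rng \<Gamma> \<kappa>' = x (p + c + (q + R), p + c + (q + R))"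
      using m(9,10) \<tau>(3) N1 N2 by metis+
    have "comp \<Gamma> (x (q, q + c)) (comp \<Gamma> (x (q + c, q + c + (p + R))) \<kappa>) =
        comp \<Gamma> (x (p, p + c)) (comp \<Gamma> (x (p + c, p + c + (q + R))) \<kappa>')"
      using s seg(1-4)[of q c] seg(1-4)[of "q + c" "p + R"] seg(1-4)[of p c] seg(1-4)[of "p + c" "q + R"] m k
      by (intro comp_inj(2)[OF _ _ _ _ _ _ eq]) (simp_all add: comp_closed rng_comp src_comp deg_comp add.commute)
    from comp_inj(1)[OF _ _ _ _ _ _ this]
    have "x (q, q + c) = x (p, p + c)"
      using s seg(1-4)[of q c] seg(1-4)[of "q + c" "p + R"] seg(1-4)[of p c] seg(1-4)[of "p + c" "q + R"] m k
      by (simp add: comp_closed rng_comp)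
    then show False using b[OF pq] by (simp add: c_def)
  qed
  then show ?thesis using \<tau>(1,2) by (intro bexI[of _ \<tau>]) auto
qed

text \<open>
  The filter selects the component of degree difference \<open>w - u\<close>; the difference
  is written with \<open>u\<close> and \<open>w\<close> because \<open>P\<close> has no
  subtraction. Once all first paths have degree \<open>p\<close>, the component is given by
  second paths of one degree \<open>q\<close>. Compression along an aperiodic path from each
  vertex bounds its blocks by the norm of the whole combination in \<open>B\<close>. The
  blocks see every coefficient of the iterated squares \<open>(a\<^sup>*a)\<close>,
  \<open>(a\<^sup>*a)\<^sup>2\<close>, \<open>(a\<^sup>*a)\<^sup>4\<close>, and so on; the
  number of coefficients does not grow, so taking roots gives the norm in \<open>A\<close>.
\<close>

lemma fourier_coefficient_bound:
  assumes A: "ck \<Gamma> A s" and B: "ck \<Gamma> B t" and ap: "aperiodic \<Gamma>"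
    and nz: "\<And>v. v \<in> vertices \<Gamma> \<Longrightarrow> t v \<noteq> \<zero>\<^bsub>B\<^esub>" and l: "supp l \<subseteq> span_pairs"
  shows "nrm A (lincomb A (ck.T A s) (filter (\<lambda>x. deg \<Gamma> (fst (snd x)) + u = deg \<Gamma> (snd (snd x)) + w) l))
    \<le> nrm B (lincomb B (ck.T B t) l)"
proof -
  interpret A: ck \<Gamma> A s by fact
  interpret B: ck \<Gamma> B t by fact
  \<comment> \<open>A common upper bound of the first degrees and of \<open>w\<close>, for
    which \<open>p + u = q + w\<close>.\<close>
  define p where "p = w + (\<Sum>z\<in>supp l. deg \<Gamma> (fst z))"
  define p' where "p' = (\<Sum>z\<in>supp l. deg \<Gamma> (fst z))"
  define q where "q = u + p'"
  define L where "L = raise_degree p l"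
  define Q where "Q z \<longleftrightarrow> deg \<Gamma> (fst z) + u = deg \<Gamma> (snd z) + w" for z :: "'g \<times> 'g"
  have ex: "\<exists>r. p = deg \<Gamma> (fst z) + r" if "z \<in> supp l" for z
  proof -
    have "p = deg \<Gamma> (fst z) + (w + (\<Sum>z\<in>supp l - {z}. deg \<Gamma> (fst z)))"
      using that unfolding p_def by (subst sum.remove[of _ z]) (auto simp: ac_simps)
    then show ?thesis by blast
  qed
  have Lp: "z \<in> span_pairs" "deg \<Gamma> (fst z) = p" if Lz: "z \<in> supp L" for z
  proof -
    obtain y \<zeta> where y: "y \<in> supp l" "\<zeta> \<in> mor \<Gamma>" "rng \<Gamma> \<zeta> = src \<Gamma> (fst y)" "deg \<Gamma> \<zeta> = difference p (deg \<Gamma> (fst y))"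
      "z = extend y \<zeta>" using supp_raise_degree[OF l Lz[unfolded L_def]] by metis
    have "y \<in> span_pairs" using y l by blast
    then show "z \<in> span_pairs" "deg \<Gamma> (fst z) = p" using extend_span[OF _ y(2,3)] y difference[OF ex[OF y(1)]] by auto
  qed
  have Lsp: "supp L \<subseteq> span_pairs" using Lp(1) by (rule subsetI)
  have sf: "supp (filter P k) \<subseteq> supp k" for P and k :: "(complex \<times> 'g \<times> 'g) list" by auto
  have Qq: "Q z \<longleftrightarrow> deg \<Gamma> (snd z) = q" if "z \<in> supp L" for z
  proof -
    have "Q z \<longleftrightarrow> w + q = w + deg \<Gamma> (snd z)"
      using Lp(2)[OF that] by (simp add: Q_def q_def p_def p'_def ac_simps)
    then show ?thesis using cancel_iff by auto
  qed
  define L0 where "L0 = filter (\<lambda>x. Q (snd x)) L"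
  have L0q: "L0 = filter (\<lambda>x. deg \<Gamma> (snd (snd x)) = q) L"
    unfolding L0_def using Qq by (intro filter_cong refl) blast
  have L0p: "L0 = raise_degree p (filter (\<lambda>x. Q (snd x)) l)"
    unfolding L0_def L_def
  proof (rule raise_degree_filter[OF l])
    fix z \<zeta> assume z: "z \<in> supp l" "\<zeta> \<in> mor \<Gamma>" "rng \<Gamma> \<zeta> = src \<Gamma> (fst z)"
    then have "z \<in> span_pairs" using l by blast
    note e = extend_span[OF this z(2,3)]
    have "Q (extend z \<zeta>) \<longleftrightarrow> deg \<Gamma> \<zeta> + (deg \<Gamma> (fst z) + u) = deg \<Gamma> \<zeta> + (deg \<Gamma> (snd z) + w)"
      using e by (simp add: Q_def ac_simps)
    then show "Q (extend z \<zeta>) \<longleftrightarrow> Q z" unfolding cancel_iff Q_def .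
  qed
  have lQ: "supp (filter (\<lambda>x. Q (snd x)) l) \<subseteq> span_pairs" using sf l by (rule subset_trans)
  have L0s: "supp L0 \<subseteq> span_pairs" unfolding L0_def using sf Lsp by (rule subset_trans)
  have L0d: "deg \<Gamma> (fst z) = p \<and> deg \<Gamma> (snd z) = q" if z: "z \<in> supp L0" for z
  proof -
    obtain x where "x \<in> set L0" "z = snd x" using z by blast
    then have "z \<in> supp L" "deg \<Gamma> (snd z) = q" unfolding L0q by auto
    then show ?thesis using Lp(2) by blast
  qed
  define F where "F = (\<lambda>z. (q, deg \<Gamma> (snd z))) ` supp L - {(q, q)}"
  have F: "finite F" by (simp add: F_def)
  have F': "\<forall>z\<in>F. fst z \<noteq> snd z" unfolding F_def by fastforce
  have "\<forall>v\<in>vertices \<Gamma>. \<exists>\<tau>. \<tau> \<in> mor \<Gamma> \<and> rng \<Gamma> \<tau> = v \<and> nrm B (lincomb B (B.block \<tau>) L0) \<le> nrm B (lincomb B B.T L)"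
  proof
    fix v assume v: "v \<in> vertices \<Gamma>"
    obtain \<tau> where \<tau>: "\<tau> \<in> mor \<Gamma>" "rng \<Gamma> \<tau> = v" and
      none: "\<forall>(p, q)\<in>F. \<forall>\<eta> \<beta> \<kappa> \<kappa>'. \<eta> \<in> mor \<Gamma> \<longrightarrow> \<beta> \<in> mor \<Gamma> \<longrightarrow> \<kappa> \<in> mor \<Gamma> \<longrightarrow> \<kappa>' \<in> mor \<Gamma> \<longrightarrow>
        deg \<Gamma> \<eta> = p \<longrightarrow> deg \<Gamma> \<beta> = q \<longrightarrow> src \<Gamma> \<eta> = v \<longrightarrow> src \<Gamma> \<beta> = v \<longrightarrow> src \<Gamma> \<tau> = rng \<Gamma> \<kappa> \<longrightarrow> src \<Gamma> \<tau> = rng \<Gamma> \<kappa>' \<longrightarrow>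
        comp \<Gamma> (comp \<Gamma> \<eta> \<tau>) \<kappa> \<noteq> comp \<Gamma> (comp \<Gamma> \<beta> \<tau>) \<kappa>'"
      using aperiodic_path[OF ap v F F'] by (elim bexE conjE)
    have "nrm B (lincomb B (B.block \<tau>) L0) \<le> nrm B (lincomb B B.T L)"
      unfolding L0q
    proof (rule B.block_le[OF \<tau>(1) Lsp Lp(2)])
      fix z \<beta> \<kappa> \<kappa>'
      assume z: "z \<in> supp L" "deg \<Gamma> (snd z) \<noteq> q" "src \<Gamma> (snd z) = rng \<Gamma> \<tau>"
        "\<beta> \<in> mor \<Gamma>" "deg \<Gamma> \<beta> = q" "src \<Gamma> \<beta> = rng \<Gamma> \<tau>" "\<kappa> \<in> mor \<Gamma>" "\<kappa>' \<in> mor \<Gamma>"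
        "src \<Gamma> \<tau> = rng \<Gamma> \<kappa>" "src \<Gamma> \<tau> = rng \<Gamma> \<kappa>'"
      have "(q, deg \<Gamma> (snd z)) \<in> F" using z(1,2) unfolding F_def by blast
      from bspec[OF none this, unfolded prod.case, rule_format, of \<beta> "snd z" \<kappa> \<kappa>']
      show "comp \<Gamma> (comp \<Gamma> \<beta> \<tau>) \<kappa> \<noteq> comp \<Gamma> (comp \<Gamma> (snd z) \<tau>) \<kappa>'"
        using z \<tau>(2) span_pairsD[OF Lsp z(1)] by metis
    qed
    then show "\<exists>\<tau>. \<tau> \<in> mor \<Gamma> \<and> rng \<Gamma> \<tau> = v \<and> nrm B (lincomb B (B.block \<tau>) L0) \<le> nrm B (lincomb B B.T L)"
      using \<tau> by blast
  qed
  then obtain \<tau> where \<tau>: "\<And>v. v \<in> vertices \<Gamma> \<Longrightarrow> \<tau> v \<in> mor \<Gamma>" "\<And>v. v \<in> vertices \<Gamma> \<Longrightarrow> rng \<Gamma> (\<tau> v) = v"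
    "\<And>v. v \<in> vertices \<Gamma> \<Longrightarrow> nrm B (lincomb B (B.block (\<tau> v)) L0) \<le> nrm B (lincomb B B.T L)" by metis
  define N where "N = nrm B (lincomb B B.T L)"
  have N: "N \<ge> 0" unfolding N_def using Lsp B.span_in by (intro B.nrm_nonneg) blast
  define H where "H = snd ` supp L0"
  define J where "J = span_pairs \<inter> H \<times> H"
  have J: "finite J" by (simp add: J_def H_def)
  have Hd: "\<eta> \<in> mor \<Gamma>" "deg \<Gamma> \<eta> = q" if "\<eta> \<in> H" for \<eta>
    using that L0d span_pairsD[OF L0s] unfolding H_def by blast+
  have "nrm A (lincomb A A.T L0) \<le> N"
  proof (rule le_if_powers_le)
    show "0 \<le> nrm A (lincomb A A.T L0)" using L0s A.span_in by (intro A.nrm_nonneg) blast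
    fix k
    have S: "supp (B.gram_power L0 k) \<subseteq> J" using B.supp_gram_power[OF L0s, of k] unfolding J_def H_def .
    have AB: "A.gram_power L0 k = B.gram_power L0 k" by (simp add: A.gram_power_def B.gram_power_def)
    have "nrm A (lincomb A A.T L0) ^ 2 ^ Suc k = nrm A (lincomb A A.T (B.gram_power L0 k))"
      using A.nrm_gram_power[OF A.matrix_system_T L0s L0d, of k] AB by simp
    also have "\<dots> \<le> (\<Sum>z\<in>J. cmod (coef z (B.gram_power L0 k)))"
      by (rule A.nrm_lincomb_coef_le[OF J S]; use A.nrm_T_le in \<open>simp add: J_def A.T_in\<close>)
    also have "\<dots> \<le> (\<Sum>z\<in>J. N ^ 2 ^ Suc k)"
    proof (rule sum_mono)
      fix z assume z: "z \<in> J"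
      define v where "v = src \<Gamma> (fst z)"
      have zp: "z \<in> span_pairs" "fst z \<in> H" "snd z \<in> H" using z by (auto simp: J_def)
      then have v: "v \<in> vertices \<Gamma>" by (simp add: v_def)
      have Ssp: "supp (B.gram_power L0 k) \<subseteq> span_pairs" using S unfolding J_def by blast
      have "cmod (coef z (B.gram_power L0 k)) \<le> nrm B (lincomb B (B.block (\<tau> v)) (B.gram_power L0 k))"
      proof (rule B.coef_le_block[OF \<tau>(1)[OF v] _ Ssp])
        show "t (src \<Gamma> (\<tau> v)) \<noteq> \<zero>\<^bsub>B\<^esub>" using nz \<tau>(1)[OF v] by simp
        show "\<And>x. x \<in> supp (B.gram_power L0 k) \<Longrightarrow> deg \<Gamma> (fst x) = q \<and> deg \<Gamma> (snd x) = q"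
        proof -
          fix x assume x: "x \<in> supp (B.gram_power L0 k)"
          then have "fst x \<in> H" "snd x \<in> H" using subsetD[OF S x] unfolding J_def Int_iff mem_Times_iff by blast+
          then show "deg \<Gamma> (fst x) = q \<and> deg \<Gamma> (snd x) = q" using Hd(2) by blast
        qed
        show "z \<in> span_pairs" "deg \<Gamma> (fst z) = q" "deg \<Gamma> (snd z) = q" "src \<Gamma> (fst z) = rng \<Gamma> (\<tau> v)"
          using zp Hd \<tau>(2)[OF v] by (simp_all add: v_def)
      qed
      also have "\<dots> = nrm B (lincomb B (B.block (\<tau> v)) L0) ^ 2 ^ Suc k"
        by (rule B.nrm_gram_power[OF B.matrix_system_block[OF \<tau>(1)[OF v]] L0s L0d])
      also have "\<dots> \<le> N ^ 2 ^ Suc k"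
      proof (rule power_mono)
        show "nrm B (lincomb B (B.block (\<tau> v)) L0) \<le> N" using \<tau>(3)[OF v] by (simp add: N_def)
        have "B.block (\<tau> v) x \<in> carrier B" if "x \<in> supp L0" for x
          using B.matrix_system_block[OF \<tau>(1)[OF v]] that L0s unfolding B.matrix_system_def by blast
        then show "0 \<le> nrm B (lincomb B (B.block (\<tau> v)) L0)" by (intro B.nrm_nonneg B.lincomb_in)
      qed
      finally show "cmod (coef z (B.gram_power L0 k)) \<le> N ^ 2 ^ Suc k" .
    qed
    finally show "nrm A (lincomb A A.T L0) ^ 2 ^ Suc k \<le> real (card J) * N ^ 2 ^ Suc k" by simp
  qed (rule N)
  then show ?thesis
    unfolding N_def L0p L_def unfolding A.lincomb_raise_degree[OF lQ] B.lincomb_raise_degree[OF l] unfolding Q_def .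
qed

end

section \<open>Characters and Folner sets\<close>

definition nmul :: "nat \<Rightarrow> 'a::comm_monoid_add \<Rightarrow> 'a" where "nmul n g = ((+) g ^^ n) 0"

lemma nmul_simps [simp]: "nmul 0 g = 0" "nmul (Suc n) g = g + nmul n g"
  by (simp_all add: nmul_def)

lemma nmul_add: "nmul (m + n) g = nmul m g + nmul n g"
  by (induction m) (simp_all add: add.assoc)

lemma nmul_mult: "nmul (m * n) g = nmul m (nmul n g)"
  by (induction m) (simp_all add: nmul_add)

text \<open>
  Characters of a subgroup \<open>H\<close>. Values outside \<open>H\<close> are arbitrary.
\<close>

definition partial_character :: "'a::ab_group_add set \<Rightarrow> ('a \<Rightarrow> complex) \<Rightarrow> bool" where
  "partial_character H \<psi> \<longleftrightarrow> 0 \<in> H \<and> (\<forall>x\<in>H. \<forall>y\<in>H. x + y \<in> H) \<and> (\<forall>x\<in>H. - x \<in> H) \<and>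
     (\<forall>x\<in>H. cmod (\<psi> x) = 1) \<and> (\<forall>x\<in>H. \<forall>y\<in>H. \<psi> (x + y) = \<psi> x * \<psi> y)"

lemma partial_characterD:
  assumes "partial_character H \<psi>"
  shows "0 \<in> H" "x \<in> H \<Longrightarrow> y \<in> H \<Longrightarrow> x + y \<in> H" "x \<in> H \<Longrightarrow> - x \<in> H" "x \<in> H \<Longrightarrow> y \<in> H \<Longrightarrow> x - y \<in> H"
    "x \<in> H \<Longrightarrow> cmod (\<psi> x) = 1" "x \<in> H \<Longrightarrow> y \<in> H \<Longrightarrow> \<psi> (x + y) = \<psi> x * \<psi> y" "x \<in> H \<Longrightarrow> \<psi> x \<noteq> 0"
    "x \<in> H \<Longrightarrow> y \<in> H \<Longrightarrow> \<psi> (x - y) = \<psi> x / \<psi> y" "\<psi> 0 = 1"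
proof -
  have H: "0 \<in> H" "\<And>x y. x \<in> H \<Longrightarrow> y \<in> H \<Longrightarrow> x + y \<in> H" "\<And>x. x \<in> H \<Longrightarrow> - x \<in> H"
    "\<And>x. x \<in> H \<Longrightarrow> cmod (\<psi> x) = 1" "\<And>x y. x \<in> H \<Longrightarrow> y \<in> H \<Longrightarrow> \<psi> (x + y) = \<psi> x * \<psi> y"
    using assms unfolding partial_character_def by blast+
  have nz: "\<psi> x \<noteq> 0" if "x \<in> H" for x using H(4)[OF that] by auto
  have d: "x - y \<in> H" if "x \<in> H" "y \<in> H" for x y using H(2)[OF that(1) H(3)[OF that(2)]] by simp
  have "\<psi> 0 * \<psi> 0 = \<psi> 0" using H(5)[OF H(1) H(1)] by simp
  then show "\<psi> 0 = 1" using nz[OF H(1)] by simp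
  show "x \<in> H \<Longrightarrow> y \<in> H \<Longrightarrow> \<psi> (x - y) = \<psi> x / \<psi> y"
    using H(5)[OF d[of x y], of y] nz[of y] by (simp add: field_simps)
  show "0 \<in> H" "x \<in> H \<Longrightarrow> y \<in> H \<Longrightarrow> x + y \<in> H" "x \<in> H \<Longrightarrow> - x \<in> H" "x \<in> H \<Longrightarrow> y \<in> H \<Longrightarrow> x - y \<in> H"
    "x \<in> H \<Longrightarrow> cmod (\<psi> x) = 1" "x \<in> H \<Longrightarrow> y \<in> H \<Longrightarrow> \<psi> (x + y) = \<psi> x * \<psi> y" "x \<in> H \<Longrightarrow> \<psi> x \<noteq> 0"
    by (simp_all add: H nz d)
qed

lemma nmul_mem: "partial_character H \<psi> \<Longrightarrow> x \<in> H \<Longrightarrow> nmul n x \<in> H \<and> \<psi> (nmul n x) = \<psi> x ^ n"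
  by (induction n) (auto simp: partial_characterD)

text \<open>
  An element of the group generated by \<open>H\<close> and \<open>g\<close> has several
  expressions \<open>h + (n - m)g\<close>, and \<open>c\<close> is a consistent value at
  \<open>g\<close> exactly if it is compatible with \<open>\<psi>\<close> on the multiples
  of \<open>g\<close> that lie in \<open>H\<close>.
\<close>

lemma extend_character:
  fixes g :: "'a::ab_group_add"
  assumes \<psi>: "partial_character H \<psi>" and c: "cmod c = 1"
    and compat: "\<And>k. nmul k g \<in> H \<Longrightarrow> \<psi> (nmul k g) = c ^ k"
  shows "\<exists>H' \<psi>'. partial_character H' \<psi>' \<and> H \<subseteq> H' \<and> g \<in> H' \<and> (\<forall>h\<in>H. \<psi>' h = \<psi> h) \<and> \<psi>' g = c"
proof -
  note H = partial_characterD[OF \<psi>]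
  have c0: "c \<noteq> 0" using c by auto
  have comp: "c ^ n = c ^ m * \<psi> h" if h: "h \<in> H" and eq: "nmul n g = nmul m g + h" for n m h
  proof (cases "m \<le> n")
    case True
    then have "nmul m g + nmul (n - m) g = nmul m g + h" using eq by (simp flip: nmul_add)
    then have e: "nmul (n - m) g = h" by simp
    then have "\<psi> h = c ^ (n - m)" using compat[of "n - m"] h by simp
    then show ?thesis using True by (simp flip: power_add)
  next
    case False
    then have "nmul m g = nmul n g + nmul (m - n) g" by (simp flip: nmul_add)
    then have "nmul n g + (nmul (m - n) g + h) = nmul n g + 0" using eq by (metis add.assoc add.right_neutral)
    then have "nmul (m - n) g + h = 0" by (rule add_left_imp_eq)
    then have "nmul (m - n) g = 0 - h" unfolding diff_0 eq_neg_iff_add_eq_0 .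
    moreover from this have "nmul (m - n) g \<in> H" using H(4)[OF H(1) h] by simp
    ultimately have "c ^ (m - n) = \<psi> 0 / \<psi> h" using compat[of "m - n"] H(8)[OF H(1) h] by metis
    then have "c ^ (m - n) * \<psi> h = 1" using H(7)[OF h] H(9) by simp
    then have "c ^ n * (c ^ (m - n) * \<psi> h) = c ^ n" by simp
    then show ?thesis using False by (simp flip: power_add mult.assoc)
  qed
  \<comment> \<open>The value \<open>w\<close> is obtained from some expression of
    \<open>x\<close>; both multiples of \<open>g\<close> have natural coefficients.\<close>
  define R where "R x w \<longleftrightarrow> (\<exists>h\<in>H. \<exists>n m. x + nmul m g = h + nmul n g \<and> w = \<psi> h * c ^ n / c ^ m)" for x w
  have uniq: "w = w'" if ww: "R x w" "R x w'" for x w w'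
  proof -
    obtain h n m where 1: "h \<in> H" "x + nmul m g = h + nmul n g" "w = \<psi> h * c ^ n / c ^ m" using ww(1) unfolding R_def by blast
    obtain h' n' m' where 2: "h' \<in> H" "x + nmul m' g = h' + nmul n' g" "w' = \<psi> h' * c ^ n' / c ^ m'" using ww(2) unfolding R_def by blast
    have "(x + nmul m g) + nmul m' g = (x + nmul m' g) + nmul m g" by (simp add: ac_simps)
    then have "(h + nmul n g) + nmul m' g = (h' + nmul n' g) + nmul m g" unfolding 1 2 .
    then have "nmul (n + m') g = nmul (n' + m) g + (h' - h)" by (simp add: nmul_add algebra_simps)
    then have "c ^ (n + m') = c ^ (n' + m) * (\<psi> h' / \<psi> h)" using comp[of "h' - h"] H(4)[OF 2(1) 1(1)] H(8)[OF 2(1) 1(1)] by simp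
    then show ?thesis using H(7)[OF 1(1)] c0 unfolding 1 2 by (simp add: field_simps power_add)
  qed
  define H' where "H' = {x. \<exists>w. R x w}"
  define \<psi>' where "\<psi>' x = (SOME w. R x w)" for x
  have R: "R x (\<psi>' x)" if "x \<in> H'" for x using that unfolding H'_def \<psi>'_def by (auto intro: someI_ex)
  have \<psi>'I: "x \<in> H' \<and> \<psi>' x = w" if "R x w" for x w
    using that uniq[OF R that] by (auto simp: H'_def)
  have RH: "R h (\<psi> h)" if "h \<in> H" for h
    unfolding R_def using that by (intro bexI[of _ h] exI[of _ 0]) simp_all
  have Rg: "R g c"
    unfolding R_def using H(1,9) by (intro bexI[of _ 0] exI[of _ 1] exI[of _ 0]) simp_all
  have add: "R (x + y) (w * z)" if A: "R x w" "R y z" for x y w z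
  proof -
    obtain h n m where 1: "h \<in> H" "x + nmul m g = h + nmul n g" "w = \<psi> h * c ^ n / c ^ m" using A(1) unfolding R_def by blast
    obtain h' n' m' where 2: "h' \<in> H" "y + nmul m' g = h' + nmul n' g" "z = \<psi> h' * c ^ n' / c ^ m'" using A(2) unfolding R_def by blast
    have "x + y + nmul (m + m') g = (x + nmul m g) + (y + nmul m' g)" by (simp add: nmul_add ac_simps)
    also have "\<dots> = (h + h') + nmul (n + n') g" unfolding 1 2 by (simp add: nmul_add ac_simps)
    finally show ?thesis unfolding R_def using H(2)[OF 1(1) 2(1)] H(6)[OF 1(1) 2(1)] 1(3) 2(3)
      by (intro bexI[of _ "h + h'"] exI[of _ "n + n'"] exI[of _ "m + m'"]) (simp_all add: power_add)
  qed
  have neg: "R (- x) (1 / w)" if A: "R x w" for x w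
  proof -
    obtain h n m where 1: "h \<in> H" "x + nmul m g = h + nmul n g" "w = \<psi> h * c ^ n / c ^ m" using A unfolding R_def by blast
    have "- x + nmul n g = - h + nmul m g" using 1(2) by (simp add: algebra_simps)
    moreover have "\<psi> (0 - h) = 1 / \<psi> h" using H(8)[OF H(1) 1(1)] H(9) by simp
    ultimately show ?thesis unfolding R_def using H(3)[OF 1(1)] 1(3)
      by (intro bexI[of _ "- h"] exI[of _ m] exI[of _ n]) simp_all
  qed
  have norm: "cmod w = 1" if "R x w" for x w
    using that H(5) c unfolding R_def by (auto simp: norm_mult norm_divide norm_power)
  have "partial_character H' \<psi>'"
    unfolding partial_character_def
  proof (intro conjI ballI)
    show "0 \<in> H'" using \<psi>'I[OF RH[OF H(1)]] by simp
    fix x assume x: "x \<in> H'"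
    show "- x \<in> H'" using \<psi>'I[OF neg[OF R[OF x]]] by simp
    show "cmod (\<psi>' x) = 1" using norm[OF R[OF x]] .
    fix y assume y: "y \<in> H'"
    show "x + y \<in> H'" "\<psi>' (x + y) = \<psi>' x * \<psi>' y" using \<psi>'I[OF add[OF R[OF x] R[OF y]]] by simp_all
  qed
  then show ?thesis using \<psi>'I[OF RH] \<psi>'I[OF Rg] by (intro exI[of _ H'] exI[of _ \<psi>']) auto
qed

lemma root_of_unit: assumes "cmod w = 1" "n > 0" shows "\<exists>c. c ^ n = w \<and> cmod c = 1"
proof -
  obtain c where c: "w = c ^ n" using exists_complex_root[of n w] assms by auto
  then have "cmod c ^ n = 1" using assms by (simp add: norm_power)
  then have "cmod c = 1" using power_eq_iff_eq_base[of n "cmod c" 1] assms(2) by simp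
  then show ?thesis using c by auto
qed

text \<open>
  The multiples of \<open>g\<close> in \<open>H\<close> are the multiples of the least
  positive one.
\<close>

lemma compatible_value:
  fixes g :: "'a::ab_group_add"
  assumes \<psi>: "partial_character H \<psi>" and n: "n > 0" "nmul n g \<in> H" "\<forall>k. 0 < k \<and> k < n \<longrightarrow> nmul k g \<notin> H"
    and c: "c ^ n = \<psi> (nmul n g)" and k: "nmul k g \<in> H"
  shows "\<psi> (nmul k g) = c ^ k"
proof -
  note H = partial_characterD[OF \<psi>]
  have eq: "nmul k g = nmul (k mod n) g + nmul (k div n) (nmul n g)"
    by (simp flip: nmul_add nmul_mult)
  have m: "nmul (k div n) (nmul n g) \<in> H" using nmul_mem[OF \<psi> n(2)] by simp
  have "nmul (k mod n) g \<in> H" using eq k H(4)[OF k m] by simp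
  then have 0: "k mod n = 0" using n(3) n(1) by (metis mod_less_divisor neq0_conv)
  then have "nmul k g = nmul (k div n) (nmul n g)" using eq by simp
  then have "\<psi> (nmul k g) = \<psi> (nmul n g) ^ (k div n)" using nmul_mem[OF \<psi> n(2)] by simp
  also have "\<dots> = c ^ (n * (k div n))" by (simp add: c[symmetric] power_mult)
  also have "n * (k div n) = k" using 0 by auto
  finally show ?thesis .
qed

lemma extend_character_step:
  fixes g :: "'a::ab_group_add"
  assumes \<psi>: "partial_character H \<psi>"
  shows "\<exists>H' \<psi>'. partial_character H' \<psi>' \<and> H \<subseteq> H' \<and> g \<in> H' \<and> (\<forall>h\<in>H. \<psi>' h = \<psi> h)"
proof -
  have "\<exists>c. cmod c = 1 \<and> (\<forall>k. nmul k g \<in> H \<longrightarrow> \<psi> (nmul k g) = c ^ k)"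
  proof (cases "\<exists>n>0. nmul n g \<in> H")
    case True
    define n where "n = (LEAST n. n > 0 \<and> nmul n g \<in> H)"
    have n: "n > 0" "nmul n g \<in> H" using LeastI_ex[OF True, folded n_def] by blast+
    have least: "\<forall>k. 0 < k \<and> k < n \<longrightarrow> nmul k g \<notin> H"
      using not_less_Least[of _ "\<lambda>n. n > 0 \<and> nmul n g \<in> H", folded n_def] by blast
    obtain c where c: "c ^ n = \<psi> (nmul n g)" "cmod c = 1"
      using root_of_unit[OF partial_characterD(5)[OF \<psi> n(2)] n(1)] by blast
    show ?thesis
    proof (intro exI[of _ c] conjI allI impI c(2))
      fix k assume k: "nmul k g \<in> H"
      show "\<psi> (nmul k g) = c ^ k" by (rule compatible_value[OF \<psi> n(1) n(2) least c(1) k])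
    qed
  next
    case False
    have z: "k = 0" if "nmul k g \<in> H" for k using False that by (metis neq0_conv)
    have "\<psi> (nmul k g) = 1 ^ k" if "nmul k g \<in> H" for k
      unfolding z[OF that] using partial_characterD(9)[OF \<psi>] by simp
    then show ?thesis by (intro exI[of _ 1]) simp
  qed
  then show ?thesis using extend_character[OF \<psi>] by blast
qed

lemma extend_character_list:
  assumes "partial_character H \<psi>"
  shows "\<exists>H' \<psi>'. partial_character H' \<psi>' \<and> H \<subseteq> H' \<and> set gs \<subseteq> H' \<and> (\<forall>h\<in>H. \<psi>' h = \<psi> h)"
  using assms
proof (induction gs arbitrary: H \<psi>)
  case (Cons g gs)
  obtain H1 \<psi>1 where 1: "partial_character H1 \<psi>1" "H \<subseteq> H1" "g \<in> H1" "\<forall>h\<in>H. \<psi>1 h = \<psi> h"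
    using extend_character_step[OF Cons.prems] by blast
  obtain H2 \<psi>2 where "partial_character H2 \<psi>2" "H1 \<subseteq> H2" "set gs \<subseteq> H2" "\<forall>h\<in>H1. \<psi>2 h = \<psi>1 h"
    using Cons.IH[OF 1(1)] by blast
  with 1 show ?case by (intro exI[of _ H2] exI[of _ \<psi>2]) auto
qed auto

text \<open>
  At \<open>g\<close> the character takes a primitive \<open>n\<close>-th root of unity if
  \<open>g\<close> has order \<open>n\<close>, and \<open>-1\<close> if the order is
  infinite.
\<close>

lemma separating_partial_character:
  fixes g :: "'a::ab_group_add"
  assumes g: "g \<noteq> 0"
  shows "\<exists>H \<psi>. partial_character H \<psi> \<and> g \<in> H \<and> \<psi> g \<noteq> 1"
proof -
  have t: "partial_character {0 :: 'a} (\<lambda>_. 1)" by (simp add: partial_character_def)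
  have "\<exists>c. cmod c = 1 \<and> c \<noteq> 1 \<and> (\<forall>k. nmul k g \<in> {0} \<longrightarrow> 1 = c ^ k)"
  proof (cases "\<exists>n>0. nmul n g \<in> {0}")
    case True
    define n where "n = (LEAST n. n > 0 \<and> nmul n g \<in> {0})"
    have n: "n > 0" "nmul n g \<in> {0}" using LeastI_ex[OF True, folded n_def] by blast+
    have least: "\<forall>k. 0 < k \<and> k < n \<longrightarrow> nmul k g \<notin> {0}"
      using not_less_Least[of _ "\<lambda>n. n > 0 \<and> nmul n g \<in> {0}", folded n_def] by blast
    have n1: "n \<noteq> 1" using n g by auto
    define c where "c = cis (2 * pi / n)"
    have c: "c ^ n = 1" unfolding c_def Complex.DeMoivre using n by simp
    have "c \<noteq> 1"
    proof
      assume "c = 1"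
      then have "cos (2 * pi / n) = 1" by (simp add: c_def complex_eq_iff)
      then obtain i :: int where i: "2 * pi / real n = real_of_int i * 2 * pi" using cos_one_2pi_int by blast
      then have "real_of_int i * n = 1" using n by (simp add: field_simps)
      then have "i * int n = 1" by (metis of_int_eq_1_iff of_int_mult of_int_of_nat_eq)
      then show False using n1 n by (simp add: zmult_eq_1_iff)
    qed
    moreover have "1 = c ^ k" if "nmul k g \<in> {0}" for k
      by (rule compatible_value[OF t n least c that])
    ultimately show ?thesis by (intro exI[of _ c]) (simp add: c_def)
  next
    case False
    have z: "k = 0" if "nmul k g \<in> {0}" for k using False that by (metis neq0_conv)
    have "1 = (- 1 :: complex) ^ k" if "nmul k g \<in> {0}" for k unfolding z[OF that] by simp
    then show ?thesis by (intro exI[of _ "-1"]) simp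
  qed
  then obtain c where c: "cmod c = 1" "c \<noteq> 1" "\<forall>k. nmul k g \<in> {0} \<longrightarrow> 1 = c ^ k" by blast
  have "\<exists>H' \<psi>'. partial_character H' \<psi>' \<and> {0} \<subseteq> H' \<and> g \<in> H' \<and> (\<forall>h\<in>{0}. \<psi>' h = 1) \<and> \<psi>' g = c"
    using c(3) by (intro extend_character[OF t c(1)]) simp
  then obtain H \<psi> where "partial_character H \<psi>" "g \<in> H" "\<psi> g = c" by (elim exE conjE)
  with c(2) show ?thesis by (intro exI[of _ H] exI[of _ \<psi>]) simp
qed

text \<open>
  The Grothendieck group of \<open>P\<close>. The summand \<open>e\<close> makes the
  relation transitive without cancellation, so that the quotient exists for every
  commutative monoid.
\<close>

definition groth_rel :: "'p::comm_monoid_add \<times> 'p \<Rightarrow> 'p \<times> 'p \<Rightarrow> bool" where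
  "groth_rel x y \<longleftrightarrow> (\<exists>e. fst x + snd y + e = fst y + snd x + e)"

lemma groth_rel_refl: "groth_rel x x" unfolding groth_rel_def by blast
lemma groth_rel_sym: assumes "groth_rel x y" shows "groth_rel y x"
proof -
    obtain e where "fst x + snd y + e = fst y + snd x + e" using assms unfolding groth_rel_def by blast
    from this[symmetric] show "groth_rel y x" unfolding groth_rel_def by (rule exI)
qed
lemma groth_rel_trans: assumes "groth_rel x y" "groth_rel y z" shows "groth_rel x z"
proof -
    obtain e e' where e: "fst x + snd y + e = fst y + snd x + e" "fst y + snd z + e' = fst z + snd y + e'"
      using assms unfolding groth_rel_def by blast
    have "fst x + snd z + (snd y + e + e') = (fst x + snd y + e) + (snd z + e')" by (simp add: ac_simps)
    also have "\<dots> = (fst y + snd z + e') + (snd x + e)" unfolding e(1) by (simp add: ac_simps)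
    also have "\<dots> = fst z + snd x + (snd y + e + e')" unfolding e(2) by (simp add: ac_simps)
    finally show "groth_rel x z" unfolding groth_rel_def by blast
qed
lemma groth_relI: "fst x + snd y = fst y + snd x \<Longrightarrow> groth_rel x y"
  unfolding groth_rel_def by (intro exI[of _ 0]) (simp only: add_0_right)

lemma equivp_groth_rel: "equivp groth_rel"
  by (intro equivpI reflpI sympI transpI) (blast intro: groth_rel_refl groth_rel_sym groth_rel_trans)+

quotient_type (overloaded) 'p groth = "'p::comm_monoid_add \<times> 'p" / groth_rel
  by (rule equivp_groth_rel)

instantiation groth :: (comm_monoid_add) ab_group_add
begin

lift_definition zero_groth :: "'a groth" is "(0, 0)" .

lift_definition plus_groth :: "'a groth \<Rightarrow> 'a groth \<Rightarrow> 'a groth" is "\<lambda>x y. (fst x + fst y, snd x + snd y)"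
proof -
  fix x x' y y' :: "'a \<times> 'a" assume "groth_rel x x'" "groth_rel y y'"
  then obtain e e' where e: "fst x + snd x' + e = fst x' + snd x + e" "fst y + snd y' + e' = fst y' + snd y + e'"
    unfolding groth_rel_def by blast
  have "(fst x + fst y) + (snd x' + snd y') + (e + e') = (fst x + snd x' + e) + (fst y + snd y' + e')" by (simp only: ac_simps)
  also have "\<dots> = (fst x' + fst y') + (snd x + snd y) + (e + e')" unfolding e by (simp only: ac_simps)
  finally show "groth_rel (fst x + fst y, snd x + snd y) (fst x' + fst y', snd x' + snd y')"
    unfolding groth_rel_def fst_conv snd_conv by (rule exI)
qed

lift_definition uminus_groth :: "'a groth \<Rightarrow> 'a groth" is prod.swap
proof -
  fix x y :: "'a \<times> 'a" assume "groth_rel x y"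
  then obtain e where e: "fst x + snd y + e = fst y + snd x + e" unfolding groth_rel_def by blast
  have "snd x + fst y + e = snd y + fst x + e" using e[symmetric] by (simp only: ac_simps)
  then show "groth_rel (prod.swap x) (prod.swap y)" unfolding groth_rel_def fst_swap snd_swap by (rule exI)
qed

definition minus_groth :: "'a groth \<Rightarrow> 'a groth \<Rightarrow> 'a groth" where "minus_groth x y = x + - y"

instance
proof
  fix x y z :: "'a groth"
  show "x + y + z = x + (y + z)" by transfer (rule groth_relI, simp add: ac_simps)
  show "x + y = y + x" by transfer (rule groth_relI, simp add: ac_simps)
  show "0 + x = x" by transfer (rule groth_relI, simp add: ac_simps)
  show "- x + x = 0" by transfer (rule groth_relI, simp add: ac_simps)
  show "x - y = x + - y" by (rule minus_groth_def)
qed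

end

lift_definition groth :: "'p::comm_monoid_add \<Rightarrow> 'p groth" is "\<lambda>p. (p, 0)" .

lemma groth_add: "groth (p + q) = groth p + groth q"
  by transfer (rule groth_relI, simp)

lemma groth_0: "groth 0 = 0"
  by transfer (rule groth_relI, simp)

lemma groth_inject:
  fixes p q :: "'p::comm_monoid_add"
  assumes cancel: "\<And>p q r :: 'p. p + q = p + r \<Longrightarrow> q = r" and "groth p = groth q"
  shows "p = q"
proof -
  have "groth_rel (p, 0) (q, 0)" using assms(2) by transfer
  then obtain e where "p + 0 + e = q + 0 + e" unfolding groth_rel_def fst_conv snd_conv by blast
  then show ?thesis using cancel[of e p q] by (simp add: add.commute)
qed

definition character :: "('p::comm_monoid_add \<Rightarrow> complex) \<Rightarrow> bool" where
  "character z \<longleftrightarrow> (\<forall>p q. z (p + q) = z p * z q) \<and> (\<forall>p. cmod (z p) = 1)"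

text \<open>
  A character of the cyclic group generated by the difference of \<open>p\<close> and
  \<open>q\<close> extends to the Grothendieck group in finitely many steps, one for each
  generator.
\<close>

lemma characters_separate:
  fixes p q :: "'p::comm_monoid_add"
  assumes cancel: "\<And>p q r :: 'p. p + q = p + r \<Longrightarrow> q = r"
    and fg: "finite S" "\<And>p :: 'p. \<exists>ps. set ps \<subseteq> S \<and> p = sum_list ps" and pq: "p \<noteq> q"
  shows "\<exists>z. character z \<and> z p \<noteq> z q"
proof -
  have "p = q" if "groth p = groth q" using cancel that by (rule groth_inject)
  then have "groth p \<noteq> groth q" using pq by blast
  then have "groth p - groth q \<noteq> 0" by simp
  then obtain H \<psi> where 1: "partial_character H \<psi>" "groth p - groth q \<in> H" "\<psi> (groth p - groth q) \<noteq> 1"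
    using separating_partial_character by blast
  obtain gs where gs: "set gs = S" using fg(1) finite_list by blast
  obtain H' \<psi>' where 2: "partial_character H' \<psi>'" "H \<subseteq> H'" "set (map groth gs) \<subseteq> H'" "\<forall>h\<in>H. \<psi>' h = \<psi> h"
    using extend_character_list[OF 1(1)] by blast
  note H = partial_characterD[OF 2(1)]
  have "groth (sum_list ps) \<in> H'" if "set ps \<subseteq> S" for ps
    using that by (induction ps) (use 2(3) gs H in \<open>auto simp: groth_0 groth_add\<close>)
  then have all: "groth x \<in> H'" for x using fg(2)[of x] by auto
  have "character (\<lambda>p. \<psi>' (groth p))"
    unfolding character_def using H(5,6) all by (simp add: groth_add)
  moreover have "\<psi>' (groth p) \<noteq> \<psi>' (groth q)"
  proof
    assume "\<psi>' (groth p) = \<psi>' (groth q)"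
    then have "\<psi>' (groth p - groth q) = 1" using H(7,8) all by simp
    then show False using 1 2 by auto
  qed
  ultimately show ?thesis by blast
qed

lemma character_cnj: "character z \<Longrightarrow> z p * cnj (z p) = 1"
  by (simp add: character_def complex_norm_square[symmetric])

lemma character_0: assumes "character z" shows "z 0 = 1"
proof -
  have "z 0 * z 0 = z 0" "z 0 \<noteq> 0" using assms unfolding character_def by (metis add_0, metis norm_zero zero_neq_one)
  then show ?thesis by simp
qed

text \<open>
  A discrete substitute for the integral of \<open>z(p) z(q)\<^sup>*\<close> over the
  compact group of all characters, which is 1 if \<open>p = q\<close> and 0 otherwise.
\<close>

definition mean :: "('p \<Rightarrow> complex) list \<Rightarrow> 'p \<Rightarrow> 'p \<Rightarrow> complex" where
  "mean zs p q = sum_list (map (\<lambda>z. z p * cnj (z q)) zs) / of_nat (length zs)"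

lemma norm_mean_le: assumes "\<forall>z\<in>set zs. character z" shows "cmod (mean zs p q) \<le> 1"
proof -
  have "cmod (sum_list (map (\<lambda>z. z p * cnj (z q)) zs)) \<le> real (length zs)"
    using assms
  proof (induction zs)
    case (Cons z zs)
    have "cmod (z p * cnj (z q)) = 1" using Cons.prems by (simp add: norm_mult character_def)
    then show ?case using Cons norm_triangle_ineq[of "z p * cnj (z q)" "sum_list (map (\<lambda>z. z p * cnj (z q)) zs)"] by simp
  qed simp
  then show ?thesis by (cases "zs = []") (simp_all add: mean_def norm_divide divide_le_eq)
qed

lemma mean_diag: assumes "\<forall>z\<in>set zs. character z" "zs \<noteq> []" shows "mean zs p p = 1"
proof -
  have "sum_list (map (\<lambda>z. z p * cnj (z p)) zs) = of_nat (length zs)"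
    using assms(1) by (induction zs) (auto simp: character_cnj)
  then show ?thesis using assms(2) by (simp add: mean_def)
qed

definition char_products :: "('p \<Rightarrow> complex) list \<Rightarrow> ('p \<Rightarrow> complex) list \<Rightarrow> ('p \<Rightarrow> complex) list" where
  "char_products zs ws = concat (map (\<lambda>z. map (\<lambda>w p. z p * w p) ws) zs)"

lemma mean_prod: "mean (char_products zs ws) p q = mean zs p q * mean ws p q"
proof -
  have "sum_list (map (\<lambda>z. z p * cnj (z q)) (map (\<lambda>w p. z p * w p) ws)) = (z p * cnj (z q)) * sum_list (map (\<lambda>w. w p * cnj (w q)) ws)" for z
    by (induction ws) (simp_all add: algebra_simps)
  then have "sum_list (map (\<lambda>z. z p * cnj (z q)) (char_products zs ws)) =
    sum_list (map (\<lambda>z. z p * cnj (z q)) zs) * sum_list (map (\<lambda>z. z p * cnj (z q)) ws)"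
    unfolding char_products_def by (induction zs) (simp_all add: algebra_simps)
  moreover have "length (char_products zs ws) = length zs * length ws"
    unfolding char_products_def by (induction zs) simp_all
  ultimately show ?thesis by (simp add: mean_def)
qed

text \<open>
  A list of characters is improved at one pair at a time. For \<open>p \<noteq> q\<close>
  choose a character \<open>w\<close> with \<open>\<zeta> = w(p) w(q)\<^sup>* \<noteq>
  1\<close>; the mean over the first \<open>K\<close> powers of \<open>w\<close> is a
  geometric sum, hence small. Means are multiplicative over products of lists and bounded by
  1, so pairs treated before are not spoiled.
\<close>

lemma mean_approximates_delta:
  fixes F :: "('p::comm_monoid_add \<times> 'p) set"
  assumes sep: "\<And>p q :: 'p. p \<noteq> q \<Longrightarrow> \<exists>z. character z \<and> z p \<noteq> z q" and F: "finite F" and \<delta>: "\<delta> > 0"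
  shows "\<exists>zs. zs \<noteq> [] \<and> (\<forall>z\<in>set zs. character z) \<and> (\<forall>(p, q)\<in>F. cmod (mean zs p q - of_bool (p = q)) \<le> \<delta>)"
  using F
proof (induction F)
  case empty
  have "character (\<lambda>_::'p. 1)" by (simp add: character_def)
  then show ?case by (intro exI[of _ "[\<lambda>_. 1]"]) simp
next
  case (insert z F)
  obtain p q where z: "z = (p, q)" by (cases z)
  obtain zs where zs: "zs \<noteq> []" "\<forall>z\<in>set zs. character z" "\<forall>(p, q)\<in>F. cmod (mean zs p q - of_bool (p = q)) \<le> \<delta>"
    using insert.IH by blast
  show ?case
  proof (cases "p = q")
    case True
    then have "cmod (mean zs p q - of_bool (p = q)) \<le> \<delta>" using mean_diag[OF zs(2,1)] \<delta> by simp
    then show ?thesis using zs z by (intro exI[of _ zs]) auto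
  next
    case False
    obtain w where w: "character w" "w p \<noteq> w q" using sep[OF False] by blast
    define \<zeta> where "\<zeta> = w p * cnj (w q)"
    have \<zeta>: "\<zeta> \<noteq> 1"
    proof
      assume "\<zeta> = 1"
      then have "w p * (w q * cnj (w q)) = w q" by (simp add: \<zeta>_def ac_simps)
      then show False using w character_cnj[OF w(1)] by simp
    qed
    have n\<zeta>: "cmod \<zeta> = 1" using w by (simp add: \<zeta>_def norm_mult character_def)
    obtain K :: nat where K: "2 / (cmod (1 - \<zeta>) * \<delta>) < real K" using reals_Archimedean2 by blast
    have d: "cmod (1 - \<zeta>) * \<delta> > 0" using \<zeta> \<delta> by simp
    then have "0 < 2 / (cmod (1 - \<zeta>) * \<delta>)" by simp
    then have K0: "K > 0" using K by (metis of_nat_0_less_iff order_less_trans)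
    define ws where "ws = map (\<lambda>k p. w p ^ k) [0..<K]"
    have wsc: "\<forall>z\<in>set ws. character z" using w by (auto simp: ws_def character_def power_mult_distrib norm_power)
    have "sum_list (map (\<lambda>z. z p * cnj (z q)) ws) = (\<Sum>k<K. \<zeta> ^ k)"
      by (simp add: ws_def interv_sum_list_conv_sum_set_nat \<zeta>_def power_mult_distrib comp_def atLeast0LessThan)
    also have "\<dots> = (1 - \<zeta> ^ K) / (1 - \<zeta>)" using \<zeta> by (simp add: sum_gp_strict)
    finally have m: "mean ws p q = (1 - \<zeta> ^ K) / (1 - \<zeta>) / of_nat K" by (simp add: mean_def ws_def)
    have "cmod (mean ws p q) \<le> 2 / cmod (1 - \<zeta>) / K"
      unfolding m norm_divide using norm_triangle_ineq4[of 1 "\<zeta> ^ K"] n\<zeta>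
      by (auto simp: norm_power intro!: divide_right_mono)
    also have "\<dots> \<le> \<delta>" using K K0 d \<zeta> by (simp add: field_simps)
    finally have small: "cmod (mean ws p q) \<le> \<delta>" .
    define us where "us = char_products zs ws"
    have us: "us \<noteq> []" "\<forall>z\<in>set us. character z"
      using zs(1,2) wsc K0
      by (auto simp: us_def char_products_def ws_def character_def norm_mult ac_simps)
    have close: "cmod (mean us p' q' - of_bool (p' = q')) \<le> \<delta>" if pq: "(p', q') \<in> insert z F" for p' q'
    proof (cases "p' = q'")
      case True then show ?thesis using mean_diag[OF us(2,1)] \<delta> by simp
    next
      case ne: False
      have b: "cmod (mean zs p' q') \<le> 1" "cmod (mean ws p' q') \<le> 1" using norm_mean_le zs(2) wsc by blast+
      have "cmod (mean zs p' q') * cmod (mean ws p' q') \<le> \<delta>"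
      proof (cases "(p', q') = z")
        case True
        then have "cmod (mean ws p' q') \<le> \<delta>" using small z by simp
        then show ?thesis using mult_mono[OF b(1), of "cmod (mean ws p' q')" \<delta>] by simp
      next
        case False
        then have "cmod (mean zs p' q') \<le> \<delta>" using pq zs(3) ne by auto
        then show ?thesis using mult_mono[of "cmod (mean zs p' q')" \<delta> "cmod (mean ws p' q')" 1] b \<delta> by simp
      qed
      then show ?thesis using ne by (simp add: us_def mean_prod norm_mult)
    qed
    show ?thesis
    proof (intro exI[of _ us] conjI us ballI)
      fix x assume "x \<in> insert z F"
      then show "case x of (p, q) \<Rightarrow> cmod (mean us p q - of_bool (p = q)) \<le> \<delta>"
        using close[of "fst x" "snd x"] by (simp add: case_prod_beta')
    qed
  qed
qed

text \<open>Otherwise \<open>b\<close> would grow exponentially.\<close>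
lemma polynomial_growth_ratio:
  fixes b :: "nat \<Rightarrow> real"
  assumes \<epsilon>: "\<epsilon> > 0" and b0: "b 0 \<ge> 1" and poly: "\<And>j. b j \<le> (real j * c + d) ^ k"
  shows "\<exists>j. b (Suc j) \<le> (1 + \<epsilon>) * b j"
proof (rule ccontr)
  assume "\<not> ?thesis"
  then have step: "b (Suc j) > (1 + \<epsilon>) * b j" for j by (auto simp: not_le)
  have ge: "b j \<ge> (1 + \<epsilon>) ^ j" for j
  proof (induction j)
    case (Suc j)
    have "(1 + \<epsilon>) * (1 + \<epsilon>) ^ j \<le> (1 + \<epsilon>) * b j" using Suc \<epsilon> by (intro mult_left_mono) auto
    then show ?case using step[of j] by simp
  qed (use b0 in simp)
  have k: "k > 0"
  proof (rule ccontr)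
    assume "\<not> k > 0"
    then have "b 1 \<le> 1" using poly[of 1] by simp
    also have "1 \<le> (1 + \<epsilon>) * b 0" using mult_mono[of 1 "1 + \<epsilon>" 1 "b 0"] b0 \<epsilon> by simp
    finally show False using step[of 0] by simp
  qed
  define y where "y = root k (1 / (1 + \<epsilon>))"
  have y: "0 \<le> y" "y < 1" "y ^ k = 1 / (1 + \<epsilon>)" using k \<epsilon> by (auto simp: y_def real_root_lt_1_iff)
  have "(\<lambda>j. c * (of_nat j * y ^ j) + d * y ^ j) \<longlonglongrightarrow> c * 0 + d * 0"
    using y(1,2) by (intro tendsto_intros powser_times_n_limit_0 LIMSEQ_realpow_zero) auto
  then have "(\<lambda>j. (c * (of_nat j * y ^ j) + d * y ^ j) ^ k) \<longlonglongrightarrow> (c * 0 + d * 0) ^ k"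
    by (rule tendsto_power)
  moreover have "(c * (of_nat j * y ^ j) + d * y ^ j) ^ k = (real j * c + d) ^ k / (1 + \<epsilon>) ^ j" for j
  proof -
    have "c * (of_nat j * y ^ j) + d * y ^ j = (real j * c + d) * y ^ j" by (simp add: algebra_simps)
    moreover have "(y ^ j) ^ k = (y ^ k) ^ j" by (simp add: mult.commute flip: power_mult)
    ultimately show ?thesis by (simp add: power_mult_distrib y(3) power_divide)
  qed
  ultimately have lim: "(\<lambda>j. (real j * c + d) ^ k / (1 + \<epsilon>) ^ j) \<longlonglongrightarrow> 0" using k by (simp add: power_0_left)
  have "\<forall>\<^sub>F j in sequentially. (real j * c + d) ^ k / (1 + \<epsilon>) ^ j < 1"
    using order_tendstoD(2)[OF lim, of 1] by simp
  then obtain j where "(real j * c + d) ^ k / (1 + \<epsilon>) ^ j < 1" by (auto simp: eventually_sequentially)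
  then have "(real j * c + d) ^ k < (1 + \<epsilon>) ^ j" using \<epsilon> by (simp add: divide_less_eq)
  then show False using ge[of j] poly[of j] by linarith
qed

definition cube :: "'p::comm_monoid_add set \<Rightarrow> nat \<Rightarrow> 'p set" where
  "cube S N = (\<lambda>n. \<Sum>g\<in>S. nmul (n g) g) ` (S \<rightarrow>\<^sub>E {..N})"

lemma cube_finite: assumes "finite S" shows "finite (cube S N)" "card (cube S N) \<le> (N + 1) ^ card S"
proof -
  have f: "finite (S \<rightarrow>\<^sub>E {..N})" using assms by (intro finite_PiE) auto
  then show "finite (cube S N)" by (simp add: cube_def)
  have "card (cube S N) \<le> card (S \<rightarrow>\<^sub>E {..N})" unfolding cube_def using f by (rule card_image_le)
  also have "\<dots> = (N + 1) ^ card S" using assms by (simp add: card_PiE)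
  finally show "card (cube S N) \<le> (N + 1) ^ card S" .
qed

lemma cubeI: assumes "\<And>g. g \<in> S \<Longrightarrow> n g \<le> N" shows "(\<Sum>g\<in>S. nmul (n g) g) \<in> cube S N"
proof -
  have "(\<Sum>g\<in>S. nmul (n g) g) = (\<Sum>g\<in>S. nmul (restrict n S g) g)" by (intro sum.cong) auto
  moreover have "restrict n S \<in> S \<rightarrow>\<^sub>E {..N}" using assms by auto
  ultimately show ?thesis unfolding cube_def by blast
qed

lemma cube_add:
  assumes "x \<in> cube S N" "y \<in> cube S M" shows "x + y \<in> cube S (N + M)"
proof -
  obtain n m where nm: "n \<in> S \<rightarrow>\<^sub>E {..N}" "m \<in> S \<rightarrow>\<^sub>E {..M}" "x = (\<Sum>g\<in>S. nmul (n g) g)" "y = (\<Sum>g\<in>S. nmul (m g) g)"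
    using assms by (auto simp: cube_def)
  have "x + y = (\<Sum>g\<in>S. nmul (n g + m g) g)" by (simp add: nm nmul_add sum.distrib)
  also have "\<dots> \<in> cube S (N + M)" using nm(1,2) by (intro cubeI add_mono) auto
  finally show ?thesis .
qed

lemma cube_mono: "N \<le> M \<Longrightarrow> cube S N \<subseteq> cube S M"
  by (auto simp: cube_def PiE_def Pi_def intro!: image_eqI)

lemma in_cube:
  fixes S :: "'p::comm_monoid_add set"
  assumes "finite S" "set ps \<subseteq> S" shows "sum_list ps \<in> cube S (length ps)"
  using assms(2)
proof (induction ps)
  case Nil
  have "(\<Sum>g\<in>S. nmul 0 g) \<in> cube S 0" by (intro cubeI) simp
  then show ?case by simp
next
  case (Cons g ps)
  have "(\<Sum>h\<in>S. nmul (of_bool (h = g)) h) \<in> cube S 1" by (intro cubeI) simp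
  moreover have "(\<Sum>h\<in>S. nmul (of_bool (h = g)) h) = g"
  proof -
    have "(\<Sum>h\<in>S. nmul (of_bool (h = g)) h) = (\<Sum>h\<in>S. if h = g then g else 0)" by (intro sum.cong) auto
    then show ?thesis using assms(1) Cons.prems by simp
  qed
  ultimately have "g \<in> cube S 1" by simp
  then show ?case using cube_add[of g S 1 "sum_list ps" "length ps"] Cons by simp
qed

text \<open>
  The sets of sums with multiplicities at most \<open>N\<close> have polynomial size, so for
  some \<open>j\<close> the step from \<open>E\<close> (radius \<open>jr\<close>) to
  \<open>E'\<close> (radius \<open>(j + 1)r\<close>) increases the size only by a factor
  \<open>1 + \<epsilon>\<close>. Translates of \<open>E\<close> by elements of
  \<open>F\<close> lie in \<open>E'\<close> and therefore overlap almost entirely.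
\<close>

lemma folner:
  fixes F :: "'p::comm_monoid_add set"
  assumes cancel: "\<And>p q r :: 'p. p + q = p + r \<Longrightarrow> q = r"
    and fg: "finite S" "\<And>p :: 'p. \<exists>ps. set ps \<subseteq> S \<and> p = sum_list ps" and F: "finite F" and \<epsilon>: "\<epsilon> > 0"
  shows "\<exists>E. finite E \<and> E \<noteq> {} \<and> (\<forall>p\<in>F. \<forall>q\<in>F.
     (1 - \<epsilon>) * real (card E) \<le> real (card {(a, b) \<in> E \<times> E. p + b = q + a}) \<and>
     card {(a, b) \<in> E \<times> E. p + b = q + a} \<le> card E)"
proof -
  have "\<exists>r. F \<subseteq> cube S r"
    using F
  proof (induction F)
    case (insert p F)
    then obtain r where r: "F \<subseteq> cube S r" by blast
    obtain r' where r': "p \<in> cube S r'" using fg(2)[of p] in_cube[OF fg(1)] by blast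
    show ?case using r r' cube_mono[of r "max r r'" S] cube_mono[of r' "max r r'" S] by (intro exI[of _ "max r r'"]) auto
  qed simp
  then obtain r where r: "F \<subseteq> cube S r" by blast
  define b where "b j = real (card (cube S (j * r)))" for j
  have z: "0 \<in> cube S 0" using in_cube[OF fg(1), of "[]"] by simp
  have ne: "cube S N \<noteq> {}" for N using z cube_mono[of 0 N S] by auto
  have pos: "card (cube S N) \<ge> 1" for N using ne[of N] cube_finite(1)[OF fg(1), of N] by (simp add: Suc_le_eq card_gt_0_iff)
  obtain j where j: "b (Suc j) \<le> (1 + \<epsilon>) * b j"
  proof (rule exE[OF polynomial_growth_ratio[OF \<epsilon>, of b "real r" 1 "card S"]])
    show "1 \<le> b 0" using pos[of 0] by (simp add: b_def)
    show "b j \<le> (real j * real r + 1) ^ card S" for j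
      using cube_finite(2)[OF fg(1), of "j * r"] unfolding b_def
      by (metis Suc_eq_plus1 of_nat_Suc of_nat_le_iff of_nat_mult of_nat_power add.commute)
  qed (rule that)
  define E where "E = cube S (j * r)"
  define E' where "E' = cube S (Suc j * r)"
  have fin: "finite E" "finite E'" using cube_finite(1)[OF fg(1)] by (auto simp: E_def E'_def)
  have inj: "inj_on ((+) p) X" for p :: 'p and X using cancel by (auto intro: inj_onI)
  have sub: "(+) p ` E \<subseteq> E'" if "p \<in> F" for p
    using that r cube_add[of p S r _ "j * r"] by (auto simp: E_def E'_def)
  have "(1 - \<epsilon>) * real (card E) \<le> real (card {(a, b) \<in> E \<times> E. p + b = q + a}) \<and>
     card {(a, b) \<in> E \<times> E. p + b = q + a} \<le> card E" if pq: "p \<in> F" "q \<in> F" for p q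
  proof -
    let ?I = "{(a, b) \<in> E \<times> E. p + b = q + a}"
    have inj2: "inj_on (\<lambda>(a, b). p + b) ?I" using cancel by (auto intro!: inj_onI)
    have img: "(\<lambda>(a, b). p + b) ` ?I = ((+) p ` E) \<inter> ((+) q ` E)" by force
    let ?P = "(+) p ` E" and ?Q = "(+) q ` E"
    have I: "card ?I = card (?P \<inter> ?Q)" using card_image[OF inj2] img by simp
    have P: "card ?P = card E" "card ?Q = card E" using card_image[OF inj] by blast+
    have "card (?P \<inter> ?Q) \<le> card ?P" using fin by (intro card_mono) auto
    then have up: "card ?I \<le> card E" using I P by simp
    have "card ?P + card ?Q = card (?P \<union> ?Q) + card (?P \<inter> ?Q)" using fin by (intro card_Un_Int) auto
    moreover have "card (?P \<union> ?Q) \<le> card E'"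
      using sub[OF pq(1)] sub[OF pq(2)] fin by (intro card_mono) auto
    ultimately have "card E + card E \<le> card E' + card ?I" using I P by simp
    then have "real (card E) + real (card E) \<le> real (card E') + real (card ?I)" by (simp flip: of_nat_add)
    moreover have "real (card E') \<le> (1 + \<epsilon>) * real (card E)" using j by (simp add: b_def E_def E'_def)
    ultimately have "(1 - \<epsilon>) * real (card E) \<le> real (card ?I)" by (simp add: distrib_right left_diff_distrib)
    with up show ?thesis by blast
  qed
  then show ?thesis using fin(1) ne[of "j * r"] by (intro exI[of _ E] conjI ballI) (simp_all add: E_def)
qed

section \<open>Fejer means along the gauge action\<close>

definition weighted :: "('k \<Rightarrow> complex) \<Rightarrow> (complex \<times> 'k) list \<Rightarrow> (complex \<times> 'k) list" where
  "weighted f = map (\<lambda>x. (f (snd x) * fst x, snd x))"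

lemma supp_weighted [simp]: "supp (weighted f l) = supp l"
  by (simp add: weighted_def image_image)

lemma sum_list_sum_swap:
  fixes G :: "'i \<Rightarrow> 'z \<Rightarrow> 'a::comm_monoid_add"
  shows "sum_list (map (\<lambda>z. \<Sum>i\<in>I. G i z) zs) = (\<Sum>i\<in>I. sum_list (map (G i) zs))"
  by (induction zs) (simp_all add: sum.distrib)

context cstar_algebra begin

lemma lincomb_weighted_in:
  "(\<And>k. k \<in> supp l \<Longrightarrow> e k \<in> carrier B) \<Longrightarrow> lincomb B e (weighted f l) \<in> carrier B"
  by (intro lincomb_in) simp

lemma lincomb_weighted_add:
  assumes "\<And>k. k \<in> supp l \<Longrightarrow> e k \<in> carrier B"
  shows "lincomb B e (weighted (\<lambda>k. f k + g k) l) = lincomb B e (weighted f l) \<oplus> lincomb B e (weighted g l)"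
  using assms
proof (induction l)
  case (Cons x l)
  have "lincomb B e (weighted f l) \<in> carrier B" "lincomb B e (weighted g l) \<in> carrier B"
    using Cons.prems by (intro lincomb_weighted_in; simp)+
  moreover have "e (snd x) \<in> carrier B" using Cons.prems by simp
  moreover have "lincomb B e (weighted (\<lambda>k. f k + g k) l) = lincomb B e (weighted f l) \<oplus> lincomb B e (weighted g l)" using Cons by simp
  ultimately show ?case by (simp add: weighted_def ring_distribs scale_add_left M.a_ac)
qed (simp add: weighted_def)

lemma lincomb_weighted_scale:
  assumes "\<And>k. k \<in> supp l \<Longrightarrow> e k \<in> carrier B"
  shows "lincomb B e (weighted (\<lambda>k. c * f k) l) = c \<odot> lincomb B e (weighted f l)"
proof -
  have "weighted (\<lambda>k. c * f k) l = map (\<lambda>x. (c * fst x, snd x)) (weighted f l)" by (simp add: weighted_def mult.assoc)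
  moreover have "\<And>k. k \<in> supp (weighted f l) \<Longrightarrow> e k \<in> carrier B" using assms by simp
  ultimately show ?thesis using lincomb_scale[of "weighted f l" e c] by simp
qed

lemma nrm_lincomb_weighted_sum_le:
  assumes "\<And>k. k \<in> supp l \<Longrightarrow> e k \<in> carrier B"
  shows "nrm B (lincomb B e (weighted (\<lambda>k. sum_list (map (\<lambda>z. G z k) zs)) l)) \<le>
    sum_list (map (\<lambda>z. nrm B (lincomb B e (weighted (G z) l))) zs)"
proof (induction zs)
  case Nil
  have c: "lincomb B e (weighted (\<lambda>k. 0) l) \<in> carrier B" using assms by (intro lincomb_in) simp
  have "lincomb B e (weighted (\<lambda>k. 0) l) = 0 \<odot> lincomb B e (weighted (\<lambda>k. 0) l)"
    using lincomb_weighted_scale[where c = 0 and f = "\<lambda>_. 0" and l = l and e = e, OF assms] by simp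
  then have "lincomb B e (weighted (\<lambda>k. 0) l) = \<zero>" unfolding scale_zero_left[OF c] .
  then show ?case by simp
next
  case (Cons z zs)
  have "lincomb B e (weighted (\<lambda>k. sum_list (map (\<lambda>z. G z k) (z # zs))) l) =
      lincomb B e (weighted (G z) l) \<oplus> lincomb B e (weighted (\<lambda>k. sum_list (map (\<lambda>z. G z k) zs)) l)"
    using lincomb_weighted_add[where f = "G z", OF assms] by simp
  moreover have "lincomb B e (weighted (G z) l) \<in> carrier B" "lincomb B e (weighted (\<lambda>k. sum_list (map (\<lambda>z. G z k) zs)) l) \<in> carrier B"
    by (rule lincomb_weighted_in, rule assms, assumption)+
  note nrm_triangle[OF this]
  ultimately show ?case using Cons by simp
qed

lemma nrm_lincomb_weighted_le:
  assumes e: "\<And>k. k \<in> supp l \<Longrightarrow> e k \<in> carrier B" "\<And>k. k \<in> supp l \<Longrightarrow> nrm B (e k) \<le> 1"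
    and f: "\<And>k. k \<in> supp l \<Longrightarrow> cmod (f k) \<le> d"
  shows "nrm B (lincomb B e (weighted f l)) \<le> d * sum_list (map (\<lambda>x. cmod (fst x)) l)"
proof -
  have "nrm B (lincomb B e (weighted f l)) \<le> sum_list (map (\<lambda>x. cmod (fst x)) (weighted f l))"
    using e by (intro nrm_lincomb_le) simp_all
  also have "\<dots> \<le> d * sum_list (map (\<lambda>x. cmod (fst x)) l)"
    using f
  proof (induction l)
    case (Cons x l)
    have "cmod (f (snd x)) * cmod (fst x) \<le> d * cmod (fst x)" using Cons.prems by (intro mult_right_mono) auto
    then show ?case using Cons by (simp add: weighted_def norm_mult ring_distribs)
  qed (simp add: weighted_def)
  finally show ?thesis .
qed

lemma lincomb_weighted_of_bool:
  assumes "\<And>k. k \<in> supp l \<Longrightarrow> e k \<in> carrier B"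
  shows "lincomb B e (weighted (\<lambda>k. of_bool (Q k)) l) = lincomb B e (filter (\<lambda>x. Q (snd x)) l)"
  using assms
proof (induction l)
  case (Cons x l)
  have "lincomb B e (filter (\<lambda>x. Q (snd x)) l) \<in> carrier B" using Cons.prems by (intro lincomb_in) auto
  then show ?case using Cons by (simp add: weighted_def)
qed (simp add: weighted_def)

end

context ck begin

lemma T_supp: "supp l \<subseteq> span_pairs \<Longrightarrow> k \<in> supp l \<Longrightarrow> T k \<in> carrier B"
  "supp l \<subseteq> span_pairs \<Longrightarrow> k \<in> supp l \<Longrightarrow> nrm B (T k) \<le> 1"
  using span_pairsD nrm_T_le T_in by blast+

lemma gauge_family:
  assumes z: "character z"
  shows "ck_family \<Gamma> B (\<lambda>\<xi>. z (deg \<Gamma> \<xi>) \<odot> t \<xi>)"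
proof -
  have zz: "cnj (z p) * z p = 1" "z p * cnj (z p) = 1" for p using character_cnj[OF z] by (simp_all add: mult.commute)
  have v: "z (deg \<Gamma> v) \<odot> t v = t v" if "v \<in> vertices \<Gamma>" for v
    using vertexD[OF that] character_0[OF z] by simp
  show ?thesis
    unfolding ck_family_def
  proof (intro conjI ballI allI impI)
    fix w p assume w: "w \<in> vertices \<Gamma>"
    have pm: "\<xi> \<in> mor \<Gamma>" if "\<xi> \<in> paths_into \<Gamma> w p" for \<xi> using that by (auto simp: paths_into_def)
    have "t w = (\<Oplus>\<xi>\<in>paths_into \<Gamma> w p. t \<xi> \<otimes> adj B (t \<xi>))" by (rule t_sum[OF w])
    also have "\<dots> = (\<Oplus>\<xi>\<in>paths_into \<Gamma> w p. (z (deg \<Gamma> \<xi>) \<odot> t \<xi>) \<otimes> adj B (z (deg \<Gamma> \<xi>) \<odot> t \<xi>))"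
      using pm by (intro M.finsum_cong') (auto simp: adj_smult smult_mult_left smult_mult_right zz)
    finally show "z (deg \<Gamma> w) \<odot> t w = (\<Oplus>\<xi>\<in>paths_into \<Gamma> w p. (z (deg \<Gamma> \<xi>) \<odot> t \<xi>) \<otimes> adj B (z (deg \<Gamma> \<xi>) \<odot> t \<xi>))"
      using v[OF w] by simp
  next
    fix \<xi> \<eta> assume "\<xi> \<in> mor \<Gamma>" "\<eta> \<in> mor \<Gamma>" "src \<Gamma> \<xi> = rng \<Gamma> \<eta>"
    then show "(z (deg \<Gamma> \<xi>) \<odot> t \<xi>) \<otimes> (z (deg \<Gamma> \<eta>) \<odot> t \<eta>) = z (deg \<Gamma> (comp \<Gamma> \<xi> \<eta>)) \<odot> t (comp \<Gamma> \<xi> \<eta>)"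
      using z by (simp add: smult_mult_left smult_mult_right t_comp deg_comp character_def mult.commute)
  next
    fix \<xi> assume \<xi>: "\<xi> \<in> mor \<Gamma>"
    then show "adj B (z (deg \<Gamma> \<xi>) \<odot> t \<xi>) \<otimes> (z (deg \<Gamma> \<xi>) \<odot> t \<xi>) = z (deg \<Gamma> (src \<Gamma> \<xi>)) \<odot> t (src \<Gamma> \<xi>)"
      using v[OF src_vertex[OF \<xi>]] by (simp add: adj_smult smult_mult_left smult_mult_right zz t_adj_self src_closed)
  qed (simp_all add: v t_projection t_orth)
qed

text \<open>
  The rotated family \<open>z(d(\<xi>)) t\<^sub>\<xi>\<close> is again a Cuntz-Krieger
  family, so by universality it is induced by an endomorphism, which is contractive.
\<close>

lemma gauge_bound:
  assumes U: "universal_ck_algebra \<Gamma> B t" and z: "character z" and l: "supp l \<subseteq> span_pairs"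
  shows "nrm B (lincomb B T (weighted (\<lambda>k. z (deg \<Gamma> (fst k)) * cnj (z (deg \<Gamma> (snd k)))) l)) \<le> nrm B (lincomb B T l)"
proof -
  obtain \<gamma> where \<gamma>: "induced_hom \<Gamma> B t B (\<lambda>\<xi>. z (deg \<Gamma> \<xi>) \<odot> t \<xi>) \<gamma>"
    using universal_hom_exists[OF p_graph_axioms row_finite U cstar_algebra_axioms gauge_family[OF z]] by blast
  then have hom: "\<gamma> \<in> cstar_hom B B" and \<gamma>t: "\<And>\<xi>. \<xi> \<in> mor \<Gamma> \<Longrightarrow> \<gamma> (t \<xi>) = z (deg \<Gamma> \<xi>) \<odot> t \<xi>"
    by (auto simp: induced_hom_def)
  have "\<gamma> (lincomb B T l) = lincomb B (\<lambda>k. \<gamma> (T k)) l"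
    using T_supp(1)[OF l] by (intro cstar_hom_lincomb[OF cstar_algebra_axioms cstar_algebra_axioms hom])
  also have "\<dots> = lincomb B T (weighted (\<lambda>k. z (deg \<Gamma> (fst k)) * cnj (z (deg \<Gamma> (snd k)))) l)"
    using l
  proof (induction l)
    case (Cons x l)
    have m: "fst (snd x) \<in> mor \<Gamma>" "snd (snd x) \<in> mor \<Gamma>" using Cons.prems by simp_all
    have "\<gamma> (T (snd x)) = (z (deg \<Gamma> (fst (snd x))) * cnj (z (deg \<Gamma> (snd (snd x))))) \<odot> T (snd x)"
      using m by (simp add: T_def cstar_homD[OF hom] \<gamma>t adj_smult smult_mult_left smult_mult_right mult.commute)
    then show ?case using Cons m by (simp add: weighted_def mult.commute)
  qed (simp add: weighted_def)
  finally show ?thesis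
    using cstar_hom_contractive[OF cstar_algebra_axioms cstar_algebra_axioms hom, of "lincomb B T l"] l by simp
qed

text \<open>
  The proportion of elements of \<open>E\<close> that remain in \<open>E\<close> after
  translation by the degree difference of the pair of paths, which for intervals of integers
  is the classical Fejer kernel.
\<close>

definition fejer :: "'p set \<Rightarrow> 'g \<times> 'g \<Rightarrow> complex" where
  "fejer E k = of_nat (card {x \<in> E \<times> E. deg \<Gamma> (fst k) + snd x = deg \<Gamma> (snd k) + fst x}) / of_nat (card E)"

lemma fejer_sum:
  assumes "finite E"
  shows "fejer E k = (\<Sum>x\<in>E \<times> E. of_bool (deg \<Gamma> (fst k) + snd x = deg \<Gamma> (snd k) + fst x)) / of_nat (card E)"
proof -
  have "{x \<in> E \<times> E. deg \<Gamma> (fst k) + snd x = deg \<Gamma> (snd k) + fst x} =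
    (E \<times> E) \<inter> {x. deg \<Gamma> (fst k) + snd x = deg \<Gamma> (snd k) + fst x}" by blast
  then show ?thesis using assms by (simp add: fejer_def)
qed

text \<open>
  The kernel is the integral, over the characters \<open>z\<close>, of the gauge
  automorphism at \<open>z\<close> against the probability density \<open>|\<Sum>\<^sub>b
  z(b)|\<^sup>2/|E|\<close>. The integral is replaced by a mean over finitely many
  characters that reproduces the delta function up to \<open>\<delta>\<close> at the
  finitely many pairs of degrees involved; the weights \<open>w z/(N n)\<close> are
  nonnegative and have total mass at most \<open>1 + n\<delta>\<close>.
\<close>

lemma fejer_contractive:
  assumes U: "universal_ck_algebra \<Gamma> B t" and sep: "\<And>p q :: 'p. p \<noteq> q \<Longrightarrow> \<exists>z. character z \<and> z p \<noteq> z q"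
    and E: "finite E" "E \<noteq> {}" and l: "supp l \<subseteq> span_pairs"
  shows "nrm B (lincomb B T (weighted (fejer E) l)) \<le> nrm B (lincomb B T l)"
proof -
  define n where "n = real (card E)"
  define X where "X = nrm B (lincomb B T l)"
  define C where "C = sum_list (map (\<lambda>x. cmod (fst x)) l)"
  have n: "n > 0" using E by (simp add: n_def card_gt_0_iff)
  have X: "X \<ge> 0" using l by (auto simp: X_def)
  have C: "C \<ge> 0" unfolding C_def by (intro sum_list_nonneg) auto
  note Tl = T_supp[OF l]
  have bound: "nrm B (lincomb B T (weighted (fejer E) l)) \<le> (1 + n * \<delta>) * X + n * \<delta> * C" if \<delta>: "\<delta> > 0" for \<delta>
  proof -
    \<comment> \<open>The pairs for the kernel itself, and those for the total mass.\<close>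
    define F where "F = (\<lambda>(x, k). (deg \<Gamma> (fst k) + snd x, deg \<Gamma> (snd k) + fst x)) ` ((E \<times> E) \<times> supp l) \<union> prod.swap ` (E \<times> E)"
    have "finite F" using E by (simp add: F_def)
    from mean_approximates_delta[OF sep this \<delta>] obtain zs where
      zs: "zs \<noteq> []" "\<forall>z\<in>set zs. character z" "\<forall>(p, q)\<in>F. cmod (mean zs p q - of_bool (p = q)) \<le> \<delta>" by blast
    have approx: "cmod (mean zs p q - of_bool (p = q)) \<le> \<delta>" if "(p, q) \<in> F" for p q using zs(3) that by blast
    define N where "N = real (length zs)"
    have N: "N > 0" using zs by (simp add: N_def)
    define w where "w z = (cmod (\<Sum>b\<in>E. z b))\<^sup>2" for z :: "'p \<Rightarrow> complex"
    have w: "complex_of_real (w z) = (\<Sum>x\<in>E \<times> E. cnj (z (fst x)) * z (snd x))" for z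
    proof -
      have "(\<Sum>x\<in>E \<times> E. cnj (z (fst x)) * z (snd x)) = (\<Sum>a\<in>E. \<Sum>b\<in>E. cnj (z a) * z b)"
        by (simp add: sum.cartesian_product case_prod_beta)
      also have "\<dots> = cnj (\<Sum>b\<in>E. z b) * (\<Sum>b\<in>E. z b)" by (simp add: sum_product)
      also have "\<dots> = of_real (w z)" unfolding w_def complex_norm_square by (rule mult.commute)
      finally show ?thesis by simp
    qed
    \<comment> \<open>The approximate kernel obtained from the finite mean.\<close>
    define \<psi> where "\<psi> k = sum_list (map (\<lambda>z. of_real (w z / (N * n)) * (z (deg \<Gamma> (fst k)) * cnj (z (deg \<Gamma> (snd k))))) zs)" for k
    have \<psi>: "\<psi> k = (\<Sum>x\<in>E \<times> E. mean zs (deg \<Gamma> (fst k) + snd x) (deg \<Gamma> (snd k) + fst x)) / of_real n" for k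
    proof -
      have "of_real (w z / (N * n)) * (z (deg \<Gamma> (fst k)) * cnj (z (deg \<Gamma> (snd k)))) =
        (\<Sum>x\<in>E \<times> E. z (deg \<Gamma> (fst k) + snd x) * cnj (z (deg \<Gamma> (snd k) + fst x)) / (of_real N * of_real n))" if "z \<in> set zs" for z
      proof -
        have zc: "character z" using zs(2) that by blast
        have "of_real (w z / (N * n)) * (z (deg \<Gamma> (fst k)) * cnj (z (deg \<Gamma> (snd k)))) =
          (\<Sum>x\<in>E \<times> E. cnj (z (fst x)) * z (snd x) / of_real (N * n) * (z (deg \<Gamma> (fst k)) * cnj (z (deg \<Gamma> (snd k)))))"
          by (simp only: of_real_divide w sum_divide_distrib sum_distrib_right)
        also have "\<dots> = (\<Sum>x\<in>E \<times> E. z (deg \<Gamma> (fst k) + snd x) * cnj (z (deg \<Gamma> (snd k) + fst x)) / (of_real N * of_real n))"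
          using zc by (intro sum.cong refl) (simp add: character_def mult_ac)
        finally show ?thesis .
      qed
      then have "\<psi> k = sum_list (map (\<lambda>z. \<Sum>x\<in>E \<times> E. z (deg \<Gamma> (fst k) + snd x) * cnj (z (deg \<Gamma> (snd k) + fst x)) / (of_real N * of_real n)) zs)"
        unfolding \<psi>_def by (intro arg_cong[where f = sum_list] map_cong refl)
      also have "\<dots> = (\<Sum>x\<in>E \<times> E. sum_list (map (\<lambda>z. z (deg \<Gamma> (fst k) + snd x) * cnj (z (deg \<Gamma> (snd k) + fst x)) * (1 / (of_real N * of_real n))) zs))"
        unfolding sum_list_sum_swap by simp
      also have "\<dots> = (\<Sum>x\<in>E \<times> E. mean zs (deg \<Gamma> (fst k) + snd x) (deg \<Gamma> (snd k) + fst x) / of_real n)"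
        unfolding sum_list_mult_const mean_def N_def by (simp add: field_simps)
      finally show ?thesis by (simp add: sum_divide_distrib)
    qed
    have "(\<Sum>z\<leftarrow>zs. w z / (N * n)) \<le> 1 + n * \<delta>"
    proof -
      have "complex_of_real (\<Sum>z\<leftarrow>zs. w z / (N * n)) = sum_list (map (\<lambda>z. of_real (w z / (N * n))) zs)"
        by (induction zs) simp_all
      also have "\<dots> = sum_list (map (\<lambda>z. \<Sum>x\<in>E \<times> E. z (snd x) * cnj (z (fst x)) * (1 / (of_real N * of_real n))) zs)"
        unfolding of_real_divide w by (simp add: sum_divide_distrib mult_ac)
      also have "\<dots> = (\<Sum>x\<in>E \<times> E. mean zs (snd x) (fst x) / of_real n)"
        unfolding sum_list_sum_swap sum_list_mult_const mean_def N_def by (simp add: field_simps)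
      finally have eq: "complex_of_real (\<Sum>z\<leftarrow>zs. w z / (N * n)) = (\<Sum>x\<in>E \<times> E. mean zs (snd x) (fst x) / of_real n)" .
      have "cmod (mean zs (snd x) (fst x) / of_real n) \<le> (of_bool (snd x = fst x) + \<delta>) / n" if x: "x \<in> E \<times> E" for x
      proof -
        have "(snd x, fst x) \<in> F" using x unfolding F_def by force
        then have "cmod (mean zs (snd x) (fst x) - of_bool (snd x = fst x)) \<le> \<delta>" by (rule approx)
        then have "cmod (mean zs (snd x) (fst x)) \<le> of_bool (snd x = fst x) + \<delta>"
          using norm_triangle_sub[of "mean zs (snd x) (fst x)" "of_bool (snd x = fst x)"] by auto
        then show ?thesis using n by (simp add: norm_divide divide_right_mono)
      qed
      then have "cmod (\<Sum>x\<in>E \<times> E. mean zs (snd x) (fst x) / of_real n) \<le> (\<Sum>x\<in>E \<times> E. (of_bool (snd x = fst x) + \<delta>) / n)"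
        by (rule sum_norm_le)
      also have "\<dots> = (\<Sum>a\<in>E. \<Sum>b\<in>E. (of_bool (b = a) + \<delta>) / n)"
        by (simp add: sum.cartesian_product case_prod_beta)
      also have "\<dots> = (\<Sum>a\<in>E. (1 + n * \<delta>) / n)"
      proof (rule sum.cong[OF refl])
        fix a assume a: "a \<in> E"
        have "(\<Sum>b\<in>E. (of_bool (b = a) :: real)) = 1" using E a by (simp add: of_bool_def)
        then show "(\<Sum>b\<in>E. (of_bool (b = a) + \<delta>) / n) = (1 + n * \<delta>) / n"
          by (simp add: sum.distrib n_def flip: sum_divide_distrib)
      qed
      also have "\<dots> = 1 + n * \<delta>" using n by (simp add: n_def)
      finally have "cmod (complex_of_real (\<Sum>z\<leftarrow>zs. w z / (N * n))) \<le> 1 + n * \<delta>" unfolding eq .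
      then show ?thesis by simp
    qed
    then have wX: "(\<Sum>z\<leftarrow>zs. w z / (N * n)) * X \<le> (1 + n * \<delta>) * X" using X by (rule mult_right_mono)
    have "nrm B (lincomb B T (weighted \<psi> l)) \<le> sum_list (map (\<lambda>z. nrm B (lincomb B T (weighted (\<lambda>k. of_real (w z / (N * n)) * (z (deg \<Gamma> (fst k)) * cnj (z (deg \<Gamma> (snd k))))) l))) zs)"
      unfolding \<psi>_def using Tl(1) by (rule nrm_lincomb_weighted_sum_le)
    also have "\<dots> \<le> (\<Sum>z\<leftarrow>zs. w z / (N * n) * X)"
    proof (rule sum_list_mono)
      fix z assume z: "z \<in> set zs"
      have c: "lincomb B T (weighted (\<lambda>k. z (deg \<Gamma> (fst k)) * cnj (z (deg \<Gamma> (snd k)))) l) \<in> carrier B" using l by (intro span_in) simp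
      have "nrm B (lincomb B T (weighted (\<lambda>k. of_real (w z / (N * n)) * (z (deg \<Gamma> (fst k)) * cnj (z (deg \<Gamma> (snd k))))) l)) =
        w z / (N * n) * nrm B (lincomb B T (weighted (\<lambda>k. z (deg \<Gamma> (fst k)) * cnj (z (deg \<Gamma> (snd k)))) l))"
      proof -
        have eq: "lincomb B T (weighted (\<lambda>k. of_real (w z / (N * n)) * (z (deg \<Gamma> (fst k)) * cnj (z (deg \<Gamma> (snd k))))) l) =
          of_real (w z / (N * n)) \<odot> lincomb B T (weighted (\<lambda>k. z (deg \<Gamma> (fst k)) * cnj (z (deg \<Gamma> (snd k)))) l)"
          using Tl(1) by (rule lincomb_weighted_scale)
        have "\<bar>w z / (N * n)\<bar> = w z / (N * n)" using N n by (simp add: w_def)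
        then show ?thesis unfolding eq nrm_smult[OF c] norm_of_real by simp
      qed
      also have "\<dots> \<le> w z / (N * n) * X"
        unfolding X_def using zs(2) z N n by (intro mult_left_mono gauge_bound[OF U _ l]) (auto simp: w_def)
      finally show "nrm B (lincomb B T (weighted (\<lambda>k. of_real (w z / (N * n)) * (z (deg \<Gamma> (fst k)) * cnj (z (deg \<Gamma> (snd k))))) l)) \<le> w z / (N * n) * X" .
    qed
    also have "\<dots> = (\<Sum>z\<leftarrow>zs. w z / (N * n)) * X" by (rule sum_list_mult_const)
    finally have 1: "nrm B (lincomb B T (weighted \<psi> l)) \<le> (1 + n * \<delta>) * X" using wX by linarith
    have "cmod (fejer E k - \<psi> k) \<le> n * \<delta>" if k: "k \<in> supp l" for k
    proof -
      define D where "D = (\<Sum>x\<in>E \<times> E. of_bool (deg \<Gamma> (fst k) + snd x = deg \<Gamma> (snd k) + fst x) -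
          mean zs (deg \<Gamma> (fst k) + snd x) (deg \<Gamma> (snd k) + fst x))"
      have eq: "fejer E k - \<psi> k = D / of_real n"
        unfolding D_def \<psi> fejer_sum[OF E(1)] sum_subtractf n_def by (simp add: diff_divide_distrib)
      have "cmod D \<le> (\<Sum>x\<in>E \<times> E. \<delta>)"
        unfolding D_def
      proof (rule sum_norm_le)
        fix x assume x: "x \<in> E \<times> E"
        have "(deg \<Gamma> (fst k) + snd x, deg \<Gamma> (snd k) + fst x) \<in> F" using x k unfolding F_def by force
        from approx[OF this] show "cmod (of_bool (deg \<Gamma> (fst k) + snd x = deg \<Gamma> (snd k) + fst x) -
          mean zs (deg \<Gamma> (fst k) + snd x) (deg \<Gamma> (snd k) + fst x)) \<le> \<delta>" by (simp only: norm_minus_commute)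
      qed
      also have "\<dots> = n * n * \<delta>" by (simp add: n_def card_cartesian_product)
      finally have "cmod D / n \<le> n * \<delta>" using n by (simp add: divide_le_eq mult_ac)
      then show ?thesis unfolding eq norm_divide norm_of_real using n by simp
    qed
    then have 2: "nrm B (lincomb B T (weighted (\<lambda>k. fejer E k - \<psi> k) l)) \<le> n * \<delta> * C"
      unfolding C_def using Tl by (intro nrm_lincomb_weighted_le)
    have "lincomb B T (weighted (fejer E) l) = lincomb B T (weighted (\<lambda>k. \<psi> k + (fejer E k - \<psi> k)) l)" by simp
    also have "\<dots> = lincomb B T (weighted \<psi> l) \<oplus> lincomb B T (weighted (\<lambda>k. fejer E k - \<psi> k) l)"
      using Tl(1) by (rule lincomb_weighted_add)
    finally show ?thesis
      using nrm_triangle[of "lincomb B T (weighted \<psi> l)" "lincomb B T (weighted (\<lambda>k. fejer E k - \<psi> k) l)"] 1 2 l by simp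
  qed
  show ?thesis
  proof (rule field_le_epsilon)
    fix e :: real assume e: "e > 0"
    define \<delta> where "\<delta> = e / (n * (X + C) + 1)"
    have p: "n * (X + C) + 1 > 0" using n X C by (simp add: add_nonneg_pos)
    have \<delta>: "\<delta> > 0" using e p by (simp add: \<delta>_def)
    have "n * \<delta> * (X + C) \<le> e"
      using e p n X C by (simp add: \<delta>_def field_simps)
    then show "nrm B (lincomb B T (weighted (fejer E) l)) \<le> nrm B (lincomb B T l) + e"
      using bound[OF \<delta>] by (simp add: X_def algebra_simps)
  qed
qed

end

text \<open>
  Two approximations of \<open>a\<close> are needed: the first, \<open>x\<^sub>1\<close>,
  fixes the Folner set \<open>E\<close>, for which the Fejer mean \<open>y\<^sub>1\<close>
  is close to \<open>x\<^sub>1\<close>; the second, \<open>x\<^sub>2\<close>, is chosen so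
  close to \<open>a\<close>, depending on the size of \<open>E\<close>, that its Fejer mean
  \<open>y\<^sub>2\<close>, a sum of at most \<open>|E|\<^sup>2\<close> components weighted
  by \<open>1/|E|\<close>, is small. Contractivity of the mean compares
  \<open>y\<^sub>1\<close> with \<open>y\<^sub>2\<close>.
\<close>

lemma (in row_finite_p_graph) kernel_trivial:
  assumes A: "ck \<Gamma> A s" and B: "ck \<Gamma> B t" and ap: "aperiodic \<Gamma>" and U: "universal_ck_algebra \<Gamma> A s"
    and fg: "finite S" "\<And>p :: 'p. \<exists>ps. set ps \<subseteq> S \<and> p = sum_list ps"
    and nz: "\<And>v. v \<in> vertices \<Gamma> \<Longrightarrow> t v \<noteq> \<zero>\<^bsub>B\<^esub>"
    and \<pi>: "induced_hom \<Gamma> A s B t \<pi>" and a: "a \<in> carrier A" and \<pi>a: "\<pi> a = \<zero>\<^bsub>B\<^esub>"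
  shows "a = \<zero>\<^bsub>A\<^esub>"
proof -
  interpret A: ck \<Gamma> A s by fact
  interpret B: ck \<Gamma> B t by fact
  have hom: "\<pi> \<in> cstar_hom A B" and \<pi>s: "\<And>\<xi>. \<xi> \<in> mor \<Gamma> \<Longrightarrow> \<pi> (s \<xi>) = t \<xi>" using \<pi> by (auto simp: induced_hom_def)
  have gen: "cstar_generated_by A (s ` mor \<Gamma>)" using U by (simp add: universal_ck_algebra_def)
  have sep: "\<exists>z. character z \<and> z p \<noteq> z q" if "p \<noteq> q" for p q :: 'p
    using cancel fg that by (rule characters_separate)
  have "nrm A a \<le> 0 + e" if e: "e > 0" for e :: real
  proof -
    \<comment> \<open>The errors are \<open>\<epsilon>\<close> for each of \<open>a -
      x\<^sub>1\<close>, \<open>x\<^sub>1 - y\<^sub>1\<close> and \<open>y\<^sub>2\<close>,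
      and \<open>2\<epsilon>\<close> for \<open>y\<^sub>1 - y\<^sub>2\<close>.\<close>
    define \<epsilon> where "\<epsilon> = e / 5"
    have \<epsilon>: "\<epsilon> > 0" using e by (simp add: \<epsilon>_def)
    obtain l1 where l1: "supp l1 \<subseteq> span_pairs" "nrm A (lincomb A A.T l1 \<ominus>\<^bsub>A\<^esub> a) < \<epsilon>" using A.span_dense[OF gen a \<epsilon>] by blast
    define C where "C = sum_list (map (\<lambda>x. cmod (fst x)) l1)"
    have C: "C \<ge> 0" unfolding C_def by (intro sum_list_nonneg) auto
    define \<epsilon>' where "\<epsilon>' = \<epsilon> / (C + 1)"
    have \<epsilon>': "\<epsilon>' > 0" "\<epsilon>' * C \<le> \<epsilon>" using \<epsilon> C by (auto simp: \<epsilon>'_def field_simps)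
    define F where "F = deg \<Gamma> ` fst ` supp l1 \<union> deg \<Gamma> ` snd ` supp l1"
    have F: "finite F" by (simp add: F_def)
    have "\<exists>E. finite E \<and> E \<noteq> {} \<and> (\<forall>p\<in>F. \<forall>q\<in>F.
       (1 - \<epsilon>') * real (card E) \<le> real (card {(a, b) \<in> E \<times> E. p + b = q + a}) \<and>
       card {(a, b) \<in> E \<times> E. p + b = q + a} \<le> card E)"
      using cancel fg F \<epsilon>'(1) by (rule folner)
    then obtain E where E: "finite E" "E \<noteq> {}" and EF: "\<forall>p\<in>F. \<forall>q\<in>F.
       (1 - \<epsilon>') * real (card E) \<le> real (card {(a, b) \<in> E \<times> E. p + b = q + a}) \<and>
       card {(a, b) \<in> E \<times> E. p + b = q + a} \<le> card E" by (elim exE conjE)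
    define n where "n = real (card E)"
    have n: "n \<ge> 1" using E by (simp add: n_def Suc_le_eq card_gt_0_iff)
    have near: "cmod (A.fejer E k - 1) \<le> \<epsilon>'" if k: "k \<in> supp l1" for k
    proof -
      define m where "m = real (card {x \<in> E \<times> E. deg \<Gamma> (fst k) + snd x = deg \<Gamma> (snd k) + fst x})"
      have "{x \<in> E \<times> E. deg \<Gamma> (fst k) + snd x = deg \<Gamma> (snd k) + fst x} = {(a, b) \<in> E \<times> E. deg \<Gamma> (fst k) + b = deg \<Gamma> (snd k) + a}" by auto
      moreover have "deg \<Gamma> (fst k) \<in> F" "deg \<Gamma> (snd k) \<in> F" using k unfolding F_def by blast+
      ultimately have m: "(1 - \<epsilon>') * n \<le> m" "m \<le> n" using EF by (simp_all add: m_def n_def)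
      have "A.fejer E k - 1 = of_real ((m - n) / n)" using n by (simp add: A.fejer_def m_def n_def diff_divide_distrib)
      then have "cmod (A.fejer E k - 1) = \<bar>(m - n) / n\<bar>" by (simp only: norm_of_real)
      also have "\<dots> \<le> \<epsilon>'"
      proof -
        have "\<bar>m - n\<bar> \<le> \<epsilon>' * n" using m by (simp add: left_diff_distrib)
        then show ?thesis using n by (simp add: divide_le_eq)
      qed
      finally show ?thesis .
    qed
    define \<epsilon>2 where "\<epsilon>2 = \<epsilon> / n"
    have \<epsilon>2: "\<epsilon>2 > 0" "n * \<epsilon>2 = \<epsilon>" "\<epsilon>2 \<le> \<epsilon>" using \<epsilon> n by (auto simp: \<epsilon>2_def divide_le_eq)
    obtain l2 where l2: "supp l2 \<subseteq> span_pairs" "nrm A (lincomb A A.T l2 \<ominus>\<^bsub>A\<^esub> a) < \<epsilon>2" using A.span_dense[OF gen a \<epsilon>2(1)] by blast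
    define x1 where "x1 = lincomb A A.T l1"
    define x2 where "x2 = lincomb A A.T l2"
    define y1 where "y1 = lincomb A A.T (weighted (A.fejer E) l1)"
    define y2 where "y2 = lincomb A A.T (weighted (A.fejer E) l2)"
    have c: "x1 \<in> carrier A" "x2 \<in> carrier A" "y1 \<in> carrier A" "y2 \<in> carrier A"
      using l1(1) l2(1) A.span_in by (simp_all add: x1_def x2_def y1_def y2_def)
    \<comment> \<open>The kernel is nearly 1 on the support of the first approximation.\<close>
    have "nrm A (lincomb A A.T (weighted (\<lambda>k. A.fejer E k - 1) l1)) \<le> \<epsilon>' * C"
      unfolding C_def using A.T_supp[OF l1(1)] near by (intro A.nrm_lincomb_weighted_le)
    moreover have "y1 = x1 \<oplus>\<^bsub>A\<^esub> lincomb A A.T (weighted (\<lambda>k. A.fejer E k - 1) l1)"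
    proof -
      have "weighted (\<lambda>k. 1) l1 = l1" by (simp add: weighted_def)
      moreover have "lincomb A A.T (weighted (\<lambda>k. 1 + (A.fejer E k - 1)) l1) = lincomb A A.T (weighted (\<lambda>k. 1) l1) \<oplus>\<^bsub>A\<^esub> lincomb A A.T (weighted (\<lambda>k. A.fejer E k - 1) l1)"
        using A.T_supp(1)[OF l1(1)] by (rule A.lincomb_weighted_add)
      ultimately show ?thesis by (simp add: y1_def x1_def)
    qed
    moreover have "lincomb A A.T (weighted (\<lambda>k. A.fejer E k - 1) l1) \<in> carrier A" using l1(1) by (intro A.span_in) simp
    ultimately have d1: "nrm A (y1 \<ominus>\<^bsub>A\<^esub> x1) \<le> \<epsilon>"
      using c \<epsilon>'(2) A.add_minus_cancel_left[of x1 "lincomb A A.T (weighted (\<lambda>k. A.fejer E k - 1) l1)" "\<zero>\<^bsub>A\<^esub>"]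
      by (simp add: a_minus_def)
    \<comment> \<open>The difference of the approximations is small, hence so is its Fejer mean.\<close>
    define L where "L = l1 @ weighted (\<lambda>_. - 1) l2"
    have L: "supp L \<subseteq> span_pairs" using l1(1) l2(1) by (simp add: L_def image_Un)
    have ev_diff: "lincomb A A.T (weighted f L) = lincomb A A.T (weighted f l1) \<ominus>\<^bsub>A\<^esub> lincomb A A.T (weighted f l2)" for f
    proof -
      have "weighted f L = weighted f l1 @ weighted (\<lambda>k. (- 1) * f k) l2" by (simp add: L_def weighted_def mult.commute)
      moreover have "lincomb A A.T (weighted f l1 @ weighted (\<lambda>k. (- 1) * f k) l2) = lincomb A A.T (weighted f l1) \<oplus>\<^bsub>A\<^esub> lincomb A A.T (weighted (\<lambda>k. (- 1) * f k) l2)"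
        using A.T_supp(1)[OF l1(1)] A.T_supp(1)[OF l2(1)] by (intro A.lincomb_append) simp_all
      moreover have "lincomb A A.T (weighted (\<lambda>k. (- 1) * f k) l2) = (- 1) \<odot>\<^bsub>A\<^esub> lincomb A A.T (weighted f l2)"
        using A.T_supp(1)[OF l2(1)] by (rule A.lincomb_weighted_scale)
      moreover have "lincomb A A.T (weighted f l1) \<in> carrier A" "lincomb A A.T (weighted f l2) \<in> carrier A"
        using l1(1) l2(1) A.span_in by simp_all
      ultimately show ?thesis by (simp only: A.minus_eq_scale)
    qed
    have "nrm A (lincomb A A.T (weighted (A.fejer E) L)) \<le> nrm A (lincomb A A.T L)"
      using U sep E L by (rule A.fejer_contractive)
    moreover have "lincomb A A.T L = x1 \<ominus>\<^bsub>A\<^esub> x2" using ev_diff[of "\<lambda>_. 1"] by (simp add: weighted_def x1_def x2_def)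
    moreover have "nrm A (x1 \<ominus>\<^bsub>A\<^esub> x2) \<le> nrm A (x1 \<ominus>\<^bsub>A\<^esub> a) + nrm A (x2 \<ominus>\<^bsub>A\<^esub> a)"
      using A.nrm_triangle_minus[of x1 a x2] A.nrm_minus_commute[of a x2] c a by simp
    ultimately have d2: "nrm A (y1 \<ominus>\<^bsub>A\<^esub> y2) \<le> \<epsilon> + \<epsilon>"
      using l1(2) l2(2) \<epsilon>2(3) ev_diff[of "A.fejer E"] by (simp add: y1_def y2_def x1_def x2_def)
    \<comment> \<open>Each component of the second approximation is bounded by its image in \<open>B\<close>, where \<open>a\<close> vanishes.\<close>
    have bsmall: "nrm B (lincomb B B.T l2) \<le> \<epsilon>2"
    proof -
      have "\<pi> (x2 \<ominus>\<^bsub>A\<^esub> a) = \<pi> x2"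
        using c a \<pi>a by (simp add: A.minus_eq_scale cstar_homD[OF hom])
      moreover have "\<pi> x2 = lincomb B (\<lambda>k. \<pi> (A.T k)) l2"
        unfolding x2_def using A.T_supp(1)[OF l2(1)]
        by (intro cstar_hom_lincomb[OF A.cstar_algebra_axioms B.cstar_algebra_axioms hom])
      moreover have "lincomb B (\<lambda>k. \<pi> (A.T k)) l2 = lincomb B B.T l2"
      proof (rule B.lincomb_cong)
        fix k assume "k \<in> supp l2"
        from span_pairsD[OF l2(1) this] show "\<pi> (A.T k) = B.T k"
          by (simp add: A.T_def B.T_def cstar_homD[OF hom] \<pi>s)
      qed
      ultimately show ?thesis
        using cstar_hom_contractive[OF A.cstar_algebra_axioms B.cstar_algebra_axioms hom, of "x2 \<ominus>\<^bsub>A\<^esub> a"] c a l2(2)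
        by (simp add: x2_def)
    qed
    \<comment> \<open>The mean \<open>y\<^sub>2\<close> is split over the
      \<open>n\<^sup>2\<close> pairs in \<open>E \<times> E\<close>, each selecting one
      component.\<close>
    obtain xs where xs: "set xs = E \<times> E" "distinct xs" using finite_distinct_list[of "E \<times> E"] E by auto
    define G where "G x k = of_real (1 / n) * (of_bool (deg \<Gamma> (fst k) + snd x = deg \<Gamma> (snd k) + fst x) :: complex)" for x and k :: "'g \<times> 'g"
    have "A.fejer E = (\<lambda>k. sum_list (map (\<lambda>x. G x k) xs))"
    proof
      fix k
      have "sum_list (map (\<lambda>x. G x k) xs) = (\<Sum>x\<in>E \<times> E. G x k)"
        using sum_list_distinct_conv_sum_set[OF xs(2)] xs(1) by simp
      then show "A.fejer E k = sum_list (map (\<lambda>x. G x k) xs)"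
        unfolding A.fejer_sum[OF E(1)] G_def by (simp add: sum_divide_distrib n_def del: sum_of_bool_eq)
    qed
    then have "nrm A y2 \<le> sum_list (map (\<lambda>x. nrm A (lincomb A A.T (weighted (G x) l2))) xs)"
      unfolding y2_def using A.nrm_lincomb_weighted_sum_le[of l2 A.T G xs] A.T_supp(1)[OF l2(1)] by simp
    also have "\<dots> \<le> sum_list (map (\<lambda>x. \<epsilon>2 / n) xs)"
    proof (rule sum_list_mono)
      fix x
      let ?Q = "\<lambda>k. deg \<Gamma> (fst k) + snd x = deg \<Gamma> (snd k) + fst x"
      have fl: "lincomb A A.T (filter (\<lambda>y. ?Q (snd y)) l2) \<in> carrier A"
        using l2(1) by (intro A.span_in) auto
      have "lincomb A A.T (weighted (G x) l2) = of_real (1 / n) \<odot>\<^bsub>A\<^esub> lincomb A A.T (weighted (\<lambda>k. of_bool (?Q k)) l2)"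
        unfolding G_def using A.T_supp(1)[OF l2(1)] by (rule A.lincomb_weighted_scale)
      also have "lincomb A A.T (weighted (\<lambda>k. of_bool (?Q k)) l2) = lincomb A A.T (filter (\<lambda>y. ?Q (snd y)) l2)"
        using A.T_supp(1)[OF l2(1)] by (rule A.lincomb_weighted_of_bool)
      finally have "nrm A (lincomb A A.T (weighted (G x) l2)) = (1 / n) * nrm A (lincomb A A.T (filter (\<lambda>y. ?Q (snd y)) l2))"
        using A.nrm_smult[OF fl, of "of_real (1 / n)"] n by (simp add: norm_divide)
      also have "\<dots> \<le> (1 / n) * \<epsilon>2"
        using fourier_coefficient_bound[OF A B ap nz l2(1), of "snd x" "fst x"] bsmall n
        by (intro mult_left_mono) (auto intro: order_trans)
      finally show "nrm A (lincomb A A.T (weighted (G x) l2)) \<le> \<epsilon>2 / n" by simp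
    qed
    also have "\<dots> = n * n * (\<epsilon>2 / n)"
    proof -
      have "real (length xs) = n * n"
        unfolding distinct_card[OF xs(2), symmetric] xs(1) by (simp add: card_cartesian_product n_def)
      then show ?thesis by (simp add: sum_list_triv)
    qed
    also have "\<dots> = \<epsilon>" using n \<epsilon>2(2) by simp
    finally have d3: "nrm A y2 \<le> \<epsilon>" .
    have "nrm A a \<le> nrm A (a \<ominus>\<^bsub>A\<^esub> x1) + nrm A x1" "nrm A x1 \<le> nrm A (x1 \<ominus>\<^bsub>A\<^esub> y1) + nrm A y1"
      "nrm A y1 \<le> nrm A (y1 \<ominus>\<^bsub>A\<^esub> y2) + nrm A y2"
      using c a by (intro A.nrm_le_minus; simp)+
    moreover have "nrm A (a \<ominus>\<^bsub>A\<^esub> x1) = nrm A (x1 \<ominus>\<^bsub>A\<^esub> a)" "nrm A (x1 \<ominus>\<^bsub>A\<^esub> y1) = nrm A (y1 \<ominus>\<^bsub>A\<^esub> x1)"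
      using c a by (simp_all add: A.nrm_minus_commute)
    ultimately show ?thesis using d1 d2 d3 l1(2) by (simp add: x1_def \<epsilon>_def)
  qed
  then have "nrm A a \<le> 0" by (rule field_le_epsilon)
  then show ?thesis using A.nrm_eq_0_iff[OF a] A.nrm_nonneg[OF a] by linarith
qed

section \<open>Operators on gram_power-summable functions\<close>

typedef 'i ell2 = "{f :: 'i \<Rightarrow> complex. (\<lambda>i. (cmod (f i))\<^sup>2) summable_on UNIV}"
  morphisms coord Abs_ell2
  by (rule exI[of _ "\<lambda>_. 0"]) simp

lemma coord_summable: "(\<lambda>i. (cmod (coord f i))\<^sup>2) summable_on UNIV"
  using coord[of f] by simp

lemma ell2_eqI: "(\<And>i. coord f i = coord g i) \<Longrightarrow> f = g"
  by (simp add: coord_inject[symmetric] fun_eq_iff)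

lemma square_summable_inner:
  fixes f g :: "'i \<Rightarrow> complex"
  assumes "(\<lambda>i. (cmod (f i))\<^sup>2) summable_on UNIV" "(\<lambda>i. (cmod (g i))\<^sup>2) summable_on UNIV"
  shows "(\<lambda>i. inner (f i) (g i)) summable_on UNIV"
proof -
  have b: "norm (inner (f i) (g i)) \<le> (cmod (f i))\<^sup>2 + (cmod (g i))\<^sup>2" for i
  proof -
    have "norm (inner (f i) (g i)) \<le> cmod (f i) * cmod (g i)"
      using Cauchy_Schwarz_ineq2[of "f i" "g i"] by simp
    also have "\<dots> \<le> (cmod (f i))\<^sup>2 + (cmod (g i))\<^sup>2"
      using sum_squares_bound[of "cmod (f i)" "cmod (g i)"] mult_nonneg_nonneg[of "cmod (f i)" "cmod (g i)"]
        norm_ge_zero[of "f i"] norm_ge_zero[of "g i"] by linarith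
    finally show ?thesis .
  qed
  have "(\<lambda>i. (cmod (f i))\<^sup>2 + (cmod (g i))\<^sup>2) summable_on UNIV"
    by (rule summable_on_add[OF assms])
  then have "(\<lambda>i. norm (inner (f i) (g i))) summable_on UNIV"
    by (rule summable_on_comparison_test) (use b in auto)
  then show ?thesis by (rule abs_summable_summable)
qed

lemma square_summable_add:
  fixes f g :: "'i \<Rightarrow> complex"
  assumes f: "(\<lambda>i. (cmod (f i))\<^sup>2) summable_on UNIV" and g: "(\<lambda>i. (cmod (g i))\<^sup>2) summable_on UNIV"
  shows "(\<lambda>i. (cmod (f i + g i))\<^sup>2) summable_on UNIV"
proof -
  have "(\<lambda>i. (cmod (f i))\<^sup>2 + (cmod (g i))\<^sup>2 + (inner (f i) (g i) + inner (f i) (g i))) summable_on UNIV"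
    by (intro summable_on_add f g square_summable_inner)
  then show ?thesis
    by (rule summable_on_cong[THEN iffD1, rotated])
       (simp add: power2_norm_eq_inner inner_add inner_commute algebra_simps)
qed

lemma square_summable_mult:
  fixes f :: "'i \<Rightarrow> complex"
  assumes f: "(\<lambda>i. (cmod (f i))\<^sup>2) summable_on UNIV"
  shows "(\<lambda>i. (cmod (c * f i))\<^sup>2) summable_on UNIV"
  using summable_on_cmult_right[OF f, of "(cmod c)\<^sup>2"] by (simp add: norm_mult power_mult_distrib)

instantiation ell2 :: (type) real_vector
begin

definition "0 = Abs_ell2 (\<lambda>_. 0)"
definition "f + g = Abs_ell2 (\<lambda>i. coord f i + coord g i)"
definition "f - g = Abs_ell2 (\<lambda>i. coord f i - coord g i)"
definition "- f = Abs_ell2 (\<lambda>i. - coord f i)"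
definition "scaleR r f = Abs_ell2 (\<lambda>i. r *\<^sub>R coord f i)"

lemma coord_zero [simp]: "coord 0 i = 0"
  unfolding zero_ell2_def by (subst Abs_ell2_inverse) simp_all
lemma coord_add [simp]: "coord (f + g) i = coord f i + coord g i"
  unfolding plus_ell2_def
  by (subst Abs_ell2_inverse) (simp_all add: square_summable_add coord_summable)
lemma coord_uminus [simp]: "coord (- f) i = - coord f i"
  unfolding uminus_ell2_def
  by (subst Abs_ell2_inverse) (simp_all add: coord_summable)
lemma coord_diff [simp]: "coord (f - g) i = coord f i - coord g i"
  unfolding minus_ell2_def
  by (subst Abs_ell2_inverse)
     (use square_summable_add[of "coord f" "\<lambda>i. - coord g i"] in \<open>simp_all add: coord_summable\<close>)
lemma coord_scaleR [simp]: "coord (r *\<^sub>R f) i = r *\<^sub>R coord f i"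
  unfolding scaleR_ell2_def
  by (subst Abs_ell2_inverse)
     (use square_summable_mult[of "coord f" "of_real r"] in \<open>simp_all add: coord_summable scaleR_conv_of_real\<close>)

instance
  by standard (rule ell2_eqI; simp add: algebra_simps)+

end

text \<open>
  The inner product is the real part of the complex one. Complex scalars act by the
  operators \<open>cscale\<close>, and the complex linear operators are those that commute
  with them.
\<close>

instantiation ell2 :: (type) real_inner
begin

definition "inner f g = infsum (\<lambda>i. inner (coord f i) (coord g i)) UNIV"
definition "norm f = sqrt (inner f f)" for f :: "'a ell2"
definition "sgn f = f /\<^sub>R norm f" for f :: "'a ell2"
definition "dist f g = norm (f - g)" for f g :: "'a ell2"
definition "uniformity = (INF e\<in>{0 <..}. principal {(x::'a ell2, y). dist x y < e})"
definition "open (U :: 'a ell2 set) = (\<forall>x\<in>U. \<forall>\<^sub>F (x', y) in uniformity. x' = x \<longrightarrow> y \<in> U)"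

lemma inner_summable: "(\<lambda>i. inner (coord f i) (coord g i)) summable_on UNIV"
  by (rule square_summable_inner) (rule coord_summable)+

instance
proof
  fix f g h :: "'a ell2" and r :: real
  show "dist f g = norm (f - g)" by (rule dist_ell2_def)
  show "sgn f = f /\<^sub>R norm f" by (rule sgn_ell2_def)
  show "uniformity = (INF e\<in>{0 <..}. principal {(x::'a ell2, y). dist x y < e})"
    by (rule uniformity_ell2_def)
  show "open U = (\<forall>x\<in>U. \<forall>\<^sub>F (x', y) in uniformity. x' = x \<longrightarrow> y \<in> U)" for U :: "'a ell2 set"
    by (rule open_ell2_def)
  show "inner f g = inner g f" by (simp add: inner_ell2_def inner_commute)
  show "inner (f + g) h = inner f h + inner g h"
    unfolding inner_ell2_def by (simp add: inner_add_left infsum_add inner_summable)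
  show "inner (r *\<^sub>R f) g = r * inner f g"
    unfolding inner_ell2_def by (simp add: infsum_cmult_right')
  show "0 \<le> inner f f" unfolding inner_ell2_def by (rule infsum_nonneg) simp
  show "inner f f = 0 \<longleftrightarrow> f = 0"
  proof
    assume *: "inner f f = 0"
    have "inner (coord f i) (coord f i) = 0" for i
      by (rule nonneg_infsum_le_0D[of "\<lambda>i. inner (coord f i) (coord f i)" UNIV])
         (use * in \<open>simp_all add: inner_ell2_def inner_summable\<close>)
    then show "f = 0" by (intro ell2_eqI) simp
  qed (simp add: inner_ell2_def)
  show "norm f = sqrt (inner f f)" by (rule norm_ell2_def)
qed

end

lemma norm_ell2_square: "(norm f)\<^sup>2 = infsum (\<lambda>i. (cmod (coord f i))\<^sup>2) UNIV"
  by (simp add: power2_norm_eq_inner inner_ell2_def)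

lemma finite_sum_le_norm_ell2: "finite F \<Longrightarrow> (\<Sum>i\<in>F. (cmod (coord f i))\<^sup>2) \<le> (norm f)\<^sup>2"
  unfolding norm_ell2_square by (rule finite_sum_le_infsum) (simp_all add: coord_summable)

lemma cmod_coord_le: "cmod (coord f i) \<le> norm f"
  by (rule power2_le_imp_le) (use finite_sum_le_norm_ell2[of "{i}" f] in simp_all)

lemma square_summableI:
  fixes f :: "'i \<Rightarrow> complex"
  assumes "\<And>F. finite F \<Longrightarrow> (\<Sum>i\<in>F. (cmod (f i))\<^sup>2) \<le> C"
  shows "(\<lambda>i. (cmod (f i))\<^sup>2) summable_on UNIV"
  by (rule nonneg_bdd_above_summable_on) (use assms in \<open>auto intro!: bdd_aboveI[of _ C]\<close>)

lemma norm_ell2_le: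
  assumes "\<And>F. finite F \<Longrightarrow> (\<Sum>i\<in>F. (cmod (coord f i))\<^sup>2) \<le> C\<^sup>2" "0 \<le> C"
  shows "norm f \<le> C"
  by (rule power2_le_imp_le[OF _ assms(2)])
     (unfold norm_ell2_square, rule infsum_le_finite_sums[OF coord_summable], use assms in auto)

instance ell2 :: (type) banach
proof
  fix X :: "nat \<Rightarrow> 'a ell2"
  assume X: "Cauchy X"
  have "Cauchy (\<lambda>n. coord (X n) i)" for i
  proof (rule metric_CauchyI)
    fix e :: real assume "0 < e"
    then obtain N where N: "\<And>m n. m \<ge> N \<Longrightarrow> n \<ge> N \<Longrightarrow> dist (X m) (X n) < e"
      using metric_CauchyD[OF X] by metis
    have "dist (coord (X m) i) (coord (X n) i) < e" if "m \<ge> N" "n \<ge> N" for m n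
      using cmod_coord_le[of "X m - X n" i] N[OF that] by (simp add: dist_norm)
    then show "\<exists>N. \<forall>m\<ge>N. \<forall>n\<ge>N. dist (coord (X m) i) (coord (X n) i) < e" by blast
  qed
  then have "\<exists>g. \<forall>i. (\<lambda>n. coord (X n) i) \<longlonglongrightarrow> g i"
    unfolding Cauchy_convergent_iff convergent_def by metis
  then obtain g where g: "\<And>i. (\<lambda>n. coord (X n) i) \<longlonglongrightarrow> g i" by blast
  have close: "\<exists>N. \<forall>m\<ge>N. \<forall>F. finite F \<longrightarrow> (\<Sum>i\<in>F. (cmod (coord (X m) i - g i))\<^sup>2) \<le> e\<^sup>2" if e: "0 < e" for e
  proof -
    obtain N where N: "\<And>m n. m \<ge> N \<Longrightarrow> n \<ge> N \<Longrightarrow> dist (X m) (X n) < e"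
      using metric_CauchyD[OF X e] by metis
    have "(\<Sum>i\<in>F. (cmod (coord (X m) i - g i))\<^sup>2) \<le> e\<^sup>2" if "m \<ge> N" "finite F" for m F
    proof (rule LIMSEQ_le_const2)
      show "(\<lambda>n. \<Sum>i\<in>F. (cmod (coord (X m) i - coord (X n) i))\<^sup>2)
          \<longlonglongrightarrow> (\<Sum>i\<in>F. (cmod (coord (X m) i - g i))\<^sup>2)"
        by (intro tendsto_intros g)
      have "(\<Sum>i\<in>F. (cmod (coord (X m) i - coord (X n) i))\<^sup>2) \<le> e\<^sup>2" if "n \<ge> N" for n
      proof -
        have "(\<Sum>i\<in>F. (cmod (coord (X m) i - coord (X n) i))\<^sup>2) \<le> (norm (X m - X n))\<^sup>2"
          using finite_sum_le_norm_ell2[OF \<open>finite F\<close>, of "X m - X n"] by simp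
        also have "\<dots> \<le> e\<^sup>2"
          using N[OF \<open>m \<ge> N\<close> that] by (intro power_mono) (auto simp: dist_norm)
        finally show ?thesis .
      qed
      then show "\<exists>k. \<forall>n\<ge>k. (\<Sum>i\<in>F. (cmod (coord (X m) i - coord (X n) i))\<^sup>2) \<le> e\<^sup>2" by blast
    qed
    then show ?thesis by blast
  qed
  obtain N where "\<And>F. finite F \<Longrightarrow> (\<Sum>i\<in>F. (cmod (coord (X N) i - g i))\<^sup>2) \<le> 1\<^sup>2"
    using close[of 1] by auto
  then have "(\<lambda>i. (cmod (coord (X N) i - g i))\<^sup>2) summable_on UNIV" by (rule square_summableI)
  then have "(\<lambda>i. (cmod (coord (X N) i + (- 1) * (coord (X N) i - g i)))\<^sup>2) summable_on UNIV"
    by (intro square_summable_add coord_summable square_summable_mult)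
  then have "(\<lambda>i. (cmod (g i))\<^sup>2) summable_on UNIV" by simp
  then obtain G where G: "\<And>i. coord G i = g i" using Abs_ell2_inverse[of g] by (metis mem_Collect_eq)
  have "X \<longlonglongrightarrow> G"
  proof (rule metric_LIMSEQ_I)
    fix e :: real assume "0 < e"
    then obtain N where N: "\<And>m F. m \<ge> N \<Longrightarrow> finite F \<Longrightarrow> (\<Sum>i\<in>F. (cmod (coord (X m) i - g i))\<^sup>2) \<le> (e/2)\<^sup>2"
      using close[of "e/2"] by auto
    have "norm (X m - G) \<le> e/2" if "m \<ge> N" for m
      by (rule norm_ell2_le) (use N[OF that] G \<open>0 < e\<close> in simp_all)
    then show "\<exists>N. \<forall>n\<ge>N. dist (X n) G < e" using \<open>0 < e\<close> by (force simp: dist_norm)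
  qed
  then show "convergent X" by (rule convergentI)
qed

lemma blinfun_eq_iff: "S = T \<longleftrightarrow> (\<forall>f. blinfun_apply S f = blinfun_apply T f)"
  using blinfun_eqI by auto

definition cscale :: "complex \<Rightarrow> 'i ell2 \<Rightarrow>\<^sub>L 'i ell2" where
  "cscale c = Blinfun (\<lambda>f. Abs_ell2 (\<lambda>i. c * coord f i))"

lemma coord_mult: "coord (Abs_ell2 (\<lambda>i. c * coord f i)) i = c * coord f i"
  by (subst Abs_ell2_inverse) (simp_all add: square_summable_mult coord_summable)

lemma norm_mult_ell2: "norm (Abs_ell2 (\<lambda>i. c * coord f i)) = cmod c * norm f"
proof (rule power2_eq_imp_eq)
  show "(norm (Abs_ell2 (\<lambda>i. c * coord f i)))\<^sup>2 = (cmod c * norm f)\<^sup>2"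
    by (simp add: norm_ell2_square coord_mult norm_mult power_mult_distrib infsum_cmult_right')
qed simp_all

lemma coord_cscale [simp]:
  fixes f :: "'i ell2"
  shows "coord (cscale c f) i = c * coord f i"
proof -
  have "bounded_linear (\<lambda>f::'i ell2. Abs_ell2 (\<lambda>i. c * coord f i))"
  proof (rule bounded_linear_intro)
    show "norm (Abs_ell2 (\<lambda>i. c * coord f i)) \<le> norm f * cmod c" for f :: "'i ell2"
      by (simp add: norm_mult_ell2)
  qed (rule ell2_eqI, subst coord_mult, simp add: coord_mult algebra_simps)+
  then show ?thesis by (simp add: cscale_def bounded_linear_Blinfun_apply coord_mult)
qed

lemma norm_cscale_apply [simp]: "norm (cscale c f) = cmod c * norm f"
proof -
  have "cscale c f = Abs_ell2 (\<lambda>i. c * coord f i)" by (rule ell2_eqI) (simp add: coord_mult)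
  then show ?thesis by (simp add: norm_mult_ell2)
qed

definition adjoint_of :: "'i ell2 \<Rightarrow>\<^sub>L 'i ell2 \<Rightarrow> 'i ell2 \<Rightarrow>\<^sub>L 'i ell2 \<Rightarrow> bool" where
  "adjoint_of T T' \<longleftrightarrow> (\<forall>f g. inner (T f) g = inner f (T' g))"

lemma adjoint_ofD: "adjoint_of T T' \<Longrightarrow> inner (T f) g = inner f (T' g)"
  by (simp add: adjoint_of_def)

lemma adjoint_of_unique: "adjoint_of T S \<Longrightarrow> adjoint_of T S' \<Longrightarrow> S = S'"
proof (rule blinfun_eqI)
  fix g assume "adjoint_of T S" "adjoint_of T S'"
  then have "inner f (S g) = inner f (S' g)" for f using adjoint_ofD by metis
  then show "S g = S' g" using vector_eq_ldot[of "S g" "S' g"] by blast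
qed

lemma adjoint_of_sym: "adjoint_of T T' \<Longrightarrow> adjoint_of T' T"
  unfolding adjoint_of_def by (metis inner_commute)

lemma adjoint_of_add: "adjoint_of T T' \<Longrightarrow> adjoint_of S S' \<Longrightarrow> adjoint_of (T + S) (T' + S')"
  by (simp add: adjoint_of_def plus_blinfun.rep_eq inner_add)

lemma adjoint_of_diff: "adjoint_of T T' \<Longrightarrow> adjoint_of S S' \<Longrightarrow> adjoint_of (T - S) (T' - S')"
  by (simp add: adjoint_of_def minus_blinfun.rep_eq inner_diff)

lemma adjoint_of_zero: "adjoint_of 0 0"
  by (simp add: adjoint_of_def zero_blinfun.rep_eq)

lemma adjoint_of_compose:
  "adjoint_of T T' \<Longrightarrow> adjoint_of S S' \<Longrightarrow> adjoint_of (T o\<^sub>L S) (S' o\<^sub>L T')"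
  by (simp add: adjoint_of_def)

lemma adjoint_of_cscale: "adjoint_of (cscale c) (cscale (cnj c))"
  unfolding adjoint_of_def inner_ell2_def
  by (simp add: inner_complex_def algebra_simps)

lemma norm_adjoint_le: assumes "adjoint_of T T'" shows "norm T' \<le> norm T"
proof (rule norm_blinfun_bound)
  fix g
  have "norm (T' g) * norm (T' g) = inner (T (T' g)) g"
    using adjoint_ofD[OF assms, of "T' g" g] by (simp add: dot_square_norm power2_eq_square)
  also have "\<dots> \<le> norm (T (T' g)) * norm g" by (rule norm_cauchy_schwarz)
  also have "\<dots> \<le> (norm T * norm (T' g)) * norm g" by (intro mult_right_mono norm_blinfun) simp
  finally have "norm (T' g) * norm (T' g) \<le> norm (T' g) * (norm T * norm g)" by (simp add: mult_ac)
  then show "norm (T' g) \<le> norm T * norm g"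
    by (cases "T' g = 0") simp_all
qed simp

text \<open>
  \<open>\<parallel>Tf\<parallel>\<^sup>2\<close> is the inner product of \<open>f\<close>
  and \<open>T\<^sup>*Tf\<close>, which gives the C*-identity.
\<close>

lemma norm_adjoint_compose: assumes "adjoint_of T T'" shows "norm (T' o\<^sub>L T) = (norm T)\<^sup>2"
proof (rule antisym)
  have "norm (T' o\<^sub>L T) \<le> norm T' * norm T" by (rule norm_blinfun_compose)
  also have "\<dots> \<le> norm T * norm T" by (intro mult_right_mono norm_adjoint_le assms) simp
  finally show "norm (T' o\<^sub>L T) \<le> (norm T)\<^sup>2" by (simp add: power2_eq_square)
  have "norm T \<le> sqrt (norm (T' o\<^sub>L T))"
  proof (rule norm_blinfun_bound)
    fix f
    have "(norm (T f))\<^sup>2 = inner f ((T' o\<^sub>L T) f)"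
      using adjoint_ofD[OF assms, of f "T f"] by (simp add: power2_norm_eq_inner)
    also have "\<dots> \<le> norm f * norm ((T' o\<^sub>L T) f)" by (rule norm_cauchy_schwarz)
    also have "\<dots> \<le> norm f * (norm (T' o\<^sub>L T) * norm f)" by (intro mult_left_mono norm_blinfun) simp
    also have "\<dots> = (sqrt (norm (T' o\<^sub>L T)) * norm f)\<^sup>2" by (simp add: power2_eq_square power_mult_distrib)
    finally show "norm (T f) \<le> sqrt (norm (T' o\<^sub>L T)) * norm f"
      by (rule power2_le_imp_le) simp
  qed simp
  then have "(norm T)\<^sup>2 \<le> (sqrt (norm (T' o\<^sub>L T)))\<^sup>2" by (intro power_mono) simp_all
  then show "(norm T)\<^sup>2 \<le> norm (T' o\<^sub>L T)" by simp
qed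

text \<open>
  Existence of an adjoint is part of the definition of the carrier, which avoids the
  representation theorem for functionals. For an operator that commutes with the complex
  scalars, an adjoint for the real inner product is one for the complex inner product.
\<close>

definition ell2_operators :: "('i ell2 \<Rightarrow>\<^sub>L 'i ell2) cstar" where
  "ell2_operators = \<lparr>carrier = {T. (\<forall>c. T o\<^sub>L cscale c = cscale c o\<^sub>L T) \<and> (\<exists>T'. adjoint_of T T')},
     monoid.mult = (o\<^sub>L), one = id_blinfun, zero = 0, add = (+),
     module.smult = (\<lambda>c T. cscale c o\<^sub>L T), adj = (\<lambda>T. THE T'. adjoint_of T T'), nrm = norm\<rparr>"

lemma ell2_operators_simps [simp]:
  "x \<otimes>\<^bsub>ell2_operators\<^esub> y = x o\<^sub>L y" "\<zero>\<^bsub>ell2_operators\<^esub> = 0" "x \<oplus>\<^bsub>ell2_operators\<^esub> y = x + y"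
  "c \<odot>\<^bsub>ell2_operators\<^esub> x = cscale c o\<^sub>L x" "nrm ell2_operators x = norm x"
  by (simp_all add: ell2_operators_def)

lemma ell2_operators_carrier:
  "T \<in> carrier ell2_operators \<longleftrightarrow> (\<forall>c f. T (cscale c f) = cscale c (T f)) \<and> (\<exists>T'. adjoint_of T T')"
  by (auto simp: ell2_operators_def blinfun_eq_iff)

lemma ell2_operators_adj:
  assumes "adjoint_of T T'" shows "adj ell2_operators T = T'"
proof -
  have "(THE S. adjoint_of T S) = T'"
    by (rule the_equality[where P = "adjoint_of T", OF assms]) (rule adjoint_of_unique[OF _ assms])
  then show ?thesis by (simp add: ell2_operators_def)
qed

lemma adjoint_of_adj: "T \<in> carrier ell2_operators \<Longrightarrow> adjoint_of T (adj ell2_operators T)"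
  by (auto simp: ell2_operators_carrier ell2_operators_adj)

lemma ell2_operators_commute: "T \<in> carrier ell2_operators \<Longrightarrow> T (cscale c f) = cscale c (T f)"
  by (simp add: ell2_operators_carrier)

lemma ell2_operators_adj_in: assumes "T \<in> carrier ell2_operators" shows "adj ell2_operators T \<in> carrier ell2_operators"
proof -
  let ?T' = "adj ell2_operators T"
  note a = adjoint_of_adj[OF assms]
  have "?T' (cscale c f) = cscale c (?T' f)" for c f
  proof -
    have "T o\<^sub>L cscale (cnj c) = cscale (cnj c) o\<^sub>L T"
      using ell2_operators_commute[OF assms] by (simp add: blinfun_eq_iff)
    moreover have "adjoint_of (T o\<^sub>L cscale (cnj c)) (cscale c o\<^sub>L ?T')"
      using adjoint_of_compose[OF a adjoint_of_cscale[of "cnj c"]] by simp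
    moreover have "adjoint_of (cscale (cnj c) o\<^sub>L T) (?T' o\<^sub>L cscale c)"
      using adjoint_of_compose[OF adjoint_of_cscale[of "cnj c"] a] by simp
    ultimately have "cscale c o\<^sub>L ?T' = ?T' o\<^sub>L cscale c" by (metis adjoint_of_unique)
    then show ?thesis by (simp add: blinfun_eq_iff)
  qed
  then show ?thesis using adjoint_of_sym[OF a] by (auto simp: ell2_operators_carrier)
qed

lemma cscale_scale [simp]: "cscale a (cscale b f) = cscale (a * b) f"
  by (rule ell2_eqI) simp

lemma cscale_one [simp]: "cscale 1 f = f" by (rule ell2_eqI) simp

lemma norm_cscale_compose: "norm (cscale c o\<^sub>L T) = cmod c * norm (T :: 'i ell2 \<Rightarrow>\<^sub>L 'i ell2)"
proof -
  have le: "norm (cscale c o\<^sub>L T) \<le> cmod c * norm T" for c and T :: "'i ell2 \<Rightarrow>\<^sub>L 'i ell2"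
  proof (rule norm_blinfun_bound)
    show "norm ((cscale c o\<^sub>L T) f) \<le> cmod c * norm T * norm f" for f
      using norm_blinfun[of T f] by (simp add: mult_left_mono mult.assoc)
  qed simp
  show ?thesis
  proof (cases "c = 0")
    case True then show ?thesis using le[of c T] by simp
  next
    case False
    have "cscale (inverse c) o\<^sub>L (cscale c o\<^sub>L T) = T" using False by (simp add: blinfun_eq_iff)
    then have "norm T \<le> cmod (inverse c) * norm (cscale c o\<^sub>L T)" using le[of "inverse c" "cscale c o\<^sub>L T"] by simp
    then have "cmod c * norm T \<le> norm (cscale c o\<^sub>L T)" using False by (simp add: norm_divide field_simps)
    then show ?thesis using le[of c T] by simp
  qed
qed

lemma cscale_add_left: "cscale (a + b) f = cscale a f + cscale b f"
  by (rule ell2_eqI) (simp add: algebra_simps)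

lemma ell2_operators_zero_in: "0 \<in> carrier ell2_operators"
  using adjoint_of_zero by (auto simp: ell2_operators_carrier)

lemma ell2_operators_add_in: "S \<in> carrier ell2_operators \<Longrightarrow> T \<in> carrier ell2_operators \<Longrightarrow> S + T \<in> carrier ell2_operators"
  by (auto simp: ell2_operators_carrier plus_blinfun.rep_eq blinfun.add_right intro: adjoint_of_add)

lemma ell2_operators_mult_in: "S \<in> carrier ell2_operators \<Longrightarrow> T \<in> carrier ell2_operators \<Longrightarrow> S o\<^sub>L T \<in> carrier ell2_operators"
  by (auto simp: ell2_operators_carrier intro: adjoint_of_compose)

lemma cscale_in: "cscale c \<in> carrier ell2_operators"
  using adjoint_of_cscale by (auto simp: ell2_operators_carrier mult.commute)

lemma ell2_operators_smult_in: "T \<in> carrier ell2_operators \<Longrightarrow> cscale c o\<^sub>L T \<in> carrier ell2_operators"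
  by (rule ell2_operators_mult_in[OF cscale_in])

lemma ell2_operators_abelian_group: "abelian_group ell2_operators"
proof (rule abelian_groupI)
  fix T :: "'i ell2 \<Rightarrow>\<^sub>L 'i ell2"
  assume "T \<in> carrier ell2_operators"
  then have "cscale (- 1) o\<^sub>L T \<in> carrier ell2_operators" by (rule ell2_operators_smult_in)
  moreover have "(cscale (- 1) o\<^sub>L T) + T = 0"
    by (rule blinfun_eqI, rule ell2_eqI) (simp add: plus_blinfun.rep_eq zero_blinfun.rep_eq)
  ultimately show "\<exists>S\<in>carrier ell2_operators. S \<oplus>\<^bsub>ell2_operators\<^esub> T = \<zero>\<^bsub>ell2_operators\<^esub>" by auto
qed (auto simp: ell2_operators_zero_in ell2_operators_add_in algebra_simps)

lemma ell2_operators_minus: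
  assumes "S \<in> carrier ell2_operators" "T \<in> carrier ell2_operators"
  shows "S \<ominus>\<^bsub>ell2_operators\<^esub> T = S - T"
proof -
  interpret abelian_group "ell2_operators :: ('a ell2 \<Rightarrow>\<^sub>L 'a ell2) cstar" by (rule ell2_operators_abelian_group)
  have "cscale (- 1) o\<^sub>L T \<in> carrier ell2_operators" by (rule ell2_operators_smult_in) fact
  moreover have "(cscale (- 1) o\<^sub>L T) + T = 0"
    by (rule blinfun_eqI, rule ell2_eqI) (simp add: plus_blinfun.rep_eq zero_blinfun.rep_eq)
  ultimately have "\<ominus>\<^bsub>ell2_operators\<^esub> T = cscale (- 1) o\<^sub>L T" using assms by (intro minus_equality) auto
  moreover have "cscale (- 1) o\<^sub>L T = - T"
    using \<open>(cscale (- 1) o\<^sub>L T) + T = 0\<close> by (rule eq_neg_iff_add_eq_0[THEN iffD2])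
  ultimately show ?thesis by (simp add: a_minus_def)
qed

text \<open>
  Adjoints form a Cauchy sequence with their operators, and the limit of the adjoints is an
  adjoint of the limit.
\<close>

lemma ell2_operators_closed:
  assumes f: "\<And>n. f n \<in> carrier ell2_operators" and lim: "f \<longlonglongrightarrow> l"
  shows "l \<in> carrier ell2_operators"
proof -
  have ap: "(\<lambda>n. f n x) \<longlonglongrightarrow> l x" for x by (intro tendsto_intros lim)
  have "l (cscale c x) = cscale c (l x)" for c x
  proof (rule LIMSEQ_unique)
    show "(\<lambda>n. f n (cscale c x)) \<longlonglongrightarrow> l (cscale c x)" by (rule ap)
    have "(\<lambda>n. cscale c (f n x)) \<longlonglongrightarrow> cscale c (l x)" by (intro tendsto_intros ap)
    then show "(\<lambda>n. f n (cscale c x)) \<longlonglongrightarrow> cscale c (l x)" using f by (simp add: ell2_operators_commute)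
  qed
  moreover have "\<exists>l'. adjoint_of l l'"
  proof -
    let ?g = "\<lambda>n. adj ell2_operators (f n)"
    note a = adjoint_of_adj[OF f]
    have "Cauchy ?g"
    proof (rule metric_CauchyI)
      fix e :: real assume "0 < e"
      then obtain N where N: "\<And>m n. m \<ge> N \<Longrightarrow> n \<ge> N \<Longrightarrow> dist (f m) (f n) < e"
        using metric_CauchyD[OF LIMSEQ_imp_Cauchy[OF lim]] by metis
      have "dist (?g m) (?g n) < e" if "m \<ge> N" "n \<ge> N" for m n
        using norm_adjoint_le[OF adjoint_of_diff[OF a[of m] a[of n]]] N[OF that] by (simp add: dist_norm)
      then show "\<exists>N. \<forall>m\<ge>N. \<forall>n\<ge>N. dist (?g m) (?g n) < e" by blast
    qed
    then obtain l' where l': "?g \<longlonglongrightarrow> l'" unfolding Cauchy_convergent_iff convergent_def by blast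
    have "inner (l x) y = inner x (l' y)" for x y
    proof (rule LIMSEQ_unique)
      show "(\<lambda>n. inner (f n x) y) \<longlonglongrightarrow> inner (l x) y" by (intro tendsto_intros ap)
      have "(\<lambda>n. inner x (?g n y)) \<longlonglongrightarrow> inner x (l' y)" by (intro tendsto_intros l')
      then show "(\<lambda>n. inner (f n x) y) \<longlonglongrightarrow> inner x (l' y)" using adjoint_ofD[OF a] by simp
    qed
    then show ?thesis by (auto simp: adjoint_of_def)
  qed
  ultimately show ?thesis by (simp add: ell2_operators_carrier)
qed

theorem ell2_operators_cstar: "cstar_algebra (ell2_operators :: ('i ell2 \<Rightarrow>\<^sub>L 'i ell2) cstar)"
proof -
  let ?L = "ell2_operators :: ('i ell2 \<Rightarrow>\<^sub>L 'i ell2) cstar"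
  interpret abelian_group ?L by (rule ell2_operators_abelian_group)
  interpret cring complex_ring by (rule cring_complex_ring)
  note ins = ell2_operators_add_in ell2_operators_mult_in ell2_operators_smult_in ell2_operators_adj_in
  note a = adjoint_of_adj
  show ?thesis
  proof (unfold_locales)
    fix x y :: "'i ell2 \<Rightarrow>\<^sub>L 'i ell2" and c
    assume x: "x \<in> carrier ?L"
    show "adj ?L (adj ?L x) = x" by (rule ell2_operators_adj[OF adjoint_of_sym[OF a[OF x]]])
    show "adj ?L (c \<odot>\<^bsub>?L\<^esub> x) = cnj c \<odot>\<^bsub>?L\<^esub> adj ?L x"
    proof -
      have "adj ?L x o\<^sub>L cscale (cnj c) = cscale (cnj c) o\<^sub>L adj ?L x"
        using ell2_operators_commute[OF ell2_operators_adj_in[OF x]] by (simp add: blinfun_eq_iff)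
      then show ?thesis
        using ell2_operators_adj[OF adjoint_of_compose[OF adjoint_of_cscale[of c] a[OF x]]] by simp
    qed
    show "nrm ?L (adj ?L x \<otimes>\<^bsub>?L\<^esub> x) = (nrm ?L x)\<^sup>2"
      using norm_adjoint_compose[OF a[OF x]] by simp
    assume y: "y \<in> carrier ?L"
    show "adj ?L (x \<oplus>\<^bsub>?L\<^esub> y) = adj ?L x \<oplus>\<^bsub>?L\<^esub> adj ?L y"
      using ell2_operators_adj[OF adjoint_of_add[OF a[OF x] a[OF y]]] by simp
    show "adj ?L (x \<otimes>\<^bsub>?L\<^esub> y) = adj ?L y \<otimes>\<^bsub>?L\<^esub> adj ?L x"
      using ell2_operators_adj[OF adjoint_of_compose[OF a[OF x] a[OF y]]] by simp
  next
    fix f :: "nat \<Rightarrow> 'i ell2 \<Rightarrow>\<^sub>L 'i ell2"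
    assume f: "\<And>n. f n \<in> carrier ?L"
      and C: "\<And>e. e > 0 \<Longrightarrow> \<exists>N. \<forall>m\<ge>N. \<forall>n\<ge>N. nrm ?L (f m \<ominus>\<^bsub>?L\<^esub> f n) < e"
    have "Cauchy f"
      by (rule metric_CauchyI) (use C in \<open>simp add: ell2_operators_minus f dist_norm\<close>)
    then obtain l where l: "f \<longlonglongrightarrow> l" unfolding Cauchy_convergent_iff convergent_def by blast
    have "l \<in> carrier ?L" by (rule ell2_operators_closed[OF f l])
    moreover have "(\<lambda>n. norm (f n - l)) \<longlonglongrightarrow> 0"
      using l by (simp add: tendsto_norm_zero LIM_zero)
    ultimately show "\<exists>l\<in>carrier ?L. (\<lambda>n. nrm ?L (f n \<ominus>\<^bsub>?L\<^esub> l)) \<longlonglongrightarrow> 0"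
      by (intro bexI[of _ l]) (simp_all add: ell2_operators_minus f)
  next
    fix x y :: "'i ell2 \<Rightarrow>\<^sub>L 'i ell2" and c d
    assume x: "x \<in> carrier ?L"
    show "c \<odot>\<^bsub>?L\<^esub> x \<in> carrier ?L" "adj ?L x \<in> carrier ?L" using x by (simp_all add: ins)
    show "(c \<oplus>\<^bsub>complex_ring\<^esub> d) \<odot>\<^bsub>?L\<^esub> x = c \<odot>\<^bsub>?L\<^esub> x \<oplus>\<^bsub>?L\<^esub> d \<odot>\<^bsub>?L\<^esub> x"
      by (simp add: blinfun_eq_iff plus_blinfun.rep_eq cscale_add_left)
    show "(c \<otimes>\<^bsub>complex_ring\<^esub> d) \<odot>\<^bsub>?L\<^esub> x = c \<odot>\<^bsub>?L\<^esub> (d \<odot>\<^bsub>?L\<^esub> x)"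
      by (simp add: blinfun_eq_iff)
    show "\<one>\<^bsub>complex_ring\<^esub> \<odot>\<^bsub>?L\<^esub> x = x" by (simp add: blinfun_eq_iff)
    show "0 \<le> nrm ?L x" "nrm ?L x = 0 \<longleftrightarrow> x = \<zero>\<^bsub>?L\<^esub>" by simp_all
    show "nrm ?L (c \<odot>\<^bsub>?L\<^esub> x) = cmod c * nrm ?L x" by (simp add: norm_cscale_compose)
    assume y: "y \<in> carrier ?L"
    show "c \<odot>\<^bsub>?L\<^esub> (x \<oplus>\<^bsub>?L\<^esub> y) = c \<odot>\<^bsub>?L\<^esub> x \<oplus>\<^bsub>?L\<^esub> c \<odot>\<^bsub>?L\<^esub> y"
      by (simp add: blinfun_eq_iff plus_blinfun.rep_eq blinfun.add_right)
    show "x \<otimes>\<^bsub>?L\<^esub> y \<in> carrier ?L" using x y by (simp add: ins)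
    show "(c \<odot>\<^bsub>?L\<^esub> x) \<otimes>\<^bsub>?L\<^esub> y = c \<odot>\<^bsub>?L\<^esub> (x \<otimes>\<^bsub>?L\<^esub> y)"
      by (simp add: blinfun_eq_iff)
    show "x \<otimes>\<^bsub>?L\<^esub> (c \<odot>\<^bsub>?L\<^esub> y) = c \<odot>\<^bsub>?L\<^esub> (x \<otimes>\<^bsub>?L\<^esub> y)"
      using ell2_operators_commute[OF x] by (simp add: blinfun_eq_iff)
    show "nrm ?L (x \<oplus>\<^bsub>?L\<^esub> y) \<le> nrm ?L x + nrm ?L y" by (simp add: norm_triangle_ineq)
    show "nrm ?L (x \<otimes>\<^bsub>?L\<^esub> y) \<le> nrm ?L x * nrm ?L y" by (simp add: norm_blinfun_compose)
    fix z :: "'i ell2 \<Rightarrow>\<^sub>L 'i ell2" assume z: "z \<in> carrier ?L"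
    show "(x \<otimes>\<^bsub>?L\<^esub> y) \<otimes>\<^bsub>?L\<^esub> z = x \<otimes>\<^bsub>?L\<^esub> (y \<otimes>\<^bsub>?L\<^esub> z)"
      by (simp add: blinfun_eq_iff)
    show "(x \<oplus>\<^bsub>?L\<^esub> y) \<otimes>\<^bsub>?L\<^esub> z = x \<otimes>\<^bsub>?L\<^esub> z \<oplus>\<^bsub>?L\<^esub> y \<otimes>\<^bsub>?L\<^esub> z"
      by (simp add: blinfun_eq_iff plus_blinfun.rep_eq)
    show "x \<otimes>\<^bsub>?L\<^esub> (y \<oplus>\<^bsub>?L\<^esub> z) = x \<otimes>\<^bsub>?L\<^esub> y \<oplus>\<^bsub>?L\<^esub> x \<otimes>\<^bsub>?L\<^esub> z"
      by (simp add: blinfun_eq_iff plus_blinfun.rep_eq blinfun.add_right)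
  qed
qed

section \<open>The path space representation\<close>

text \<open>
  Composition with an injective partial map \<open>\<phi>\<close> with domain
  \<open>D\<close>: a partial isometry, whose adjoint is the pullback along the partial
  inverse.
\<close>

definition pullback :: "'i set \<Rightarrow> ('i \<Rightarrow> 'i) \<Rightarrow> 'i ell2 \<Rightarrow>\<^sub>L 'i ell2" where
  "pullback D \<phi> = Blinfun (\<lambda>f. Abs_ell2 (\<lambda>i. if i \<in> D then coord f (\<phi> i) else 0))"

lemma pullback_finite_sum_le:
  assumes "inj_on \<phi> D" "finite F"
  shows "(\<Sum>i\<in>F. (cmod (if i \<in> D then coord f (\<phi> i) else 0))\<^sup>2) \<le> (norm f)\<^sup>2"
proof -
  have "(\<Sum>i\<in>F. (cmod (if i \<in> D then coord f (\<phi> i) else 0))\<^sup>2) = (\<Sum>i\<in>F \<inter> D. (cmod (coord f (\<phi> i)))\<^sup>2)"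
    by (subst sum.inter_restrict[OF assms(2)]) (rule sum.cong, auto)
  also have "\<dots> = (\<Sum>i\<in>\<phi> ` (F \<inter> D). (cmod (coord f i))\<^sup>2)"
    using inj_on_subset[OF assms(1)] by (subst sum.reindex) auto
  also have "\<dots> \<le> (norm f)\<^sup>2" by (rule finite_sum_le_norm_ell2) (use assms in simp)
  finally show ?thesis .
qed

lemma coord_pullback:
  assumes "inj_on \<phi> D"
  shows "coord (pullback D \<phi> f) i = (if i \<in> D then coord f (\<phi> i) else 0)"
proof -
  let ?g = "\<lambda>f i. if i \<in> D then coord f (\<phi> i) else 0"
  have c: "coord (Abs_ell2 (?g f)) i = ?g f i" for f i
    using Abs_ell2_inverse[of "?g f"] square_summableI[OF pullback_finite_sum_le[OF assms]] by simp
  have "bounded_linear (\<lambda>f. Abs_ell2 (?g f))"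
  proof (rule bounded_linear_intro)
    fix f g :: "'a ell2" and r :: real
    show "Abs_ell2 (?g (f + g)) = Abs_ell2 (?g f) + Abs_ell2 (?g g)"
      by (rule ell2_eqI, subst c) (simp only: coord_add c, simp)
    show "Abs_ell2 (?g (r *\<^sub>R f)) = r *\<^sub>R Abs_ell2 (?g f)"
      by (rule ell2_eqI, subst c) (simp only: coord_scaleR c, simp)
    have "norm (Abs_ell2 (?g f)) \<le> norm f"
      by (rule norm_ell2_le) (use pullback_finite_sum_le[OF assms] in \<open>simp_all only: c norm_ge_zero\<close>)
    then show "norm (Abs_ell2 (?g f)) \<le> norm f * 1" by simp
  qed
  then show ?thesis by (simp only: pullback_def bounded_linear_Blinfun_apply c)
qed

lemma pullback_cong:
  assumes "inj_on \<phi> D" "inj_on \<psi> E" "D = E" "\<And>i. i \<in> D \<Longrightarrow> \<phi> i = \<psi> i"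
  shows "pullback D \<phi> = pullback E \<psi>"
  by (rule blinfun_eqI, rule ell2_eqI) (use assms in \<open>simp add: coord_pullback\<close>)

lemma pullback_compose:
  assumes "inj_on \<phi> D" "inj_on \<psi> E"
  shows "pullback D \<phi> o\<^sub>L pullback E \<psi> = pullback {i \<in> D. \<phi> i \<in> E} (\<psi> \<circ> \<phi>)"
proof -
  have "inj_on (\<psi> \<circ> \<phi>) {i \<in> D. \<phi> i \<in> E}"
    using assms unfolding inj_on_def by auto
  then show ?thesis
    by (intro blinfun_eqI ell2_eqI) (simp add: coord_pullback assms)
qed

lemma adjoint_of_pullback:
  assumes "inj_on \<phi> D"
  shows "adjoint_of (pullback D \<phi>) (pullback (\<phi> ` D) (inv_into D \<phi>))"
proof -
  have inj: "inj_on (inv_into D \<phi>) (\<phi> ` D)" by (rule inj_on_inv_into) simp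
  have "inner (pullback D \<phi> f) g = inner f (pullback (\<phi> ` D) (inv_into D \<phi>) g)" for f g
  proof -
    have "inner (pullback D \<phi> f) g = infsum (\<lambda>i. inner (coord f (\<phi> i)) (coord g i)) D"
      unfolding inner_ell2_def
      by (rule infsum_cong_neutral) (use assms in \<open>auto simp: coord_pullback\<close>)
    also have "\<dots> = infsum ((\<lambda>j. inner (coord f j) (coord g (inv_into D \<phi> j))) \<circ> \<phi>) D"
      by (rule infsum_cong) (simp add: assms)
    also have "\<dots> = infsum (\<lambda>j. inner (coord f j) (coord g (inv_into D \<phi> j))) (\<phi> ` D)"
      by (rule infsum_reindex[symmetric]) fact
    also have "\<dots> = inner f (pullback (\<phi> ` D) (inv_into D \<phi>) g)"
      unfolding inner_ell2_def
      by (rule infsum_cong_neutral) (use inj in \<open>simp_all add: coord_pullback\<close>)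
    finally show ?thesis .
  qed
  then show ?thesis by (simp add: adjoint_of_def)
qed

lemma pullback_in: assumes "inj_on \<phi> D" shows "pullback D \<phi> \<in> carrier ell2_operators"
proof -
  have "pullback D \<phi> (cscale c f) = cscale c (pullback D \<phi> f)" for c f
    by (rule ell2_eqI) (simp add: coord_pullback assms)
  then show ?thesis using adjoint_of_pullback[OF assms] by (auto simp: ell2_operators_carrier)
qed

lemma adj_pullback:
  "inj_on \<phi> D \<Longrightarrow> adj ell2_operators (pullback D \<phi>) = pullback (\<phi> ` D) (inv_into D \<phi>)"
  by (rule ell2_operators_adj[OF adjoint_of_pullback])

lemma adj_pullback_compose:
  assumes "inj_on \<phi> D"
  shows "adj ell2_operators (pullback D \<phi>) o\<^sub>L pullback D \<phi> = pullback (\<phi> ` D) (\<lambda>i. i)"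
    and "pullback D \<phi> o\<^sub>L adj ell2_operators (pullback D \<phi>) = pullback D (\<lambda>i. i)"
proof -
  have inj: "inj_on (inv_into D \<phi>) (\<phi> ` D)" by (rule inj_on_inv_into) simp
  show "adj ell2_operators (pullback D \<phi>) o\<^sub>L pullback D \<phi> = pullback (\<phi> ` D) (\<lambda>i. i)"
    "pullback D \<phi> o\<^sub>L adj ell2_operators (pullback D \<phi>) = pullback D (\<lambda>i. i)"
    by (intro blinfun_eqI ell2_eqI;
      auto simp: adj_pullback assms inj coord_pullback inj_on_def[of "\<lambda>i. i"] inv_into_into f_inv_into_f)+
qed

lemma pullback_empty: "pullback {} \<phi> = 0"
  by (intro blinfun_eqI ell2_eqI) (simp add: coord_pullback zero_blinfun.rep_eq)

lemma coord_sum: "coord (sum f I) i = (\<Sum>j\<in>I. coord (f j) i)"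
  by (induction I rule: infinite_finite_induct) simp_all

lemma ell2_operators_finsum:
  fixes F :: "'j \<Rightarrow> 'i ell2 \<Rightarrow>\<^sub>L 'i ell2"
  assumes "finite I" "\<And>j. j \<in> I \<Longrightarrow> F j \<in> carrier ell2_operators"
  shows "finsum ell2_operators F I = sum F I"
proof -
  interpret cstar_algebra "ell2_operators :: ('i ell2 \<Rightarrow>\<^sub>L 'i ell2) cstar" by (rule ell2_operators_cstar)
  show ?thesis using assms
    by (induction I rule: finite_induct) (simp_all add: M.finsum_insert Pi_iff)
qed

lemma pullback_id_nonzero: assumes "i \<in> D" shows "pullback D (\<lambda>i. i) \<noteq> 0"
proof
  assume *: "pullback D (\<lambda>i. i) = 0"
  define \<delta> where "\<delta> = (\<lambda>j. if j = i then 1 else 0 :: complex)"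
  have "(\<lambda>j. (cmod (\<delta> j))\<^sup>2) summable_on UNIV"
  proof (rule square_summableI)
    fix F :: "'a set" assume "finite F"
    then have "(\<Sum>j\<in>F. (cmod (\<delta> j))\<^sup>2) = (\<Sum>j\<in>F. if j = i then 1 else 0)"
      by (intro sum.cong) (simp_all add: \<delta>_def)
    then show "(\<Sum>j\<in>F. (cmod (\<delta> j))\<^sup>2) \<le> 1" using \<open>finite F\<close> by simp
  qed
  then have "coord (Abs_ell2 \<delta>) i = 1" using Abs_ell2_inverse[of \<delta>] by (simp add: \<delta>_def)
  moreover have "coord (pullback D (\<lambda>i. i) (Abs_ell2 \<delta>)) i = coord (Abs_ell2 \<delta>) i"
    using assms by (simp add: coord_pullback inj_on_def)
  ultimately show False using * by (simp add: zero_blinfun.rep_eq)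
qed

context row_finite_p_graph
begin

text \<open>
  An infinite path is determined by its initial segments \<open>x(0, p)\<close>, and is
  given here by the coherent family of these.
\<close>

definition path_space :: "('p \<Rightarrow> 'g) set" where
  "path_space = {x. \<forall>p. x p \<in> mor \<Gamma> \<and> deg \<Gamma> (x p) = p \<and> (\<forall>q. init p (x (p + q)) = x p)}"

definition cylinder :: "'g \<Rightarrow> ('p \<Rightarrow> 'g) set" where
  "cylinder \<xi> = {x \<in> path_space. x (deg \<Gamma> \<xi>) = \<xi>}"

definition path_tail :: "'p \<Rightarrow> ('p \<Rightarrow> 'g) \<Rightarrow> 'p \<Rightarrow> 'g" where
  "path_tail p x = (\<lambda>q. tail p (x (p + q)))"

definition path_cons :: "'g \<Rightarrow> ('p \<Rightarrow> 'g) \<Rightarrow> 'p \<Rightarrow> 'g" where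
  "path_cons \<xi> y = (\<lambda>q. init q (comp \<Gamma> \<xi> (y q)))"

lemma path_spaceD:
  assumes "x \<in> path_space"
  shows "x p \<in> mor \<Gamma>" "deg \<Gamma> (x p) = p" "init p (x (p + q)) = x p"
  using assms by (auto simp: path_space_def)

lemma path_tail_decomp:
  assumes "x \<in> path_space"
  shows "path_tail p x q \<in> mor \<Gamma>" "deg \<Gamma> (path_tail p x q) = q"
    "src \<Gamma> (x p) = rng \<Gamma> (path_tail p x q)" "comp \<Gamma> (x p) (path_tail p x q) = x (p + q)"
  using init_tail[OF path_spaceD(1)[OF assms] path_spaceD(2)[OF assms], of p q] path_spaceD(3)[OF assms, of p q]
  by (auto simp: path_tail_def)

lemma path_tail_unique:
  assumes "x \<in> path_space" "\<zeta> \<in> mor \<Gamma>" "src \<Gamma> (x p) = rng \<Gamma> \<zeta>" "comp \<Gamma> (x p) \<zeta> = x (p + q)"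
  shows "path_tail p x q = \<zeta>"
  using init_comp_eq(2)[OF path_spaceD(1)[OF assms(1), of p] assms(2,3)] assms
  by (simp add: path_spaceD path_tail_def)

lemma path_rng: assumes "x \<in> path_space" shows "rng \<Gamma> (x p) = x 0"
proof -
  have "x 0 \<in> vertices \<Gamma>"
    using deg_0_vertex[of "x 0"] path_spaceD[OF assms] by (simp add: vertices_def)
  then show ?thesis
    using init_tail(7)[of "x p" 0 p] path_spaceD[OF assms, of p] path_spaceD(3)[OF assms, of 0 p]
    by (simp add: vertexD)
qed

lemma path_0_vertex: "x \<in> path_space \<Longrightarrow> x 0 \<in> vertices \<Gamma>"
  using path_rng[of x 0] rng_vertex[of "x 0"] path_spaceD[of x 0] by simp

lemma path_tail_comp:
  assumes "x \<in> path_space"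
  shows "path_tail p x (q + r) = comp \<Gamma> (path_tail p x q) (path_tail (p + q) x r)"
    and "src \<Gamma> (path_tail p x q) = rng \<Gamma> (path_tail (p + q) x r)"
proof -
  note d = path_tail_decomp[OF assms]
  have "src \<Gamma> (x (p + q)) = src \<Gamma> (path_tail p x q)"
    using src_comp[of "x p" "path_tail p x q"] d[of p q] path_spaceD[OF assms] by simp
  then show s: "src \<Gamma> (path_tail p x q) = rng \<Gamma> (path_tail (p + q) x r)"
    using d(3)[of "p + q" r] by simp
  show "path_tail p x (q + r) = comp \<Gamma> (path_tail p x q) (path_tail (p + q) x r)"
  proof (rule path_tail_unique[OF assms])
    have "comp \<Gamma> (x p) (comp \<Gamma> (path_tail p x q) (path_tail (p + q) x r))
        = comp \<Gamma> (comp \<Gamma> (x p) (path_tail p x q)) (path_tail (p + q) x r)"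
      using comp_assoc[of "x p" "path_tail p x q" "path_tail (p + q) x r"] d s path_spaceD[OF assms] by simp
    also have "\<dots> = x (p + q + r)" using d(4) by simp
    finally show "comp \<Gamma> (x p) (comp \<Gamma> (path_tail p x q) (path_tail (p + q) x r)) = x (p + (q + r))"
      by (simp add: add.assoc)
  qed (use d s in \<open>simp_all add: comp_closed rng_comp\<close>)
qed

lemma path_tail_in: assumes "x \<in> path_space" shows "path_tail p x \<in> path_space"
proof -
  note d = path_tail_decomp[OF assms]
  have "init q (path_tail p x (q + r)) = path_tail p x q" for q r
    using init_comp_eq(1)[of "path_tail p x q" "path_tail (p + q) x r"] path_tail_comp[OF assms] d by simp
  then show ?thesis using d by (simp add: path_space_def)
qed

lemma path_tail_0: assumes "x \<in> path_space" shows "path_tail 0 x = x" "path_tail p x 0 = src \<Gamma> (x p)"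
proof -
  show "path_tail 0 x = x"
  proof
    fix q
    have "comp \<Gamma> (x 0) (x q) = x (0 + q)"
      using comp_rng[of "x q"] path_rng[OF assms, of q] path_spaceD[OF assms] by simp
    then show "path_tail 0 x q = x q"
      using path_0_vertex[OF assms] path_rng[OF assms] path_spaceD[OF assms]
      by (intro path_tail_unique[OF assms]) (simp_all add: vertexD)
  qed
  show "path_tail p x 0 = src \<Gamma> (x p)"
    using path_spaceD[OF assms] by (intro path_tail_unique[OF assms]) (simp_all add: src_closed rng_src comp_src)
qed

lemma path_tail_path_tail:
  assumes "x \<in> path_space" shows "path_tail q (path_tail p x) = path_tail (p + q) x"
proof
  fix r
  show "path_tail q (path_tail p x) r = path_tail (p + q) x r"
    using path_tail_comp[OF assms] path_tail_decomp[OF assms]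
    by (intro path_tail_unique[OF path_tail_in[OF assms]]) simp_all
qed

lemma path_tail_inj: "inj_on (path_tail (deg \<Gamma> \<xi>)) (cylinder \<xi>)"
proof (rule inj_onI)
  fix x y assume x: "x \<in> cylinder \<xi>" and y: "y \<in> cylinder \<xi>"
    and eq: "path_tail (deg \<Gamma> \<xi>) x = path_tail (deg \<Gamma> \<xi>) y"
  have X: "x \<in> path_space" "y \<in> path_space" "x (deg \<Gamma> \<xi>) = \<xi>" "y (deg \<Gamma> \<xi>) = \<xi>"
    using x y by (auto simp: cylinder_def)
  have "x (deg \<Gamma> \<xi> + q) = y (deg \<Gamma> \<xi> + q)" for q
    using path_tail_decomp(4)[OF X(1), of "deg \<Gamma> \<xi>" q] path_tail_decomp(4)[OF X(2), of "deg \<Gamma> \<xi>" q] X eq by simp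
  then have "x q = y q" for q
    using path_spaceD(3)[OF X(1), of q "deg \<Gamma> \<xi>"] path_spaceD(3)[OF X(2), of q "deg \<Gamma> \<xi>"]
    by (simp add: add.commute)
  then show "x = y" by (rule ext)
qed

lemma path_cons_eq:
  assumes \<xi>: "\<xi> \<in> mor \<Gamma>" and y: "y \<in> path_space" "y 0 = src \<Gamma> \<xi>"
  shows "path_cons \<xi> y (deg \<Gamma> \<xi> + q) = comp \<Gamma> \<xi> (y q)"
    and "path_cons \<xi> y q \<in> mor \<Gamma>" "deg \<Gamma> (path_cons \<xi> y q) = q"
    and "init p (path_cons \<xi> y (p + q)) = path_cons \<xi> y p"
proof -
  have src: "src \<Gamma> \<xi> = rng \<Gamma> (y q)" for q using path_rng[OF y(1)] y(2) by simp
  note yD = path_spaceD[OF y(1)] and d = path_tail_decomp[OF y(1)]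
  have c: "comp \<Gamma> \<xi> (y q) \<in> mor \<Gamma>" "deg \<Gamma> (comp \<Gamma> \<xi> (y q)) = q + deg \<Gamma> \<xi>" "src \<Gamma> (comp \<Gamma> \<xi> (y q)) = src \<Gamma> (y q)" for q
    using \<xi> yD src by (simp_all add: comp_closed deg_comp add.commute src_comp)
  have split: "comp \<Gamma> \<xi> (y (p + q)) = comp \<Gamma> (comp \<Gamma> \<xi> (y p)) (path_tail p y q)" for p q
    using comp_assoc[OF \<xi> yD(1) d(1) src d(3)] d(4) by simp
  show "path_cons \<xi> y q \<in> mor \<Gamma>" "deg \<Gamma> (path_cons \<xi> y q) = q"
    using init_tail[OF c(1,2)] by (simp_all add: path_cons_def)
  have "path_cons \<xi> y (q + deg \<Gamma> \<xi>) = comp \<Gamma> \<xi> (y q)"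
    using init_comp_eq(1)[of "comp \<Gamma> \<xi> (y q)" "path_tail q y (deg \<Gamma> \<xi>)"] c d
    by (simp add: path_cons_def split)
  then show "path_cons \<xi> y (deg \<Gamma> \<xi> + q) = comp \<Gamma> \<xi> (y q)" by (simp add: add.commute)
  have "init p (path_cons \<xi> y (p + q)) = init p (comp \<Gamma> \<xi> (y (p + q)))"
    unfolding path_cons_def by (rule init_init) (use c in auto)
  also have "\<dots> = path_cons \<xi> y p"
    unfolding split path_cons_def by (rule init_comp) (use c d in auto)
  finally show "init p (path_cons \<xi> y (p + q)) = path_cons \<xi> y p" .
qed

lemma vertex_cylinder: "v \<in> vertices \<Gamma> \<Longrightarrow> cylinder v = {x \<in> path_space. x 0 = v}"
  by (simp add: cylinder_def vertexD)

text \<open>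
  Prefixing \<open>\<xi>\<close> inverts the removal of \<open>\<xi>\<close>. The initial
  segment of degree \<open>q\<close> of \<open>\<xi>y\<close> is that of \<open>\<xi>
  y(q)\<close>.
\<close>

lemma path_tail_cylinder:
  assumes \<xi>: "\<xi> \<in> mor \<Gamma>" shows "path_tail (deg \<Gamma> \<xi>) ` cylinder \<xi> = cylinder (src \<Gamma> \<xi>)"
proof (intro equalityI subsetI)
  fix y assume "y \<in> path_tail (deg \<Gamma> \<xi>) ` cylinder \<xi>"
  then show "y \<in> cylinder (src \<Gamma> \<xi>)"
    using \<xi> by (auto simp: cylinder_def vertexD path_tail_in path_tail_0)
next
  fix y assume "y \<in> cylinder (src \<Gamma> \<xi>)"
  then have y: "y \<in> path_space" "y 0 = src \<Gamma> \<xi>" using \<xi> by (auto simp: cylinder_def vertexD)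
  note e = path_cons_eq[OF \<xi> y]
  have X: "path_cons \<xi> y \<in> path_space" using e(2-4) by (simp add: path_space_def)
  have \<xi>': "path_cons \<xi> y (deg \<Gamma> \<xi>) = \<xi>" using e(1)[of 0] \<xi> y by (simp add: comp_src)
  have "path_tail (deg \<Gamma> \<xi>) (path_cons \<xi> y) = y"
  proof
    fix q show "path_tail (deg \<Gamma> \<xi>) (path_cons \<xi> y) q = y q"
      using path_rng[OF y(1)] y path_spaceD[OF y(1)] e(1) \<xi>'
      by (intro path_tail_unique[OF X]) simp_all
  qed
  moreover have "path_cons \<xi> y \<in> cylinder \<xi>" using X \<xi>' by (simp add: cylinder_def)
  ultimately show "y \<in> path_tail (deg \<Gamma> \<xi>) ` cylinder \<xi>" by (metis imageI)
qed

lemma cylinder_comp: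
  assumes "\<xi> \<in> mor \<Gamma>" "\<eta> \<in> mor \<Gamma>" "src \<Gamma> \<xi> = rng \<Gamma> \<eta>"
  shows "{x \<in> cylinder \<xi>. path_tail (deg \<Gamma> \<xi>) x \<in> cylinder \<eta>} = cylinder (comp \<Gamma> \<xi> \<eta>)"
proof (intro equalityI subsetI)
  fix x assume "x \<in> {x \<in> cylinder \<xi>. path_tail (deg \<Gamma> \<xi>) x \<in> cylinder \<eta>}"
  then have x: "x \<in> path_space" "x (deg \<Gamma> \<xi>) = \<xi>" "path_tail (deg \<Gamma> \<xi>) x (deg \<Gamma> \<eta>) = \<eta>"
    by (auto simp: cylinder_def)
  then show "x \<in> cylinder (comp \<Gamma> \<xi> \<eta>)"
    using path_tail_decomp(4)[OF x(1), of "deg \<Gamma> \<xi>" "deg \<Gamma> \<eta>"] deg_comp[OF assms]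
    by (simp add: cylinder_def)
next
  fix x assume "x \<in> cylinder (comp \<Gamma> \<xi> \<eta>)"
  then have x: "x \<in> path_space" "x (deg \<Gamma> \<xi> + deg \<Gamma> \<eta>) = comp \<Gamma> \<xi> \<eta>"
    using assms by (auto simp: cylinder_def deg_comp)
  have \<xi>: "x (deg \<Gamma> \<xi>) = \<xi>"
    using path_spaceD(3)[OF x(1), of "deg \<Gamma> \<xi>" "deg \<Gamma> \<eta>"] init_comp_eq(1)[OF assms] x(2) by simp
  have "path_tail (deg \<Gamma> \<xi>) x (deg \<Gamma> \<eta>) = \<eta>"
    by (rule path_tail_unique[OF x(1)]) (use assms \<xi> x in simp_all)
  then show "x \<in> {x \<in> cylinder \<xi>. path_tail (deg \<Gamma> \<xi>) x \<in> cylinder \<eta>}"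
    using \<xi> x path_tail_in[OF x(1)] by (simp add: cylinder_def)
qed

text \<open>
  The operator that sends the point mass at \<open>y\<close> to the point mass at
  \<open>\<xi>y\<close>, written as a pullback along the inverse map, the removal of
  \<open>\<xi>\<close>.
\<close>

definition path_rep :: "'g \<Rightarrow> ('p \<Rightarrow> 'g) ell2 \<Rightarrow>\<^sub>L ('p \<Rightarrow> 'g) ell2" where
  "path_rep \<xi> = pullback (cylinder \<xi>) (path_tail (deg \<Gamma> \<xi>))"

lemma path_rep_vertex: assumes "v \<in> vertices \<Gamma>" shows "path_rep v = pullback (cylinder v) (\<lambda>x. x)"
  unfolding path_rep_def
  by (rule pullback_cong[OF path_tail_inj])
     (use assms in \<open>auto simp: inj_on_def vertexD cylinder_def path_tail_0\<close>)

lemma path_rep_ck_family: "ck_family \<Gamma> ell2_operators path_rep"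
proof -
  have id: "inj_on (\<lambda>i. i) D" for D :: "('p \<Rightarrow> 'g) set" by (simp add: inj_on_def)
  have cc: "path_rep \<xi> \<in> carrier ell2_operators" for \<xi> unfolding path_rep_def by (rule pullback_in[OF path_tail_inj])
  have adj: "adj ell2_operators (path_rep \<xi>) o\<^sub>L path_rep \<xi> = path_rep (src \<Gamma> \<xi>)" if "\<xi> \<in> mor \<Gamma>" for \<xi>
    using adj_pullback_compose(1)[OF path_tail_inj, of \<xi>] path_tail_cylinder[OF that] that
    by (simp add: path_rep_vertex) (simp add: path_rep_def)
  have rr: "path_rep \<xi> o\<^sub>L adj ell2_operators (path_rep \<xi>) = pullback (cylinder \<xi>) (\<lambda>x. x)" for \<xi>
    using adj_pullback_compose(2)[OF path_tail_inj, of \<xi>] by (simp add: path_rep_def)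
  show ?thesis unfolding ck_family_def
  proof (intro conjI ballI allI impI)
    show "path_rep \<xi> \<in> carrier ell2_operators" for \<xi> by (rule cc)
    fix v assume v: "v \<in> vertices \<Gamma>"
    have "adjoint_of (path_rep v) (path_rep v)"
    proof -
      have "adjoint_of (path_rep v) (pullback (cylinder v) (inv_into (cylinder v) (\<lambda>x. x)))"
        using adjoint_of_pullback[OF id, of "cylinder v"] by (simp add: path_rep_vertex[OF v])
      moreover have "pullback (cylinder v) (inv_into (cylinder v) (\<lambda>x. x)) = path_rep v"
        unfolding path_rep_vertex[OF v]
        by (rule pullback_cong) (auto simp: id inv_into_f_f[OF id] intro: inj_onI)
      ultimately show ?thesis by simp
    qed
    then have "adj ell2_operators (path_rep v) = path_rep v" by (rule ell2_operators_adj)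
    moreover have "path_rep v o\<^sub>L path_rep v = path_rep v"
      unfolding path_rep_vertex[OF v] pullback_compose[OF id id] by (rule pullback_cong) (auto simp: id inj_on_def)
    ultimately show "projection ell2_operators (path_rep v)" by (simp add: projection_def cc)
    show "path_rep v \<otimes>\<^bsub>ell2_operators\<^esub> path_rep w = \<zero>\<^bsub>ell2_operators\<^esub>" if w: "w \<in> vertices \<Gamma>" "v \<noteq> w" for w
    proof -
      have e: "{x \<in> cylinder v. x \<in> cylinder w} = {}" using that v by (auto simp: vertex_cylinder)
      have "path_rep v o\<^sub>L path_rep w = 0"
        unfolding path_rep_vertex[OF v] path_rep_vertex[OF w(1)] pullback_compose[OF id id] e
        by (rule pullback_empty)
      then show ?thesis by simp
    qed
    show "path_rep v = (\<Oplus>\<^bsub>ell2_operators\<^esub>\<xi>\<in>paths_into \<Gamma> v p. path_rep \<xi> \<otimes>\<^bsub>ell2_operators\<^esub> adj ell2_operators (path_rep \<xi>))" for p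
    proof -
      have "(\<Oplus>\<^bsub>ell2_operators\<^esub>\<xi>\<in>paths_into \<Gamma> v p. path_rep \<xi> \<otimes>\<^bsub>ell2_operators\<^esub> adj ell2_operators (path_rep \<xi>))
          = (\<Sum>\<xi>\<in>paths_into \<Gamma> v p. pullback (cylinder \<xi>) (\<lambda>x. x))"
        using v by (simp add: rr) (rule ell2_operators_finsum, simp_all add: pullback_in id)
      also have "\<dots> = path_rep v"
      proof (intro blinfun_eqI ell2_eqI)
        fix f :: "('p \<Rightarrow> 'g) ell2" and x
        have "coord ((\<Sum>\<xi>\<in>paths_into \<Gamma> v p. pullback (cylinder \<xi>) (\<lambda>x. x)) f) x
            = (\<Sum>\<xi>\<in>paths_into \<Gamma> v p. if x \<in> cylinder \<xi> then coord f x else 0)"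
          by (simp add: blinfun.sum_left coord_sum coord_pullback id)
        also have "\<dots> = (\<Sum>\<xi>\<in>paths_into \<Gamma> v p. if \<xi> = x p then if x \<in> cylinder v then coord f x else 0 else 0)"
        proof (rule sum.cong[OF refl])
          fix \<xi> assume "\<xi> \<in> paths_into \<Gamma> v p"
          then have \<xi>: "\<xi> \<in> mor \<Gamma>" "deg \<Gamma> \<xi> = p" "rng \<Gamma> \<xi> = v" by (auto simp: paths_into_def)
          then have "x \<in> cylinder \<xi> \<longleftrightarrow> \<xi> = x p \<and> x \<in> cylinder v"
            using path_rng[of x p] by (auto simp: cylinder_def v vertexD)
          then show "(if x \<in> cylinder \<xi> then coord f x else 0)
              = (if \<xi> = x p then if x \<in> cylinder v then coord f x else 0 else 0)" by simp
        qed
        also have "\<dots> = (if x p \<in> paths_into \<Gamma> v p then if x \<in> cylinder v then coord f x else 0 else 0)"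
          by (simp add: v)
        also have "\<dots> = (if x \<in> cylinder v then coord f x else 0)"
          using path_rng[of x p] path_spaceD[of x p] by (auto simp: paths_into_def vertex_cylinder v)
        also have "\<dots> = coord (path_rep v f) x" by (simp add: path_rep_vertex v coord_pullback id)
        finally show "coord ((\<Sum>\<xi>\<in>paths_into \<Gamma> v p. pullback (cylinder \<xi>) (\<lambda>x. x)) f) x
            = coord (path_rep v f) x" .
      qed
      finally show ?thesis by simp
    qed
  next
    fix \<xi> assume \<xi>: "\<xi> \<in> mor \<Gamma>"
    show "adj ell2_operators (path_rep \<xi>) \<otimes>\<^bsub>ell2_operators\<^esub> path_rep \<xi> = path_rep (src \<Gamma> \<xi>)"
      using adj[OF \<xi>] by simp
    fix \<eta> assume \<eta>: "\<eta> \<in> mor \<Gamma>" and s: "src \<Gamma> \<xi> = rng \<Gamma> \<eta>"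
    have "pullback (cylinder \<xi>) (path_tail (deg \<Gamma> \<xi>)) o\<^sub>L pullback (cylinder \<eta>) (path_tail (deg \<Gamma> \<eta>))
      = pullback (cylinder (comp \<Gamma> \<xi> \<eta>)) (path_tail (deg \<Gamma> (comp \<Gamma> \<xi> \<eta>)))"
      unfolding pullback_compose[OF path_tail_inj path_tail_inj] cylinder_comp[OF \<xi> \<eta> s]
    proof (rule pullback_cong[OF _ path_tail_inj refl])
      show eq: "(path_tail (deg \<Gamma> \<eta>) \<circ> path_tail (deg \<Gamma> \<xi>)) x = path_tail (deg \<Gamma> (comp \<Gamma> \<xi> \<eta>)) x"
        if "x \<in> cylinder (comp \<Gamma> \<xi> \<eta>)" for x
        using that by (simp add: cylinder_def path_tail_path_tail deg_comp \<xi> \<eta> s)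
      show "inj_on (path_tail (deg \<Gamma> \<eta>) \<circ> path_tail (deg \<Gamma> \<xi>)) (cylinder (comp \<Gamma> \<xi> \<eta>))"
        by (rule inj_on_cong[THEN iffD2, OF eq path_tail_inj])
    qed
    then show "path_rep \<xi> \<otimes>\<^bsub>ell2_operators\<^esub> path_rep \<eta> = path_rep (comp \<Gamma> \<xi> \<eta>)"
      by (simp add: path_rep_def)
  qed
qed

text \<open>
  Homomorphisms preserve zero, and the point mass at an infinite path \<open>x\<close> with
  \<open>x(0) = v\<close> is fixed by the projection at \<open>v\<close> in the path space
  representation.
\<close>

lemma universal_vertex_nonzero:
  assumes univ: "universal_ck_algebra \<Gamma> A s" and ap: "aperiodic \<Gamma>" and v: "v \<in> vertices \<Gamma>"
  shows "s v \<noteq> \<zero>\<^bsub>A\<^esub>"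
proof
  assume *: "s v = \<zero>\<^bsub>A\<^esub>"
  obtain x where x: "x \<in> infinite_paths \<Gamma>" "x (0, 0) = v" using ap v by (auto simp: aperiodic_def)
  note seg = infinite_path_segment[OF x(1), of 0]
  define y where "y = (\<lambda>p. x (0, 0 + p))"
  have "init p (y (p + q)) = y p" for p q
  proof -
    have "init (deg \<Gamma> (x (0, 0 + p))) (comp \<Gamma> (x (0, 0 + p)) (x (0 + p, 0 + p + q))) = x (0, 0 + p)"
      using seg infinite_path_segment[OF x(1), of "0 + p" q] by (intro init_comp_eq) auto
    then show ?thesis using seg(2)[of p] seg(5)[of p q] by (simp add: y_def add.assoc)
  qed
  then have "y \<in> cylinder v"
    using seg x(2) v by (simp add: cylinder_def path_space_def y_def vertexD)
  then have "path_rep v \<noteq> 0" using v by (simp add: path_rep_vertex pullback_id_nonzero)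
  moreover obtain \<pi> where \<pi>: "induced_hom \<Gamma> A s ell2_operators path_rep \<pi>"
    using universal_hom_exists[OF p_graph_axioms row_finite univ ell2_operators_cstar path_rep_ck_family] by blast
  moreover have "\<pi> \<zero>\<^bsub>A\<^esub> = \<zero>\<^bsub>ell2_operators\<^esub>"
    using \<pi> univ by (intro cstar_hom_zero ell2_operators_cstar) (auto simp: induced_hom_def universal_ck_algebra_def)
  moreover have "\<pi> (s v) = path_rep v" using \<pi> vertexD(1)[OF v] by (auto simp: induced_hom_def)
  ultimately show False using * by simp
qed

end

section \<open>The uniqueness theorem\<close>

theorem corollary2p8:
  fixes \<Gamma> :: "('g, 'p::comm_monoid_add) pgraph"
    and A :: "'a cstar" and s :: "'g \<Rightarrow> 'a"
    and B :: "'b cstar" and t :: "'g \<Rightarrow> 'b"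
  assumes cancellative: "\<And>p q r :: 'p. p + q = p + r \<Longrightarrow> q = r"
    and finitely_generated:
      "\<exists>S :: 'p set. finite S \<and> (\<forall>p. \<exists>ps. set ps \<subseteq> S \<and> p = sum_list ps)"
    and "p_graph \<Gamma>"
    and "row_finite_no_sources \<Gamma>"
    and "aperiodic \<Gamma>"
    and "universal_ck_algebra \<Gamma> A s"
    and "cstar_algebra B"
    and "ck_family \<Gamma> B t"
  shows "(\<exists>\<pi>. induced_hom \<Gamma> A s B t \<pi>) \<and>
    (\<forall>\<pi>. induced_hom \<Gamma> A s B t \<pi> \<longrightarrow>
       (inj_on \<pi> (carrier A) \<longleftrightarrow> (\<forall>v\<in>vertices \<Gamma>. t v \<noteq> \<zero>\<^bsub>B\<^esub>)))"
proof -
  have P: "row_finite_p_graph \<Gamma>"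
    unfolding row_finite_p_graph_def row_finite_p_graph_axioms_def using assms by blast
  have cA: "cstar_algebra A" and sA: "ck_family \<Gamma> A s"
    using \<open>universal_ck_algebra \<Gamma> A s\<close> by (auto simp: universal_ck_algebra_def)
  interpret row_finite_p_graph \<Gamma> by (rule P)
  interpret A: cstar_algebra A by (rule cA)
  interpret B: cstar_algebra B by fact
  have ckA: "ck \<Gamma> A s" unfolding ck_def ck_axioms_def using P cA sA by blast
  have ckB: "ck \<Gamma> B t" unfolding ck_def ck_axioms_def using P assms(7,8) by blast
  obtain S :: "'p set" where S: "finite S" "\<And>p. \<exists>ps. set ps \<subseteq> S \<and> p = sum_list ps"
    using finitely_generated by blast
  show ?thesis
  proof (intro conjI allI impI)
    show "\<exists>\<pi>. induced_hom \<Gamma> A s B t \<pi>" by (rule universal_hom_exists) fact+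
    fix \<pi> assume \<pi>: "induced_hom \<Gamma> A s B t \<pi>"
    then have hom: "\<pi> \<in> cstar_hom A B" and \<pi>s: "\<And>\<xi>. \<xi> \<in> mor \<Gamma> \<Longrightarrow> \<pi> (s \<xi>) = t \<xi>"
      by (auto simp: induced_hom_def)
    note h = cstar_homD[OF hom]
    show "inj_on \<pi> (carrier A) \<longleftrightarrow> (\<forall>v\<in>vertices \<Gamma>. t v \<noteq> \<zero>\<^bsub>B\<^esub>)"
    proof
      assume inj: "inj_on \<pi> (carrier A)"
      show "\<forall>v\<in>vertices \<Gamma>. t v \<noteq> \<zero>\<^bsub>B\<^esub>"
      proof (intro ballI notI)
        fix v assume v: "v \<in> vertices \<Gamma>" "t v = \<zero>\<^bsub>B\<^esub>"
        have "\<pi> (s v) = \<pi> \<zero>\<^bsub>A\<^esub>"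
          using \<pi>s[OF vertexD(1)[OF v(1)]] v(2) cstar_hom_zero[OF cA B.cstar_algebra_axioms hom] by simp
        then have "s v = \<zero>\<^bsub>A\<^esub>"
          using inj_onD[OF inj] ck.t_in[OF ckA vertexD(1)[OF v(1)]] by simp
        then show False using universal_vertex_nonzero assms(5,6) v(1) by blast
      qed
    next
      assume nz: "\<forall>v\<in>vertices \<Gamma>. t v \<noteq> \<zero>\<^bsub>B\<^esub>"
      show "inj_on \<pi> (carrier A)"
      proof (rule inj_onI)
        fix x y assume xy: "x \<in> carrier A" "y \<in> carrier A" "\<pi> x = \<pi> y"
        have d: "x \<ominus>\<^bsub>A\<^esub> y \<in> carrier A" using xy by simp
        have "\<pi> (x \<ominus>\<^bsub>A\<^esub> y) = \<pi> x \<ominus>\<^bsub>B\<^esub> \<pi> y"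
          using xy h by (simp add: A.minus_eq_scale B.minus_eq_scale)
        also have "\<dots> = \<zero>\<^bsub>B\<^esub>" using xy h(1) by (simp add: B.M.r_neg a_minus_def)
        finally have "x \<ominus>\<^bsub>A\<^esub> y = \<zero>\<^bsub>A\<^esub>"
          using kernel_trivial[OF ckA ckB assms(5,6) S _ \<pi> d] nz by blast
        then show "x = y" using A.eq_if_nrm_minus_0 xy by simp
      qed
    qed
  qed
qed

end
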